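(* Let $\mathcal{C}$ be a class of finite groups closed under subgroups, quotients, finite direct products and extensions with abelian kernel. Let $G$ be a pro-$\mathcal{C}$ group such that every action of $G$ on a pro-$\mathcal{C}$ tree with trivial edge stabilizers has a global fixed point (i.e. $G$ does not act on a pro-$\mathcal{C}$ tree with trivial edge stabilizers without a global fixed point). Then $G$ does not admit a hyperbolic-elliptic pair of cyclic splittings.
   Context: Groups are profinite, subgroups are closed, homomorphisms and actions are continuous, generation is topological, and "cyclic" means procyclic. $\widehat{\mathbb{Z}}_{\mathcal{C}}$ is the pro-$\mathcal{C}$ completion of $\mathbb{Z}$. A profinite graph is a profinite space $\Gamma$ with a closed subset $V(\Gamma)$ (vertices), $E(\Gamma)=\Gamma\setminus V(\Gamma)$ (edges), and continuous maps $d_0,d_1:\Gamma\to V(\Gamma)$ that restrict to the identity on $V(\Gamma)$. It is a pro-$\mathcal{C}$ tree if the sequence $0\to[[\widehat{\mathbb{Z}}_{\mathcal{C}}(E^*(\Gamma),* )]]\xrightarrow{\delta}[[\widehat{\mathbb{Z}}_{\mathcal{C}}V(\Gamma)]]\xrightarrow{\epsilon}\widehat{\mathbb{Z}}_{\mathcal{C}}\to 0$ is exact, where $E^*(\Gamma)=\Gamma/V(\Gamma)$ is pointed by the image $*$ of $V(\Gamma)$, $[[\cdot]]$ denotes free profinite $\widehat{\mathbb{Z}}_{\mathcal{C}}$-modules on (pointed) profinite spaces, $\delta(\bar e)=d_1(e)-d_0(e)$, $\delta( * )=0$, $\epsilon(v)=1$. An action of $G$ on a profinite graph is a continuous action commuting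 with $d_0,d_1$. A global fixed point is a vertex fixed by all of $G$. A cyclic splitting of $G$ is a decomposition of $G$ either as a non-fictitious (i.e. $C\ne A$, $C\ne B$) proper amalgamated free pro-$\mathcal{C}$ product $G=A\amalg_C B$, or as a proper pro-$\mathcal{C}$ HNN-extension $G=HNN(A,C,t)$ (with $C, C^t\le A$), where $C$ is an infinite cyclic group; "proper" means that the factors (resp. the base group) embed in $G$. The standard pro-$\mathcal{C}$ tree of $G=A\amalg_C B$ has vertex set $G/A\sqcup G/B$, edge set $G/C$, and $d_0(gC)=gA$, $d_1(gC)=gB$; for $G=HNN(A,C,t)$ it has vertex set $G/A$, edge set $G/C$, $d_0(gC)=gA$, $d_1(gC)=gtA$. $G$ acts on it by left multiplication. An element $g$ of a group acting on a pro-$\mathcal{C}$ tree is elliptic if it fixes a vertex, and hyperbolic if $\langle g\rangle$ acts freely on the tree. Given two cyclic splittings of $G$ over $C_1=\langle c_1\rangle$ and $C_2=\langle c_2\rangle$ with standard pro-$\mathcal{C}$ trees $T_1,T_2$, the pair is hyperbolic-elliptic if $c_1$ is hyperbolic in $T_2$ and $c_2$ is elliptic in $T_1$. *)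

theory Defs
  imports "HOL-Analysis.Analysis" "HOL-Algebra.Module" "HOL-Algebra.Group_Action"
    "HOL-Algebra.Generated_Groups" "HOL-Algebra.Product_Groups" "HOL-Algebra.Elementary_Groups"
begin

(* this prefix notation collides with the topological infix closure_of *)
no_notation eq_closure_of (\<open>closure'_of\<index>\<close>)

section \<open>Classes of finite groups\<close>

text \<open>
  A class of finite groups is given by its members with carrier in \<^typ>\<open>nat\<close>, which represent all
  finite groups up to isomorphism; \<open>in_class\<close> is membership for a group over any type.
\<close>

definition in_class :: "(nat monoid \<Rightarrow> bool) \<Rightarrow> ('a, 'b) monoid_scheme \<Rightarrow> bool" where
  "in_class \<C> H \<longleftrightarrow> group H \<and> (\<exists>K. \<C> K \<and> H \<cong> K)"

text \<open>
  Finite direct products include the empty one, so the trivial group belongs to the class.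
\<close>

definition closed_class :: "(nat monoid \<Rightarrow> bool) \<Rightarrow> bool" where
  "closed_class \<C> \<longleftrightarrow>
     (\<forall>K. \<C> K \<longrightarrow> group K \<and> finite (carrier K)) \<and>
     (\<forall>K K'. \<C> K \<and> group K' \<and> K \<cong> K' \<longrightarrow> \<C> K') \<and>
     (\<forall>K H. \<C> K \<and> subgroup H K \<longrightarrow> in_class \<C> (K\<lparr>carrier := H\<rparr>)) \<and>
     (\<forall>K N. \<C> K \<and> N \<lhd> K \<longrightarrow> in_class \<C> (K Mod N)) \<and>
     (\<forall>(n::nat) K. (\<forall>i<n. \<C> (K i)) \<longrightarrow> in_class \<C> (product_group {..<n} K)) \<and>
     (\<forall>K N. group K \<and> finite (carrier K) \<and> N \<lhd> K \<and> comm_group (K\<lparr>carrier := N\<rparr>) \<and>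
        in_class \<C> (K\<lparr>carrier := N\<rparr>) \<and> in_class \<C> (K Mod N) \<longrightarrow> \<C> K)"


section \<open>Profinite spaces and groups\<close>

definition profinite_space :: "'a topology \<Rightarrow> bool" where
  "profinite_space X \<longleftrightarrow> compact_space X \<and> Hausdorff_space X \<and>
     (\<forall>S. connectedin X S \<longrightarrow> S = {} \<or> (\<exists>x. S = {x}))"

definition quotient_topology :: "'a topology \<Rightarrow> ('a \<Rightarrow> 'b) \<Rightarrow> 'b topology" where
  "quotient_topology X q =
     topology (\<lambda>U. U \<subseteq> q ` topspace X \<and> openin X {x \<in> topspace X. q x \<in> U})"

lemma openin_quotient_topology:
  "openin (quotient_topology X q) U \<longleftrightarrow>
     U \<subseteq> q ` topspace X \<and> openin X {x \<in> topspace X. q x \<in> U}"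
proof -
  have "{x \<in> topspace X. q x \<in> S \<inter> T} =
      {x \<in> topspace X. q x \<in> S} \<inter> {x \<in> topspace X. q x \<in> T}" for S T
    by auto
  moreover have "{x \<in> topspace X. q x \<in> \<Union>\<K>} = (\<Union>K\<in>\<K>. {x \<in> topspace X. q x \<in> K})" for \<K>
    by auto
  ultimately have "istopology (\<lambda>U. U \<subseteq> q ` topspace X \<and> openin X {x \<in> topspace X. q x \<in> U})"
    unfolding istopology_def by (auto intro!: openin_Union)
  then show ?thesis
    by (simp add: quotient_topology_def topology_inverse')
qed

lemma topspace_quotient_topology [simp]: "topspace (quotient_topology X q) = q ` topspace X"
proof
  show "topspace (quotient_topology X q) \<subseteq> q ` topspace X"
    by (auto simp: topspace_def openin_quotient_topology)
  have "{x \<in> topspace X. q x \<in> q ` topspace X} = topspace X"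
    by auto
  then have "openin (quotient_topology X q) (q ` topspace X)"
    by (simp add: openin_quotient_topology)
  then show "q ` topspace X \<subseteq> topspace (quotient_topology X q)"
    by (rule openin_subset)
qed

lemma quotient_map_quotient_topology: "quotient_map X (quotient_topology X q) q"
  by (auto simp: quotient_map_def openin_quotient_topology)

record 'a topgroup = "'a monoid" +
  gtop :: "'a topology"

definition profinite_group :: "'a topgroup \<Rightarrow> bool" where
  "profinite_group G \<longleftrightarrow> group G \<and> topspace (gtop G) = carrier G \<and> profinite_space (gtop G) \<and>
     continuous_map (prod_topology (gtop G) (gtop G)) (gtop G) (\<lambda>(x, y). x \<otimes>\<^bsub>G\<^esub> y) \<and>
     continuous_map (gtop G) (gtop G) (\<lambda>x. inv\<^bsub>G\<^esub> x)"

definition pro_class_group :: "(nat monoid \<Rightarrow> bool) \<Rightarrow> 'a topgroup \<Rightarrow> bool" where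
  "pro_class_group \<C> G \<longleftrightarrow> profinite_group G \<and>
     (\<forall>N. N \<lhd> G \<and> openin (gtop G) N \<longrightarrow> in_class \<C> (G Mod N))"

definition closed_subgroup :: "'a set \<Rightarrow> 'a topgroup \<Rightarrow> bool" where
  "closed_subgroup H G \<longleftrightarrow> subgroup H G \<and> closedin (gtop G) H"

definition subgrp :: "'a topgroup \<Rightarrow> 'a set \<Rightarrow> 'a topgroup" where
  "subgrp G H = G\<lparr>carrier := H, gtop := subtopology (gtop G) H\<rparr>"

definition top_generate :: "'a topgroup \<Rightarrow> 'a set \<Rightarrow> 'a set" where
  "top_generate G S = gtop G closure_of generate G S"

definition cont_hom :: "'a topgroup \<Rightarrow> 'b topgroup \<Rightarrow> ('a \<Rightarrow> 'b) set" where
  "cont_hom G H = {f \<in> hom G H. continuous_map (gtop G) (gtop H) f}"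


section \<open>The pro-\<open>\<C>\<close> completion of the integers\<close>

text \<open>
  The inverse limit of the rings of integers modulo \<open>n\<close>, over those \<open>n \<ge> 1\<close> for which the cyclic
  group of order \<open>n\<close> is in the class. An element is the compatible family of its residues.
\<close>

record 'r topring = "'r ring" +
  rtop :: "'r topology"

definition class_moduli :: "(nat monoid \<Rightarrow> bool) \<Rightarrow> nat set" where
  "class_moduli \<C> = {n. n \<ge> 1 \<and> in_class \<C> (integer_mod_group n)}"

definition zhat_carrier :: "(nat monoid \<Rightarrow> bool) \<Rightarrow> (nat \<Rightarrow> int) set" where
  "zhat_carrier \<C> = {x \<in> (\<Pi>\<^sub>E n\<in>class_moduli \<C>. {0..<int n}).
     \<forall>m\<in>class_moduli \<C>. \<forall>n\<in>class_moduli \<C>. m dvd n \<longrightarrow> x n mod int m = x m}"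

definition zhat :: "(nat monoid \<Rightarrow> bool) \<Rightarrow> (nat \<Rightarrow> int) topring" where
  "zhat \<C> =
     \<lparr>carrier = zhat_carrier \<C>,
      monoid.mult = (\<lambda>x y. \<lambda>n\<in>class_moduli \<C>. (x n * y n) mod int n),
      one = (\<lambda>n\<in>class_moduli \<C>. 1 mod int n),
      zero = (\<lambda>n\<in>class_moduli \<C>. 0),
      add = (\<lambda>x y. \<lambda>n\<in>class_moduli \<C>. (x n + y n) mod int n),
      rtop = subtopology
        (product_topology (\<lambda>n. discrete_topology {0..<int n}) (class_moduli \<C>)) (zhat_carrier \<C>)\<rparr>"


section \<open>Profinite modules and free profinite modules\<close>

record ('r, 'm) topmodule = "('r, 'm) module" +
  mtop :: "'m topology"

definition profinite_module :: "'r topring \<Rightarrow> ('r, 'm) topmodule \<Rightarrow> bool" where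
  "profinite_module R M \<longleftrightarrow> Module.module R M \<and>
     topspace (mtop M) = carrier M \<and> profinite_space (mtop M) \<and>
     continuous_map (prod_topology (mtop M) (mtop M)) (mtop M) (\<lambda>(x, y). x \<oplus>\<^bsub>M\<^esub> y) \<and>
     continuous_map (mtop M) (mtop M) (\<lambda>x. \<ominus>\<^bsub>M\<^esub> x) \<and>
     continuous_map (prod_topology (rtop R) (mtop M)) (mtop M) (\<lambda>(r, x). r \<odot>\<^bsub>M\<^esub> x)"

definition cont_module_hom ::
  "'r topring \<Rightarrow> ('r, 'm) topmodule \<Rightarrow> ('r, 'n) topmodule \<Rightarrow> ('m \<Rightarrow> 'n) set" where
  "cont_module_hom R M N = {h. h \<in> hom (add_monoid M) (add_monoid N) \<and>
     (\<forall>r\<in>carrier R. \<forall>x\<in>carrier M. h (r \<odot>\<^bsub>M\<^esub> x) = r \<odot>\<^bsub>N\<^esub> h x) \<and>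
     continuous_map (mtop M) (mtop N) h}"

definition regular_module :: "'r topring \<Rightarrow> ('r, 'r) topmodule" where
  "regular_module R =
     \<lparr>carrier = carrier R, monoid.mult = monoid.mult R, one = one R,
      zero = zero R, add = add R, smult = monoid.mult R, mtop = rtop R\<rparr>"

text \<open>
  The universal property of the free profinite \<open>R\<close>-module on the space \<open>X\<close>, where \<open>B\<close> is the set
  of points sent to \<open>0\<close>: empty for \<open>[[R X]]\<close>, and the singleton of the base point for
  \<open>[[R (X, *)]]\<close>. The test modules \<open>N\<close> range over the type of \<open>M\<close>. If that type is infinite
  they include, up to isomorphism, all finite \<open>R\<close>-modules, and the universal property for
  arbitrary profinite modules follows by passing to inverse limits.
\<close>

definition free_profinite_module ::
  "'r topring \<Rightarrow> 'x topology \<Rightarrow> 'x set \<Rightarrow> ('r, 'm) topmodule \<Rightarrow> ('x \<Rightarrow> 'm) \<Rightarrow> bool" where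
  "free_profinite_module R X B M \<iota> \<longleftrightarrow>
     profinite_module R M \<and> continuous_map X (mtop M) \<iota> \<and> (\<forall>b\<in>B. \<iota> b = \<zero>\<^bsub>M\<^esub>) \<and>
     (\<forall>(N :: ('r, 'm) topmodule) f.
        profinite_module R N \<and> continuous_map X (mtop N) f \<and> (\<forall>b\<in>B. f b = \<zero>\<^bsub>N\<^esub>) \<longrightarrow>
        (\<exists>!h. h \<in> extensional (carrier M) \<and> h \<in> cont_module_hom R M N \<and>
              (\<forall>x\<in>topspace X. h (\<iota> x) = f x)))"


section \<open>Profinite graphs and pro-\<open>\<C>\<close> trees\<close>

record 'a pgraph =
  ptop :: "'a topology"
  verts :: "'a set"
  d0 :: "'a \<Rightarrow> 'a"
  d1 :: "'a \<Rightarrow> 'a"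

abbreviation points :: "'a pgraph \<Rightarrow> 'a set" where
  "points \<Gamma> \<equiv> topspace (ptop \<Gamma>)"

abbreviation edges :: "'a pgraph \<Rightarrow> 'a set" where
  "edges \<Gamma> \<equiv> points \<Gamma> - verts \<Gamma>"

abbreviation vtop :: "'a pgraph \<Rightarrow> 'a topology" where
  "vtop \<Gamma> \<equiv> subtopology (ptop \<Gamma>) (verts \<Gamma>)"

definition profinite_graph :: "'a pgraph \<Rightarrow> bool" where
  "profinite_graph \<Gamma> \<longleftrightarrow> profinite_space (ptop \<Gamma>) \<and> closedin (ptop \<Gamma>) (verts \<Gamma>) \<and>
     continuous_map (ptop \<Gamma>) (vtop \<Gamma>) (d0 \<Gamma>) \<and> continuous_map (ptop \<Gamma>) (vtop \<Gamma>) (d1 \<Gamma>) \<and>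
     (\<forall>v\<in>verts \<Gamma>. d0 \<Gamma> v = v \<and> d1 \<Gamma> v = v)"

text \<open>
  The quotient space \<open>\<Gamma>/V(\<Gamma>)\<close> (called \<open>E\<^sup>*(\<Gamma>)\<close> in the literature), with base point \<^const>\<open>None\<close>
  and with \<open>Some e\<close> for the class of an edge \<open>e\<close>.
\<close>

definition edge_space :: "'a pgraph \<Rightarrow> 'a option topology" where
  "edge_space \<Gamma> = quotient_topology (ptop \<Gamma>) (\<lambda>x. if x \<in> verts \<Gamma> then None else Some x)"

text \<open>
  The two free modules are taken over a type large enough to contain them: an element of
  \<open>[[R X]]\<close>, being the inverse limit of the finite free modules \<open>(R/I)[X/\<sim>]\<close>, amounts to a finitely
  additive function assigning to each clopen subset of \<open>X\<close> an element of \<open>R\<close> (for a pointed space,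
  to each clopen subset that misses the base point). As free modules are unique up to a unique
  isomorphism, and the maps \<open>\<delta>\<close>, \<open>\<epsilon>\<close> are determined by their values on the generators,
  the exactness condition does not depend on the choices. The value of \<open>\<delta>\<close> at the base point is
  \<open>0\<close> because \<open>\<iota>\<^sub>E None = 0\<close>.
\<close>

type_synonym 'a free_elem = "'a set \<Rightarrow> nat \<Rightarrow> int"

definition pro_class_tree :: "(nat monoid \<Rightarrow> bool) \<Rightarrow> 'a pgraph \<Rightarrow> bool" where
  "pro_class_tree \<C> \<Gamma> \<longleftrightarrow> profinite_graph \<Gamma> \<and>
     (\<exists>(M\<^sub>E :: (nat \<Rightarrow> int, 'a free_elem) topmodule) \<iota>\<^sub>E
       (M\<^sub>V :: (nat \<Rightarrow> int, 'a free_elem) topmodule) \<iota>\<^sub>V \<delta> \<epsilon>.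
        free_profinite_module (zhat \<C>) (edge_space \<Gamma>) {None} M\<^sub>E \<iota>\<^sub>E \<and>
        free_profinite_module (zhat \<C>) (vtop \<Gamma>) {} M\<^sub>V \<iota>\<^sub>V \<and>
        \<delta> \<in> cont_module_hom (zhat \<C>) M\<^sub>E M\<^sub>V \<and>
        (\<forall>e\<in>edges \<Gamma>. \<delta> (\<iota>\<^sub>E (Some e)) = \<iota>\<^sub>V (d1 \<Gamma> e) \<ominus>\<^bsub>M\<^sub>V\<^esub> \<iota>\<^sub>V (d0 \<Gamma> e)) \<and>
        \<epsilon> \<in> cont_module_hom (zhat \<C>) M\<^sub>V (regular_module (zhat \<C>)) \<and>
        (\<forall>v\<in>verts \<Gamma>. \<epsilon> (\<iota>\<^sub>V v) = \<one>\<^bsub>zhat \<C>\<^esub>) \<and>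
        inj_on \<delta> (carrier M\<^sub>E) \<and>
        \<delta> ` carrier M\<^sub>E = {m \<in> carrier M\<^sub>V. \<epsilon> m = \<zero>\<^bsub>zhat \<C>\<^esub>} \<and>
        \<epsilon> ` carrier M\<^sub>V = carrier (zhat \<C>))"


section \<open>Actions on profinite graphs\<close>

definition graph_action :: "'g topgroup \<Rightarrow> 'a pgraph \<Rightarrow> ('g \<Rightarrow> 'a \<Rightarrow> 'a) \<Rightarrow> bool" where
  "graph_action G \<Gamma> \<phi> \<longleftrightarrow> group_action G (points \<Gamma>) \<phi> \<and>
     continuous_map (prod_topology (gtop G) (ptop \<Gamma>)) (ptop \<Gamma>) (\<lambda>(g, x). \<phi> g x) \<and>
     (\<forall>g\<in>carrier G. \<forall>x\<in>points \<Gamma>. d0 \<Gamma> (\<phi> g x) = \<phi> g (d0 \<Gamma> x) \<and> d1 \<Gamma> (\<phi> g x) = \<phi> g (d1 \<Gamma> x))"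

definition trivial_edge_stabilizers :: "'g topgroup \<Rightarrow> 'a pgraph \<Rightarrow> ('g \<Rightarrow> 'a \<Rightarrow> 'a) \<Rightarrow> bool" where
  "trivial_edge_stabilizers G \<Gamma> \<phi> \<longleftrightarrow> (\<forall>e\<in>edges \<Gamma>. stabilizer G \<phi> e = {\<one>\<^bsub>G\<^esub>})"

definition global_fixed_point :: "'g topgroup \<Rightarrow> 'a pgraph \<Rightarrow> ('g \<Rightarrow> 'a \<Rightarrow> 'a) \<Rightarrow> bool" where
  "global_fixed_point G \<Gamma> \<phi> \<longleftrightarrow> (\<exists>v\<in>verts \<Gamma>. \<forall>g\<in>carrier G. \<phi> g v = v)"

text \<open>
  A remark on sizes. A statement about all actions of a fixed infinite profinite group \<open>G\<close> on
  pro-\<open>\<C>\<close> trees with trivial edge stabilizers and without global fixed point may be restricted to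
  trees with at most \<open>|G|\<close> points: given such an action on \<open>\<Gamma>\<close>, a closing-off argument yields a
  \<open>G\<close>-invariant Boolean algebra of at most \<open>w(G)\<close> clopen subsets of \<open>\<Gamma>\<close>, closed under preimages
  along \<open>d\<^sub>0\<close>, \<open>d\<^sub>1\<close>, such that the corresponding quotient graph is again a pro-\<open>\<C>\<close> tree with
  trivial edge stabilizers and no global fixed point; it has at most \<open>2\<^bsup>w(G)\<^esup> = |G|\<close> points, where
  \<open>w(G)\<close> is the weight of \<open>G\<close>. For \<open>G\<close> over the type \<open>'g\<close>, the trees over \<open>'g set set\<close> therefore
  suffice; this type also accommodates the standard trees of splittings below and their quotients.
\<close>

definition elliptic :: "'a pgraph \<Rightarrow> ('g \<Rightarrow> 'a \<Rightarrow> 'a) \<Rightarrow> 'g \<Rightarrow> bool" where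
  "elliptic \<Gamma> \<phi> g \<longleftrightarrow> (\<exists>v\<in>verts \<Gamma>. \<phi> g v = v)"

definition hyperbolic :: "'g topgroup \<Rightarrow> 'a pgraph \<Rightarrow> ('g \<Rightarrow> 'a \<Rightarrow> 'a) \<Rightarrow> 'g \<Rightarrow> bool" where
  "hyperbolic G \<Gamma> \<phi> g \<longleftrightarrow>
     (\<forall>x\<in>points \<Gamma>. \<forall>h\<in>top_generate G {g}. \<phi> h x = x \<longrightarrow> h = \<one>\<^bsub>G\<^esub>)"


section \<open>Cyclic splittings\<close>

text \<open>
  Since the decompositions are proper, the factors \<open>A\<close>, \<open>B\<close> (the base group \<open>A\<close>) and \<open>C\<close> are taken
  to be closed subgroups of \<open>G\<close>. The universal properties are tested on the pro-\<open>\<C>\<close> groups over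
  the type of \<open>G\<close>. For infinite \<open>G\<close>, as in a cyclic splitting, these include up to isomorphism all
  groups of the class, and the property for arbitrary pro-\<open>\<C>\<close> groups follows by passing to inverse
  limits.
\<close>

definition proper_amalgam ::
  "(nat monoid \<Rightarrow> bool) \<Rightarrow> 'g topgroup \<Rightarrow> 'g set \<Rightarrow> 'g set \<Rightarrow> 'g set \<Rightarrow> bool" where
  "proper_amalgam \<C> G A B C \<longleftrightarrow>
     closed_subgroup A G \<and> closed_subgroup B G \<and> closed_subgroup C G \<and> C \<subseteq> A \<and> C \<subseteq> B \<and>
     (\<forall>(K :: 'g topgroup) \<alpha> \<beta>.
        pro_class_group \<C> K \<and> \<alpha> \<in> cont_hom (subgrp G A) K \<and> \<beta> \<in> cont_hom (subgrp G B) K \<and>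
        (\<forall>c\<in>C. \<alpha> c = \<beta> c) \<longrightarrow>
        (\<exists>!h. h \<in> extensional (carrier G) \<and> h \<in> cont_hom G K \<and>
              (\<forall>a\<in>A. h a = \<alpha> a) \<and> (\<forall>b\<in>B. h b = \<beta> b)))"

text \<open>Here \<open>C\<^sup>t = t\<inverse>Ct\<close>, in accordance with \<open>d\<^sub>1(gC) = gtA\<close> in the standard tree.\<close>

definition proper_hnn ::
  "(nat monoid \<Rightarrow> bool) \<Rightarrow> 'g topgroup \<Rightarrow> 'g set \<Rightarrow> 'g set \<Rightarrow> 'g \<Rightarrow> bool" where
  "proper_hnn \<C> G A C t \<longleftrightarrow>
     closed_subgroup A G \<and> closed_subgroup C G \<and> C \<subseteq> A \<and> t \<in> carrier G \<and>
     (\<forall>c\<in>C. inv\<^bsub>G\<^esub> t \<otimes>\<^bsub>G\<^esub> c \<otimes>\<^bsub>G\<^esub> t \<in> A) \<and>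
     (\<forall>(K :: 'g topgroup) \<alpha> k.
        pro_class_group \<C> K \<and> \<alpha> \<in> cont_hom (subgrp G A) K \<and> k \<in> carrier K \<and>
        (\<forall>c\<in>C. inv\<^bsub>K\<^esub> k \<otimes>\<^bsub>K\<^esub> \<alpha> c \<otimes>\<^bsub>K\<^esub> k = \<alpha> (inv\<^bsub>G\<^esub> t \<otimes>\<^bsub>G\<^esub> c \<otimes>\<^bsub>G\<^esub> t)) \<longrightarrow>
        (\<exists>!h. h \<in> extensional (carrier G) \<and> h \<in> cont_hom G K \<and>
              (\<forall>a\<in>A. h a = \<alpha> a) \<and> h t = k))"

definition infinite_cyclic :: "'g topgroup \<Rightarrow> 'g set \<Rightarrow> bool" where
  "infinite_cyclic G C \<longleftrightarrow> infinite C \<and> (\<exists>c\<in>carrier G. C = top_generate G {c})"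

datatype 'g splitting =
    Amalgam (left_factor: "'g set") (right_factor: "'g set") (edge_group: "'g set")
  | HNN (base_group: "'g set") (edge_group: "'g set") (stable_letter: 'g)

fun cyclic_splitting :: "(nat monoid \<Rightarrow> bool) \<Rightarrow> 'g topgroup \<Rightarrow> 'g splitting \<Rightarrow> bool" where
  "cyclic_splitting \<C> G (Amalgam A B C) \<longleftrightarrow>
     proper_amalgam \<C> G A B C \<and> C \<noteq> A \<and> C \<noteq> B \<and> infinite_cyclic G C"
| "cyclic_splitting \<C> G (HNN A C t) \<longleftrightarrow> proper_hnn \<C> G A C t \<and> infinite_cyclic G C"


subsection \<open>The standard tree of a splitting\<close>

definition coset_space :: "'g topgroup \<Rightarrow> 'g set \<Rightarrow> 'g set topology" where
  "coset_space G H = quotient_topology (gtop G) (\<lambda>g. g <#\<^bsub>G\<^esub> H)"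

text \<open>
  Points of the standard tree are cosets with a tag, so that the union of \<open>G/A\<close>, \<open>G/B\<close> and \<open>G/C\<close>
  is disjoint. The incidence maps are expressed with products of sets: \<open>gA = (gC)A\<close> and,
  as \<open>C\<^sup>t \<le> A\<close>, \<open>gtA = (gC)(tA)\<close>.
\<close>

datatype tag = LeftV | RightV | Edge

fun std_tree :: "'g topgroup \<Rightarrow> 'g splitting \<Rightarrow> (tag \<times> 'g set) pgraph" where
  "std_tree G (Amalgam A B C) =
     \<lparr>ptop = sum_topology
        (\<lambda>i. case i of LeftV \<Rightarrow> coset_space G A | RightV \<Rightarrow> coset_space G B | Edge \<Rightarrow> coset_space G C)
        {LeftV, RightV, Edge},
      verts = {LeftV} \<times> topspace (coset_space G A) \<union> {RightV} \<times> topspace (coset_space G B),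
      d0 = (\<lambda>(i, X). if i = Edge then (LeftV, X <#>\<^bsub>G\<^esub> A) else (i, X)),
      d1 = (\<lambda>(i, X). if i = Edge then (RightV, X <#>\<^bsub>G\<^esub> B) else (i, X))\<rparr>"
| "std_tree G (HNN A C t) =
     \<lparr>ptop = sum_topology
        (\<lambda>i. if i = Edge then coset_space G C else coset_space G A) {LeftV, Edge},
      verts = {LeftV} \<times> topspace (coset_space G A),
      d0 = (\<lambda>(i, X). if i = Edge then (LeftV, X <#>\<^bsub>G\<^esub> A) else (i, X)),
      d1 = (\<lambda>(i, X). if i = Edge then (LeftV, X <#>\<^bsub>G\<^esub> (t <#\<^bsub>G\<^esub> A)) else (i, X))\<rparr>"

definition std_action :: "'g topgroup \<Rightarrow> 'g splitting \<Rightarrow> 'g \<Rightarrow> tag \<times> 'g set \<Rightarrow> tag \<times> 'g set" where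
  "std_action G S g = (\<lambda>(i, X)\<in>points (std_tree G S). (i, g <#\<^bsub>G\<^esub> X))"

definition hyperbolic_elliptic_pair ::
  "(nat monoid \<Rightarrow> bool) \<Rightarrow> 'g topgroup \<Rightarrow> 'g splitting \<Rightarrow> 'g splitting \<Rightarrow> bool" where
  "hyperbolic_elliptic_pair \<C> G S\<^sub>1 S\<^sub>2 \<longleftrightarrow>
     cyclic_splitting \<C> G S\<^sub>1 \<and> cyclic_splitting \<C> G S\<^sub>2 \<and>
     (\<exists>c\<^sub>1\<in>carrier G. \<exists>c\<^sub>2\<in>carrier G.
        edge_group S\<^sub>1 = top_generate G {c\<^sub>1} \<and> edge_group S\<^sub>2 = top_generate G {c\<^sub>2} \<and>
        hyperbolic G (std_tree G S\<^sub>2) (std_action G S\<^sub>2) c\<^sub>1 \<and>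
        elliptic (std_tree G S\<^sub>1) (std_action G S\<^sub>1) c\<^sub>2)"

end

theory Submission
  imports Defs "HOL-Algebra.Multiplicative_Group"
begin

text \<open>
  Let \<open>T1\<close> and \<open>T2\<close> be the standard trees of a hyperbolic-elliptic pair over \<open>C1 = \<langle>c1\<rangle>\<close> and
  \<open>C2 = \<langle>c2\<rangle>\<close>, and let \<open>v\<close> be a vertex of \<open>T1\<close> fixed by \<open>c2\<close>. Blow up \<open>T2\<close>: replace each vertex by
  a copy of \<open>T1\<close>, and glue the copies at the end points of the edge \<open>gC2\<close> along the vertex \<open>gv\<close>.
  The group acts on the result. The stabilizer of an edge is, up to conjugation, the subgroup of \<open>C1\<close>
  that fixes a vertex of \<open>T2\<close>; it is trivial, because \<open>c1\<close> is hyperbolic in \<open>T2\<close>. So there is a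
  fixed vertex, and it projects to a fixed vertex of \<open>T1\<close>, which is impossible as the splitting is
  proper and non-fictitious.

  That the blow-up is a pro-\<open>\<C>\<close> tree is proved by duality. A graph is acyclic modulo \<open>n\<close> if every
  locally constant function on it is on the edges, modulo \<open>n\<close>, the coboundary of a locally constant
  potential that is unique up to a constant. This property passes from \<open>T1\<close> and \<open>T2\<close> to the blow-up.
  For a standard tree it follows from the universal property of the splitting, applied to
  homomorphisms into wreath products. If it holds for all \<open>n\<close> such that the cyclic group of order \<open>n\<close>
  is in \<open>\<C>\<close>, then the sequence that defines pro-\<open>\<C>\<close> trees is exact for the free modules of
  measures on the clopen sets, hence for all free modules.
\<close>

section \<open>Locally constant functions and profinite spaces\<close>

text \<open>The edges of \<open>T2\<close> have to be contracted: if it were kept, an edge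
  \<open>gC2\<close> would have a conjugate of \<open>C2\<close> as its stabilizer, while the
  hypothesis on \<open>G\<close> speaks of trivial edge stabilizers. Ellipticity of
  \<open>c2\<close> is what makes the attaching vertex \<open>gv\<close> depend on the coset
  \<open>gC2\<close> alone. The obstacle is that the equivalence relation generated by the
  contractions need not be closed. Therefore the quotient is described by the locally constant
  functions that respect the gluing, and acyclicity is expressed by such functions as well. Wreath
  products arise because a potential on a standard tree is a derivation of \<open>G\<close>,
  evaluated at one point, with values in the functions on a finite quotient. A derivation is a
  homomorphism into a semidirect product, and homomorphisms are what a universal property provides.
  Closure of the class under extensions with abelian kernel makes the wreath products admissible
  targets. The same potentials, for one modulus at least 2, exclude a vertex of \<open>T1\<close>
  fixed by \<open>G\<close>; such a modulus exists because \<open>G\<close> has a nontrivial finite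
  quotient in the class.\<close>

definition locally_constant :: "'a topology \<Rightarrow> ('a \<Rightarrow> 'b) \<Rightarrow> bool" where
  "locally_constant X f \<longleftrightarrow> continuous_map X (discrete_topology UNIV) f"

lemma locally_constant_openin:
  "locally_constant X f \<Longrightarrow> openin X {x \<in> topspace X. P (f x)}"
  using openin_continuous_map_preimage[of X "discrete_topology UNIV" f "Collect P"]
  by (simp add: locally_constant_def)

lemma locally_constant_closedin:
  "locally_constant X f \<Longrightarrow> closedin X {x \<in> topspace X. P (f x)}"
  using closedin_continuous_map_preimage[of X "discrete_topology UNIV" f "Collect P"]
  by (simp add: locally_constant_def)

lemma locally_constantI:
  assumes "\<And>y. openin X {x \<in> topspace X. f x = y}"
  shows "locally_constant X f"
proof -
  have "openin X {x \<in> topspace X. f x \<in> U}" for U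
  proof -
    have "{x \<in> topspace X. f x \<in> U} = (\<Union>y\<in>U. {x \<in> topspace X. f x = y})" by auto
    then show ?thesis using assms by auto
  qed
  then show ?thesis by (simp add: locally_constant_def continuous_map_def)
qed

lemma locally_constant_const [simp]: "locally_constant X (\<lambda>x. c)"
  by (simp add: locally_constant_def)

lemma locally_constant_comp:
  "locally_constant X f \<Longrightarrow> locally_constant X (\<lambda>x. g (f x))"
  by (rule locally_constantI) (rule locally_constant_openin)

lemma locally_constant_pair:
  assumes "locally_constant X f" "locally_constant X g"
  shows "locally_constant X (\<lambda>x. (f x, g x))"
proof (rule locally_constantI)
  fix y
  have "{x \<in> topspace X. (f x, g x) = y} = {x \<in> topspace X. f x = fst y} \<inter> {x \<in> topspace X. g x = snd y}"
    by auto
  then show "openin X {x \<in> topspace X. (f x, g x) = y}"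
    using assms by (auto intro: locally_constant_openin)
qed

lemma locally_constant_comp2:
  "locally_constant X f \<Longrightarrow> locally_constant X g \<Longrightarrow> locally_constant X (\<lambda>x. h (f x) (g x))"
  using locally_constant_comp[OF locally_constant_pair, of X f g "\<lambda>(a, b). h a b"] by simp

lemma locally_constant_compose:
  "locally_constant X f \<Longrightarrow> continuous_map Y X h \<Longrightarrow> locally_constant Y (\<lambda>y. f (h y))"
  unfolding locally_constant_def
  using continuous_map_compose[of Y X h "discrete_topology UNIV" f] by (simp add: o_def)

lemma locally_constant_cong:
  assumes "locally_constant X f" "\<And>x. x \<in> topspace X \<Longrightarrow> f x = g x"
  shows "locally_constant X g"
  using assms unfolding locally_constant_def by (rule continuous_map_eq)

lemma locally_constant_finite_image:
  assumes "compact_space X" "locally_constant X f"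
  shows "finite (f ` topspace X)"
proof -
  have "compactin (discrete_topology UNIV) (f ` topspace X)"
    using assms image_compactin unfolding compact_space_def locally_constant_def by blast
  then show ?thesis by (simp add: compactin_discrete_topology)
qed

lemma locally_constant_mem:
  "openin X U \<Longrightarrow> closedin X U \<Longrightarrow> locally_constant X (\<lambda>x. x \<in> U)"
proof (rule locally_constantI)
  fix b :: bool assume U: "openin X U" "closedin X U"
  have "{x \<in> topspace X. (x \<in> U) = b} = (if b then U else topspace X - U)"
    using openin_subset[OF U(1)] by auto
  then show "openin X {x \<in> topspace X. (x \<in> U) = b}"
    using U by auto
qed

lemma locally_constant_extend:
  assumes "openin X S" "closedin X S" "locally_constant (subtopology X S) f"
    and "locally_constant (subtopology X (topspace X - S)) g"
  shows "locally_constant X (\<lambda>x. if x \<in> S then f x else g x)"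
proof (rule locally_constantI)
  fix y
  have S: "S \<subseteq> topspace X" by (simp add: assms(1) openin_subset)
  have "openin X (topspace X - S)" using assms(2) by auto
  then have "openin X {x \<in> topspace X - S. g x = y}"
    using locally_constant_openin[OF assms(4), of "\<lambda>z. z = y"]
    by (auto simp: openin_open_subtopology Int_absorb1 Int_Diff)
  moreover have "openin X {x \<in> S. f x = y}"
    using assms(1) S locally_constant_openin[OF assms(3), of "\<lambda>z. z = y"]
    by (auto simp: openin_open_subtopology Int_absorb1)
  moreover have "{x \<in> topspace X. (if x \<in> S then f x else g x) = y} =
      {x \<in> S. f x = y} \<union> {x \<in> topspace X - S. g x = y}"
    using S by auto
  ultimately show "openin X {x \<in> topspace X. (if x \<in> S then f x else g x) = y}"
    by auto
qed

text \<open>The projection along a compact factor is a closed map, so the set of \<open>y\<close>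
  for which some \<open>k\<close> leaves \<open>W\<close> is closed. In later uses a condition on
  all elements of a compact group, ring or space becomes an open condition.\<close>

lemma openin_tube:
  assumes "compact_space K" "continuous_map (prod_topology K Y) Z m" "openin Z W"
  shows "openin Y {y \<in> topspace Y. \<forall>k\<in>topspace K. m (k, y) \<in> W}"
proof -
  let ?C = "{x \<in> topspace (prod_topology K Y). m x \<in> topspace Z - W}"
  have "closedin (prod_topology K Y) ?C"
    using assms(2,3) closedin_continuous_map_preimage by blast
  then have "closedin Y (snd ` ?C)"
    using closed_map_snd[OF assms(1)] unfolding closed_map_def by blast
  moreover have "topspace Y - snd ` ?C = {y \<in> topspace Y. \<forall>k\<in>topspace K. m (k, y) \<in> W}"
  proof -
    have "m (k, y) \<in> topspace Z" if "k \<in> topspace K" "y \<in> topspace Y" for k y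
      using continuous_map_image_subset_topspace[OF assms(2)] that by auto
    then show ?thesis by (force simp: image_iff)
  qed
  ultimately show ?thesis by (metis openin_diff openin_topspace)
qed

text \<open>In a compact Hausdorff space quasi-components coincide with connected components, so two
  points that no clopen set separates would lie in a common connected set. Conversely, a clopen set
  that separates two points yields disjoint neighbourhoods and splits every connected set containing
  both.\<close>

lemma profinite_space_iff:
  "profinite_space X \<longleftrightarrow> compact_space X \<and>
     (\<forall>x\<in>topspace X. \<forall>y\<in>topspace X. x \<noteq> y \<longrightarrow> (\<exists>U. openin X U \<and> closedin X U \<and> x \<in> U \<and> y \<notin> U))"
  (is "?L \<longleftrightarrow> ?R")
proof
  assume L: ?L
  have "\<exists>U. openin X U \<and> closedin X U \<and> x \<in> U \<and> y \<notin> U"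
    if xy: "x \<in> topspace X" "y \<in> topspace X" "x \<noteq> y" for x y
  proof (rule ccontr)
    assume "\<not> ?thesis"
    then have "quasi_component_of X x y"
      using xy unfolding quasi_component_of_def
      by (metis DiffD2 DiffI closedin_def openin_closedin_eq)
    then have "connected_component_of X x y"
      using L quasi_eq_connected_component_of unfolding profinite_space_def by metis
    then obtain S where "connectedin X S" "x \<in> S" "y \<in> S"
      unfolding connected_component_of_def by auto
    then show False using L xy(3) unfolding profinite_space_def by (metis empty_iff singletonD)
  qed
  then show ?R using L by (auto simp: profinite_space_def)
next
  assume R: ?R
  have "Hausdorff_space X"
    unfolding Hausdorff_space_def
  proof (intro allI impI)
    fix x y assume "x \<in> topspace X \<and> y \<in> topspace X \<and> x \<noteq> y"
    then obtain U where U: "openin X U" "closedin X U" "x \<in> U" "y \<notin> U" using R by blast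
    then have "openin X (topspace X - U)" by auto
    then show "\<exists>U V. openin X U \<and> openin X V \<and> x \<in> U \<and> y \<in> V \<and> disjnt U V"
      using U \<open>x \<in> topspace X \<and> y \<in> topspace X \<and> x \<noteq> y\<close>
      by (intro exI[of _ U] exI[of _ "topspace X - U"]) (auto simp: disjnt_def)
  qed
  moreover have "S = {} \<or> (\<exists>x. S = {x})" if S: "connectedin X S" for S
  proof (rule ccontr)
    assume "\<not> ?thesis"
    then obtain x y where xy: "x \<in> S" "y \<in> S" "x \<noteq> y" by blast
    then obtain U where U: "openin X U" "closedin X U" "x \<in> U" "y \<notin> U"
      using R connectedin_subset_topspace[OF S] by (meson subsetD)
    then show False using connectedin_clopen_cases[OF S U(2,1)] xy by (auto simp: disjnt_def)
  qed
  ultimately show ?L using R unfolding profinite_space_def by blast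
qed

lemma profinite_spaceI:
  assumes "compact_space X"
    and "\<And>x y. x \<in> topspace X \<Longrightarrow> y \<in> topspace X \<Longrightarrow> x \<noteq> y \<Longrightarrow>
      \<exists>f :: 'a \<Rightarrow> 'b. locally_constant X f \<and> f x \<noteq> f y"
  shows "profinite_space X"
  unfolding profinite_space_iff
proof (intro conjI ballI impI assms(1))
  fix x y assume xy: "x \<in> topspace X" "y \<in> topspace X" "x \<noteq> y"
  then obtain f :: "'a \<Rightarrow> 'b" where f: "locally_constant X f" "f x \<noteq> f y" using assms(2) by blast
  show "\<exists>U. openin X U \<and> closedin X U \<and> x \<in> U \<and> y \<notin> U"
    by (rule exI[of _ "{z \<in> topspace X. f z = f x}"])
      (use f xy in \<open>auto intro: locally_constant_openin locally_constant_closedin\<close>)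
qed

lemma profinite_space_separation:
  assumes "profinite_space X" "x \<in> topspace X" "y \<in> topspace X" "x \<noteq> y"
  obtains f :: "'a \<Rightarrow> bool" where "locally_constant X f" "f x" "\<not> f y"
proof -
  obtain U where "openin X U" "closedin X U" "x \<in> U" "y \<notin> U"
    using assms unfolding profinite_space_iff by blast
  then show ?thesis using that[of "\<lambda>x. x \<in> U"] locally_constant_mem by blast
qed

lemma profinite_space_compact: "profinite_space X \<Longrightarrow> compact_space X"
  and profinite_space_Hausdorff: "profinite_space X \<Longrightarrow> Hausdorff_space X"
  by (auto simp: profinite_space_def)

text \<open>The complement of \<open>W\<close> is compact and is covered by clopen sets missing
  \<open>x\<close>; the complement of the union of a finite subcover is the required
  neighbourhood.\<close>

lemma profinite_space_clopen_basis:
  assumes X: "profinite_space X" and W: "openin X W" "x \<in> W"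
  obtains U where "openin X U" "closedin X U" "x \<in> U" "U \<subseteq> W"
proof -
  have x: "x \<in> topspace X" using W openin_subset by blast
  define F where "F = {U. openin X U \<and> closedin X U \<and> x \<notin> U}"
  have "compactin X (topspace X - W)"
    using X W by (intro closedin_compact_space) (auto simp: profinite_space_def)
  moreover have "topspace X - W \<subseteq> \<Union>F"
  proof
    fix y assume y: "y \<in> topspace X - W"
    then have "y \<noteq> x" using W by auto
    then obtain U where "openin X U" "closedin X U" "y \<in> U" "x \<notin> U"
      using X x y unfolding profinite_space_iff by blast
    then show "y \<in> \<Union>F" unfolding F_def by blast
  qed
  moreover have "\<And>U. U \<in> F \<Longrightarrow> openin X U" by (simp add: F_def)
  ultimately obtain F' where F': "finite F'" "F' \<subseteq> F" "topspace X - W \<subseteq> \<Union>F'"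
    using compactinD by metis
  have "openin X (\<Union>F')" "closedin X (\<Union>F')" "x \<notin> \<Union>F'"
    using F' by (auto simp: F_def intro!: closedin_Union)
  then have "openin X (topspace X - \<Union>F')" "closedin X (topspace X - \<Union>F')" "x \<in> topspace X - \<Union>F'"
    "topspace X - \<Union>F' \<subseteq> W"
    using x F'(3) by auto
  then show ?thesis using that by blast
qed

lemma profinite_space_closed_subspace:
  assumes "profinite_space X" "closedin X S"
  shows "profinite_space (subtopology X S)"
proof (rule profinite_spaceI)
  show "compact_space (subtopology X S)"
    using assms by (simp add: closedin_compact_space compact_space_subtopology profinite_space_def)
  fix x y assume xy: "x \<in> topspace (subtopology X S)" "y \<in> topspace (subtopology X S)" "x \<noteq> y"
  then obtain f :: "'a \<Rightarrow> bool" where f: "locally_constant X f" "f x" "\<not> f y"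
    using profinite_space_separation[OF assms(1)] by (metis IntD1 topspace_subtopology)
  then show "\<exists>f :: 'a \<Rightarrow> bool. locally_constant (subtopology X S) f \<and> f x \<noteq> f y"
    unfolding locally_constant_def by (metis continuous_map_from_subtopology)
qed

lemma profinite_space_prod:
  assumes "profinite_space X" "profinite_space Y"
  shows "profinite_space (prod_topology X Y)"
proof (rule profinite_spaceI)
  show "compact_space (prod_topology X Y)"
    using assms by (simp add: compact_space_prod_topology profinite_space_def)
  fix x y assume xy: "x \<in> topspace (prod_topology X Y)" "y \<in> topspace (prod_topology X Y)" "x \<noteq> y"
  show "\<exists>f :: 'a \<times> 'b \<Rightarrow> bool. locally_constant (prod_topology X Y) f \<and> f x \<noteq> f y"
  proof (cases "fst x = fst y")
    case False
    then obtain f :: "'a \<Rightarrow> bool" where "locally_constant X f" "f (fst x)" "\<not> f (fst y)"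
      using profinite_space_separation[OF assms(1), of "fst x" "fst y"] xy(1,2)
      unfolding topspace_prod_topology mem_Times_iff by metis
    then show ?thesis using locally_constant_compose continuous_map_fst by metis
  next
    case True
    then have "snd x \<noteq> snd y" using xy by (metis prod.expand)
    then obtain f :: "'b \<Rightarrow> bool" where "locally_constant Y f" "f (snd x)" "\<not> f (snd y)"
      using profinite_space_separation[OF assms(2), of "snd x" "snd y"] xy(1,2)
      unfolding topspace_prod_topology mem_Times_iff by metis
    then show ?thesis using locally_constant_compose continuous_map_snd by metis
  qed
qed

text \<open>A continuous surjection from a compact space to a Hausdorff space is a quotient map.
  Thus the continuity of an action can be tested on a cover of the graph, although in general the
  product of a quotient map with an identity map fails to be a quotient map.\<close>

lemma continuous_map_closed_compose:
  assumes q: "continuous_map X Y q" "compact_space X" "Hausdorff_space Y" "q ` topspace X = topspace Y"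
    and h: "continuous_map X Z (\<lambda>x. h (q x))"
  shows "continuous_map Y Z h"
  using continuous_compose_quotient_map[OF continuous_imp_quotient_map[OF q]] h by (simp add: o_def)

section \<open>Finite groups in a class\<close>

text \<open>The parameter \<open>m\<close> supplies the remaining record fields, so that the same
  transport produces plain groups over \<open>nat\<close> and topological groups.\<close>

definition transport_group ::
  "('a \<Rightarrow> 'b) \<Rightarrow> ('a, 'm) monoid_scheme \<Rightarrow> 'c \<Rightarrow> ('b, 'c) monoid_scheme" where
  "transport_group f H m =
     \<lparr>carrier = f ` carrier H,
      monoid.mult = (\<lambda>x y. f (inv_into (carrier H) f x \<otimes>\<^bsub>H\<^esub> inv_into (carrier H) f y)),
      one = f \<one>\<^bsub>H\<^esub>, \<dots> = m\<rparr>"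

lemma transport_group_iso:
  assumes "group H" "inj_on f (carrier H)"
  shows "f \<in> iso H (transport_group f H m)"
  using assms by (auto simp: transport_group_def iso_def hom_def bij_betw_def)

lemma transport_group_group:
  assumes "group H" "inj_on f (carrier H)"
  shows "group (transport_group f H m)"
  using group.iso_imp_img_group[OF assms(1) transport_group_iso[OF assms, of m]]
  by (simp add: transport_group_def)

lemma in_class_group: "in_class \<C> H \<Longrightarrow> group H"
  by (simp add: in_class_def)

lemma in_class_isoE:
  assumes "in_class \<C> H"
  obtains K f where "\<C> K" "f \<in> iso K H"
  using assms group.iso_sym unfolding in_class_def is_iso_def by blast

lemma in_class_iso:
  assumes "in_class \<C> H" "group H'" "f \<in> iso H H'"
  shows "in_class \<C> H'"
proof -
  obtain K where K: "\<C> K" "H \<cong> K" "group H" using assms(1) by (auto simp: in_class_def)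
  have "H' \<cong> H" using assms(3) K(3) group.iso_sym by (auto simp: is_iso_def)
  then show ?thesis using K assms(2) iso_trans unfolding in_class_def by blast
qed

section \<open>Closure properties of the class for groups over arbitrary types\<close>

context
  fixes \<C> :: "nat monoid \<Rightarrow> bool"
  assumes closed: "closed_class \<C>"
begin

lemma class_group: "\<C> K \<Longrightarrow> group K"
  and class_finite: "\<C> K \<Longrightarrow> finite (carrier K)"
  by (erule closed[unfolded closed_class_def, THEN conjunct1, rule_format, THEN conjunct1], erule closed[unfolded closed_class_def, THEN conjunct1, rule_format, THEN conjunct2])

lemma class_subgroup: "\<C> K \<Longrightarrow> subgroup S K \<Longrightarrow> in_class \<C> (K\<lparr>carrier := S\<rparr>)"
  by (rule closed[unfolded closed_class_def, THEN conjunct2, THEN conjunct2, THEN conjunct1, rule_format, OF conjI])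

lemma class_quotient: "\<C> K \<Longrightarrow> N \<lhd> K \<Longrightarrow> in_class \<C> (K Mod N)"
  by (rule closed[unfolded closed_class_def, THEN conjunct2, THEN conjunct2, THEN conjunct2, THEN conjunct1, rule_format, OF conjI])

lemma class_product: "(\<And>i. i < n \<Longrightarrow> \<C> (L i)) \<Longrightarrow> in_class \<C> (product_group {..<n::nat} L)"
  by (rule closed[unfolded closed_class_def, THEN conjunct2, THEN conjunct2, THEN conjunct2, THEN conjunct2, THEN conjunct1, rule_format])

lemma class_extension: "group K \<Longrightarrow> finite (carrier K) \<Longrightarrow> N \<lhd> K \<Longrightarrow>
    comm_group (K\<lparr>carrier := N\<rparr>) \<Longrightarrow> in_class \<C> (K\<lparr>carrier := N\<rparr>) \<Longrightarrow> in_class \<C> (K Mod N) \<Longrightarrow> \<C> K"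
  by (rule closed[unfolded closed_class_def, THEN conjunct2, THEN conjunct2, THEN conjunct2, THEN conjunct2, THEN conjunct2, rule_format]) (intro conjI)

lemma class_in_class: "\<C> K \<Longrightarrow> in_class \<C> K"
  using class_group[of K] iso_set_refl[of K] unfolding in_class_def is_iso_def by blast

lemma in_class_finite:
  assumes "in_class \<C> H"
  shows "finite (carrier H)"
proof -
  obtain K f where "\<C> K" "f \<in> iso K H" using in_class_isoE[OF assms] .
  then show ?thesis using class_finite[of K] bij_betw_finite by (auto simp: iso_def)
qed

text \<open>By the first isomorphism theorem, \<open>Q\<close> is the quotient of a representative
  \<open>K\<close> of \<open>H\<close> by the kernel of the composite map.\<close>

lemma in_class_quotient:
  assumes H: "in_class \<C> H" and Q: "group Q" "p \<in> hom H Q" "p ` carrier H = carrier Q"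
  shows "in_class \<C> Q"
proof -
  obtain K f where K: "\<C> K" "f \<in> iso K H" using in_class_isoE[OF H] .
  define r where "r = p \<circ> f"
  have r: "r \<in> hom K Q" unfolding r_def
    using K(2) Q(2) by (auto simp: iso_def intro: hom_compose)
  have "f ` carrier K = carrier H" using K(2) by (auto simp: iso_def bij_betw_def)
  then have rs: "r ` carrier K = carrier Q" using Q(3) by (metis image_comp r_def)
  interpret group_hom K Q r
    using class_group[OF K(1)] Q(1) r by (simp add: group_hom_def group_hom_axioms_def)
  have "kernel K Q r \<lhd> K" by (rule normal_kernel)
  then have "in_class \<C> (K Mod kernel K Q r)" by (rule class_quotient[OF K(1)])
  then show ?thesis using in_class_iso Q(1) FactGroup_iso_set[OF rs] by blast
qed

lemma in_class_subgroup:
  assumes H: "in_class \<C> H" and S: "subgroup S H"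
  shows "in_class \<C> (H\<lparr>carrier := S\<rparr>)"
proof -
  obtain K f where K: "\<C> K" "f \<in> iso K H" using in_class_isoE[OF H] .
  have gK: "group K" and gH: "group H" using K class_group H in_class_group by auto
  define g where "g = inv_into (carrier K) f"
  have g: "g \<in> iso H K" unfolding g_def using group.iso_set_sym[OF gK K(2)] .
  have gS: "subgroup (g ` S) K" using subgroup.iso_subgroup[OF S gH gK g] .
  then have "in_class \<C> (K\<lparr>carrier := g ` S\<rparr>)" by (rule class_subgroup[OF K(1)])
  moreover have "restrict f (g ` S) \<in> iso (K\<lparr>carrier := g ` S\<rparr>) (H\<lparr>carrier := f ` (g ` S)\<rparr>)"
    using iso_restrict[OF K(2) gK gH gS] .
  moreover have "f ` g ` S = S"
  proof -
    have "S \<subseteq> f ` carrier K" using S K(2) by (auto simp: iso_def bij_betw_def dest: subgroup.subset)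
    then have "f (g x) = x" if "x \<in> S" for x
      unfolding g_def using that by (meson f_inv_into_f subsetD)
    then show ?thesis by force
  qed
  moreover have "group (H\<lparr>carrier := S\<rparr>)" using subgroup.subgroup_is_group[OF S gH] .
  ultimately show ?thesis using in_class_iso by metis
qed

text \<open>Closure under extensions speaks of groups on \<open>nat\<close>; the finite group is
  transported there along an injection, and its kernel and quotient follow.\<close>

lemma in_class_extension:
  assumes H: "group H" "finite (carrier H)" and p: "p \<in> hom H Q" "p ` carrier H = carrier Q"
    and Q: "in_class \<C> Q" and ker: "comm_group (H\<lparr>carrier := kernel H Q p\<rparr>)"
      "in_class \<C> (H\<lparr>carrier := kernel H Q p\<rparr>)"
  shows "in_class \<C> H"
proof -
  obtain f :: "'a \<Rightarrow> nat" where f: "inj_on f (carrier H)"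
    using H(2) finite_imp_inj_to_nat_seg by blast
  define K where "K = transport_group f H ()"
  have K: "group K" "f \<in> iso H K" unfolding K_def
    by (rule transport_group_group[OF H(1) f], rule transport_group_iso[OF H(1) f])
  define g where "g = inv_into (carrier H) f"
  have g: "g \<in> iso K H" unfolding g_def using group.iso_set_sym[OF H(1) K(2)] .
  have cK: "carrier K = f ` carrier H" by (simp add: K_def transport_group_def)
  have gf: "g (f x) = x" if "x \<in> carrier H" for x using that f by (simp add: g_def)
  define r where "r = p \<circ> g"
  have r: "r \<in> hom K Q" unfolding r_def
    using g p(1) by (auto simp: iso_def intro: hom_compose)
  have rs: "r ` carrier K = carrier Q"
    unfolding cK p(2)[symmetric] r_def by (force simp: gf)
  have gQ: "group Q" using Q by (rule in_class_group)
  interpret group_hom K Q r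
    using K(1) gQ r by (simp add: group_hom_def group_hom_axioms_def)
  interpret p: group_hom H Q p
    using H(1) gQ p by (simp add: group_hom_def group_hom_axioms_def)
  have kK: "kernel K Q r = f ` kernel H Q p"
    unfolding kernel_def cK r_def by (auto simp: gf)
  have kiso: "restrict f (kernel H Q p) \<in> iso (H\<lparr>carrier := kernel H Q p\<rparr>) (K\<lparr>carrier := kernel K Q r\<rparr>)"
    unfolding kK using iso_restrict[OF K(2) H(1) K(1) p.subgroup_kernel] .
  have gk: "group (K\<lparr>carrier := kernel K Q r\<rparr>)"
    using subgroup.subgroup_is_group[OF subgroup_kernel K(1)] .
  have "in_class \<C> (K\<lparr>carrier := kernel K Q r\<rparr>)"
    using in_class_iso[OF ker(2) gk kiso] .
  moreover have "comm_group (K\<lparr>carrier := kernel K Q r\<rparr>)"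
    using comm_group.iso_imp_comm_group[OF ker(1) _ group.is_monoid[OF gk]] kiso
    unfolding is_iso_def by blast
  moreover have "in_class \<C> (K Mod kernel K Q r)"
  proof -
    have *: "group (K Mod kernel K Q r)" using normal.factorgroup_is_group[OF normal_kernel] .
    show ?thesis
      using in_class_iso[OF Q *] group.iso_set_sym[OF * FactGroup_iso_set[OF rs]] by blast
  qed
  moreover have "finite (carrier K)" using cK H(2) by simp
  ultimately have "\<C> K" using class_extension[OF K(1) _ normal_kernel] by blast
  then show ?thesis using in_class_iso[OF class_in_class H(1) g] by blast
qed

text \<open>Closure under products speaks of members of the class indexed by an initial segment of
  \<open>nat\<close>. An enumeration of \<open>X\<close> together with a representative of
  \<open>A\<close> gives the isomorphism.\<close>

lemma in_class_power:
  assumes A: "in_class \<C> A" and X: "finite X"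
  shows "in_class \<C> (product_group X (\<lambda>_. A))"
proof -
  obtain K f where K: "\<C> K" "f \<in> iso K A" using in_class_isoE[OF A] .
  have gK: "group K" and gA: "group A" using K class_group A in_class_group by auto
  obtain e where e: "bij_betw e X {..<card X}"
    using X ex_bij_betw_finite_nat lessThan_atLeast0 by metis
  let ?P = "product_group {..<card X} (\<lambda>_. K)"
  let ?h = "\<lambda>u. \<lambda>x\<in>X. f (u (e x))"
  let ?k = "\<lambda>v. \<lambda>i\<in>{..<card X}. inv_into (carrier K) f (v (inv_into X e i))"
  have P: "in_class \<C> ?P"
    using K(1) by (rule class_product)
  have fb: "bij_betw f (carrier K) (carrier A)" and fh: "f \<in> hom K A"
    using K(2) by (auto simp: iso_def)
  have ex: "e x \<in> {..<card X}" "inv_into X e (e x) = x" if "x \<in> X" for x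
    using bij_betwE[OF e] bij_betw_inv_into_left[OF e] that by auto
  have ei: "inv_into X e i \<in> X" "e (inv_into X e i) = i" if "i \<in> {..<card X}" for i
    using e that by (simp_all add: bij_betw_def inv_into_into f_inv_into_f)
  have fk: "f z \<in> carrier A" "inv_into (carrier K) f (f z) = z" if "z \<in> carrier K" for z
    using bij_betwE[OF fb] bij_betw_inv_into_left[OF fb] that by auto
  have fi: "inv_into (carrier K) f z \<in> carrier K" "f (inv_into (carrier K) f z) = z"
    if "z \<in> carrier A" for z
    using fb that by (simp_all add: bij_betw_def inv_into_into f_inv_into_f)
  have "bij_betw ?h (carrier ?P) (carrier (product_group X (\<lambda>_. A)))"
  proof (rule bij_betwI[where g = ?k])
    show "?h \<in> carrier ?P \<rightarrow> carrier (product_group X (\<lambda>_. A))"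
      using ex fk by (fastforce simp: PiE_iff Pi_iff)
    show "?k \<in> carrier (product_group X (\<lambda>_. A)) \<rightarrow> carrier ?P"
      using ei fi by (fastforce simp: PiE_iff Pi_iff)
  next
    fix u assume u: "u \<in> carrier ?P"
    show "?k (?h u) = u"
    proof (rule extensionalityI[of _ "{..<card X}"])
      show "?k (?h u) \<in> extensional {..<card X}" "u \<in> extensional {..<card X}"
        using u by (auto simp: PiE_iff)
      fix i assume i: "i \<in> {..<card X}"
      have "u i \<in> carrier K" using u i by (auto simp: PiE_iff)
      then show "?k (?h u) i = u i"
        using i ei[OF i] fk(2) by simp
    qed
  next
    fix v assume v: "v \<in> carrier (product_group X (\<lambda>_. A))"
    show "?h (?k v) = v"
    proof (rule extensionalityI[of _ X])
      show "?h (?k v) \<in> extensional X" "v \<in> extensional X"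
        using v by (auto simp: PiE_iff)
      fix x assume x: "x \<in> X"
      have "v x \<in> carrier A" using v x by (auto simp: PiE_iff)
      then show "?h (?k v) x = v x"
        using x ex[OF x] fi(2) by simp
    qed
  qed
  moreover have "?h \<in> hom ?P (product_group X (\<lambda>_. A))"
    using ex fk fh
    by (auto simp: hom_def PiE_iff Pi_iff intro!: restrict_ext)
  ultimately have "?h \<in> iso ?P (product_group X (\<lambda>_. A))" by (simp add: iso_def)
  then show ?thesis using in_class_iso[OF P] gA by (metis product_group)
qed

text \<open>The cyclic subgroup generated by \<open>x\<close> belongs to the class, and its order is
  at least 2. Residues for such a modulus are able to tell potentials apart.\<close>

lemma exists_class_modulus:
  assumes H: "in_class \<C> H" and x: "x \<in> carrier H" "x \<noteq> \<one>\<^bsub>H\<^esub>"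
  shows "\<exists>n\<in>class_moduli \<C>. n \<ge> 2"
proof -
  interpret group H using H by (rule in_class_group)
  let ?S = "generate H {x}" and ?n = "ord x"
  have n: "?n \<ge> 1" using ord_ge_1[OF in_class_finite[OF H] x(1)] .
  have n': "?n \<noteq> 1" using iffD1[OF ord_eq_1[OF x(1)]] x(2) by blast
  have S: "subgroup ?S H" using x(1) by (intro generate_is_subgroup) auto
  then have "in_class \<C> (H\<lparr>carrier := ?S\<rparr>)" by (rule in_class_subgroup[OF H])
  have gS: "group (H\<lparr>carrier := ?S\<rparr>)" using S subgroup_imp_group by blast
  have eq: "x [^]\<^bsub>H\<^esub> (i::int) = x [^]\<^bsub>H\<^esub> (j::int) \<longleftrightarrow> int ?n dvd i - j" for i j
    using int_pow_eq[OF x(1)] by (simp add: dvd_diff_commute)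
  let ?f = "\<lambda>k :: int. x [^]\<^bsub>H\<^esub> k"
  have car: "carrier (integer_mod_group ?n) = {0..<int ?n}"
    using n by (simp add: carrier_integer_mod_group)
  have "?f \<in> iso (integer_mod_group ?n) (H\<lparr>carrier := ?S\<rparr>)"
  proof -
    have "?f \<in> hom (integer_mod_group ?n) (H\<lparr>carrier := ?S\<rparr>)"
    proof (rule homI)
      fix i j :: int
      have "x [^]\<^bsub>H\<^esub> ((i + j) mod int ?n) = x [^]\<^bsub>H\<^esub> (i + j)"
        unfolding eq by (simp add: mod_eq_dvd_iff[symmetric])
      then show "?f (i \<otimes>\<^bsub>integer_mod_group ?n\<^esub> j) = ?f i \<otimes>\<^bsub>H\<lparr>carrier := ?S\<rparr>\<^esub> ?f j"
        using x(1) by (simp add: int_pow_mult)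
    qed (auto simp: generate_pow[OF x(1)])
    moreover have "inj_on ?f {0..<int ?n}"
    proof (rule inj_onI)
      fix i j assume ij: "i \<in> {0..<int ?n}" "j \<in> {0..<int ?n}" "x [^]\<^bsub>H\<^esub> i = x [^]\<^bsub>H\<^esub> j"
      then have "i mod int ?n = j mod int ?n" by (simp only: eq mod_eq_dvd_iff)
      then show "i = j" using ij by simp
    qed
    moreover have "?f ` {0..<int ?n} = ?S"
    proof -
      have "x [^]\<^bsub>H\<^esub> k = x [^]\<^bsub>H\<^esub> (k mod int ?n)" for k :: int
        unfolding eq by (simp add: mod_eq_dvd_iff[symmetric])
      moreover have "k mod int ?n \<in> {0..<int ?n}" for k
        using n by simp
      ultimately show ?thesis unfolding generate_pow[OF x(1)] by blast
    qed
    ultimately show ?thesis by (simp add: iso_def bij_betw_def car)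
  qed
  then have "in_class \<C> (integer_mod_group ?n)"
    using in_class_iso[OF \<open>in_class \<C> (H\<lparr>carrier := ?S\<rparr>)\<close> group_integer_mod_group]
      group.iso_set_sym[OF group_integer_mod_group] by blast
  then have "?n \<in> class_moduli \<C>" using n by (simp add: class_moduli_def)
  moreover have "?n \<ge> 2" using n n' by linarith
  ultimately show ?thesis by blast
qed

end

text \<open>The semidirect product of the functions from \<open>Q\<close> to the integers modulo
  \<open>n\<close> by \<open>Q\<close>, which acts by right translation. A homomorphism into it that
  lifts \<open>p\<close> is the same as a derivation with values in functions on \<open>Q\<close>.
  Residues are integers in \<open>{0..<n}\<close> and functions are extensional, so that equality in
  the group is equality of pairs.\<close>

definition wreath :: "nat \<Rightarrow> ('a, 'm) monoid_scheme \<Rightarrow> (('a \<Rightarrow> int) \<times> 'a) monoid" where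
  "wreath n Q =
     \<lparr>carrier = (carrier Q \<rightarrow>\<^sub>E {0..<int n}) \<times> carrier Q,
      monoid.mult = (\<lambda>(a, p) (b, q). (\<lambda>x\<in>carrier Q. (a x + b (x \<otimes>\<^bsub>Q\<^esub> p)) mod int n, p \<otimes>\<^bsub>Q\<^esub> q)),
      one = (\<lambda>x\<in>carrier Q. 0, \<one>\<^bsub>Q\<^esub>)\<rparr>"

lemma wreath_carrier: "(a, p) \<in> carrier (wreath n Q) \<longleftrightarrow> a \<in> carrier Q \<rightarrow>\<^sub>E {0..<int n} \<and> p \<in> carrier Q"
  and wreath_mult: "(a, p) \<otimes>\<^bsub>wreath n Q\<^esub> (b, q) =
    (\<lambda>x\<in>carrier Q. (a x + b (x \<otimes>\<^bsub>Q\<^esub> p)) mod int n, p \<otimes>\<^bsub>Q\<^esub> q)"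
  and wreath_one: "\<one>\<^bsub>wreath n Q\<^esub> = (\<lambda>x\<in>carrier Q. 0, \<one>\<^bsub>Q\<^esub>)"
  by (simp_all add: wreath_def)

lemma wreath_group:
  assumes "group Q" "n \<ge> 1"
  shows "group (wreath n Q)"
proof (rule groupI)
  interpret group Q by fact
  have n: "int n > 0" using assms by simp
  show "\<one>\<^bsub>wreath n Q\<^esub> \<in> carrier (wreath n Q)" using n by (simp add: wreath_one wreath_carrier)
  fix x assume x: "x \<in> carrier (wreath n Q)"
  obtain a p where xe: "x = (a, p)" by (cases x)
  have a: "a \<in> carrier Q \<rightarrow>\<^sub>E {0..<int n}" and p: "p \<in> carrier Q"
    using x by (simp_all add: xe wreath_carrier)
  show "\<one>\<^bsub>wreath n Q\<^esub> \<otimes>\<^bsub>wreath n Q\<^esub> x = x"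
    using a p by (auto simp: xe wreath_one wreath_mult fun_eq_iff PiE_iff extensional_def)
  let ?y = "(\<lambda>z\<in>carrier Q. (- a (z \<otimes>\<^bsub>Q\<^esub> inv\<^bsub>Q\<^esub> p)) mod int n, inv\<^bsub>Q\<^esub> p)"
  have "?y \<in> carrier (wreath n Q)" using n p by (simp add: wreath_carrier)
  moreover have "?y \<otimes>\<^bsub>wreath n Q\<^esub> x = \<one>\<^bsub>wreath n Q\<^esub>"
    using p by (auto simp: xe wreath_one wreath_mult fun_eq_iff mod_simps)
  ultimately show "\<exists>y\<in>carrier (wreath n Q). y \<otimes>\<^bsub>wreath n Q\<^esub> x = \<one>\<^bsub>wreath n Q\<^esub>" by blast
  fix y assume y: "y \<in> carrier (wreath n Q)"
  obtain b q where ye: "y = (b, q)" by (cases y)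
  have b: "b \<in> carrier Q \<rightarrow>\<^sub>E {0..<int n}" and q: "q \<in> carrier Q"
    using y by (simp_all add: ye wreath_carrier)
  show "x \<otimes>\<^bsub>wreath n Q\<^esub> y \<in> carrier (wreath n Q)"
    using p q n by (simp add: xe ye wreath_mult wreath_carrier)
  fix z assume z: "z \<in> carrier (wreath n Q)"
  obtain c r where ze: "z = (c, r)" by (cases z)
  have r: "r \<in> carrier Q" using z by (simp add: ze wreath_carrier)
  show "x \<otimes>\<^bsub>wreath n Q\<^esub> y \<otimes>\<^bsub>wreath n Q\<^esub> z = x \<otimes>\<^bsub>wreath n Q\<^esub> (y \<otimes>\<^bsub>wreath n Q\<^esub> z)"
    using p q r by (auto simp: xe ye ze wreath_mult fun_eq_iff mod_simps m_assoc add.assoc)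
qed

text \<open>The kernel of \<open>snd\<close> is a power of the cyclic group of order
  \<open>n\<close>, hence abelian and in the class, and the quotient is \<open>Q\<close>. So closure
  under extensions with abelian kernel applies.\<close>

lemma in_class_wreath:
  assumes closed: "closed_class \<C>" and Q: "in_class \<C> Q" and n: "n \<in> class_moduli \<C>"
  shows "in_class \<C> (wreath n Q)"
proof -
  interpret group Q using Q by (rule in_class_group)
  have n1: "n \<ge> 1" and nc: "in_class \<C> (integer_mod_group n)"
    using n by (auto simp: class_moduli_def)
  have fQ: "finite (carrier Q)" using in_class_finite[OF closed Q] .
  have gW: "group (wreath n Q)" using wreath_group n1 is_group by blast
  let ?W = "wreath n Q" and ?P = "product_group (carrier Q) (\<lambda>_. integer_mod_group n)"
  have cW: "carrier ?W = (carrier Q \<rightarrow>\<^sub>E {0..<int n}) \<times> carrier Q" by (simp add: wreath_def)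
  have ker: "kernel ?W Q snd = (carrier Q \<rightarrow>\<^sub>E {0..<int n}) \<times> {\<one>\<^bsub>Q\<^esub>}"
    by (auto simp: kernel_def cW)
  have sndhom: "snd \<in> hom ?W Q"
    by (auto simp: hom_def cW wreath_mult)
  interpret s: group_hom ?W Q snd
    using gW is_group sndhom by (simp add: group_hom_def group_hom_axioms_def)
  let ?K = "?W\<lparr>carrier := kernel ?W Q snd\<rparr>"
  have gK: "group ?K" using subgroup.subgroup_is_group[OF s.subgroup_kernel gW] .
  have gP: "group ?P" by simp
  have cP: "carrier ?P = carrier Q \<rightarrow>\<^sub>E {0..<int n}" using n1 by (simp add: carrier_integer_mod_group)
  have iso: "(\<lambda>a. (a, \<one>\<^bsub>Q\<^esub>)) \<in> iso ?P ?K"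
  proof -
    have "bij_betw (\<lambda>a. (a, \<one>\<^bsub>Q\<^esub>)) (carrier ?P) (carrier ?K)"
      unfolding cP by (auto simp: bij_betw_def inj_on_def ker)
    moreover have "(\<lambda>a. (a, \<one>\<^bsub>Q\<^esub>)) \<in> hom ?P ?K"
      unfolding hom_def cP by (auto simp: ker wreath_mult fun_eq_iff)
    ultimately show ?thesis by (simp add: iso_def)
  qed
  have "in_class \<C> ?K" using in_class_iso[OF in_class_power[OF closed nc fQ] gK iso] .
  moreover have "comm_group ?K"
    by (rule group.group_comm_groupI[OF gK]) (auto simp: ker wreath_mult fun_eq_iff PiE_iff add.commute)
  moreover have "snd ` carrier ?W = carrier Q"
  proof -
    have "(\<lambda>x\<in>carrier Q. 0) \<in> carrier Q \<rightarrow>\<^sub>E {0..<int n}" using n1 by auto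
    then show ?thesis unfolding cW snd_image_times by (auto simp only: if_False split: if_splits)
  qed
  moreover have "finite (carrier ?W)" unfolding cW using fQ by (simp add: finite_PiE)
  ultimately show ?thesis using in_class_extension[OF closed gW _ sndhom _ Q] by blast
qed

section \<open>Profinite groups\<close>

locale profinite_topgroup = group G for G :: "'g topgroup" (structure) +
  assumes profinite: "profinite_group G"
begin

lemma topspace_gtop [simp]: "topspace (gtop G) = carrier G"
  and profinite_gtop: "profinite_space (gtop G)"
  and compact_gtop: "compact_space (gtop G)"
  using profinite by (auto simp: profinite_group_def profinite_space_def)

lemma continuous_map_mult:
  assumes "continuous_map X (gtop G) f" "continuous_map X (gtop G) g"
  shows "continuous_map X (gtop G) (\<lambda>x. f x \<otimes> g x)"
proof -
  have "continuous_map X (prod_topology (gtop G) (gtop G)) (\<lambda>x. (f x, g x))"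
    using assms by (simp add: continuous_map_pairedI)
  moreover have "continuous_map (prod_topology (gtop G) (gtop G)) (gtop G) (\<lambda>(x, y). x \<otimes> y)"
    using profinite by (simp add: profinite_group_def)
  ultimately show ?thesis
    using continuous_map_compose by (fastforce simp: o_def)
qed

lemma continuous_map_inv:
  assumes "continuous_map X (gtop G) f"
  shows "continuous_map X (gtop G) (\<lambda>x. inv (f x))"
proof -
  have "continuous_map (gtop G) (gtop G) (\<lambda>x. inv x)"
    using profinite by (simp add: profinite_group_def)
  then show ?thesis
    using continuous_map_compose[OF assms] by (fastforce simp: o_def)
qed

lemma continuous_map_group_const: "c \<in> carrier G \<Longrightarrow> continuous_map X (gtop G) (\<lambda>x. c)"
  by simp

lemma openin_invI:
  assumes "openin (gtop G) U"
  shows "openin (gtop G) {x \<in> carrier G. inv x \<in> U}"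
  using openin_continuous_map_preimage[OF continuous_map_inv[OF continuous_map_id] assms]
  by (simp add: o_def id_def)

text \<open>For a clopen neighbourhood \<open>U\<close> of the identity, the elements
  \<open>x\<close> such that right translation by \<open>x\<close> and by its inverse maps
  \<open>U\<close> into itself form an open subgroup inside \<open>U\<close>. The elements whose
  conjugates all lie in it form a normal subgroup, which is still open because the group is
  compact.\<close>

lemma open_normal_basis:
  assumes W: "openin (gtop G) W" "\<one> \<in> W"
  obtains N where "N \<lhd> G" "openin (gtop G) N" "N \<subseteq> W"
proof -
  obtain U where U: "openin (gtop G) U" "closedin (gtop G) U" "\<one> \<in> U" "U \<subseteq> W"
    using profinite_space_clopen_basis[OF profinite_gtop W] by metis
  have UG: "U \<subseteq> carrier G" using openin_subset[OF U(1)] by simp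
  define A where "A = {x \<in> carrier G. \<forall>u\<in>U. u \<otimes> x \<in> U}"
  have "openin (gtop G) A"
  proof -
    let ?K = "subtopology (gtop G) U"
    have "compact_space ?K"
      using profinite_space_compact[OF profinite_space_closed_subspace[OF profinite_gtop U(2)]] .
    moreover have "continuous_map (prod_topology ?K (gtop G)) (gtop G) (\<lambda>z. fst z \<otimes> snd z)"
      by (intro continuous_map_mult continuous_map_snd continuous_map_into_fulltopology[OF continuous_map_fst])
    ultimately have "openin (gtop G) {x \<in> topspace (gtop G). \<forall>u\<in>topspace ?K. fst (u, x) \<otimes> snd (u, x) \<in> U}"
      using U(1) by (rule openin_tube)
    moreover have "topspace ?K = U" using UG by auto
    ultimately show ?thesis by (simp add: A_def)
  qed
  define H where "H = A \<inter> {x \<in> carrier G. inv x \<in> A}"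
  have oH: "openin (gtop G) H"
    unfolding H_def using \<open>openin (gtop G) A\<close> openin_invI by blast
  have Hi: "x \<in> H \<longleftrightarrow> x \<in> carrier G \<and> (\<forall>u\<in>U. u \<otimes> x \<in> U \<and> u \<otimes> inv x \<in> U)" for x
    by (auto simp: H_def A_def)
  have H1: "\<one> \<in> H" using UG by (auto simp: Hi)
  have Hinv: "inv x \<in> H" if "x \<in> H" for x using that by (auto simp: Hi)
  have Hmult: "x \<otimes> y \<in> H" if "x \<in> H" "y \<in> H" for x y
  proof -
    have c: "x \<in> carrier G" "y \<in> carrier G" using that by (auto simp: Hi)
    have "u \<otimes> (x \<otimes> y) \<in> U" "u \<otimes> inv (x \<otimes> y) \<in> U" if u: "u \<in> U" for u
    proof -
      have uc: "u \<in> carrier G" using u UG by auto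
      have "u \<otimes> x \<otimes> y \<in> U" "u \<otimes> inv y \<otimes> inv x \<in> U"
        using \<open>x \<in> H\<close> \<open>y \<in> H\<close> u by (auto simp: Hi)
      then show "u \<otimes> (x \<otimes> y) \<in> U" "u \<otimes> inv (x \<otimes> y) \<in> U"
        using c uc by (auto simp: m_assoc inv_mult_group)
    qed
    then show ?thesis using c by (auto simp: Hi)
  qed
  define N where "N = {x \<in> carrier G. \<forall>g\<in>carrier G. g \<otimes> x \<otimes> inv g \<in> H}"
  have "openin (gtop G) {x \<in> topspace (gtop G). \<forall>g\<in>topspace (gtop G).
      (\<lambda>z. fst z \<otimes> snd z \<otimes> inv (fst z)) (g, x) \<in> H}"
    by (rule openin_tube[OF compact_gtop _ oH])
      (intro continuous_map_mult continuous_map_snd continuous_map_fst continuous_map_inv)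
  then have oN: "openin (gtop G) N" by (simp add: N_def)
  have NH: "N \<subseteq> H"
  proof
    fix x assume x: "x \<in> N"
    then have "\<one> \<otimes> x \<otimes> inv \<one> \<in> H" unfolding N_def by blast
    then show "x \<in> H" using x by (simp add: N_def)
  qed
  have "subgroup N G"
  proof (rule subgroupI)
    show "N \<subseteq> carrier G" by (auto simp: N_def)
    show "N \<noteq> {}" using H1 by (auto simp: N_def intro!: exI[of _ \<one>])
    fix x assume x: "x \<in> N"
    have xc: "x \<in> carrier G" using x by (simp add: N_def)
    have "g \<otimes> inv x \<otimes> inv g = inv (g \<otimes> x \<otimes> inv g)" if "g \<in> carrier G" for g
      using that xc by (simp add: inv_mult_group m_assoc)
    then show "inv x \<in> N" using x Hinv by (simp add: N_def)
    fix y assume y: "y \<in> N"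
    have yc: "y \<in> carrier G" using y by (simp add: N_def)
    have "g \<otimes> (x \<otimes> y) \<otimes> inv g = (g \<otimes> x \<otimes> inv g) \<otimes> (g \<otimes> y \<otimes> inv g)" if "g \<in> carrier G" for g
      using that xc yc by (simp add: m_assoc inv_solve_left)
    then show "x \<otimes> y \<in> N" using x y Hmult by (simp add: N_def)
  qed
  moreover have "g \<otimes> x \<otimes> inv g \<in> N" if "x \<in> N" "g \<in> carrier G" for x g
  proof -
    have xc: "x \<in> carrier G" using that by (simp add: N_def)
    have "k \<otimes> (g \<otimes> x \<otimes> inv g) \<otimes> inv k = (k \<otimes> g) \<otimes> x \<otimes> inv (k \<otimes> g)" if "k \<in> carrier G" for k
      using that xc \<open>g \<in> carrier G\<close> by (simp add: inv_mult_group m_assoc)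
    then show ?thesis using that xc by (simp add: N_def)
  qed
  ultimately have "N \<lhd> G" by (simp add: normal_inv_iff)
  moreover have "N \<subseteq> W"
  proof
    fix x assume "x \<in> N"
    then have "\<one> \<otimes> x \<in> U" "x \<in> carrier G" using NH U(3) Hi by blast+
    then show "x \<in> W" using U(4) by auto
  qed
  ultimately show ?thesis using that oN by blast
qed

lemma locally_constant_right_invariant:
  assumes N: "subgroup N G" "openin (gtop G) N"
    and f: "\<And>g u. g \<in> carrier G \<Longrightarrow> u \<in> N \<Longrightarrow> f (g \<otimes> u) = f g"
  shows "locally_constant (gtop G) f"
proof (rule locally_constantI)
  fix y
  have "\<exists>T. openin (gtop G) T \<and> g \<in> T \<and> T \<subseteq> {x \<in> carrier G. f x = y}"
    if g: "g \<in> carrier G" "f g = y" for g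
  proof (intro exI conjI)
    have "continuous_map (gtop G) (gtop G) (\<lambda>x. inv g \<otimes> x)"
      using g continuous_map_id by (intro continuous_map_mult continuous_map_group_const) (auto simp: id_def)
    then show "openin (gtop G) {x \<in> carrier G. inv g \<otimes> x \<in> N}"
      using openin_continuous_map_preimage[OF _ N(2)] by fastforce
    show "g \<in> {x \<in> carrier G. inv g \<otimes> x \<in> N}" using g subgroup.one_closed[OF N(1)] by simp
    have "f x = y" if "x \<in> carrier G" "inv g \<otimes> x \<in> N" for x
      using f[OF g(1) that(2)] g that(1) by (simp add: m_assoc[symmetric])
    then show "{x \<in> carrier G. inv g \<otimes> x \<in> N} \<subseteq> {x \<in> carrier G. f x = y}" by blast
  qed
  then show "openin (gtop G) {x \<in> topspace (gtop G). f x = y}"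
    by (subst openin_subopen) auto
qed

text \<open>Uniform continuity on a compact group: the \<open>u\<close> with
  \<open>f (g \<otimes> u) = f g\<close> for all \<open>g\<close> form an open set around the
  identity, and this set contains an open normal subgroup.\<close>

lemma locally_constant_factor:
  assumes f: "locally_constant (gtop G) f"
  obtains N where "N \<lhd> G" "openin (gtop G) N"
    "\<And>g u. g \<in> carrier G \<Longrightarrow> u \<in> N \<Longrightarrow> f (g \<otimes> u) = f g"
proof -
  let ?m = "\<lambda>z. f (fst z \<otimes> snd z) = f (fst z)"
  have "continuous_map (prod_topology (gtop G) (gtop G)) (gtop G) (\<lambda>z. fst z \<otimes> snd z)"
    by (intro continuous_map_mult continuous_map_fst continuous_map_snd)
  then have "locally_constant (prod_topology (gtop G) (gtop G)) ?m"
    by (intro locally_constant_comp2[where h = "(=)"] locally_constant_compose[OF f] continuous_map_fst)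
  then have "openin (gtop G) {u \<in> topspace (gtop G). \<forall>g\<in>topspace (gtop G). ?m (g, u) \<in> {True}}"
    unfolding locally_constant_def by (rule openin_tube[OF compact_gtop]) simp
  then have "openin (gtop G) {u \<in> carrier G. \<forall>g\<in>carrier G. f (g \<otimes> u) = f g}" by simp
  then obtain N where "N \<lhd> G" "openin (gtop G) N" "N \<subseteq> {u \<in> carrier G. \<forall>g\<in>carrier G. f (g \<otimes> u) = f g}"
    by (rule open_normal_basis) auto
  then show ?thesis using that by blast
qed

section \<open>Cosets and coset spaces\<close>

lemma l_coset_mult_right:
  assumes "subgroup H G" "g \<in> carrier G" "h \<in> H"
  shows "(g \<otimes> h) <# H = g <# H"
proof -
  have "g \<otimes> h \<in> g <# H" using assms by (auto simp: l_coset_def)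
  then show ?thesis using l_repr_independence assms by metis
qed

lemma l_coset_self: "subgroup H G \<Longrightarrow> g \<in> carrier G \<Longrightarrow> g \<in> g <# H"
  using subgroup.one_closed by (force simp: l_coset_def)

lemma l_coset_eqD:
  assumes "subgroup H G" "g \<in> carrier G" "g' \<in> carrier G" "g <# H = g' <# H"
  shows "\<exists>h\<in>H. g' = g \<otimes> h"
  using l_coset_self[OF assms(1,3)] assms(4) by (auto simp: l_coset_def)

lemma l_coset_descend:
  assumes H: "subgroup H G"
    and p: "\<And>g h. g \<in> carrier G \<Longrightarrow> h \<in> H \<Longrightarrow> p (g \<otimes> h) = p g"
  obtains F where "\<And>g. g \<in> carrier G \<Longrightarrow> F (g <# H) = p g"
proof
  fix g assume g: "g \<in> carrier G"
  have "(SOME g'. g' \<in> g <# H) \<in> g <# H" using l_coset_self[OF H g] by (rule someI)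
  then show "p (SOME g'. g' \<in> g <# H) = p g" using p[OF g] by (auto simp: l_coset_def)
qed

text \<open>An open normal subgroup \<open>N\<close> is chosen so small that \<open>g'\<close> is
  outside \<open>gNH\<close>, and \<open>f\<close> is the indicator function of \<open>gNH\<close>.
  This set is right invariant under \<open>H\<close>, and also under \<open>N\<close> because
  \<open>N\<close> is normal, so it is clopen.\<close>

lemma coset_separation:
  assumes H: "closed_subgroup H G" and g: "g \<in> carrier G" "g' \<in> carrier G" "g <# H \<noteq> g' <# H"
  obtains f :: "'g \<Rightarrow> bool" where "locally_constant (gtop G) f" "f g" "\<not> f g'"
    "\<And>x h. x \<in> carrier G \<Longrightarrow> h \<in> H \<Longrightarrow> f (x \<otimes> h) = f x"
proof -
  have sH: "subgroup H G" and cH: "closedin (gtop G) H" using H by (auto simp: closed_subgroup_def)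
  have HG: "H \<subseteq> carrier G" using sH by (rule subgroup.subset)
  \<comment> \<open>An element \<open>u\<close> belongs to \<open>?W\<close> exactly when
    \<open>g'\<close> is outside \<open>guH\<close>.\<close>
  let ?W = "{x \<in> carrier G. inv g' \<otimes> g \<otimes> x \<notin> H}"
  have "openin (gtop G) ?W"
  proof -
    have "continuous_map (gtop G) (gtop G) (\<lambda>x. inv g' \<otimes> g \<otimes> x)"
      using g continuous_map_id by (intro continuous_map_mult continuous_map_group_const) (auto simp: id_def)
    moreover have "openin (gtop G) (carrier G - H)" using cH by (metis closedin_def topspace_gtop)
    ultimately have "openin (gtop G) {x \<in> carrier G. inv g' \<otimes> g \<otimes> x \<in> carrier G - H}"
      using openin_continuous_map_preimage by fastforce
    moreover have "{x \<in> carrier G. inv g' \<otimes> g \<otimes> x \<in> carrier G - H} = ?W" using g by auto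
    ultimately show ?thesis by simp
  qed
  moreover have "\<one> \<in> ?W"
  proof -
    have "inv g' \<otimes> g \<notin> H"
    proof
      assume h: "inv g' \<otimes> g \<in> H"
      have "g = g' \<otimes> (inv g' \<otimes> g)" using g by (simp add: m_assoc[symmetric])
      then show False using l_coset_mult_right[OF sH g(2) h] g(3) by simp
    qed
    then show ?thesis using g by simp
  qed
  ultimately obtain N where N: "N \<lhd> G" "openin (gtop G) N" "N \<subseteq> ?W"
    using open_normal_basis by blast
  have sN: "subgroup N G" using N(1) by (rule normal_imp_subgroup)
  define f where "f = (\<lambda>x. \<exists>u\<in>N. \<exists>h\<in>H. x = g \<otimes> u \<otimes> h)"
  have NG: "N \<subseteq> carrier G" using sN by (rule subgroup.subset)
  have fH1: "f (x \<otimes> h)" if "f x" "h \<in> H" for x h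
  proof -
    obtain u k where "u \<in> N" "k \<in> H" "x = g \<otimes> u \<otimes> k" using \<open>f x\<close> f_def by blast
    then show ?thesis unfolding f_def
      using that g HG NG sH by (intro bexI[of _ u] bexI[of _ "k \<otimes> h"])
        (auto simp: m_assoc subgroup.m_closed subset_iff)
  qed
  have fN1: "f (x \<otimes> v)" if "f x" "v \<in> N" for x v
  proof -
    obtain u k where u: "u \<in> N" "k \<in> H" "x = g \<otimes> u \<otimes> k" using \<open>f x\<close> f_def by blast
    have k: "k \<in> carrier G" and v: "v \<in> carrier G" and uc: "u \<in> carrier G"
      using u that HG NG by auto
    have "k \<otimes> v \<otimes> inv k \<in> N" using N(1) that(2) k normal_inv_iff by blast
    then have "u \<otimes> (k \<otimes> v \<otimes> inv k) \<in> N" using u sN subgroup.m_closed by metis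
    moreover have "x \<otimes> v = g \<otimes> (u \<otimes> (k \<otimes> v \<otimes> inv k)) \<otimes> k"
      using u g k v uc by (simp add: m_assoc)
    ultimately show ?thesis unfolding f_def using u by blast
  qed
  have fH: "f (x \<otimes> h) = f x" if "x \<in> carrier G" "h \<in> H" for x h
  proof
    assume "f (x \<otimes> h)"
    then have "f (x \<otimes> h \<otimes> inv h)" using fH1 that subgroup.m_inv_closed[OF sH] by blast
    then show "f x" using that HG by (simp add: m_assoc subset_iff)
  qed (use fH1 that in blast)
  have fN: "f (x \<otimes> h) = f x" if "x \<in> carrier G" "h \<in> N" for x h
  proof
    assume "f (x \<otimes> h)"
    then have "f (x \<otimes> h \<otimes> inv h)" using fN1 that subgroup.m_inv_closed[OF sN] by blast
    then show "f x" using that NG by (simp add: m_assoc subset_iff)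
  qed (use fN1 that in blast)
  have "f g" unfolding f_def using g subgroup.one_closed[OF sN] subgroup.one_closed[OF sH]
    by (intro bexI[of _ \<one>]) auto
  moreover have "\<not> f g'"
  proof
    assume "f g'"
    then obtain u h where u: "u \<in> N" "h \<in> H" "g' = g \<otimes> u \<otimes> h" using f_def by blast
    have c: "u \<in> carrier G" "h \<in> carrier G" using u HG NG by auto
    have "g' \<otimes> inv h = g \<otimes> u" using u(3) c g by (simp add: m_assoc)
    then have "inv g' \<otimes> (g \<otimes> u) = inv h" using g c by (metis inv_closed inv_solve_left m_closed)
    then have "inv g' \<otimes> g \<otimes> u = inv h" using g c by (simp add: m_assoc)
    then show False using u N(3) subgroup.m_inv_closed[OF sH u(2)] by auto
  qed
  ultimately show ?thesis
    using that[of f] fH locally_constant_right_invariant[OF sN N(2), of f] fN by blast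
qed

lemma continuous_map_coset_space:
  "continuous_map (coset_space G H) Z F \<longleftrightarrow> continuous_map (gtop G) Z (\<lambda>g. F (g <# H))"
  using continuous_compose_quotient_map_eq[OF quotient_map_quotient_topology[of "gtop G" "\<lambda>g. g <# H"], of Z F]
  unfolding coset_space_def by (auto simp: o_def)

lemma topspace_coset_space: "topspace (coset_space G H) = (\<lambda>g. g <# H) ` carrier G"
  by (simp add: coset_space_def)

lemma locally_constant_coset_space:
  "locally_constant (coset_space G H) F \<longleftrightarrow> locally_constant (gtop G) (\<lambda>g. F (g <# H))"
  unfolding locally_constant_def by (rule continuous_map_coset_space)

lemma continuous_map_to_coset: "continuous_map (gtop G) (coset_space G H) (\<lambda>g. g <# H)"
  using continuous_map_coset_space[of H "coset_space G H" "\<lambda>x. x"] by simp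

lemma profinite_coset_space:
  assumes H: "closed_subgroup H G"
  shows "profinite_space (coset_space G H)"
proof (rule profinite_spaceI)
  show "compact_space (coset_space G H)"
    using image_compactin[OF _ continuous_map_to_coset, of "carrier G" H] compact_gtop
    by (simp add: compact_space_def topspace_coset_space)
  have sH: "subgroup H G" using H by (simp add: closed_subgroup_def)
  fix x y assume "x \<in> topspace (coset_space G H)" "y \<in> topspace (coset_space G H)" "x \<noteq> y"
  then obtain g g' where g: "g \<in> carrier G" "g' \<in> carrier G" "x = g <# H" "y = g' <# H"
    by (auto simp: topspace_coset_space)
  then obtain f :: "'g \<Rightarrow> bool" where f: "locally_constant (gtop G) f" "f g" "\<not> f g'"
    "\<And>x h. x \<in> carrier G \<Longrightarrow> h \<in> H \<Longrightarrow> f (x \<otimes> h) = f x"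
    using coset_separation[OF H g(1,2)] \<open>x \<noteq> y\<close> by metis
  obtain F where F: "\<And>g. g \<in> carrier G \<Longrightarrow> F (g <# H) = f g"
    using l_coset_descend[OF sH f(4)] by metis
  have "locally_constant (coset_space G H) F"
    unfolding locally_constant_coset_space using f(1) by (rule locally_constant_cong) (simp add: F)
  moreover have "F x \<noteq> F y" using F f g by simp
  ultimately show "\<exists>F :: 'g set \<Rightarrow> bool. locally_constant (coset_space G H) F \<and> F x \<noteq> F y" by blast
qed

text \<open>\<open>Q\<close> is the quotient by an open normal subgroup under which \<open>f\<close>
  is invariant; it is in the class because \<open>G\<close> is a pro-\<open>\<C>\<close>
  group.\<close>

lemma finite_class_quotient:
  assumes G: "pro_class_group \<C> G" and f: "locally_constant (gtop G) f"
  obtains Q :: "'g set monoid" and p f' where "in_class \<C> Q" "p \<in> hom G Q" "p ` carrier G = carrier Q"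
    "locally_constant (gtop G) p" "\<And>g. g \<in> carrier G \<Longrightarrow> f g = f' (p g)"
proof -
  obtain N where N: "N \<lhd> G" "openin (gtop G) N"
    "\<And>g u. g \<in> carrier G \<Longrightarrow> u \<in> N \<Longrightarrow> f (g \<otimes> u) = f g"
    using locally_constant_factor[OF f] by metis
  interpret normal N G by fact
  let ?p = "\<lambda>g. N #> g"
  have p: "?p g = g <# N" if "g \<in> carrier G" for g using coset_eq that by blast
  have "in_class \<C> (G Mod N)" using G N by (simp add: pro_class_group_def)
  moreover have "?p \<in> hom G (G Mod N)" by (rule r_coset_hom_Mod)
  moreover have "?p ` carrier G = carrier (G Mod N)" by (auto simp: FactGroup_def RCOSETS_def)
  moreover have "locally_constant (gtop G) ?p"
    by (rule locally_constant_right_invariant[OF subgroup_axioms N(2)])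
      (use l_coset_mult_right[OF subgroup_axioms] subset in \<open>auto simp: p subset_iff\<close>)
  moreover obtain f' where "\<And>g. g \<in> carrier G \<Longrightarrow> f' (g <# N) = f g"
    using l_coset_descend[OF subgroup_axioms N(3)] by metis
  ultimately show ?thesis using that[of "G Mod N" ?p f'] p by metis
qed

text \<open>A locally constant function that separates \<open>x\<close> from the identity factors
  through a finite quotient in the class, in which \<open>x\<close> survives.\<close>

lemma exists_modulus_infinite:
  assumes G: "pro_class_group \<C> G" and closed: "closed_class \<C>" and x: "x \<in> carrier G" "x \<noteq> \<one>"
  obtains n where "n \<in> class_moduli \<C>" "n \<ge> 2"
proof -
  obtain f :: "'g \<Rightarrow> bool" where f: "locally_constant (gtop G) f" "f \<one>" "\<not> f x"
    using profinite_space_separation[OF profinite_gtop, of \<one> x] x by auto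
  obtain Q :: "'g set monoid" and p f' where Q: "in_class \<C> Q" "p \<in> hom G Q" "p ` carrier G = carrier Q"
    "\<And>g. g \<in> carrier G \<Longrightarrow> f g = f' (p g)"
    using finite_class_quotient[OF G f(1)] by metis
  have "p \<one> = \<one>\<^bsub>Q\<^esub>" using hom_one[OF Q(2) is_group in_class_group[OF Q(1)]] .
  moreover have "p x \<noteq> p \<one>" using Q(4)[of x] Q(4)[of \<one>] x f by auto
  moreover have "p x \<in> carrier Q" using Q(3) x by blast
  ultimately show ?thesis using exists_class_modulus[OF closed Q(1), of "p x"] that by metis
qed

end

text \<open>A finite group with the discrete topology is profinite, and its quotients stay in the
  class. This makes a finite group over any type into a test object over the required one.\<close>

lemma pro_class_transport_group:
  fixes f :: "'a \<Rightarrow> 'b"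
  assumes closed: "closed_class \<C>" and H: "in_class \<C> H" and f: "inj_on f (carrier H)"
  shows "pro_class_group \<C> (transport_group f H (topgroup.fields (discrete_topology (f ` carrier H))))"
proof -
  define K where "K = transport_group f H (topgroup.fields (discrete_topology (f ` carrier H)))"
  have cK: "carrier K = f ` carrier H" by (simp add: K_def transport_group_def)
  have tK: "gtop K = discrete_topology (carrier K)"
    unfolding cK by (simp add: K_def transport_group_def topgroup.defs)
  have gH: "group H" using H by (rule in_class_group)
  interpret K: group K unfolding K_def using transport_group_group[OF gH f] .
  have "in_class \<C> K" unfolding K_def
    using in_class_iso[OF H transport_group_group[OF gH f] transport_group_iso[OF gH f]] .
  have fin: "finite (carrier K)" using cK in_class_finite[OF closed H] by simp
  have "profinite_space (gtop K)"
  proof (rule profinite_spaceI)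
    show "compact_space (gtop K)" using fin by (simp add: tK compact_space_discrete_topology)
    fix x y :: 'b assume "x \<noteq> y"
    then show "\<exists>h :: 'b \<Rightarrow> 'b. locally_constant (gtop K) h \<and> h x \<noteq> h y"
      by (intro exI[of _ id]) (simp add: tK locally_constant_def)
  qed
  then have "profinite_group K"
    unfolding profinite_group_def
    by (auto simp: tK K.is_group prod_topology_discrete_topology[symmetric])
  moreover have "in_class \<C> (K Mod N)" if N: "N \<lhd> K" for N
  proof (rule in_class_quotient[OF closed \<open>in_class \<C> K\<close>])
    interpret normal N K by fact
    show "group (K Mod N)" by (rule factorgroup_is_group)
    show "(\<lambda>g. N #>\<^bsub>K\<^esub> g) \<in> hom K (K Mod N)" by (rule r_coset_hom_Mod)
    show "(\<lambda>g. N #>\<^bsub>K\<^esub> g) ` carrier K = carrier (K Mod N)" by (auto simp: FactGroup_def RCOSETS_def)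
  qed
  ultimately show ?thesis unfolding K_def[symmetric] pro_class_group_def by blast
qed

section \<open>Splittings and potentials\<close>

lemma finite_inj_into_infinite:
  assumes "finite A" "infinite (B :: 'b set)"
  obtains f :: "'a \<Rightarrow> 'b" where "inj_on f A"
proof -
  obtain B' where "B' \<subseteq> B" "finite B'" "card B' = card A"
    using infinite_arbitrarily_large[OF assms(2)] by metis
  then show ?thesis using that finite_same_card_bij[OF assms(1), of B'] bij_betw_imp_inj_on by metis
qed

context profinite_topgroup
begin

lemma topspace_subgrp: "A \<subseteq> carrier G \<Longrightarrow> topspace (gtop (subgrp G A)) = A"
  and gtop_subgrp: "gtop (subgrp G A) = subtopology (gtop G) A"
  and carrier_subgrp: "carrier (subgrp G A) = A"
  and mult_subgrp: "monoid.mult (subgrp G A) = monoid.mult G"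
  by (auto simp: subgrp_def)

lemma hom_subgrp: "h \<in> hom G H \<Longrightarrow> A \<subseteq> carrier G \<Longrightarrow> h \<in> hom (subgrp G A) H"
  by (auto simp: hom_def carrier_subgrp mult_subgrp)

end

lemma locally_constant_subtopology: "locally_constant X f \<Longrightarrow> locally_constant (subtopology X S) f"
  unfolding locally_constant_def by (rule continuous_map_from_subtopology)

lemma continuous_map_discrete_iff:
  "continuous_map X (discrete_topology S) f \<longleftrightarrow> locally_constant X f \<and> f ` topspace X \<subseteq> S"
  using continuous_map_in_subtopology[of X "discrete_topology UNIV" S f]
  by (auto simp: locally_constant_def subtopology_discrete_topology)

lemma Ex1_unique: "\<exists>!x. P x \<Longrightarrow> P a \<Longrightarrow> P b \<Longrightarrow> a = b"
  by blast

text \<open>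
  The universal properties only mention pro-\<open>\<C>\<close> groups over the type of \<open>G\<close>; a finite group over
  any type has a copy there.
\<close>

locale finite_target = profinite_topgroup G for G :: "'g topgroup" (structure) +
  fixes \<C> :: "nat monoid \<Rightarrow> bool" and H :: "('b, 'm) monoid_scheme" and f :: "'b \<Rightarrow> 'g"
  assumes closed: "closed_class \<C>" and H: "in_class \<C> H" and f: "inj_on f (carrier H)"
begin

definition K :: "'g topgroup" where
  "K = transport_group f H (topgroup.fields (discrete_topology (f ` carrier H)))"

lemma pro_class_K: "pro_class_group \<C> K"
  unfolding K_def by (rule pro_class_transport_group[OF closed H f])

lemma K_iso: "f \<in> iso H K"
  unfolding K_def by (rule transport_group_iso[OF in_class_group[OF H] f])

lemma carrier_K: "carrier K = f ` carrier H"
  by (simp add: K_def transport_group_def)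

lemma gtop_K: "gtop K = discrete_topology (carrier K)"
  unfolding carrier_K by (simp add: K_def transport_group_def topgroup.defs)

lemma group_K: "group K"
  unfolding K_def by (rule transport_group_group[OF in_class_group[OF H] f])

lemma hom_to_K: "a \<in> hom L H \<Longrightarrow> (\<lambda>x. f (a x)) \<in> hom L K"
  using K_iso by (auto simp: iso_def hom_def Pi_iff)

lemma cont_hom_to_K:
  assumes "a \<in> hom L H" "locally_constant (gtop L) a" "topspace (gtop L) = carrier L"
  shows "(\<lambda>x. f (a x)) \<in> cont_hom L K"
proof -
  have "locally_constant (gtop L) (\<lambda>x. f (a x))" using assms(2) by (rule locally_constant_comp)
  moreover have "f (a x) \<in> carrier K" if "x \<in> carrier L" for x
    using that assms(1) by (auto simp: carrier_K hom_def)
  ultimately have "continuous_map (gtop L) (gtop K) (\<lambda>x. f (a x))"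
    using assms(3) by (auto simp: gtop_K continuous_map_discrete_iff)
  then show ?thesis using hom_to_K[OF assms(1)] by (simp add: cont_hom_def)
qed

lemma restrict_cont_hom:
  assumes "a \<in> cont_hom G K"
  shows "restrict a (carrier G) \<in> cont_hom G K"
  using assms continuous_map_eq[of "gtop G" "gtop K" a "restrict a (carrier G)"]
  by (auto simp: cont_hom_def hom_def)

lemma hom_from_K:
  assumes "h \<in> cont_hom G K"
  shows "(\<lambda>x. inv_into (carrier H) f (h x)) \<in> hom G H"
    and "locally_constant (gtop G) (\<lambda>x. inv_into (carrier H) f (h x))"
proof -
  have "inv_into (carrier H) f \<in> iso K H"
    using group.iso_set_sym[OF in_class_group[OF H] K_iso] .
  then show "(\<lambda>x. inv_into (carrier H) f (h x)) \<in> hom G H"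
    using assms by (auto simp: cont_hom_def iso_def hom_def Pi_iff)
  have "locally_constant (gtop G) h"
    using assms by (simp add: cont_hom_def gtop_K continuous_map_discrete_iff)
  then show "locally_constant (gtop G) (\<lambda>x. inv_into (carrier H) f (h x))"
    by (rule locally_constant_comp)
qed

text \<open>The universal property is applied to the copy \<open>K\<close> of the target, and the
  resulting homomorphism is brought back along the inverse of \<open>f\<close>.\<close>

lemma amalgam_hom_exists:
  assumes amalgam: "proper_amalgam \<C> G A B C"
    and a: "a \<in> hom (subgrp G A) H" "locally_constant (subtopology (gtop G) A) a"
    and b: "b \<in> hom (subgrp G B) H" "locally_constant (subtopology (gtop G) B) b"
    and ab: "\<And>c. c \<in> C \<Longrightarrow> a c = b c"
  obtains h where "h \<in> hom G H" "locally_constant (gtop G) h"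
    "\<And>x. x \<in> A \<Longrightarrow> h x = a x" "\<And>x. x \<in> B \<Longrightarrow> h x = b x"
proof -
  have AB: "A \<subseteq> carrier G" "B \<subseteq> carrier G"
    using amalgam by (auto simp: proper_amalgam_def closed_subgroup_def dest: subgroup.subset)
  have "(\<lambda>x. f (a x)) \<in> cont_hom (subgrp G A) K" "(\<lambda>x. f (b x)) \<in> cont_hom (subgrp G B) K"
    using cont_hom_to_K[OF a(1)] cont_hom_to_K[OF b(1)] a b AB
    by (simp_all only: gtop_subgrp topspace_subgrp carrier_subgrp topspace_subgrp[unfolded gtop_subgrp])
  then have "\<exists>!h. h \<in> extensional (carrier G) \<and> h \<in> cont_hom G K \<and>
      (\<forall>x\<in>A. h x = f (a x)) \<and> (\<forall>x\<in>B. h x = f (b x))"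
    using amalgam pro_class_K ab unfolding proper_amalgam_def by simp
  then obtain h where h: "h \<in> cont_hom G K" "\<And>x. x \<in> A \<Longrightarrow> h x = f (a x)" "\<And>x. x \<in> B \<Longrightarrow> h x = f (b x)"
    by blast
  have "a x \<in> carrier H" if "x \<in> A" for x using that a(1) by (auto simp: hom_def carrier_subgrp)
  moreover have "b x \<in> carrier H" if "x \<in> B" for x using that b(1) by (auto simp: hom_def carrier_subgrp)
  ultimately show ?thesis
    using that[OF hom_from_K[OF h(1)]] h f by simp
qed

text \<open>Composed with \<open>f\<close> and restricted to the carrier, both maps solve the
  extension problem posed by the restrictions of \<open>h\<close> to the two factors, and the
  solution is unique.\<close>

lemma amalgam_hom_unique:
  assumes amalgam: "proper_amalgam \<C> G A B C"
    and h: "h \<in> hom G H" "locally_constant (gtop G) h" and k: "k \<in> hom G H" "locally_constant (gtop G) k"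
    and eq: "\<And>x. x \<in> A \<Longrightarrow> h x = k x" "\<And>x. x \<in> B \<Longrightarrow> h x = k x" and x: "x \<in> carrier G"
  shows "h x = k x"
proof -
  have AB: "A \<subseteq> carrier G" "B \<subseteq> carrier G" "C \<subseteq> A"
    using amalgam by (auto simp: proper_amalgam_def closed_subgroup_def dest: subgroup.subset)
  have "(\<lambda>x. f (h x)) \<in> cont_hom (subgrp G D) K" if "D \<subseteq> carrier G" for D
    by (rule cont_hom_to_K[OF hom_subgrp[OF h(1) that]])
      (use that h(2) in \<open>auto simp: gtop_subgrp carrier_subgrp intro: locally_constant_subtopology\<close>)
  then have ex: "\<exists>!h'. h' \<in> extensional (carrier G) \<and> h' \<in> cont_hom G K \<and>
      (\<forall>x\<in>A. h' x = f (h x)) \<and> (\<forall>x\<in>B. h' x = f (h x))"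
    using amalgam pro_class_K AB unfolding proper_amalgam_def by simp
  have hK: "restrict (\<lambda>x. f (h x)) (carrier G) \<in> cont_hom G K"
    "restrict (\<lambda>x. f (k x)) (carrier G) \<in> cont_hom G K"
    using restrict_cont_hom[OF cont_hom_to_K[OF h topspace_gtop]]
      restrict_cont_hom[OF cont_hom_to_K[OF k topspace_gtop]] by blast+
  have "restrict (\<lambda>x. f (h x)) (carrier G) = restrict (\<lambda>x. f (k x)) (carrier G)"
    by (rule Ex1_unique[OF ex]) (use hK AB eq in \<open>auto simp: subset_iff\<close>)
  then have "f (h x) = f (k x)" using x by (metis restrict_apply')
  moreover have "h x \<in> carrier H" "k x \<in> carrier H" using h k x by (auto simp: hom_def)
  ultimately show ?thesis using f by (simp add: inj_on_eq_iff)
qed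

text \<open>The conjugation relation is stated as a commutation rule, because inverses in a wreath
  product are awkward to compute.\<close>

lemma hnn_hom_exists:
  assumes hnn: "proper_hnn \<C> G A C t"
    and a: "a \<in> hom (subgrp G A) H" "locally_constant (subtopology (gtop G) A) a"
    and k: "k \<in> carrier H"
    and ak: "\<And>c. c \<in> C \<Longrightarrow> a c \<otimes>\<^bsub>H\<^esub> k = k \<otimes>\<^bsub>H\<^esub> a (inv t \<otimes> c \<otimes> t)"
  obtains h where "h \<in> hom G H" "locally_constant (gtop G) h" "\<And>x. x \<in> A \<Longrightarrow> h x = a x" "h t = k"
proof -
  interpret H: group H using H by (rule in_class_group)
  interpret K: group K by (rule group_K)
  have A: "A \<subseteq> carrier G" and CA: "C \<subseteq> A" and tC: "\<And>c. c \<in> C \<Longrightarrow> inv t \<otimes> c \<otimes> t \<in> A"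
    using hnn by (auto simp: proper_hnn_def closed_subgroup_def dest: subgroup.subset)
  have aH: "a x \<in> carrier H" if "x \<in> A" for x using that a(1) by (auto simp: hom_def carrier_subgrp)
  have f_mult: "f (x \<otimes>\<^bsub>H\<^esub> y) = f x \<otimes>\<^bsub>K\<^esub> f y" and f_in: "f x \<in> carrier K"
    if "x \<in> carrier H" "y \<in> carrier H" for x y
    using K_iso that by (auto simp: iso_def hom_def)
  have "inv\<^bsub>K\<^esub> f k \<otimes>\<^bsub>K\<^esub> f (a c) \<otimes>\<^bsub>K\<^esub> f k = f (a (inv t \<otimes> c \<otimes> t))" if c: "c \<in> C" for c
  proof -
    have "f (a c) \<otimes>\<^bsub>K\<^esub> f k = f k \<otimes>\<^bsub>K\<^esub> f (a (inv t \<otimes> c \<otimes> t))"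
      using ak[OF c] aH CA tC c k f_mult by (metis subsetD)
    moreover have "f k \<in> carrier K" "f (a c) \<in> carrier K" "f (a (inv t \<otimes> c \<otimes> t)) \<in> carrier K"
      using f_in aH CA tC[OF c] c k by blast+
    ultimately show ?thesis by (simp add: K.m_assoc K.inv_solve_left')
  qed
  moreover have "(\<lambda>x. f (a x)) \<in> cont_hom (subgrp G A) K"
    using cont_hom_to_K[OF a(1)] a A
    by (simp only: gtop_subgrp carrier_subgrp topspace_subgrp[unfolded gtop_subgrp])
  moreover have "f k \<in> carrier K" using f_in k by blast
  ultimately have "\<exists>!h. h \<in> extensional (carrier G) \<and> h \<in> cont_hom G K \<and>
      (\<forall>x\<in>A. h x = f (a x)) \<and> h t = f k"
    using hnn pro_class_K unfolding proper_hnn_def by simp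
  then obtain h where h: "h \<in> cont_hom G K" "\<And>x. x \<in> A \<Longrightarrow> h x = f (a x)" "h t = f k"
    by blast
  then show ?thesis using that[OF hom_from_K[OF h(1)]] aH k f by simp
qed

lemma hnn_hom_unique:
  assumes hnn: "proper_hnn \<C> G A C t"
    and h: "h \<in> hom G H" "locally_constant (gtop G) h" and k: "k \<in> hom G H" "locally_constant (gtop G) k"
    and eq: "\<And>x. x \<in> A \<Longrightarrow> h x = k x" "h t = k t" and x: "x \<in> carrier G"
  shows "h x = k x"
proof -
  have A: "A \<subseteq> carrier G" and CA: "C \<subseteq> A" and t: "t \<in> carrier G"
    and tC: "\<And>c. c \<in> C \<Longrightarrow> inv t \<otimes> c \<otimes> t \<in> A"
    using hnn by (auto simp: proper_hnn_def closed_subgroup_def dest: subgroup.subset)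
  have hA: "(\<lambda>x. f (h x)) \<in> cont_hom (subgrp G A) K"
    by (rule cont_hom_to_K[OF hom_subgrp[OF h(1) A]])
      (use A h(2) in \<open>auto simp: gtop_subgrp carrier_subgrp intro: locally_constant_subtopology\<close>)
  interpret fh: group_hom G K "\<lambda>x. f (h x)"
    using hom_to_K[OF h(1)] is_group group_K by (simp add: group_hom_def group_hom_axioms_def)
  have "inv\<^bsub>K\<^esub> f (h t) \<otimes>\<^bsub>K\<^esub> f (h c) \<otimes>\<^bsub>K\<^esub> f (h t) = f (h (inv t \<otimes> c \<otimes> t))" if "c \<in> C" for c
  proof -
    have "c \<in> carrier G" using that CA A by auto
    then show ?thesis using t by (simp del: fh.hom_inv add: fh.hom_inv[symmetric] fh.hom_mult)
  qed
  then have ex: "\<exists>!h'. h' \<in> extensional (carrier G) \<and> h' \<in> cont_hom G K \<and>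
      (\<forall>x\<in>A. h' x = f (h x)) \<and> h' t = f (h t)"
    using hnn pro_class_K hA fh.hom_closed[OF t] unfolding proper_hnn_def by simp
  have hK: "restrict (\<lambda>x. f (h x)) (carrier G) \<in> cont_hom G K"
    "restrict (\<lambda>x. f (k x)) (carrier G) \<in> cont_hom G K"
    using restrict_cont_hom[OF cont_hom_to_K[OF h topspace_gtop]]
      restrict_cont_hom[OF cont_hom_to_K[OF k topspace_gtop]] by blast+
  have "restrict (\<lambda>x. f (h x)) (carrier G) = restrict (\<lambda>x. f (k x)) (carrier G)"
    by (rule Ex1_unique[OF ex]) (use hK A t eq in \<open>auto simp: subset_iff\<close>)
  then have "f (h x) = f (k x)" using x by (metis restrict_apply')
  moreover have "h x \<in> carrier H" "k x \<in> carrier H" using h k x by (auto simp: hom_def)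
  ultimately show ?thesis using f by (simp add: inj_on_eq_iff)
qed

end

text \<open>This is the conjugate by the function \<open>f\<close> of the lift
  \<open>g \<mapsto> (0, p g)\<close>; its first component is the principal derivation of
  \<open>f\<close>. For \<open>f = 0\<close> it is the trivial lift itself.\<close>

lemma wreath_coboundary_hom:
  assumes "group Q" "n \<ge> 1" "p \<in> hom L Q"
  shows "(\<lambda>g. (\<lambda>x\<in>carrier Q. (f x - f (x \<otimes>\<^bsub>Q\<^esub> p g)) mod int n, p g)) \<in> hom L (wreath n Q)"
proof (rule homI)
  interpret group Q by fact
  have n: "int n > 0" using assms(2) by simp
  have p: "p g \<in> carrier Q" "p (g \<otimes>\<^bsub>L\<^esub> h) = p g \<otimes>\<^bsub>Q\<^esub> p h" if "g \<in> carrier L" "h \<in> carrier L" for g h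
    using assms(3) that by (auto simp: hom_def)
  fix g assume g: "g \<in> carrier L"
  then show "(\<lambda>x\<in>carrier Q. (f x - f (x \<otimes>\<^bsub>Q\<^esub> p g)) mod int n, p g) \<in> carrier (wreath n Q)"
    using n p by (simp add: wreath_carrier)
  fix h assume h: "h \<in> carrier L"
  show "(\<lambda>x\<in>carrier Q. (f x - f (x \<otimes>\<^bsub>Q\<^esub> p (g \<otimes>\<^bsub>L\<^esub> h))) mod int n, p (g \<otimes>\<^bsub>L\<^esub> h)) =
    (\<lambda>x\<in>carrier Q. (f x - f (x \<otimes>\<^bsub>Q\<^esub> p g)) mod int n, p g) \<otimes>\<^bsub>wreath n Q\<^esub>
    (\<lambda>x\<in>carrier Q. (f x - f (x \<otimes>\<^bsub>Q\<^esub> p h)) mod int n, p h)"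
    using g h by (auto simp: wreath_mult p fun_eq_iff mod_simps m_assoc)
qed

lemma wreath_hom_snd: "h \<in> hom G (wreath n Q) \<Longrightarrow> (\<lambda>g. snd (h g)) \<in> hom G Q"
  by (fastforce simp: hom_def wreath_def Pi_iff split: prod.splits)

text \<open>The first component, evaluated at the identity of \<open>Q\<close>, will serve as the
  potential; the product law tells how it changes under right multiplication.\<close>

lemma wreath_hom_derivation:
  assumes "h \<in> hom G (wreath n Q)" "group Q" "g \<in> carrier G" "g' \<in> carrier G"
  shows "fst (h (g \<otimes>\<^bsub>G\<^esub> g')) \<one>\<^bsub>Q\<^esub> = (fst (h g) \<one>\<^bsub>Q\<^esub> + fst (h g') (snd (h g))) mod int n"
    and "fst (h g) \<one>\<^bsub>Q\<^esub> \<in> {0..<int n}" and "snd (h g) \<in> carrier Q"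
proof -
  interpret group Q by fact
  obtain a p b q where hg: "h g = (a, p)" "h g' = (b, q)" by (metis surj_pair)
  have "(a, p) \<in> carrier (wreath n Q)" using assms hg by (auto simp: hom_def Pi_iff)
  then have ap: "a \<in> carrier Q \<rightarrow>\<^sub>E {0..<int n}" "p \<in> carrier Q" by (auto simp: wreath_carrier)
  then show "fst (h g) \<one>\<^bsub>Q\<^esub> \<in> {0..<int n}" "snd (h g) \<in> carrier Q"
    unfolding hg by (auto simp: PiE_iff)
  have "h (g \<otimes>\<^bsub>G\<^esub> g') = (a, p) \<otimes>\<^bsub>wreath n Q\<^esub> (b, q)"
    using assms hg by (metis hom_mult)
  then show "fst (h (g \<otimes>\<^bsub>G\<^esub> g')) \<one>\<^bsub>Q\<^esub> = (fst (h g) \<one>\<^bsub>Q\<^esub> + fst (h g') (snd (h g))) mod int n"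
    using ap(2) by (simp add: hg wreath_mult)
qed

text \<open>An infinite carrier guarantees that every finite group injects into the type of
  \<open>G\<close>, where the universal properties are tested.\<close>

locale splitting_group = profinite_topgroup G for G :: "'g topgroup" (structure) +
  fixes \<C> :: "nat monoid \<Rightarrow> bool" and n :: nat
  assumes closed: "closed_class \<C>" and pro_class: "pro_class_group \<C> G"
    and infinite: "infinite (carrier G)" and n: "n \<in> class_moduli \<C>"
begin

lemma n1: "n \<ge> 1"
  using n by (simp add: class_moduli_def)

lemma finite_targetE:
  fixes H :: "('b, 'm) monoid_scheme"
  assumes "in_class \<C> H"
  obtains f where "finite_target G \<C> H f"
proof -
  have "infinite (UNIV :: 'g set)" using infinite rev_finite_subset by blast
  then obtain f :: "'b \<Rightarrow> 'g" where "inj_on f (carrier H)"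
    using finite_inj_into_infinite[OF in_class_finite[OF closed assms]] by metis
  then show ?thesis
    using that closed assms profinite_topgroup_axioms by (simp add: finite_target_def finite_target_axioms_def)
qed

text \<open>\<open>Q\<close> is a finite quotient through which \<open>f\<close> factors. It is a
  target alongside the wreath product in order to recognise the second component of a homomorphism
  as \<open>p\<close>.\<close>

lemma wreath_targetE:
  assumes f: "locally_constant (gtop G) (f :: 'g \<Rightarrow> int)"
  obtains Q :: "'g set monoid" and p f' i j where
    "group Q" "finite_target G \<C> Q i" "finite_target G \<C> (wreath n Q) j"
    "p \<in> hom G Q" "p ` carrier G = carrier Q" "locally_constant (gtop G) p"
    "\<And>g. g \<in> carrier G \<Longrightarrow> f g = f' (p g)"
proof -
  obtain Q :: "'g set monoid" and p f' where Q: "in_class \<C> Q" "p \<in> hom G Q" "p ` carrier G = carrier Q"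
    "locally_constant (gtop G) p" "\<And>g. g \<in> carrier G \<Longrightarrow> f g = f' (p g)"
    using finite_class_quotient[OF pro_class f] by metis
  obtain i where "finite_target G \<C> Q i" using finite_targetE[OF Q(1)] by metis
  moreover obtain j where "finite_target G \<C> (wreath n Q) j"
    using finite_targetE[OF in_class_wreath[OF closed Q(1) n]] by metis
  ultimately show ?thesis using that Q in_class_group by metis
qed

text \<open>
  Let \<open>G\<close> act on the functions from a finite quotient \<open>Q\<close> to the integers modulo \<open>n\<close> by right
  translation. The homomorphism to the wreath product that is trivial on \<open>A\<close> and conjugation by
  \<open>f\<close> on \<open>B\<close> gives a derivation \<open>D\<close>, and \<open>P g = D g \<one>\<close> is the potential.
\<close>

lemma amalgam_potential:
  assumes amalgam: "proper_amalgam \<C> G A B C"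
    and f: "locally_constant (gtop G) (f :: 'g \<Rightarrow> int)"
    and fC: "\<And>g c. g \<in> carrier G \<Longrightarrow> c \<in> C \<Longrightarrow> f (g \<otimes> c) = f g"
  obtains P :: "'g \<Rightarrow> int" where "locally_constant (gtop G) P"
    "\<And>g a. g \<in> carrier G \<Longrightarrow> a \<in> A \<Longrightarrow> P (g \<otimes> a) = P g"
    "\<And>g b. g \<in> carrier G \<Longrightarrow> b \<in> B \<Longrightarrow> (P (g \<otimes> b) + f (g \<otimes> b)) mod int n = (P g + f g) mod int n"
proof -
  obtain Q :: "'g set monoid" and p f' i j where
    Q: "group Q" "finite_target G \<C> Q i" "finite_target G \<C> (wreath n Q) j"
    "p \<in> hom G Q" "p ` carrier G = carrier Q" "locally_constant (gtop G) p"
    and f': "\<And>g. g \<in> carrier G \<Longrightarrow> f g = f' (p g)"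
    using wreath_targetE[OF f] by metis
  interpret Q: group Q by fact
  have AB: "A \<subseteq> carrier G" "B \<subseteq> carrier G" "C \<subseteq> A" "C \<subseteq> B"
    using amalgam by (auto simp: proper_amalgam_def closed_subgroup_def dest: subgroup.subset)
  have p: "p (g \<otimes> h) = p g \<otimes>\<^bsub>Q\<^esub> p h" "p g \<in> carrier Q" if "g \<in> carrier G" "h \<in> carrier G" for g h
    using Q(4) that by (auto simp: hom_def)
  define w where "w = (\<lambda>(f :: 'g set \<Rightarrow> int) g. (\<lambda>x\<in>carrier Q. (f x - f (x \<otimes>\<^bsub>Q\<^esub> p g)) mod int n, p g))"
  have w: "w k \<in> hom (subgrp G D) (wreath n Q)" "locally_constant (subtopology (gtop G) D) (w k)"
    if "D \<subseteq> carrier G" for D k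
    unfolding w_def
    using wreath_coboundary_hom[OF Q(1) n1 hom_subgrp[OF Q(4) that]]
      locally_constant_subtopology[OF locally_constant_comp[OF Q(6)]] by auto
  \<comment> \<open>The principal derivation of \<open>f'\<close> vanishes on \<open>C\<close>
    because \<open>f\<close> is right invariant under \<open>C\<close>; so the trivial lift on
    \<open>A\<close> and the conjugated lift on \<open>B\<close> fit together.\<close>
  have ab: "w (\<lambda>_. 0) c = w f' c" if c: "c \<in> C" for c
  proof -
    have "f' (x \<otimes>\<^bsub>Q\<^esub> p c) = f' x" if xQ: "x \<in> carrier Q" for x
    proof -
      obtain g where "g \<in> carrier G" "x = p g" using xQ unfolding Q(5)[symmetric] by blast
      then show ?thesis using fC[of g c] c AB f' p by (metis m_closed subsetD)
    qed
    then show ?thesis by (auto simp: w_def fun_eq_iff)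
  qed
  obtain h where h: "h \<in> hom G (wreath n Q)" "locally_constant (gtop G) h"
    "\<And>x. x \<in> A \<Longrightarrow> h x = w (\<lambda>_. 0) x" "\<And>x. x \<in> B \<Longrightarrow> h x = w f' x"
    using finite_target.amalgam_hom_exists[OF Q(3) amalgam
      w[OF AB(1), of "\<lambda>_. 0"] w[OF AB(2), of f'] ab] by blast
  \<comment> \<open>Both maps are homomorphisms to \<open>Q\<close> that coincide on
    \<open>A\<close> and on \<open>B\<close>.\<close>
  have sndh: "snd (h g) = p g" if "g \<in> carrier G" for g
    by (rule finite_target.amalgam_hom_unique[OF Q(2) amalgam wreath_hom_snd[OF h(1)] _ Q(4,6) _ _ that])
      (use h in \<open>auto simp: w_def intro: locally_constant_comp\<close>)
  \<comment> \<open>In terms of the tree, \<open>P g\<close> is the value at the vertex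
    \<open>gA\<close>, and \<open>P g + f g\<close> is the value at \<open>gB\<close>.\<close>
  define P where "P = (\<lambda>g. fst (h g) \<one>\<^bsub>Q\<^esub>)"
  have Pmult: "P (g \<otimes> k) = (P g + fst (h k) (p g)) mod int n" if "g \<in> carrier G" "k \<in> carrier G" for g k
    using wreath_hom_derivation(1)[OF h(1) Q(1) that] sndh that by (simp add: P_def)
  have Prange: "P g \<in> {0..<int n}" if "g \<in> carrier G" for g
    using wreath_hom_derivation(2)[OF h(1) Q(1) that that] by (simp add: P_def)
  show ?thesis
  proof (rule that)
    show "locally_constant (gtop G) P" unfolding P_def using h(2) by (rule locally_constant_comp)
    fix g assume g: "g \<in> carrier G"
    show "P (g \<otimes> a) = P g" if a: "a \<in> A" for a
    proof -
      have "fst (h a) (p g) = 0" using h(3)[OF a] g p by (simp add: w_def)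
      then show ?thesis using Pmult[of g a] Prange[OF g] a AB g by auto
    qed
    show "(P (g \<otimes> b) + f (g \<otimes> b)) mod int n = (P g + f g) mod int n" if b: "b \<in> B" for b
    proof -
      have bG: "b \<in> carrier G" using b AB by auto
      have "fst (h b) (p g) = (f g - f (g \<otimes> b)) mod int n"
        using h(4)[OF b] g bG p by (simp add: w_def f')
      then show ?thesis using Pmult[OF g bG] by (simp add: mod_simps)
    qed
  qed
qed

text \<open>If \<open>P\<close> is invariant under \<open>A\<close> and \<open>B\<close>, the lift
  of \<open>p\<close> by the principal derivation of \<open>P\<close> equals the trivial lift on
  both factors, hence on \<open>G\<close>. At the identity of \<open>Q\<close> this says that
  \<open>P \<one>\<close> and \<open>P g\<close> are congruent.\<close>

lemma amalgam_constant:
  assumes amalgam: "proper_amalgam \<C> G A B C"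
    and P: "locally_constant (gtop G) (P :: 'g \<Rightarrow> int)"
    and PA: "\<And>g a. g \<in> carrier G \<Longrightarrow> a \<in> A \<Longrightarrow> P (g \<otimes> a) mod int n = P g mod int n"
    and PB: "\<And>g b. g \<in> carrier G \<Longrightarrow> b \<in> B \<Longrightarrow> P (g \<otimes> b) mod int n = P g mod int n"
    and g: "g \<in> carrier G"
  shows "P g mod int n = P \<one> mod int n"
proof -
  obtain Q :: "'g set monoid" and p P' i j where
    Q: "group Q" "finite_target G \<C> Q i" "finite_target G \<C> (wreath n Q) j"
    "p \<in> hom G Q" "p ` carrier G = carrier Q" "locally_constant (gtop G) p"
    and P': "\<And>g. g \<in> carrier G \<Longrightarrow> P g = P' (p g)"
    using wreath_targetE[OF P] by metis
  interpret Q: group Q by fact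
  have AB: "A \<subseteq> carrier G" "B \<subseteq> carrier G"
    using amalgam by (auto simp: proper_amalgam_def closed_subgroup_def dest: subgroup.subset)
  have p: "p (g \<otimes> h) = p g \<otimes>\<^bsub>Q\<^esub> p h" if "g \<in> carrier G" "h \<in> carrier G" for g h
    using Q(4) that by (auto simp: hom_def)
  define w where "w = (\<lambda>(f :: 'g set \<Rightarrow> int) g. (\<lambda>x\<in>carrier Q. (f x - f (x \<otimes>\<^bsub>Q\<^esub> p g)) mod int n, p g))"
  have w: "w k \<in> hom G (wreath n Q)" "locally_constant (gtop G) (w k)" for k
    unfolding w_def using wreath_coboundary_hom[OF Q(1) n1 Q(4)] locally_constant_comp[OF Q(6)] by auto
  have eq: "w P' x = w (\<lambda>_. 0) x" if x: "x \<in> carrier G"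
    "\<And>g. g \<in> carrier G \<Longrightarrow> P (g \<otimes> x) mod int n = P g mod int n" for x
  proof -
    have "(P' z - P' (z \<otimes>\<^bsub>Q\<^esub> p x)) mod int n = 0" if xQ: "z \<in> carrier Q" for z
    proof -
      obtain g where "g \<in> carrier G" "z = p g" using xQ unfolding Q(5)[symmetric] by blast
      then show ?thesis using x(2)[of g] x(1) P' p by (metis m_closed mod_0_imp_dvd dvd_imp_mod_0 mod_eq_dvd_iff)
    qed
    then show ?thesis by (auto simp: w_def fun_eq_iff)
  qed
  have "w P' g = w (\<lambda>_. 0) g"
    by (rule finite_target.amalgam_hom_unique[OF Q(3) amalgam w w _ _ g])
      (use eq PA PB AB in \<open>auto simp: subset_iff\<close>)
  then have "fst (w P' g) \<one>\<^bsub>Q\<^esub> = fst (w (\<lambda>_. 0) g) \<one>\<^bsub>Q\<^esub>" by simp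
  moreover have "p g \<in> carrier Q" "p \<one> = \<one>\<^bsub>Q\<^esub>"
    using Q(5) g hom_one[OF Q(4) is_group Q(1)] by auto
  ultimately have "(P \<one> - P g) mod int n = 0"
    using g P'[OF g] P'[OF one_closed] by (simp add: w_def)
  then show ?thesis by (metis mod_0_imp_dvd mod_eq_dvd_iff)
qed

text \<open>The homomorphism is the trivial lift on \<open>A\<close> and sends \<open>t\<close> to
  the pair of \<open>f'\<close> and \<open>p t\<close>; the HNN relation holds because
  \<open>f\<close> is right invariant under \<open>C\<close>. Passing from \<open>g\<close> to
  \<open>g \<otimes> t\<close> then adds \<open>f g\<close>, the increment along the edge
  \<open>gC\<close> from \<open>gA\<close> to \<open>gtA\<close>.\<close>

lemma hnn_potential:
  assumes hnn: "proper_hnn \<C> G A C t"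
    and f: "locally_constant (gtop G) (f :: 'g \<Rightarrow> int)"
    and fC: "\<And>g c. g \<in> carrier G \<Longrightarrow> c \<in> C \<Longrightarrow> f (g \<otimes> c) = f g"
  obtains P :: "'g \<Rightarrow> int" where "locally_constant (gtop G) P"
    "\<And>g a. g \<in> carrier G \<Longrightarrow> a \<in> A \<Longrightarrow> P (g \<otimes> a) = P g"
    "\<And>g. g \<in> carrier G \<Longrightarrow> P (g \<otimes> t) = (P g + f g) mod int n"
proof -
  obtain Q :: "'g set monoid" and p f' i j where
    Q: "group Q" "finite_target G \<C> Q i" "finite_target G \<C> (wreath n Q) j"
    "p \<in> hom G Q" "p ` carrier G = carrier Q" "locally_constant (gtop G) p"
    and f': "\<And>g. g \<in> carrier G \<Longrightarrow> f g = f' (p g)"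
    using wreath_targetE[OF f] by metis
  interpret Q: group Q by fact
  have A: "A \<subseteq> carrier G" "C \<subseteq> A" and t: "t \<in> carrier G"
    using hnn by (auto simp: proper_hnn_def closed_subgroup_def dest: subgroup.subset)
  have p: "p (g \<otimes> h) = p g \<otimes>\<^bsub>Q\<^esub> p h" "p g \<in> carrier Q" if "g \<in> carrier G" "h \<in> carrier G" for g h
    using Q(4) that by (auto simp: hom_def)
  define w where "w = (\<lambda>g. (\<lambda>x\<in>carrier Q. (0 - 0) mod int n, p g))"
  have w: "w \<in> hom (subgrp G A) (wreath n Q)" "locally_constant (subtopology (gtop G) A) w"
    unfolding w_def
    using wreath_coboundary_hom[OF Q(1) n1 hom_subgrp[OF Q(4) A(1)], of "\<lambda>_. 0"]
      locally_constant_subtopology[OF locally_constant_comp[OF Q(6)]] by auto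
  define k where "k = (\<lambda>x\<in>carrier Q. f' x mod int n, p t)"
  have kc: "k \<in> carrier (wreath n Q)" using n1 t p by (simp add: k_def wreath_carrier)
  have wk: "w c \<otimes>\<^bsub>wreath n Q\<^esub> k = k \<otimes>\<^bsub>wreath n Q\<^esub> w (inv t \<otimes> c \<otimes> t)" if c: "c \<in> C" for c
  proof -
    have cG: "c \<in> carrier G" using c A by auto
    have "f' (x \<otimes>\<^bsub>Q\<^esub> p c) = f' x" if xQ: "x \<in> carrier Q" for x
    proof -
      obtain g where "g \<in> carrier G" "x = p g" using xQ unfolding Q(5)[symmetric] by blast
      then show ?thesis using fC[of g c] c cG f' p by (metis m_closed)
    qed
    moreover have "p c \<otimes>\<^bsub>Q\<^esub> p t = p t \<otimes>\<^bsub>Q\<^esub> p (inv t \<otimes> c \<otimes> t)"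
    proof -
      have "c \<otimes> t = t \<otimes> (inv t \<otimes> c \<otimes> t)" using cG t by (simp add: m_assoc[symmetric])
      then show ?thesis using p cG t by (metis inv_closed m_closed)
    qed
    ultimately show ?thesis using p cG t by (auto simp: w_def k_def wreath_mult fun_eq_iff)
  qed
  obtain h where h: "h \<in> hom G (wreath n Q)" "locally_constant (gtop G) h"
    "\<And>x. x \<in> A \<Longrightarrow> h x = w x" "h t = k"
    using finite_target.hnn_hom_exists[OF Q(3) hnn w kc wk] by blast
  have sndh: "snd (h g) = p g" if "g \<in> carrier G" for g
    by (rule finite_target.hnn_hom_unique[OF Q(2) hnn wreath_hom_snd[OF h(1)] _ Q(4,6) _ _ that])
      (use h in \<open>auto simp: w_def k_def intro: locally_constant_comp\<close>)
  define P where "P = (\<lambda>g. fst (h g) \<one>\<^bsub>Q\<^esub>)"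
  have Pmult: "P (g \<otimes> k) = (P g + fst (h k) (p g)) mod int n" if "g \<in> carrier G" "k \<in> carrier G" for g k
    using wreath_hom_derivation(1)[OF h(1) Q(1) that] sndh that by (simp add: P_def)
  have Prange: "P g \<in> {0..<int n}" if "g \<in> carrier G" for g
    using wreath_hom_derivation(2)[OF h(1) Q(1) that that] by (simp add: P_def)
  show ?thesis
  proof (rule that)
    show "locally_constant (gtop G) P" unfolding P_def using h(2) by (rule locally_constant_comp)
    fix g assume g: "g \<in> carrier G"
    show "P (g \<otimes> a) = P g" if a: "a \<in> A" for a
    proof -
      have "fst (h a) (p g) = 0" using h(3)[OF a] g p by (simp add: w_def)
      then show ?thesis using Pmult[of g a] Prange[OF g] a A g by auto
    qed
    show "P (g \<otimes> t) = (P g + f g) mod int n"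
      using Pmult[OF g t] h(4) g p by (simp add: k_def f' mod_simps)
  qed
qed

text \<open>As for amalgams: the principal derivation of \<open>P\<close> vanishes on
  \<open>A\<close> and at \<open>t\<close>, and a homomorphism is determined by its values
  there.\<close>

lemma hnn_constant:
  assumes hnn: "proper_hnn \<C> G A C t"
    and P: "locally_constant (gtop G) (P :: 'g \<Rightarrow> int)"
    and PA: "\<And>g a. g \<in> carrier G \<Longrightarrow> a \<in> A \<Longrightarrow> P (g \<otimes> a) mod int n = P g mod int n"
    and Pt: "\<And>g. g \<in> carrier G \<Longrightarrow> P (g \<otimes> t) mod int n = P g mod int n"
    and g: "g \<in> carrier G"
  shows "P g mod int n = P \<one> mod int n"
proof -
  obtain Q :: "'g set monoid" and p P' i j where
    Q: "group Q" "finite_target G \<C> Q i" "finite_target G \<C> (wreath n Q) j"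
    "p \<in> hom G Q" "p ` carrier G = carrier Q" "locally_constant (gtop G) p"
    and P': "\<And>g. g \<in> carrier G \<Longrightarrow> P g = P' (p g)"
    using wreath_targetE[OF P] by metis
  interpret Q: group Q by fact
  have A: "A \<subseteq> carrier G" and t: "t \<in> carrier G"
    using hnn by (auto simp: proper_hnn_def closed_subgroup_def dest: subgroup.subset)
  have p: "p (g \<otimes> h) = p g \<otimes>\<^bsub>Q\<^esub> p h" if "g \<in> carrier G" "h \<in> carrier G" for g h
    using Q(4) that by (auto simp: hom_def)
  define w where "w = (\<lambda>(f :: 'g set \<Rightarrow> int) g. (\<lambda>x\<in>carrier Q. (f x - f (x \<otimes>\<^bsub>Q\<^esub> p g)) mod int n, p g))"
  have w: "w k \<in> hom G (wreath n Q)" "locally_constant (gtop G) (w k)" for k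
    unfolding w_def using wreath_coboundary_hom[OF Q(1) n1 Q(4)] locally_constant_comp[OF Q(6)] by auto
  have eq: "w P' x = w (\<lambda>_. 0) x" if x: "x \<in> carrier G"
    "\<And>g. g \<in> carrier G \<Longrightarrow> P (g \<otimes> x) mod int n = P g mod int n" for x
  proof -
    have "(P' z - P' (z \<otimes>\<^bsub>Q\<^esub> p x)) mod int n = 0" if xQ: "z \<in> carrier Q" for z
    proof -
      obtain g where "g \<in> carrier G" "z = p g" using xQ unfolding Q(5)[symmetric] by blast
      then show ?thesis using x(2)[of g] x(1) P' p by (metis m_closed mod_0_imp_dvd dvd_imp_mod_0 mod_eq_dvd_iff)
    qed
    then show ?thesis by (auto simp: w_def fun_eq_iff)
  qed
  have "w P' g = w (\<lambda>_. 0) g"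
    by (rule finite_target.hnn_hom_unique[OF Q(3) hnn w w _ _ g])
      (use eq PA Pt A t in \<open>auto simp: subset_iff\<close>)
  then have "fst (w P' g) \<one>\<^bsub>Q\<^esub> = fst (w (\<lambda>_. 0) g) \<one>\<^bsub>Q\<^esub>" by simp
  moreover have "p g \<in> carrier Q" "p \<one> = \<one>\<^bsub>Q\<^esub>"
    using Q(5) g hom_one[OF Q(4) is_group Q(1)] by auto
  ultimately have "(P \<one> - P g) mod int n = 0"
    using g P'[OF g] P'[OF one_closed] by (simp add: w_def)
  then show ?thesis by (metis mod_0_imp_dvd mod_eq_dvd_iff)
qed

end

section \<open>Standard trees\<close>

lemma continuous_map_compose': "continuous_map X Y f \<Longrightarrow> continuous_map Y Z g \<Longrightarrow> continuous_map X Z (\<lambda>x. g (f x))"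
  using continuous_map_compose[of X Y f Z g] by (simp add: o_def)

lemma continuous_map_sum_component:
  assumes "i \<in> I"
  shows "continuous_map (X i) (sum_topology X I) (\<lambda>x. (i, x))"
proof -
  have "openin (X i) {x \<in> topspace (X i). (i, x) \<in> U}" if "openin (sum_topology X I) U" for U
  proof -
    have "openin (X i) {x. (i, x) \<in> U}" using that assms by (simp add: openin_sum_topology)
    then have "{x \<in> topspace (X i). (i, x) \<in> U} = {x. (i, x) \<in> U}" using openin_subset by blast
    then show ?thesis using \<open>openin (X i) {x. (i, x) \<in> U}\<close> by simp
  qed
  then show ?thesis using assms by (simp add: continuous_map_def)
qed

lemma continuous_map_from_sum_topology:
  "continuous_map (sum_topology X I) Z h \<longleftrightarrow> (\<forall>i\<in>I. continuous_map (X i) Z (\<lambda>x. h (i, x)))"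
proof
  assume h: "continuous_map (sum_topology X I) Z h"
  show "\<forall>i\<in>I. continuous_map (X i) Z (\<lambda>x. h (i, x))"
    by (intro ballI continuous_map_compose'[OF continuous_map_sum_component h])
next
  assume h: "\<forall>i\<in>I. continuous_map (X i) Z (\<lambda>x. h (i, x))"
  have "openin (sum_topology X I) {z \<in> Sigma I (topspace \<circ> X). h z \<in> U}" if U: "openin Z U" for U
  proof -
    have "{x. (i, x) \<in> {z \<in> Sigma I (topspace \<circ> X). h z \<in> U}} = {x \<in> topspace (X i). h (i, x) \<in> U}"
      if "i \<in> I" for i
      using that by auto
    moreover have "openin (X i) {x \<in> topspace (X i). h (i, x) \<in> U}" if "i \<in> I" for i
      using that h U openin_continuous_map_preimage by blast
    ultimately show ?thesis
      by (simp add: openin_sum_topology del: mem_Collect_eq)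
  qed
  then show "continuous_map (sum_topology X I) Z h"
    using h by (auto simp: continuous_map_def Pi_iff)
qed

lemma continuous_map_from_discrete_prod:
  assumes "\<And>i. i \<in> I \<Longrightarrow> continuous_map Y Z (\<lambda>y. h (i, y))"
  shows "continuous_map (prod_topology (discrete_topology I) Y) Z h"
proof -
  have "openin (prod_topology (discrete_topology I) Y) {z \<in> I \<times> topspace Y. h z \<in> U}" if U: "openin Z U" for U
  proof -
    have "{z \<in> I \<times> topspace Y. h z \<in> U} = (\<Union>i\<in>I. {i} \<times> {y \<in> topspace Y. h (i, y) \<in> U})"
      by auto
    moreover have "openin (prod_topology (discrete_topology I) Y) ({i} \<times> {y \<in> topspace Y. h (i, y) \<in> U})"
      if "i \<in> I" for i
      using that openin_continuous_map_preimage[OF assms[OF that] U] by (simp add: openin_prod_Times_iff)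
    ultimately show ?thesis by auto
  qed
  moreover have "h z \<in> topspace Z" if "z \<in> I \<times> topspace Y" for z
    using that assms by (cases z) (auto simp: continuous_map_def Pi_iff)
  ultimately show ?thesis by (auto simp: continuous_map_def)
qed

text \<open>The dual form of exactness: modulo \<open>n\<close>, the kernel of the coboundary
  consists of the constants, and the coboundary is onto. Residue classes are represented by
  integers, and functions are given on the whole graph, although only vertex values of
  \<open>F\<close> and edge values of \<open>f\<close> enter.\<close>

definition acyclic_mod :: "nat \<Rightarrow> 'a pgraph \<Rightarrow> bool" where
  "acyclic_mod n \<Gamma> \<longleftrightarrow>
     (\<forall>F :: 'a \<Rightarrow> int. locally_constant (ptop \<Gamma>) F \<and>
        (\<forall>e\<in>edges \<Gamma>. F (d1 \<Gamma> e) mod int n = F (d0 \<Gamma> e) mod int n) \<longrightarrow>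
        (\<forall>v\<in>verts \<Gamma>. \<forall>w\<in>verts \<Gamma>. F v mod int n = F w mod int n)) \<and>
     (\<forall>f :: 'a \<Rightarrow> int. locally_constant (ptop \<Gamma>) f \<longrightarrow>
        (\<exists>F :: 'a \<Rightarrow> int. locally_constant (ptop \<Gamma>) F \<and>
           (\<forall>e\<in>edges \<Gamma>. (F (d1 \<Gamma> e) - F (d0 \<Gamma> e)) mod int n = f e mod int n)))"

text \<open>The common shape of both standard trees. Amalgams have \<open>i1 = RightV\<close> and
  \<open>t = \<one>\<close>; for HNN-extensions \<open>i1 = LeftV\<close> and \<open>t\<close> is
  the stable letter.\<close>

locale coset_graph = profinite_topgroup G for G :: "'g topgroup" (structure) +
  fixes T :: "(tag \<times> 'g set) pgraph" and I :: "tag set" and H :: "tag \<Rightarrow> 'g set"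
    and i1 :: tag and t :: 'g
  assumes ptop_T: "ptop T = sum_topology (\<lambda>i. coset_space G (H i)) I"
    and I: "Edge \<in> I" "LeftV \<in> I" "i1 \<in> I" "i1 \<noteq> Edge"
    and H: "\<And>i. i \<in> I \<Longrightarrow> closed_subgroup (H i) G"
    and t: "t \<in> carrier G"
    and verts_T: "verts T = (SIGMA i:I - {Edge}. topspace (coset_space G (H i)))"
    and d_vert: "\<And>i X. i \<noteq> Edge \<Longrightarrow> d0 T (i, X) = (i, X) \<and> d1 T (i, X) = (i, X)"
    and d_edge: "\<And>g. g \<in> carrier G \<Longrightarrow> d0 T (Edge, g <# H Edge) = (LeftV, g <# H LeftV)"
      "\<And>g. g \<in> carrier G \<Longrightarrow> d1 T (Edge, g <# H Edge) = (i1, (g \<otimes> t) <# H i1)"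
begin

text \<open>It acts on all points, edges included; the restriction to \<open>points T\<close> makes
  each map extensional, as group actions require.\<close>

definition vertex_action :: "'g \<Rightarrow> tag \<times> 'g set \<Rightarrow> tag \<times> 'g set" where
  "vertex_action g = (\<lambda>(i, X)\<in>points T. (i, g <# X))"

lemma subgroup_H: "i \<in> I \<Longrightarrow> subgroup (H i) G"
  using H by (simp add: closed_subgroup_def)

lemma points_T: "points T = {(i, g <# H i) | i g. i \<in> I \<and> g \<in> carrier G}"
  by (auto simp: ptop_T topspace_coset_space)

lemma pointsI: "i \<in> I \<Longrightarrow> g \<in> carrier G \<Longrightarrow> (i, g <# H i) \<in> points T"
  by (auto simp: points_T)

lemma pointsE:
  assumes "x \<in> points T"
  obtains i g where "i \<in> I" "g \<in> carrier G" "x = (i, g <# H i)"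
  using assms by (auto simp: points_T)

lemma verts_iff: "x \<in> verts T \<longleftrightarrow> x \<in> points T \<and> fst x \<noteq> Edge"
  by (auto simp: verts_T ptop_T)

lemma edgesE:
  assumes "x \<in> edges T"
  obtains g where "g \<in> carrier G" "x = (Edge, g <# H Edge)"
  using assms by (auto simp: points_T verts_iff)

lemma edgesI: "g \<in> carrier G \<Longrightarrow> (Edge, g <# H Edge) \<in> edges T"
  using I by (auto simp: points_T verts_iff)

lemma continuous_map_T:
  "continuous_map (ptop T) Z h \<longleftrightarrow> (\<forall>i\<in>I. continuous_map (gtop G) Z (\<lambda>g. h (i, g <# H i)))"
  unfolding ptop_T continuous_map_from_sum_topology continuous_map_coset_space ..

lemma locally_constant_T:
  "locally_constant (ptop T) h \<longleftrightarrow> (\<forall>i\<in>I. locally_constant (gtop G) (\<lambda>g. h (i, g <# H i)))"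
  unfolding locally_constant_def by (rule continuous_map_T)

lemma continuous_map_to_T:
  assumes "i \<in> I" "continuous_map X (gtop G) f"
  shows "continuous_map X (ptop T) (\<lambda>x. (i, f x <# H i))"
proof -
  have "continuous_map X (coset_space G (H i)) (\<lambda>x. f x <# H i)"
    using continuous_map_compose'[OF assms(2) continuous_map_to_coset] .
  then show ?thesis
    unfolding ptop_T
    by (rule continuous_map_compose'[OF _ continuous_map_sum_component[OF assms(1), of "\<lambda>i. coset_space G (H i)"]])
qed

lemma finite_I: "finite I"
proof -
  have "i \<in> {LeftV, RightV, Edge}" for i by (cases i) auto
  then have "I \<subseteq> {LeftV, RightV, Edge}" by blast
  then show ?thesis by (rule finite_subset) simp
qed

text \<open>Finitely many copies of the group: a compact space that maps onto the graph, on which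
  compactness and continuity are checked.\<close>

definition cover :: "(tag \<times> 'g) topology" where
  "cover = prod_topology (discrete_topology I) (gtop G)"

lemma compact_cover: "compact_space cover"
  unfolding cover_def using finite_I compact_gtop by (simp add: compact_space_prod_topology compact_space_discrete_topology)

lemma topspace_cover: "topspace cover = I \<times> carrier G"
  by (simp add: cover_def)

lemma continuous_cover: "continuous_map cover (ptop T) (\<lambda>(i, g). (i, g <# H i))"
  unfolding cover_def
  by (rule continuous_map_from_discrete_prod)
    (use continuous_map_to_T[OF _ continuous_map_id] in \<open>auto simp: id_def\<close>)

lemma cover_image: "(\<lambda>(i, g). (i, g <# H i)) ` topspace cover = points T"
  by (auto simp: points_T topspace_cover)

lemma locally_constant_fst: "locally_constant (ptop T) fst"
  by (simp add: locally_constant_T)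

text \<open>Points with different tags are separated by the tag, points with the same tag by a
  function on their coset space.\<close>

lemma profinite_T: "profinite_space (ptop T)"
proof (rule profinite_spaceI)
  show "compact_space (ptop T)"
    using image_compactin[OF _ continuous_cover, of "topspace cover"] compact_cover
    by (simp add: compact_space_def cover_image)
  fix x y assume xy: "x \<in> points T" "y \<in> points T" "x \<noteq> y"
  show "\<exists>f :: tag \<times> 'g set \<Rightarrow> bool. locally_constant (ptop T) f \<and> f x \<noteq> f y"
  proof (cases "fst x = fst y")
    case False
    then have "locally_constant (ptop T) (\<lambda>z. fst z = fst x)" "(fst x = fst x) \<noteq> (fst y = fst x)"
      using locally_constant_comp[OF locally_constant_fst, of "\<lambda>i. i = fst x"] by auto
    then show ?thesis by (intro exI[of _ "\<lambda>z. fst z = fst x"]) simp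
  next
    case True
    obtain i g where x: "i \<in> I" "g \<in> carrier G" "x = (i, g <# H i)" using xy(1) by (rule pointsE)
    obtain g' where y: "g' \<in> carrier G" "y = (i, g' <# H i)" using xy(2) True x by (auto elim: pointsE)
    obtain f :: "'g set \<Rightarrow> bool" where f: "locally_constant (coset_space G (H i)) f" "f (g <# H i)" "\<not> f (g' <# H i)"
      using profinite_space_separation[OF profinite_coset_space[OF H[OF x(1)]], of "g <# H i" "g' <# H i"]
        x y xy(3) by (auto simp: topspace_coset_space)
    have "locally_constant (ptop T) (\<lambda>z. fst z = i \<and> f (snd z))"
      unfolding locally_constant_T
    proof
      fix j assume "j \<in> I"
      show "locally_constant (gtop G) (\<lambda>g. fst (j, g <# H j) = i \<and> f (snd (j, g <# H j)))"
        using f(1) by (cases "j = i") (auto simp: locally_constant_coset_space)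
    qed
    then show ?thesis using f x y by (intro exI[of _ "\<lambda>z. fst z = i \<and> f (snd z)"]) simp
  qed
qed

lemma clopen_verts: "openin (ptop T) (verts T)" "closedin (ptop T) (verts T)"
proof -
  have "verts T = {x \<in> points T. fst x \<noteq> Edge}" by (auto simp: verts_iff)
  then show "openin (ptop T) (verts T)" "closedin (ptop T) (verts T)"
    using locally_constant_openin[OF locally_constant_fst, of "\<lambda>i. i \<noteq> Edge"]
      locally_constant_closedin[OF locally_constant_fst, of "\<lambda>i. i \<noteq> Edge"] by simp_all
qed

lemma d_point:
  assumes "i \<in> I" "g \<in> carrier G"
  shows "d0 T (i, g <# H i) = (if i = Edge then (LeftV, g <# H LeftV) else (i, g <# H i))"
    and "d1 T (i, g <# H i) = (if i = Edge then (i1, (g \<otimes> t) <# H i1) else (i, g <# H i))"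
  using assms d_vert d_edge by auto

lemma profinite_graph_T: "profinite_graph T"
proof -
  have "continuous_map (gtop G) (ptop T) (\<lambda>g. d0 T (i, g <# H i))"
    "continuous_map (gtop G) (ptop T) (\<lambda>g. d1 T (i, g <# H i))" if i: "i \<in> I" for i
  proof -
    have "continuous_map (gtop G) (ptop T) (\<lambda>g. if i = Edge then (LeftV, g <# H LeftV) else (i, g <# H i))"
      using I i continuous_map_id by (auto intro!: continuous_map_to_T simp: id_def)
    then show "continuous_map (gtop G) (ptop T) (\<lambda>g. d0 T (i, g <# H i))"
      by (rule continuous_map_eq) (simp add: d_point[OF i])
    have "continuous_map (gtop G) (ptop T) (\<lambda>g. if i = Edge then (i1, (g \<otimes> t) <# H i1) else (i, g <# H i))"
      using I i t continuous_map_id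
      by (auto intro!: continuous_map_to_T continuous_map_mult simp: id_def)
    then show "continuous_map (gtop G) (ptop T) (\<lambda>g. d1 T (i, g <# H i))"
      by (rule continuous_map_eq) (simp add: d_point[OF i])
  qed
  then have "continuous_map (ptop T) (ptop T) (d0 T)" "continuous_map (ptop T) (ptop T) (d1 T)"
    unfolding continuous_map_T by blast+
  moreover have "d0 T x \<in> verts T" "d1 T x \<in> verts T" if xT: "x \<in> points T" for x
  proof -
    obtain i g where x: "i \<in> I" "g \<in> carrier G" "x = (i, g <# H i)" using xT by (rule pointsE)
    show "d0 T x \<in> verts T" "d1 T x \<in> verts T"
      using x I t pointsI by (auto simp: d_point verts_iff)
  qed
  ultimately show ?thesis
    using profinite_T clopen_verts d_vert
    by (auto simp: profinite_graph_def continuous_map_in_subtopology verts_iff)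
qed

lemma l_coset_assoc: "i \<in> I \<Longrightarrow> g \<in> carrier G \<Longrightarrow> h \<in> carrier G \<Longrightarrow> g <# (h <# H i) = (g \<otimes> h) <# H i"
  using lcos_m_assoc subgroup.subset[OF subgroup_H] by blast

lemma vertex_action_point:
  assumes "i \<in> I" "g \<in> carrier G" "h \<in> carrier G"
  shows "vertex_action g (i, h <# H i) = (i, (g \<otimes> h) <# H i)"
  using assms pointsI l_coset_assoc by (simp add: vertex_action_def)

lemma vertex_action_points:
  "g \<in> carrier G \<Longrightarrow> x \<in> points T \<Longrightarrow> vertex_action g x \<in> points T"
  by (elim pointsE) (simp add: vertex_action_point pointsI)

lemma vertex_action_verts:
  "g \<in> carrier G \<Longrightarrow> x \<in> verts T \<Longrightarrow> vertex_action g x \<in> verts T"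
  unfolding verts_iff by (elim conjE pointsE) (simp add: vertex_action_point pointsI)

lemma vertex_action_mult:
  "g \<in> carrier G \<Longrightarrow> h \<in> carrier G \<Longrightarrow> x \<in> points T \<Longrightarrow>
    vertex_action (g \<otimes> h) x = vertex_action g (vertex_action h x)"
  by (elim pointsE) (simp add: vertex_action_point m_assoc)

lemma vertex_action_one: "x \<in> points T \<Longrightarrow> vertex_action \<one> x = x"
  by (elim pointsE) (simp add: vertex_action_point)

text \<open>On \<open>cover\<close> the action is multiplication in the second component, and the
  cover maps to a Hausdorff space.\<close>

lemma continuous_vertex_action:
  "continuous_map (prod_topology (gtop G) (ptop T)) (ptop T) (\<lambda>(g, x). vertex_action g x)"
proof (rule continuous_map_closed_compose)
  let ?q = "\<lambda>(g, (i, h)). (g, (i, h <# H i))"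
  let ?X = "prod_topology (gtop G) cover" and ?Y = "prod_topology (gtop G) (ptop T)"
  show "continuous_map ?X ?Y ?q"
    using continuous_map_prod_top[of "gtop G" cover "gtop G" "ptop T" id "\<lambda>(i, g). (i, g <# H i)"] continuous_cover
    by (simp add: case_prod_unfold)
  show "compact_space ?X" using compact_gtop compact_cover by (simp add: compact_space_prod_topology)
  show "Hausdorff_space ?Y"
    using profinite_space_Hausdorff[OF profinite_space_prod[OF profinite_gtop profinite_T]] .
  show "?q ` topspace ?X = topspace ?Y"
    by (force simp: topspace_cover points_T)
  have "continuous_map (prod_topology (gtop G) (prod_topology (discrete_topology I) (gtop G))) (ptop T)
      (\<lambda>z. (fst (snd z), (fst z \<otimes> snd (snd z)) <# H (fst (snd z))))"
  proof -
    have "continuous_map ?X cover (\<lambda>z. (fst (snd z), fst z \<otimes> snd (snd z)))"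
      unfolding cover_def
      by (intro continuous_map_pairedI continuous_map_mult continuous_map_fst
        continuous_map_compose'[OF continuous_map_snd continuous_map_fst]
        continuous_map_compose'[OF continuous_map_snd continuous_map_snd])
    then show ?thesis
      using continuous_map_compose'[OF _ continuous_cover, of ?X "\<lambda>z. (fst (snd z), fst z \<otimes> snd (snd z))"]
      by (simp add: case_prod_unfold cover_def)
  qed
  then show "continuous_map ?X (ptop T) (\<lambda>z. (\<lambda>(g, x). vertex_action g x) (?q z))"
    unfolding cover_def by (rule continuous_map_eq) (auto simp: vertex_action_point)
qed

lemma vertex_action_d:
  assumes "g \<in> carrier G" "x \<in> points T"
  shows "d0 T (vertex_action g x) = vertex_action g (d0 T x)" "d1 T (vertex_action g x) = vertex_action g (d1 T x)"
proof -
  obtain i h where x: "i \<in> I" "h \<in> carrier G" "x = (i, h <# H i)" using assms(2) by (rule pointsE)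
  show "d0 T (vertex_action g x) = vertex_action g (d0 T x)" "d1 T (vertex_action g x) = vertex_action g (d1 T x)"
    using x assms(1) I t by (simp_all add: d_point vertex_action_point m_assoc)
qed

end

lemma graph_actionI:
  assumes G: "group G"
    and ext: "\<And>g. g \<in> carrier G \<Longrightarrow> \<phi> g \<in> extensional (points \<Gamma>)"
    and closed: "\<And>g x. g \<in> carrier G \<Longrightarrow> x \<in> points \<Gamma> \<Longrightarrow> \<phi> g x \<in> points \<Gamma>"
    and mult: "\<And>g h x. g \<in> carrier G \<Longrightarrow> h \<in> carrier G \<Longrightarrow> x \<in> points \<Gamma> \<Longrightarrow> \<phi> (g \<otimes>\<^bsub>G\<^esub> h) x = \<phi> g (\<phi> h x)"
    and one: "\<And>x. x \<in> points \<Gamma> \<Longrightarrow> \<phi> \<one>\<^bsub>G\<^esub> x = x"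
    and cont: "continuous_map (prod_topology (gtop G) (ptop \<Gamma>)) (ptop \<Gamma>) (\<lambda>(g, x). \<phi> g x)"
    and d: "\<And>g x. g \<in> carrier G \<Longrightarrow> x \<in> points \<Gamma> \<Longrightarrow> d0 \<Gamma> (\<phi> g x) = \<phi> g (d0 \<Gamma> x)"
      "\<And>g x. g \<in> carrier G \<Longrightarrow> x \<in> points \<Gamma> \<Longrightarrow> d1 \<Gamma> (\<phi> g x) = \<phi> g (d1 \<Gamma> x)"
  shows "graph_action G \<Gamma> \<phi>"
proof -
  interpret group G by fact
  have bij: "\<phi> g \<in> Bij (points \<Gamma>)" if g: "g \<in> carrier G" for g
  proof -
    have "bij_betw (\<phi> g) (points \<Gamma>) (points \<Gamma>)"
    proof (rule bij_betwI[where g = "\<phi> (inv\<^bsub>G\<^esub> g)"])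
      show "\<phi> (inv\<^bsub>G\<^esub> g) (\<phi> g x) = x" if "x \<in> points \<Gamma>" for x
        using mult[of "inv\<^bsub>G\<^esub> g" g x] that g one by simp
      show "\<phi> g (\<phi> (inv\<^bsub>G\<^esub> g) x) = x" if "x \<in> points \<Gamma>" for x
        using mult[of g "inv\<^bsub>G\<^esub> g" x] that g one by simp
    qed (use closed g in auto)
    then show ?thesis using ext[OF g] by (simp add: Bij_def)
  qed
  have "\<phi> \<in> hom G (BijGroup (points \<Gamma>))"
  proof (rule homI)
    show "\<phi> g \<in> carrier (BijGroup (points \<Gamma>))" if "g \<in> carrier G" for g
      using bij[OF that] by (simp add: BijGroup_def)
    show "\<phi> (g \<otimes>\<^bsub>G\<^esub> h) = \<phi> g \<otimes>\<^bsub>BijGroup (points \<Gamma>)\<^esub> \<phi> h" if gh: "g \<in> carrier G" "h \<in> carrier G" for g h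
    proof (rule extensionalityI[of _ "points \<Gamma>"])
      show "\<phi> (g \<otimes>\<^bsub>G\<^esub> h) \<in> extensional (points \<Gamma>)" using gh ext by simp
      show "\<phi> g \<otimes>\<^bsub>BijGroup (points \<Gamma>)\<^esub> \<phi> h \<in> extensional (points \<Gamma>)"
        using gh bij by (simp add: BijGroup_def compose_def)
      show "\<phi> (g \<otimes>\<^bsub>G\<^esub> h) x = (\<phi> g \<otimes>\<^bsub>BijGroup (points \<Gamma>)\<^esub> \<phi> h) x" if "x \<in> points \<Gamma>" for x
        using gh bij that mult by (simp add: BijGroup_def compose_def)
    qed
  qed
  then have "group_action G (points \<Gamma>) \<phi>"
    using group_BijGroup by (simp add: group_action_def group_hom_def group_hom_axioms_def)
  then show ?thesis using cont d by (simp add: graph_action_def)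
qed

section \<open>The two kinds of standard trees as coset graphs\<close>

context profinite_topgroup
begin

text \<open>The stabilizer of a point is a subgroup, and it is closed because points of a Hausdorff
  space are closed. So it contains the closure of the subgroup generated by
  \<open>c\<close>.\<close>

lemma fixed_by_top_generate:
  assumes \<phi>: "graph_action G \<Gamma> \<phi>" and \<Gamma>: "Hausdorff_space (ptop \<Gamma>)" and v: "v \<in> points \<Gamma>"
    and c: "c \<in> carrier G" "\<phi> c v = v" and h: "h \<in> top_generate G {c}"
  shows "\<phi> h v = v"
proof -
  interpret group_action G "points \<Gamma>" \<phi> using \<phi> by (simp add: graph_action_def)
  let ?S = "stabilizer G \<phi> v"
  have "subgroup ?S G" using stabilizer_subgroup[OF v] .
  moreover have "c \<in> ?S" using c by (simp add: stabilizer_def)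
  ultimately have "generate G {c} \<subseteq> ?S" using generate_subgroup_incl by blast
  moreover have "closedin (gtop G) ?S"
  proof -
    have cont: "continuous_map (gtop G) (prod_topology (gtop G) (ptop \<Gamma>)) (\<lambda>g. (g, v))"
      using v by (intro continuous_map_pairedI continuous_map_id[unfolded id_def]) simp
    have "continuous_map (gtop G) (ptop \<Gamma>) (\<lambda>g. (\<lambda>(g, x). \<phi> g x) (g, v))"
      using \<phi> by (intro continuous_map_compose'[OF cont]) (simp add: graph_action_def)
    moreover have "closedin (ptop \<Gamma>) {v}"
      using \<Gamma> v by (simp add: closedin_Hausdorff_singleton)
    ultimately have "closedin (gtop G) {g \<in> topspace (gtop G). (\<lambda>(g, x). \<phi> g x) (g, v) \<in> {v}}"
      by (rule closedin_continuous_map_preimage)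
    then show ?thesis by (simp add: stabilizer_def)
  qed
  ultimately have "top_generate G {c} \<subseteq> ?S"
    unfolding top_generate_def by (rule closure_of_minimal)
  then show ?thesis using h by (auto simp: stabilizer_def)
qed

text \<open>With \<open>c\<close> in \<open>C\<close> and \<open>a\<close> in \<open>A\<close>, the
  rule \<open>(gc)(ta) = gt(t\<inverse>ct)a\<close> reduces the product to a single coset. It
  justifies the incidence map \<open>d1\<close> of the tree of an HNN-extension.\<close>

lemma l_coset_set_mult:
  assumes "g \<in> carrier G" "subgroup C G" "subgroup A G" "t \<in> carrier G"
    and "\<And>c. c \<in> C \<Longrightarrow> inv t \<otimes> c \<otimes> t \<in> A"
  shows "(g <# C) <#> (t <# A) = (g \<otimes> t) <# A"
proof
  have CA: "C \<subseteq> carrier G" "A \<subseteq> carrier G" using assms by (auto dest: subgroup.subset)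
  show "(g <# C) <#> (t <# A) \<subseteq> (g \<otimes> t) <# A"
  proof
    fix x assume "x \<in> (g <# C) <#> (t <# A)"
    then obtain c a where x: "c \<in> C" "a \<in> A" "x = (g \<otimes> c) \<otimes> (t \<otimes> a)"
      by (auto simp: l_coset_def set_mult_def)
    have c: "c \<in> carrier G" "a \<in> carrier G" using x CA by auto
    have "x = (g \<otimes> t) \<otimes> ((inv t \<otimes> c \<otimes> t) \<otimes> a)"
    proof -
      have "t \<otimes> (inv t \<otimes> (c \<otimes> (t \<otimes> a))) = c \<otimes> (t \<otimes> a)"
        using c assms by (simp add: m_assoc[symmetric])
      then show ?thesis using c assms by (simp add: x(3) m_assoc)
    qed
    moreover have "(inv t \<otimes> c \<otimes> t) \<otimes> a \<in> A" using assms x by (meson subgroup.m_closed)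
    ultimately show "x \<in> (g \<otimes> t) <# A" by (auto simp: l_coset_def)
  qed
  show "(g \<otimes> t) <# A \<subseteq> (g <# C) <#> (t <# A)"
  proof
    fix x assume "x \<in> (g \<otimes> t) <# A"
    then obtain a where a: "a \<in> A" "x = (g \<otimes> t) \<otimes> a" by (auto simp: l_coset_def)
    have "x = (g \<otimes> \<one>) \<otimes> (t \<otimes> a)" using a assms CA by (simp add: m_assoc subset_iff)
    moreover have "g \<otimes> \<one> \<in> g <# C" using subgroup.one_closed[OF assms(2)] by (auto simp: l_coset_def)
    moreover have "t \<otimes> a \<in> t <# A" using a by (auto simp: l_coset_def)
    ultimately show "x \<in> (g <# C) <#> (t <# A)" by (auto simp: set_mult_def)
  qed
qed

lemma l_coset_set_mult_subgroup:
  assumes "g \<in> carrier G" "subgroup C G" "subgroup A G" "C \<subseteq> A"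
  shows "(g <# C) <#> A = g <# A"
proof -
  have "\<one> <# A = A" using assms(3) by (simp add: lcos_mult_one subgroup.subset)
  moreover have "inv \<one> \<otimes> c \<otimes> \<one> \<in> A" if "c \<in> C" for c
    using that assms subgroup.subset[OF assms(3)] by (auto simp: subset_iff)
  ultimately show ?thesis
    using l_coset_set_mult[OF assms(1-3) one_closed] assms(1) by simp
qed

lemma coset_graph_amalgam:
  assumes S: "proper_amalgam \<C> G A B C"
  shows "coset_graph G (std_tree G (Amalgam A B C)) {LeftV, RightV, Edge}
    (\<lambda>i. case i of LeftV \<Rightarrow> A | RightV \<Rightarrow> B | Edge \<Rightarrow> C) RightV \<one>"
proof (unfold_locales)
  have cl: "closed_subgroup A G" "closed_subgroup B G" "closed_subgroup C G" and CA: "C \<subseteq> A" "C \<subseteq> B"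
    using S by (auto simp: proper_amalgam_def)
  have sg: "subgroup A G" "subgroup B G" "subgroup C G" using cl by (auto simp: closed_subgroup_def)
  show "ptop (std_tree G (Amalgam A B C)) = sum_topology (\<lambda>i. coset_space G
      (case i of LeftV \<Rightarrow> A | RightV \<Rightarrow> B | Edge \<Rightarrow> C)) {LeftV, RightV, Edge}"
  proof -
    have "(\<lambda>i. case i of LeftV \<Rightarrow> coset_space G A | RightV \<Rightarrow> coset_space G B | Edge \<Rightarrow> coset_space G C) =
        (\<lambda>i. coset_space G (case i of LeftV \<Rightarrow> A | RightV \<Rightarrow> B | Edge \<Rightarrow> C))"
      by (auto split: tag.split)
    then show ?thesis by simp
  qed
  show "closed_subgroup (case i of LeftV \<Rightarrow> A | RightV \<Rightarrow> B | Edge \<Rightarrow> C) G" for i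
    using cl by (cases i) auto
  show "verts (std_tree G (Amalgam A B C)) = (SIGMA i:{LeftV, RightV, Edge} - {Edge}.
      topspace (coset_space G (case i of LeftV \<Rightarrow> A | RightV \<Rightarrow> B | Edge \<Rightarrow> C)))"
    by auto
  fix g assume g: "g \<in> carrier G"
  show "d0 (std_tree G (Amalgam A B C)) (Edge, g <# (case Edge of LeftV \<Rightarrow> A | RightV \<Rightarrow> B | Edge \<Rightarrow> C)) =
      (LeftV, g <# (case LeftV of LeftV \<Rightarrow> A | RightV \<Rightarrow> B | Edge \<Rightarrow> C))"
    using l_coset_set_mult_subgroup[OF g sg(3,1) CA(1)] by simp
  show "d1 (std_tree G (Amalgam A B C)) (Edge, g <# (case Edge of LeftV \<Rightarrow> A | RightV \<Rightarrow> B | Edge \<Rightarrow> C)) =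
      (RightV, (g \<otimes> \<one>) <# (case RightV of LeftV \<Rightarrow> A | RightV \<Rightarrow> B | Edge \<Rightarrow> C))"
    using l_coset_set_mult_subgroup[OF g sg(3,2) CA(2)] g by simp
qed auto

lemma coset_graph_hnn:
  assumes S: "proper_hnn \<C> G A C t"
  shows "coset_graph G (std_tree G (HNN A C t)) {LeftV, Edge} (\<lambda>i. if i = Edge then C else A) LeftV t"
proof (unfold_locales)
  have cl: "closed_subgroup A G" "closed_subgroup C G" and CA: "C \<subseteq> A"
    and tC: "\<And>c. c \<in> C \<Longrightarrow> inv t \<otimes> c \<otimes> t \<in> A" and t: "t \<in> carrier G"
    using S by (auto simp: proper_hnn_def)
  have sg: "subgroup A G" "subgroup C G" using cl by (auto simp: closed_subgroup_def)
  show "t \<in> carrier G" by fact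
  show "ptop (std_tree G (HNN A C t)) =
      sum_topology (\<lambda>i. coset_space G (if i = Edge then C else A)) {LeftV, Edge}"
  proof -
    have "(\<lambda>i. if i = Edge then coset_space G C else coset_space G A) =
        (\<lambda>i. coset_space G (if i = Edge then C else A))"
      by auto
    then show ?thesis by simp
  qed
  show "closed_subgroup (if i = Edge then C else A) G" for i using cl by auto
  show "verts (std_tree G (HNN A C t)) =
      (SIGMA i:{LeftV, Edge} - {Edge}. topspace (coset_space G (if i = Edge then C else A)))"
    by auto
  fix g assume g: "g \<in> carrier G"
  show "d0 (std_tree G (HNN A C t)) (Edge, g <# (if Edge = Edge then C else A)) =
      (LeftV, g <# (if LeftV = Edge then C else A))"
    using l_coset_set_mult_subgroup[OF g sg(2,1) CA] by simp
  show "d1 (std_tree G (HNN A C t)) (Edge, g <# (if Edge = Edge then C else A)) =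
      (LeftV, (g \<otimes> t) <# (if LeftV = Edge then C else A))"
    using l_coset_set_mult[OF g sg(2,1) t tC] by simp
qed auto

lemma cyclic_splitting_coset_graph:
  assumes "cyclic_splitting \<C> G S"
  obtains I H i1 t where "coset_graph G (std_tree G S) I H i1 t" "H Edge = edge_group S"
proof (cases S)
  case (Amalgam A B C)
  have "proper_amalgam \<C> G A B C" using assms Amalgam by simp
  from that[unfolded Amalgam, OF coset_graph_amalgam[OF this]] show ?thesis by simp
next
  case (HNN A C t)
  have "proper_hnn \<C> G A C t" using assms HNN by simp
  from that[unfolded HNN, OF coset_graph_hnn[OF this]] show ?thesis by simp
qed

end

lemma (in coset_graph) vertex_action_extensional: "vertex_action g \<in> extensional (points T)"
  by (simp add: vertex_action_def)

lemma (in coset_graph) graph_action_T: "graph_action G T vertex_action"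
  by (rule graph_actionI)
    (auto intro: is_group vertex_action_points continuous_vertex_action
      simp: vertex_action_mult vertex_action_one vertex_action_d vertex_action_extensional)

text \<open>A vertex \<open>hH\<close> fixed by the whole group is fixed by the conjugate
  \<open>hxh\<inverse>\<close> of every \<open>x\<close>, which means \<open>hxH = hH\<close>, so
  \<open>x\<close> lies in \<open>H\<close>.\<close>

lemma (in coset_graph) fixed_vertex_whole_group:
  assumes v: "v \<in> verts T" and fixed: "\<And>g. g \<in> carrier G \<Longrightarrow> vertex_action g v = v"
  obtains i where "i \<in> I" "i \<noteq> Edge" "H i = carrier G"
proof -
  obtain i h where i: "i \<in> I" "h \<in> carrier G" "v = (i, h <# H i)" "i \<noteq> Edge"
    using v by (auto simp: verts_iff elim: pointsE)
  have "x \<in> H i" if x: "x \<in> carrier G" for x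
  proof -
    have e: "h \<otimes> x \<otimes> inv h \<otimes> h = h \<otimes> x" using i x by (simp add: m_assoc)
    have "h <# H i = (h \<otimes> x) <# H i"
      using fixed[of "h \<otimes> x \<otimes> inv h"] i x by (simp add: vertex_action_point e)
    then obtain k where "k \<in> H i" "h \<otimes> x = h \<otimes> k"
      using l_coset_eqD[OF subgroup_H[OF i(1)] i(2)] i x by (metis m_closed)
    then show ?thesis using i x subgroup.subset[OF subgroup_H[OF i(1)]] by (metis Units_eq Units_l_cancel subsetD)
  qed
  then show ?thesis using that[OF i(1,4)] subgroup.subset[OF subgroup_H[OF i(1)]] by blast
qed

section \<open>Standard trees are acyclic and have no fixed vertex\<close>

context splitting_group
begin

text \<open>A vertex function amounts to a right \<open>A\<close>-invariant and a right
  \<open>B\<close>-invariant function on the group. If its coboundary vanishes modulo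
  \<open>n\<close>, the two are congruent, and \<open>amalgam_constant\<close> applies; potentials
  come from \<open>amalgam_potential\<close>.\<close>

lemma acyclic_mod_amalgam:
  assumes S: "proper_amalgam \<C> G A B C"
  shows "acyclic_mod n (std_tree G (Amalgam A B C))"
proof -
  define T where "T = std_tree G (Amalgam A B C)"
  interpret coset_graph G T "{LeftV, RightV, Edge}" "\<lambda>i. case i of LeftV \<Rightarrow> A | RightV \<Rightarrow> B | Edge \<Rightarrow> C" RightV \<one>
    unfolding T_def by (rule coset_graph_amalgam[OF S])
  have cl: "closed_subgroup A G" "closed_subgroup B G" "closed_subgroup C G"
    using S by (auto simp: proper_amalgam_def)
  have sg: "subgroup A G" "subgroup B G" "subgroup C G" using cl by (auto simp: closed_subgroup_def)
  note ABC = subgroup.subset[OF sg(1)] subgroup.subset[OF sg(2)] subgroup.subset[OF sg(3)]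
  have lcT: "locally_constant (ptop T) h \<longleftrightarrow> locally_constant (gtop G) (\<lambda>g. h (LeftV, g <# A)) \<and>
      locally_constant (gtop G) (\<lambda>g. h (RightV, g <# B)) \<and> locally_constant (gtop G) (\<lambda>g. h (Edge, g <# C))"
    for h :: "_ \<Rightarrow> int"
    unfolding locally_constant_T by simp
  have vertsT: "v \<in> verts T \<Longrightarrow> \<exists>g\<in>carrier G. v = (LeftV, g <# A) \<or> v = (RightV, g <# B)" for v
    by (auto simp: verts_iff elim!: pointsE)
  have edgesT: "e \<in> edges T \<Longrightarrow> \<exists>g\<in>carrier G. e = (Edge, g <# C)" for e
    by (auto elim!: edgesE simp del: Diff_iff)
  have edgeI: "g \<in> carrier G \<Longrightarrow> (Edge, g <# C) \<in> edges T" for g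
    using edgesI by simp
  have dT: "d0 T (Edge, g <# C) = (LeftV, g <# A)" "d1 T (Edge, g <# C) = (RightV, g <# B)" if "g \<in> carrier G" for g
    using d_edge[OF that] that by simp_all
  have "acyclic_mod n T"
    unfolding acyclic_mod_def
  proof (intro conjI allI impI ballI, elim conjE)
    fix F :: "_ \<Rightarrow> int" and v w
    assume F: "locally_constant (ptop T) F" "\<forall>e\<in>edges T. F (d1 T e) mod int n = F (d0 T e) mod int n"
      and vw: "v \<in> verts T" "w \<in> verts T"
    define P where "P = (\<lambda>g. F (LeftV, g <# A))"
    have P: "locally_constant (gtop G) P" using F(1) lcT by (simp add: P_def)
    have PB: "F (RightV, g <# B) mod int n = P g mod int n" if "g \<in> carrier G" for g
      using F(2) edgeI[OF that] dT[OF that] by (metis P_def)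
    have "P g mod int n = P \<one> mod int n" if "g \<in> carrier G" for g
    proof (rule amalgam_constant[OF S P _ _ that])
      show "P (g \<otimes> a) mod int n = P g mod int n" if "g \<in> carrier G" "a \<in> A" for g a
        using l_coset_mult_right[OF sg(1) that] by (simp add: P_def)
      show "P (g \<otimes> b) mod int n = P g mod int n" if "g \<in> carrier G" "b \<in> B" for g b
        using l_coset_mult_right[OF sg(2) that] PB that ABC by (metis m_closed subsetD)
    qed
    then have "F u mod int n = P \<one> mod int n" if "u \<in> verts T" for u
      using vertsT[OF that] PB by (metis P_def)
    then show "F v mod int n = F w mod int n" using vw by simp
  next
    fix f :: "_ \<Rightarrow> int" assume f: "locally_constant (ptop T) f"
    define f0 where "f0 = (\<lambda>g. f (Edge, g <# C))"
    have f0: "locally_constant (gtop G) f0" using f lcT by (simp add: f0_def)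
    have "f0 (g \<otimes> c) = f0 g" if "g \<in> carrier G" "c \<in> C" for g c
      using l_coset_mult_right[OF sg(3) that] by (simp add: f0_def)
    then obtain P :: "'g \<Rightarrow> int" where P: "locally_constant (gtop G) P"
      "\<And>g a. g \<in> carrier G \<Longrightarrow> a \<in> A \<Longrightarrow> P (g \<otimes> a) = P g"
      "\<And>g b. g \<in> carrier G \<Longrightarrow> b \<in> B \<Longrightarrow> (P (g \<otimes> b) + f0 (g \<otimes> b)) mod int n = (P g + f0 g) mod int n"
      using amalgam_potential[OF S f0] by metis
    obtain FA where FA: "\<And>g. g \<in> carrier G \<Longrightarrow> FA (g <# A) = P g"
      using l_coset_descend[OF sg(1) P(2)] by metis
    \<comment> \<open>The edge \<open>gC\<close> leads from \<open>gA\<close> to \<open>gB\<close>,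
      so the value at \<open>gB\<close> is shifted by \<open>f0 g\<close>.\<close>
    obtain FB where FB: "\<And>g. g \<in> carrier G \<Longrightarrow> FB (g <# B) = (P g + f0 g) mod int n"
      using l_coset_descend[OF sg(2), of "\<lambda>g. (P g + f0 g) mod int n"] P(3) by metis
    define F where "F = (\<lambda>(i, X). case i of LeftV \<Rightarrow> FA X | RightV \<Rightarrow> FB X | Edge \<Rightarrow> 0)"
    have "locally_constant (gtop G) (\<lambda>g. FA (g <# A))"
      by (rule locally_constant_cong[OF P(1)]) (simp add: FA)
    moreover have "locally_constant (gtop G) (\<lambda>g. FB (g <# B))"
      by (rule locally_constant_cong[OF locally_constant_comp2[OF P(1) f0, of "\<lambda>x y. (x + y) mod int n"]])
        (simp add: FB)
    ultimately have "locally_constant (ptop T) F" by (simp add: lcT F_def)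
    moreover have "(F (d1 T e) - F (d0 T e)) mod int n = f e mod int n" if "e \<in> edges T" for e
    proof -
      obtain g where "g \<in> carrier G" "e = (Edge, g <# C)" using edgesT[OF \<open>e \<in> edges T\<close>] by blast
      then show ?thesis by (simp add: dT F_def FA FB mod_simps f0_def)
    qed
    ultimately show "\<exists>F :: _ \<Rightarrow> int. locally_constant (ptop T) F \<and>
        (\<forall>e\<in>edges T. (F (d1 T e) - F (d0 T e)) mod int n = f e mod int n)" by blast
  qed
  then show ?thesis by (simp only: T_def)
qed

text \<open>Both ends of an edge are cosets of \<open>A\<close>, so a vertex function is a single
  right \<open>A\<close>-invariant function \<open>P\<close>, whose coboundary at \<open>gC\<close>
  is \<open>P (g \<otimes> t) - P g\<close>.\<close>

lemma acyclic_mod_hnn: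
  assumes S: "proper_hnn \<C> G A C t"
  shows "acyclic_mod n (std_tree G (HNN A C t))"
proof -
  define T where "T = std_tree G (HNN A C t)"
  interpret coset_graph G T "{LeftV, Edge}" "\<lambda>i. if i = Edge then C else A" LeftV t
    unfolding T_def by (rule coset_graph_hnn[OF S])
  have cl: "closed_subgroup A G" "closed_subgroup C G"
    using S by (auto simp: proper_hnn_def)
  have sg: "subgroup A G" "subgroup C G" using cl by (auto simp: closed_subgroup_def)
  have lcT: "locally_constant (ptop T) h \<longleftrightarrow> locally_constant (gtop G) (\<lambda>g. h (LeftV, g <# A)) \<and>
      locally_constant (gtop G) (\<lambda>g. h (Edge, g <# C))"
    for h :: "_ \<Rightarrow> int"
    unfolding locally_constant_T by simp
  have vertsT: "v \<in> verts T \<Longrightarrow> \<exists>g\<in>carrier G. v = (LeftV, g <# A)" for v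
    by (auto simp: verts_iff elim!: pointsE)
  have edgesT: "e \<in> edges T \<Longrightarrow> \<exists>g\<in>carrier G. e = (Edge, g <# C)" for e
    by (auto elim!: edgesE simp del: Diff_iff)
  have edgeI: "g \<in> carrier G \<Longrightarrow> (Edge, g <# C) \<in> edges T" for g
    using edgesI by simp
  have dT: "d0 T (Edge, g <# C) = (LeftV, g <# A)" "d1 T (Edge, g <# C) = (LeftV, (g \<otimes> t) <# A)" if "g \<in> carrier G" for g
    using d_edge[OF that] by simp_all
  have "acyclic_mod n T"
    unfolding acyclic_mod_def
  proof (intro conjI allI impI ballI, elim conjE)
    fix F :: "_ \<Rightarrow> int" and v w
    assume F: "locally_constant (ptop T) F" "\<forall>e\<in>edges T. F (d1 T e) mod int n = F (d0 T e) mod int n"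
      and vw: "v \<in> verts T" "w \<in> verts T"
    define P where "P = (\<lambda>g. F (LeftV, g <# A))"
    have P: "locally_constant (gtop G) P" using F(1) lcT by (simp add: P_def)
    have "P g mod int n = P \<one> mod int n" if "g \<in> carrier G" for g
    proof (rule hnn_constant[OF S P _ _ that])
      show "P (g \<otimes> a) mod int n = P g mod int n" if "g \<in> carrier G" "a \<in> A" for g a
        using l_coset_mult_right[OF sg(1) that] by (simp add: P_def)
      show "P (g \<otimes> t) mod int n = P g mod int n" if "g \<in> carrier G" for g
        using F(2) edgeI[OF that] dT[OF that] by (metis P_def)
    qed
    then have "F u mod int n = P \<one> mod int n" if "u \<in> verts T" for u
      using vertsT[OF that] by (metis P_def)
    then show "F v mod int n = F w mod int n" using vw by simp
  next
    fix f :: "_ \<Rightarrow> int" assume f: "locally_constant (ptop T) f"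
    define f0 where "f0 = (\<lambda>g. f (Edge, g <# C))"
    have f0: "locally_constant (gtop G) f0" using f lcT by (simp add: f0_def)
    have "f0 (g \<otimes> c) = f0 g" if "g \<in> carrier G" "c \<in> C" for g c
      using l_coset_mult_right[OF sg(2) that] by (simp add: f0_def)
    then obtain P :: "'g \<Rightarrow> int" where P: "locally_constant (gtop G) P"
      "\<And>g a. g \<in> carrier G \<Longrightarrow> a \<in> A \<Longrightarrow> P (g \<otimes> a) = P g"
      "\<And>g. g \<in> carrier G \<Longrightarrow> P (g \<otimes> t) = (P g + f0 g) mod int n"
      using hnn_potential[OF S f0] by metis
    obtain FA where FA: "\<And>g. g \<in> carrier G \<Longrightarrow> FA (g <# A) = P g"
      using l_coset_descend[OF sg(1) P(2)] by metis
    define F where "F = (\<lambda>(i, X). if i = Edge then 0 else FA X)"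
    have "locally_constant (gtop G) (\<lambda>g. FA (g <# A))"
      by (rule locally_constant_cong[OF P(1)]) (simp add: FA)
    then have "locally_constant (ptop T) F" by (simp add: lcT F_def)
    moreover have "(F (d1 T e) - F (d0 T e)) mod int n = f e mod int n" if "e \<in> edges T" for e
    proof -
      obtain g where "g \<in> carrier G" "e = (Edge, g <# C)" using edgesT[OF \<open>e \<in> edges T\<close>] by blast
      then show ?thesis using t by (simp add: dT F_def FA P(3) mod_simps f0_def)
    qed
    ultimately show "\<exists>F :: _ \<Rightarrow> int. locally_constant (ptop T) F \<and>
        (\<forall>e\<in>edges T. (F (d1 T e) - F (d0 T e)) mod int n = f e mod int n)" by blast
  qed
  then show ?thesis by (simp only: T_def)
qed

lemma acyclic_mod_std_tree: "cyclic_splitting \<C> G S \<Longrightarrow> acyclic_mod n (std_tree G S)"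
  by (cases S) (auto intro: acyclic_mod_amalgam acyclic_mod_hnn simp del: std_tree.simps)

text \<open>A fixed vertex forces a vertex group to be all of \<open>G\<close>. Then some element of
  an amalgam lies in both factors but not in \<open>C\<close>, or the stable letter of an
  HNN-extension lies in the base group; a potential contradicts either of these modulo
  \<open>n\<close>.\<close>

lemma no_fixed_vertex:
  assumes S: "cyclic_splitting \<C> G S" and n2: "n \<ge> 2"
    and v: "v \<in> verts (std_tree G S)" and fixed: "\<And>g. g \<in> carrier G \<Longrightarrow> std_action G S g v = v"
  shows False
proof (cases S)
  case (Amalgam A B C)
  have am: "proper_amalgam \<C> G A B C" "C \<noteq> A" "C \<noteq> B" using S Amalgam by auto
  have cl: "closed_subgroup A G" "closed_subgroup B G" "closed_subgroup C G" "C \<subseteq> A" "C \<subseteq> B"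
    using am by (auto simp: proper_amalgam_def)
  have sg: "subgroup A G" "subgroup B G" "subgroup C G" using cl by (auto simp: closed_subgroup_def)
  interpret coset_graph G "std_tree G S" "{LeftV, RightV, Edge}"
    "\<lambda>i. case i of LeftV \<Rightarrow> A | RightV \<Rightarrow> B | Edge \<Rightarrow> C" RightV \<one>
    unfolding Amalgam by (rule coset_graph_amalgam[OF am(1)])
  have "vertex_action g v = v" if "g \<in> carrier G" for g
    using fixed[OF that] by (simp add: std_action_def vertex_action_def)
  then obtain i where i: "i \<noteq> Edge"
    "(case i of LeftV \<Rightarrow> A | RightV \<Rightarrow> B | Edge \<Rightarrow> C) = carrier G"
    using fixed_vertex_whole_group[OF v] by metis
  have AB: "A = carrier G \<or> B = carrier G"
    using i by (cases i) simp_all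
  \<comment> \<open>One factor is all of \<open>G\<close>, so \<open>A \<inter> B\<close> is the
    other one, which properly contains \<open>C\<close>.\<close>
  then obtain x where x: "x \<in> A" "x \<in> B" "x \<notin> C" "x \<in> carrier G"
    using am(2,3) cl sg(1,2)[THEN subgroup.subset] by blast
  have "\<one> <# C \<noteq> x <# C"
    using l_coset_self[OF sg(3) x(4)] x(3) lcos_mult_one[OF subgroup.subset[OF sg(3)]] by auto
  then obtain f :: "'g \<Rightarrow> bool" where f: "locally_constant (gtop G) f" "f \<one>" "\<not> f x"
    "\<And>x h. x \<in> carrier G \<Longrightarrow> h \<in> C \<Longrightarrow> f (x \<otimes> h) = f x"
    using coset_separation[OF cl(3) one_closed x(4)] by metis
  define f0 :: "'g \<Rightarrow> int" where "f0 = (\<lambda>g. of_bool (f g))"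
  have lcf: "locally_constant (gtop G) f0" unfolding f0_def using f(1) by (rule locally_constant_comp)
  have fC: "f0 (g \<otimes> c) = f0 g" if "g \<in> carrier G" "c \<in> C" for g c
    using f(4)[OF that] by (simp add: f0_def)
  \<comment> \<open>Right multiplication by \<open>x\<close> preserves \<open>P\<close>, because
    \<open>x\<close> is in \<open>A\<close>, and preserves \<open>P + f0\<close> modulo
    \<open>n\<close>, because \<open>x\<close> is in \<open>B\<close>; but \<open>f0\<close> drops
    from 1 at \<open>\<one>\<close> to 0 at \<open>x\<close>.\<close>
  obtain P :: "'g \<Rightarrow> int" where "locally_constant (gtop G) P" and P:
    "\<And>g a. g \<in> carrier G \<Longrightarrow> a \<in> A \<Longrightarrow> P (g \<otimes> a) = P g"
    "\<And>g b. g \<in> carrier G \<Longrightarrow> b \<in> B \<Longrightarrow>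
      (P (g \<otimes> b) + f0 (g \<otimes> b)) mod int n = (P g + f0 g) mod int n"
    by (rule amalgam_potential[OF am(1) lcf], rule fC, assumption+, rule that)
  have "P x = P \<one>" using P(1)[of \<one> x] x by simp
  moreover have "(P x + f0 x) mod int n = (P \<one> + f0 \<one>) mod int n" using P(2)[of \<one> x] x by simp
  moreover have "f0 x = 0" "f0 \<one> = 1" using f(2,3) by (simp_all add: f0_def)
  ultimately have "(P \<one> + 1) mod int n = P \<one> mod int n" by (metis add.right_neutral)
  then have "int n dvd 1" by (metis add_diff_cancel_left' mod_eq_dvd_iff)
  then show False using n2 by simp
next
  case (HNN A C t)
  have hnn: "proper_hnn \<C> G A C t" using S HNN by auto
  have t: "t \<in> carrier G" using hnn by (simp add: proper_hnn_def)
  interpret coset_graph G "std_tree G S" "{LeftV, Edge}" "\<lambda>i. if i = Edge then C else A" LeftV t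
    unfolding HNN by (rule coset_graph_hnn[OF hnn])
  have "vertex_action g v = v" if "g \<in> carrier G" for g
    using fixed[OF that] by (simp add: std_action_def vertex_action_def)
  then obtain i where i: "i \<noteq> Edge" "(if i = Edge then C else A) = carrier G"
    using fixed_vertex_whole_group[OF v] by metis
  have A: "A = carrier G" using i by simp
  \<comment> \<open>A potential of the constant 1 grows by 1 under right multiplication by
    \<open>t\<close>, yet it is invariant under \<open>A\<close>, which contains
    \<open>t\<close>.\<close>
  obtain P :: "'g \<Rightarrow> int" where P:
    "\<And>g a. g \<in> carrier G \<Longrightarrow> a \<in> A \<Longrightarrow> P (g \<otimes> a) = P g"
    "\<And>g. g \<in> carrier G \<Longrightarrow> P (g \<otimes> t) = (P g + 1) mod int n"
    using hnn_potential[OF hnn locally_constant_const[of _ 1]] by metis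
  have "(P \<one> + 1) mod int n = P \<one> mod int n"
    using P(1)[of \<one> t] P(2)[of \<one>] A t by (metis mod_mod_trivial one_closed)
  then have "int n dvd 1" by (metis add_diff_cancel_left' mod_eq_dvd_iff)
  then show False using n2 by simp
qed

end

section \<open>Measures with values in the completion of the integers\<close>

lemma closedin_Collect_ball:
  assumes "\<And>i. i \<in> J \<Longrightarrow> closedin X {x \<in> topspace X. P i x}"
  shows "closedin X {x \<in> topspace X. \<forall>i\<in>J. P i x}"
proof -
  have "{x \<in> topspace X. \<forall>i\<in>J. P i x} = \<Inter>(insert (topspace X) ((\<lambda>i. {x \<in> topspace X. P i x}) ` J))"
    by auto
  moreover have "closedin X \<dots>" using assms by (intro closedin_Inter) auto
  ultimately show ?thesis by simp
qed

section \<open>The completion of the integers as a profinite ring\<close>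

lemma class_moduli_pos: "n \<in> class_moduli \<C> \<Longrightarrow> 0 < n"
  by (simp add: class_moduli_def)

lemma zhat_simps [simp]:
  "carrier (zhat \<C>) = zhat_carrier \<C>"
  "\<zero>\<^bsub>zhat \<C>\<^esub> = (\<lambda>n\<in>class_moduli \<C>. 0)"
  "\<one>\<^bsub>zhat \<C>\<^esub> = (\<lambda>n\<in>class_moduli \<C>. 1 mod int n)"
  "x \<oplus>\<^bsub>zhat \<C>\<^esub> y = (\<lambda>n\<in>class_moduli \<C>. (x n + y n) mod int n)"
  "x \<otimes>\<^bsub>zhat \<C>\<^esub> y = (\<lambda>n\<in>class_moduli \<C>. (x n * y n) mod int n)"
  by (simp_all add: zhat_def)

lemma zhat_carrier_iff:
  "x \<in> zhat_carrier \<C> \<longleftrightarrow> x \<in> extensional (class_moduli \<C>) \<and>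
     (\<forall>n\<in>class_moduli \<C>. 0 \<le> x n \<and> x n < int n) \<and>
     (\<forall>m\<in>class_moduli \<C>. \<forall>n\<in>class_moduli \<C>. m dvd n \<longrightarrow> x n mod int m = x m)"
  by (auto simp: zhat_carrier_def PiE_iff)

lemma zhat_mod: "x \<in> zhat_carrier \<C> \<Longrightarrow> n \<in> class_moduli \<C> \<Longrightarrow> x n mod int n = x n"
  by (simp add: zhat_carrier_iff)

lemma zhat_eqI:
  assumes "x \<in> zhat_carrier \<C>" "y \<in> zhat_carrier \<C>"
    "\<And>n. n \<in> class_moduli \<C> \<Longrightarrow> x n mod int n = y n mod int n"
  shows "x = y"
  using assms by (intro extensionalityI[of x "class_moduli \<C>" y]) (auto simp: zhat_carrier_iff)

lemma zhat_residuesI: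
  assumes "\<And>m n. m \<in> class_moduli \<C> \<Longrightarrow> n \<in> class_moduli \<C> \<Longrightarrow> m dvd n \<Longrightarrow>
    f n mod int m = f m mod int m"
  shows "(\<lambda>n\<in>class_moduli \<C>. f n mod int n) \<in> zhat_carrier \<C>"
  unfolding zhat_carrier_iff
proof (intro conjI ballI impI)
  fix m n assume mn: "m \<in> class_moduli \<C>" "n \<in> class_moduli \<C>" "m dvd n"
  then have "f n mod int n mod int m = f n mod int m" by (intro mod_mod_cancel) simp
  then show "restrict (\<lambda>n. f n mod int n) (class_moduli \<C>) n mod int m =
      restrict (\<lambda>n. f n mod int n) (class_moduli \<C>) m"
    using mn assms[OF mn] by simp
qed (auto simp: class_moduli_pos)

lemma zhat_closed:
  "(\<lambda>n\<in>class_moduli \<C>. 0) \<in> zhat_carrier \<C>"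
  "(\<lambda>n\<in>class_moduli \<C>. 1 mod int n) \<in> zhat_carrier \<C>"
  "x \<in> zhat_carrier \<C> \<Longrightarrow> y \<in> zhat_carrier \<C> \<Longrightarrow> (\<lambda>n\<in>class_moduli \<C>. (x n + y n) mod int n) \<in> zhat_carrier \<C>"
  "x \<in> zhat_carrier \<C> \<Longrightarrow> y \<in> zhat_carrier \<C> \<Longrightarrow> (\<lambda>n\<in>class_moduli \<C>. (x n * y n) mod int n) \<in> zhat_carrier \<C>"
  "x \<in> zhat_carrier \<C> \<Longrightarrow> (\<lambda>n\<in>class_moduli \<C>. (- x n) mod int n) \<in> zhat_carrier \<C>"
proof -
  show "(\<lambda>n\<in>class_moduli \<C>. 0) \<in> zhat_carrier \<C>"
    by (auto simp: zhat_carrier_iff class_moduli_pos)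
  show "(\<lambda>n\<in>class_moduli \<C>. 1 mod int n) \<in> zhat_carrier \<C>" by (rule zhat_residuesI) simp
  assume x: "x \<in> zhat_carrier \<C>"
  have xm: "x n mod int m = x m" if "m \<in> class_moduli \<C>" "n \<in> class_moduli \<C>" "m dvd n" for m n
    using x that by (simp add: zhat_carrier_iff)
  show "(\<lambda>n\<in>class_moduli \<C>. (- x n) mod int n) \<in> zhat_carrier \<C>"
    by (rule zhat_residuesI) (metis mod_minus_eq xm)
  assume y: "y \<in> zhat_carrier \<C>"
  have ym: "y n mod int m = y m" if "m \<in> class_moduli \<C>" "n \<in> class_moduli \<C>" "m dvd n" for m n
    using y that by (simp add: zhat_carrier_iff)
  show "(\<lambda>n\<in>class_moduli \<C>. (x n + y n) mod int n) \<in> zhat_carrier \<C>"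
    by (rule zhat_residuesI) (metis mod_add_eq xm ym)
  show "(\<lambda>n\<in>class_moduli \<C>. (x n * y n) mod int n) \<in> zhat_carrier \<C>"
    by (rule zhat_residuesI) (metis mod_mult_eq xm ym)
qed

lemma zhat_unit:
  assumes x: "x \<in> zhat_carrier \<C>"
  shows "\<zero>\<^bsub>zhat \<C>\<^esub> \<oplus>\<^bsub>zhat \<C>\<^esub> x = x" "\<one>\<^bsub>zhat \<C>\<^esub> \<otimes>\<^bsub>zhat \<C>\<^esub> x = x"
proof -
  have e: "x \<in> extensional (class_moduli \<C>)" using x by (simp add: zhat_carrier_iff)
  show "\<zero>\<^bsub>zhat \<C>\<^esub> \<oplus>\<^bsub>zhat \<C>\<^esub> x = x" "\<one>\<^bsub>zhat \<C>\<^esub> \<otimes>\<^bsub>zhat \<C>\<^esub> x = x"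
    using e zhat_mod[OF x] by (auto simp: fun_eq_iff mod_simps extensional_def)
qed

lemma zhat_cring: "cring (zhat \<C>)"
proof (rule cringI)
  show "abelian_group (zhat \<C>)"
  proof (rule abelian_groupI)
    fix x y assume "x \<in> carrier (zhat \<C>)" "y \<in> carrier (zhat \<C>)"
    then show "x \<oplus>\<^bsub>zhat \<C>\<^esub> y \<in> carrier (zhat \<C>)" using zhat_closed(3)[of x \<C> y] by simp
    show "x \<oplus>\<^bsub>zhat \<C>\<^esub> y \<oplus>\<^bsub>zhat \<C>\<^esub> z = x \<oplus>\<^bsub>zhat \<C>\<^esub> (y \<oplus>\<^bsub>zhat \<C>\<^esub> z)" for z
      by (auto simp: fun_eq_iff mod_simps algebra_simps)
    show "x \<oplus>\<^bsub>zhat \<C>\<^esub> y = y \<oplus>\<^bsub>zhat \<C>\<^esub> x"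
      by (auto simp: fun_eq_iff algebra_simps)
  next
    show "\<zero>\<^bsub>zhat \<C>\<^esub> \<in> carrier (zhat \<C>)" using zhat_closed(1)[of \<C>] by simp
    fix x assume x: "x \<in> carrier (zhat \<C>)"
    show "\<zero>\<^bsub>zhat \<C>\<^esub> \<oplus>\<^bsub>zhat \<C>\<^esub> x = x"
      using zhat_unit(1)[of x \<C>] x by (simp only: zhat_simps(1))
    show "\<exists>y\<in>carrier (zhat \<C>). y \<oplus>\<^bsub>zhat \<C>\<^esub> x = \<zero>\<^bsub>zhat \<C>\<^esub>"
      using zhat_closed(5)[of x \<C>] x
      by (intro bexI[of _ "\<lambda>n\<in>class_moduli \<C>. (- x n) mod int n"])
        (auto simp: mod_simps fun_eq_iff)
  qed
  show "comm_monoid (zhat \<C>)"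
  proof (rule comm_monoidI)
    fix x y assume "x \<in> carrier (zhat \<C>)" "y \<in> carrier (zhat \<C>)"
    then show "x \<otimes>\<^bsub>zhat \<C>\<^esub> y \<in> carrier (zhat \<C>)" using zhat_closed(4)[of x \<C> y] by simp
    show "x \<otimes>\<^bsub>zhat \<C>\<^esub> y \<otimes>\<^bsub>zhat \<C>\<^esub> z = x \<otimes>\<^bsub>zhat \<C>\<^esub> (y \<otimes>\<^bsub>zhat \<C>\<^esub> z)" for z
      by (auto simp: fun_eq_iff mod_simps algebra_simps)
    show "x \<otimes>\<^bsub>zhat \<C>\<^esub> y = y \<otimes>\<^bsub>zhat \<C>\<^esub> x"
      by (auto simp: fun_eq_iff algebra_simps)
  next
    show "\<one>\<^bsub>zhat \<C>\<^esub> \<in> carrier (zhat \<C>)" using zhat_closed(2)[of \<C>] by simp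
    fix x assume x: "x \<in> carrier (zhat \<C>)"
    show "\<one>\<^bsub>zhat \<C>\<^esub> \<otimes>\<^bsub>zhat \<C>\<^esub> x = x"
      using zhat_unit(2)[of x \<C>] x by (simp only: zhat_simps(1))
  qed
  fix x y z
  show "(x \<oplus>\<^bsub>zhat \<C>\<^esub> y) \<otimes>\<^bsub>zhat \<C>\<^esub> z = x \<otimes>\<^bsub>zhat \<C>\<^esub> z \<oplus>\<^bsub>zhat \<C>\<^esub> y \<otimes>\<^bsub>zhat \<C>\<^esub> z"
    by (auto simp: fun_eq_iff mod_simps algebra_simps)
qed

lemma rtop_zhat:
  "rtop (zhat \<C>) = subtopology
     (product_topology (\<lambda>n. discrete_topology {0..<int n}) (class_moduli \<C>)) (zhat_carrier \<C>)"
  by (simp add: zhat_def)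

lemma topspace_rtop_zhat [simp]: "topspace (rtop (zhat \<C>)) = zhat_carrier \<C>"
  by (auto simp: rtop_zhat zhat_carrier_def)

text \<open>The coordinates take values in finite discrete sets, so continuity into the inverse
  limit is local constancy of every residue.\<close>

lemma continuous_into_zhat:
  "continuous_map X (rtop (zhat \<C>)) h \<longleftrightarrow>
     (\<forall>x\<in>topspace X. h x \<in> zhat_carrier \<C>) \<and>
     (\<forall>n\<in>class_moduli \<C>. locally_constant X (\<lambda>x. h x n))"
proof -
  have "x \<in> extensional (class_moduli \<C>)" "n \<in> class_moduli \<C> \<Longrightarrow> 0 \<le> x n \<and> x n < int n"
    if "x \<in> zhat_carrier \<C>" for x n
    using that by (auto simp: zhat_carrier_iff)
  then show ?thesis
    unfolding rtop_zhat continuous_map_in_subtopology continuous_map_componentwise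
      continuous_map_discrete_iff
    by (auto simp: image_subset_iff Pi_iff)
qed

lemma locally_constant_zhat: "n \<in> class_moduli \<C> \<Longrightarrow> locally_constant (rtop (zhat \<C>)) (\<lambda>x. x n)"
  using continuous_into_zhat[of "rtop (zhat \<C>)" \<C> "\<lambda>x. x"] continuous_map_id[of "rtop (zhat \<C>)"]
  by (simp add: id_def)

lemma profinite_space_subproduct:
  assumes X: "\<And>i. profinite_space (X i)" and S: "closedin (product_topology X I) S"
  shows "profinite_space (subtopology (product_topology X I) S)"
proof (rule profinite_space_closed_subspace[OF _ S], rule profinite_spaceI)
  show "compact_space (product_topology X I)"
    using X profinite_space_compact by (metis compact_space_product_topology)
  fix x y assume xy: "x \<in> topspace (product_topology X I)" "y \<in> topspace (product_topology X I)" "x \<noteq> y"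
  then obtain i where i: "i \<in> I" "x i \<noteq> y i"
    using PiE_ext[of x I "\<lambda>i. topspace (X i)" y] by (metis topspace_product_topology)
  then obtain f :: "'b \<Rightarrow> bool" where f: "locally_constant (X i) f" "f (x i)" "\<not> f (y i)"
    using profinite_space_separation[OF X, of "x i" i "y i"] xy by (auto simp: PiE_iff)
  have "locally_constant (product_topology X I) (\<lambda>z. f (z i))"
    using locally_constant_compose[OF f(1), of "product_topology X I" "\<lambda>z. z i"]
      continuous_map_product_projection[OF i(1)] by blast
  then show "\<exists>f :: ('a \<Rightarrow> 'b) \<Rightarrow> bool. locally_constant (product_topology X I) f \<and> f x \<noteq> f y"
    using f by (intro exI[of _ "\<lambda>z. f (z i)"]) simp
qed

lemma profinite_space_discrete: "finite A \<Longrightarrow> profinite_space (discrete_topology A)"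
  unfolding profinite_space_iff
  by (auto simp: compact_space_discrete_topology intro!: exI[of _ "{_}"])

lemma locally_constant_projection:
  assumes "i \<in> I"
  shows "locally_constant (product_topology (\<lambda>i. discrete_topology (A i)) I) (\<lambda>x. x i)"
  using continuous_map_product_projection[OF assms, of "\<lambda>i. discrete_topology (A i)"]
  unfolding continuous_map_discrete_iff by simp

text \<open>Each compatibility condition involves two coordinates, so the inverse limit is closed in
  a product of finite discrete spaces.\<close>

lemma profinite_zhat: "profinite_space (rtop (zhat \<C>))"
  unfolding rtop_zhat
proof (rule profinite_space_subproduct)
  show "profinite_space (discrete_topology {0..<int i})" for i
    by (rule profinite_space_discrete) simp
  let ?P = "product_topology (\<lambda>n. discrete_topology {0..<int n}) (class_moduli \<C>)"
  have "closedin ?P {x \<in> topspace ?P. \<forall>m\<in>class_moduli \<C>. \<forall>n\<in>class_moduli \<C>. m dvd n \<longrightarrow> x n mod int m = x m}"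
  proof (rule closedin_Collect_ball)
    fix m assume m: "m \<in> class_moduli \<C>"
    have "closedin ?P {x \<in> topspace ?P. m dvd n \<longrightarrow> x n mod int m = x m}" if "n \<in> class_moduli \<C>" for n
      using locally_constant_closedin[OF locally_constant_comp2[OF locally_constant_projection[OF that]
        locally_constant_projection[OF m], where h = "\<lambda>a b. m dvd n \<longrightarrow> a mod int m = b"], where P = "\<lambda>b. b"] by simp
    then have "closedin ?P {x \<in> topspace ?P. \<forall>n\<in>class_moduli \<C>. m dvd n \<longrightarrow> x n mod int m = x m}"
      by (rule closedin_Collect_ball)
    then show "closedin ?P {x \<in> topspace ?P. \<forall>n\<in>class_moduli \<C>. m dvd n \<longrightarrow> x n mod int m = x m}" .
  qed
  then show "closedin ?P (zhat_carrier \<C>)"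
    by (simp add: zhat_carrier_def)
qed

section \<open>Finitely additive measures on clopen sets\<close>

abbreviation clopenin :: "'a topology \<Rightarrow> 'a set \<Rightarrow> bool" where
  "clopenin X U \<equiv> openin X U \<and> closedin X U"

text \<open>The value 0 off the clopen sets makes a function on all sets depend only on its clopen
  values. The laws are imposed residue by residue, so that each of them concerns finitely many
  locally constant functions of the measure.\<close>

definition zmeasures :: "(nat monoid \<Rightarrow> bool) \<Rightarrow> 'a topology \<Rightarrow> 'a free_elem set" where
  "zmeasures \<C> X = {\<mu>. (\<forall>U. \<mu> U \<in> zhat_carrier \<C>) \<and> (\<forall>n\<in>class_moduli \<C>.
     (\<forall>U. \<not> clopenin X U \<longrightarrow> \<mu> U n = 0) \<and>
     (\<forall>U V. clopenin X U \<and> clopenin X V \<and> U \<inter> V = {} \<longrightarrow> \<mu> (U \<union> V) n = (\<mu> U n + \<mu> V n) mod int n))}"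

definition measure_module :: "(nat monoid \<Rightarrow> bool) \<Rightarrow> 'a topology \<Rightarrow> (nat \<Rightarrow> int, 'a free_elem) topmodule" where
  "measure_module \<C> X =
     \<lparr>carrier = zmeasures \<C> X, monoid.mult = (\<lambda>_ _ _. \<zero>\<^bsub>zhat \<C>\<^esub>), one = (\<lambda>_. \<zero>\<^bsub>zhat \<C>\<^esub>),
      zero = (\<lambda>_. \<zero>\<^bsub>zhat \<C>\<^esub>), add = (\<lambda>\<mu> \<nu> U. \<mu> U \<oplus>\<^bsub>zhat \<C>\<^esub> \<nu> U),
      smult = (\<lambda>r \<mu> U. r \<otimes>\<^bsub>zhat \<C>\<^esub> \<mu> U),
      mtop = subtopology (product_topology (\<lambda>_. rtop (zhat \<C>)) UNIV) (zmeasures \<C> X)\<rparr>"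

definition dirac :: "(nat monoid \<Rightarrow> bool) \<Rightarrow> 'a topology \<Rightarrow> 'a \<Rightarrow> 'a free_elem" where
  "dirac \<C> X x U = (if clopenin X U \<and> x \<in> U then \<one>\<^bsub>zhat \<C>\<^esub> else \<zero>\<^bsub>zhat \<C>\<^esub>)"

lemma measure_module_simps [simp]:
  "carrier (measure_module \<C> X) = zmeasures \<C> X"
  "\<zero>\<^bsub>measure_module \<C> X\<^esub> = (\<lambda>_. \<zero>\<^bsub>zhat \<C>\<^esub>)"
  "\<mu> \<oplus>\<^bsub>measure_module \<C> X\<^esub> \<nu> = (\<lambda>U. \<mu> U \<oplus>\<^bsub>zhat \<C>\<^esub> \<nu> U)"
  "r \<odot>\<^bsub>measure_module \<C> X\<^esub> \<mu> = (\<lambda>U. r \<otimes>\<^bsub>zhat \<C>\<^esub> \<mu> U)"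
  by (simp_all add: measure_module_def)

lemma measuresD:
  assumes "\<mu> \<in> zmeasures \<C> X"
  shows "\<mu> U \<in> zhat_carrier \<C>" "n \<in> class_moduli \<C> \<Longrightarrow> \<not> clopenin X U \<Longrightarrow> \<mu> U n = 0"
    "n \<in> class_moduli \<C> \<Longrightarrow> clopenin X U \<Longrightarrow> clopenin X V \<Longrightarrow> U \<inter> V = {} \<Longrightarrow>
      \<mu> (U \<union> V) n = (\<mu> U n + \<mu> V n) mod int n"
  using assms unfolding zmeasures_def by blast+

lemma measuresI:
  assumes "\<And>U. \<mu> U \<in> zhat_carrier \<C>"
    and "\<And>n U. n \<in> class_moduli \<C> \<Longrightarrow> \<not> clopenin X U \<Longrightarrow> \<mu> U n = 0"
    and "\<And>n U V. n \<in> class_moduli \<C> \<Longrightarrow> clopenin X U \<Longrightarrow> clopenin X V \<Longrightarrow> U \<inter> V = {} \<Longrightarrow>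
      \<mu> (U \<union> V) n = (\<mu> U n + \<mu> V n) mod int n"
  shows "\<mu> \<in> zmeasures \<C> X"
  using assms unfolding zmeasures_def by blast

text \<open>Additivity for the disjoint pair of \<open>{}\<close> with itself makes the residue
  divisible by \<open>n\<close>, and it lies between 0 and \<open>n - 1\<close>.\<close>

lemma measure_empty:
  assumes "\<mu> \<in> zmeasures \<C> X" "n \<in> class_moduli \<C>"
  shows "\<mu> {} n = 0"
proof -
  have "\<mu> {} n = (\<mu> {} n + \<mu> {} n) mod int n"
    using measuresD(3)[OF assms, of "{}" "{}"] by simp
  moreover have "0 \<le> \<mu> {} n" "\<mu> {} n < int n"
    using measuresD(1)[OF assms(1), of "{}"] assms(2) by (auto simp: zhat_carrier_iff)
  ultimately have "int n dvd \<mu> {} n"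
    by (metis add_diff_cancel_left' mod_eq_dvd_iff mod_pos_pos_trivial)
  then show ?thesis using \<open>0 \<le> \<mu> {} n\<close> \<open>\<mu> {} n < int n\<close> by (metis dvd_imp_mod_0 mod_pos_pos_trivial)
qed

lemma measures_closed:
  "(\<lambda>_. \<zero>\<^bsub>zhat \<C>\<^esub>) \<in> zmeasures \<C> X"
  "\<mu> \<in> zmeasures \<C> X \<Longrightarrow> \<nu> \<in> zmeasures \<C> X \<Longrightarrow> (\<lambda>U. \<mu> U \<oplus>\<^bsub>zhat \<C>\<^esub> \<nu> U) \<in> zmeasures \<C> X"
  "r \<in> zhat_carrier \<C> \<Longrightarrow> \<mu> \<in> zmeasures \<C> X \<Longrightarrow> (\<lambda>U. r \<otimes>\<^bsub>zhat \<C>\<^esub> \<mu> U) \<in> zmeasures \<C> X"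
  "dirac \<C> X x \<in> zmeasures \<C> X"
proof -
  show "(\<lambda>_. \<zero>\<^bsub>zhat \<C>\<^esub>) \<in> zmeasures \<C> X"
    by (rule measuresI) (use zhat_closed in auto)
  show "dirac \<C> X x \<in> zmeasures \<C> X"
    by (rule measuresI) (use zhat_closed in \<open>auto simp: dirac_def\<close>)
  assume \<mu>: "\<mu> \<in> zmeasures \<C> X"
  show "(\<lambda>U. r \<otimes>\<^bsub>zhat \<C>\<^esub> \<mu> U) \<in> zmeasures \<C> X" if "r \<in> zhat_carrier \<C>"
  proof (rule measuresI)
    show "r \<otimes>\<^bsub>zhat \<C>\<^esub> \<mu> U \<in> zhat_carrier \<C>" for U
      using measuresD(1)[OF \<mu>] zhat_closed(4) that by simp
    fix n U assume n: "n \<in> class_moduli \<C>"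
    show "(r \<otimes>\<^bsub>zhat \<C>\<^esub> \<mu> U) n = 0" if "\<not> clopenin X U"
      using measuresD(2)[OF \<mu> n that] n by simp
    show "(r \<otimes>\<^bsub>zhat \<C>\<^esub> \<mu> (U \<union> V)) n = ((r \<otimes>\<^bsub>zhat \<C>\<^esub> \<mu> U) n + (r \<otimes>\<^bsub>zhat \<C>\<^esub> \<mu> V) n) mod int n"
      if "clopenin X U" "clopenin X V" "U \<inter> V = {}" for V
      using measuresD(3)[OF \<mu> n that] n by (simp add: mod_simps algebra_simps)
  qed
  assume \<nu>: "\<nu> \<in> zmeasures \<C> X"
  show "(\<lambda>U. \<mu> U \<oplus>\<^bsub>zhat \<C>\<^esub> \<nu> U) \<in> zmeasures \<C> X"
  proof (rule measuresI)
    show "\<mu> U \<oplus>\<^bsub>zhat \<C>\<^esub> \<nu> U \<in> zhat_carrier \<C>" for U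
      using measuresD(1)[OF \<mu>] measuresD(1)[OF \<nu>] zhat_closed(3) by simp
    fix n U assume n: "n \<in> class_moduli \<C>"
    show "(\<mu> U \<oplus>\<^bsub>zhat \<C>\<^esub> \<nu> U) n = 0" if "\<not> clopenin X U"
      using measuresD(2)[OF \<mu> n that] measuresD(2)[OF \<nu> n that] n by simp
    show "(\<mu> (U \<union> V) \<oplus>\<^bsub>zhat \<C>\<^esub> \<nu> (U \<union> V)) n =
        ((\<mu> U \<oplus>\<^bsub>zhat \<C>\<^esub> \<nu> U) n + (\<mu> V \<oplus>\<^bsub>zhat \<C>\<^esub> \<nu> V) n) mod int n"
      if "clopenin X U" "clopenin X V" "U \<inter> V = {}" for V
      using measuresD(3)[OF \<mu> n that] measuresD(3)[OF \<nu> n that] n by (simp add: mod_simps; simp add: ac_simps)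
  qed
qed

lemma measure_uminus:
  assumes \<mu>: "\<mu> \<in> zmeasures \<C> X"
  shows "(\<lambda>U. \<lambda>n\<in>class_moduli \<C>. (- \<mu> U n) mod int n) \<in> zmeasures \<C> X"
proof (rule measuresI)
  show "(\<lambda>n\<in>class_moduli \<C>. (- \<mu> U n) mod int n) \<in> zhat_carrier \<C>" for U
    using measuresD(1)[OF \<mu>] zhat_closed(5) by simp
  fix n U assume n: "n \<in> class_moduli \<C>"
  show "restrict (\<lambda>n. (- \<mu> U n) mod int n) (class_moduli \<C>) n = 0" if "\<not> clopenin X U"
    using measuresD(2)[OF \<mu> n that] n by simp
  show "restrict (\<lambda>n. (- \<mu> (U \<union> V) n) mod int n) (class_moduli \<C>) n =
      (restrict (\<lambda>n. (- \<mu> U n) mod int n) (class_moduli \<C>) n +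
       restrict (\<lambda>n. (- \<mu> V n) mod int n) (class_moduli \<C>) n) mod int n"
    if "clopenin X U" "clopenin X V" "U \<inter> V = {}" for V
    using measuresD(3)[OF \<mu> n that] n by (simp add: mod_simps algebra_simps)
qed

lemma measure_eqI:
  assumes "\<mu> \<in> zmeasures \<C> X" "\<nu> \<in> zmeasures \<C> X"
    "\<And>U n. clopenin X U \<Longrightarrow> n \<in> class_moduli \<C> \<Longrightarrow> \<mu> U n mod int n = \<nu> U n mod int n"
  shows "\<mu> = \<nu>"
proof
  fix U
  show "\<mu> U = \<nu> U"
    by (rule zhat_eqI[of _ \<C>]) (use measuresD[OF assms(1)] measuresD[OF assms(2)] assms(3) in \<open>cases "clopenin X U"; simp\<close>)+
qed

lemma measure_module_module: "Module.module (zhat \<C>) (measure_module \<C> X)"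
proof -
  interpret R: cring "zhat \<C>" by (rule zhat_cring)
  have c: "x U \<in> carrier (zhat \<C>)" if "x \<in> carrier (measure_module \<C> X)" for x U
    using measuresD(1)[of x \<C> X U] that by simp
  have "abelian_group (measure_module \<C> X)"
  proof (rule abelian_groupI)
    fix x y assume x: "x \<in> carrier (measure_module \<C> X)" and y: "y \<in> carrier (measure_module \<C> X)"
    show "x \<oplus>\<^bsub>measure_module \<C> X\<^esub> y \<in> carrier (measure_module \<C> X)"
      using measures_closed(2)[of x \<C> X y] x y by simp
    show "x \<oplus>\<^bsub>measure_module \<C> X\<^esub> y = y \<oplus>\<^bsub>measure_module \<C> X\<^esub> x"
      unfolding measure_module_simps by (intro ext R.a_comm c x y)
    show "x \<oplus>\<^bsub>measure_module \<C> X\<^esub> y \<oplus>\<^bsub>measure_module \<C> X\<^esub> z = x \<oplus>\<^bsub>measure_module \<C> X\<^esub> (y \<oplus>\<^bsub>measure_module \<C> X\<^esub> z)"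
      if z: "z \<in> carrier (measure_module \<C> X)" for z
      unfolding measure_module_simps by (intro ext R.a_assoc c x y z)
  next
    show "\<zero>\<^bsub>measure_module \<C> X\<^esub> \<in> carrier (measure_module \<C> X)"
      using measures_closed(1)[of \<C> X] by simp
    fix x assume x: "x \<in> carrier (measure_module \<C> X)"
    show "\<zero>\<^bsub>measure_module \<C> X\<^esub> \<oplus>\<^bsub>measure_module \<C> X\<^esub> x = x"
      unfolding measure_module_simps by (intro ext R.l_zero c x)
    show "\<exists>y\<in>carrier (measure_module \<C> X). y \<oplus>\<^bsub>measure_module \<C> X\<^esub> x = \<zero>\<^bsub>measure_module \<C> X\<^esub>"
      using measure_uminus[of x \<C> X] x
      by (intro bexI[of _ "\<lambda>U. \<lambda>n\<in>class_moduli \<C>. (- x U n) mod int n"])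
        (auto simp: mod_simps fun_eq_iff)
  qed
  then show ?thesis
  proof (rule Module.moduleI[OF zhat_cring])
    fix a b x y assume a: "a \<in> carrier (zhat \<C>)" and b: "b \<in> carrier (zhat \<C>)"
      and x: "x \<in> carrier (measure_module \<C> X)" and y: "y \<in> carrier (measure_module \<C> X)"
    show "(a \<oplus>\<^bsub>zhat \<C>\<^esub> b) \<odot>\<^bsub>measure_module \<C> X\<^esub> x = a \<odot>\<^bsub>measure_module \<C> X\<^esub> x \<oplus>\<^bsub>measure_module \<C> X\<^esub> b \<odot>\<^bsub>measure_module \<C> X\<^esub> x"
      unfolding measure_module_simps by (intro ext R.l_distr c x a b)
    show "(a \<otimes>\<^bsub>zhat \<C>\<^esub> b) \<odot>\<^bsub>measure_module \<C> X\<^esub> x = a \<odot>\<^bsub>measure_module \<C> X\<^esub> (b \<odot>\<^bsub>measure_module \<C> X\<^esub> x)"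
      unfolding measure_module_simps by (intro ext R.m_assoc c x a b)
  next
    fix a x y assume a: "a \<in> carrier (zhat \<C>)"
      and x: "x \<in> carrier (measure_module \<C> X)" and y: "y \<in> carrier (measure_module \<C> X)"
    show "a \<odot>\<^bsub>measure_module \<C> X\<^esub> (x \<oplus>\<^bsub>measure_module \<C> X\<^esub> y) = a \<odot>\<^bsub>measure_module \<C> X\<^esub> x \<oplus>\<^bsub>measure_module \<C> X\<^esub> a \<odot>\<^bsub>measure_module \<C> X\<^esub> y"
      unfolding measure_module_simps by (intro ext R.r_distr c x y a)
  next
    fix a x assume a: "a \<in> carrier (zhat \<C>)" and x: "x \<in> carrier (measure_module \<C> X)"
    show "a \<odot>\<^bsub>measure_module \<C> X\<^esub> x \<in> carrier (measure_module \<C> X)"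
      using measures_closed(3)[of a \<C> x X] a x by simp
  next
    fix x assume x: "x \<in> carrier (measure_module \<C> X)"
    show "\<one>\<^bsub>zhat \<C>\<^esub> \<odot>\<^bsub>measure_module \<C> X\<^esub> x = x"
      unfolding measure_module_simps by (intro ext R.l_one c x)
  qed
qed

lemma mtop_measure_module:
  "mtop (measure_module \<C> X) = subtopology (product_topology (\<lambda>_. rtop (zhat \<C>)) UNIV) (zmeasures \<C> X)"
  by (simp add: measure_module_def)

lemma topspace_measure_module [simp]: "topspace (mtop (measure_module \<C> X)) = zmeasures \<C> X"
  using measuresD(1) by (fastforce simp: mtop_measure_module)

lemma continuous_into_measures:
  "continuous_map Y (mtop (measure_module \<C> X)) h \<longleftrightarrow>
     (\<forall>y\<in>topspace Y. h y \<in> zmeasures \<C> X) \<and>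
     (\<forall>U. \<forall>n\<in>class_moduli \<C>. locally_constant Y (\<lambda>y. h y U n))"
  unfolding mtop_measure_module continuous_map_in_subtopology continuous_map_componentwise_UNIV
    continuous_into_zhat
  using measuresD(1) by (fastforce simp: image_subset_iff)

lemma locally_constant_measure:
  "n \<in> class_moduli \<C> \<Longrightarrow> locally_constant (mtop (measure_module \<C> X)) (\<lambda>\<mu>. \<mu> U n)"
  using continuous_into_measures[of "mtop (measure_module \<C> X)" \<C> X "\<lambda>x. x"]
    continuous_map_id[of "mtop (measure_module \<C> X)"]
  by (simp add: id_def)

text \<open>Every defining law involves finitely many coordinates, so the measures form a closed
  subset of a power of the profinite ring.\<close>

lemma profinite_measures: "profinite_space (mtop (measure_module \<C> X))"
  unfolding mtop_measure_module
proof (rule profinite_space_subproduct[OF profinite_zhat])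
  let ?P = "product_topology (\<lambda>_ :: 'a set. rtop (zhat \<C>)) UNIV"
  have lc: "locally_constant ?P (\<lambda>\<mu>. \<mu> U n)" if "n \<in> class_moduli \<C>" for U n
    using locally_constant_compose[OF locally_constant_zhat[OF that], of ?P "\<lambda>\<mu>. \<mu> U"]
      continuous_map_product_projection[of U UNIV "\<lambda>_. rtop (zhat \<C>)"] by simp
  have "closedin ?P {\<mu> \<in> topspace ?P. \<forall>n\<in>class_moduli \<C>.
      (\<forall>U\<in>{U. \<not> clopenin X U}. \<mu> U n = 0) \<and>
      (\<forall>p\<in>{(U, V). clopenin X U \<and> clopenin X V \<and> U \<inter> V = {}}.
         \<mu> (fst p \<union> snd p) n = (\<mu> (fst p) n + \<mu> (snd p) n) mod int n)}"
  proof (rule closedin_Collect_ball)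
    fix n assume n: "n \<in> class_moduli \<C>"
    have "closedin ?P {\<mu> \<in> topspace ?P. \<forall>U\<in>{U. \<not> clopenin X U}. \<mu> U n = 0}"
      by (intro closedin_Collect_ball locally_constant_closedin[OF lc[OF n]])
    moreover have "closedin ?P {\<mu> \<in> topspace ?P. \<forall>p\<in>{(U, V). clopenin X U \<and> clopenin X V \<and> U \<inter> V = {}}.
        \<mu> (fst p \<union> snd p) n = (\<mu> (fst p) n + \<mu> (snd p) n) mod int n}"
    proof (rule closedin_Collect_ball)
      fix p :: "'a set \<times> 'a set"
      have "locally_constant ?P (\<lambda>\<mu>. \<mu> (fst p \<union> snd p) n = (\<mu> (fst p) n + \<mu> (snd p) n) mod int n)"
        by (intro locally_constant_comp2[OF lc[OF n] locally_constant_comp2[OF lc[OF n] lc[OF n], where h = "\<lambda>a b. (a + b) mod int n"],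
          of "(=)"])
      then show "closedin ?P {\<mu> \<in> topspace ?P. \<mu> (fst p \<union> snd p) n = (\<mu> (fst p) n + \<mu> (snd p) n) mod int n}"
        using locally_constant_closedin[where P = "\<lambda>b. b"] by fastforce
    qed
    ultimately have "closedin ?P ({\<mu> \<in> topspace ?P. \<forall>U\<in>{U. \<not> clopenin X U}. \<mu> U n = 0} \<inter>
        {\<mu> \<in> topspace ?P. \<forall>p\<in>{(U, V). clopenin X U \<and> clopenin X V \<and> U \<inter> V = {}}.
          \<mu> (fst p \<union> snd p) n = (\<mu> (fst p) n + \<mu> (snd p) n) mod int n})"
      by (rule closedin_Int)
    then show "closedin ?P {\<mu> \<in> topspace ?P. (\<forall>U\<in>{U. \<not> clopenin X U}. \<mu> U n = 0) \<and>
        (\<forall>p\<in>{(U, V). clopenin X U \<and> clopenin X V \<and> U \<inter> V = {}}.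
          \<mu> (fst p \<union> snd p) n = (\<mu> (fst p) n + \<mu> (snd p) n) mod int n)}"
      by (rule back_subst[of "closedin ?P"]) blast
  qed
  moreover have "zmeasures \<C> X = {\<mu> \<in> topspace ?P. \<forall>n\<in>class_moduli \<C>.
      (\<forall>U\<in>{U. \<not> clopenin X U}. \<mu> U n = 0) \<and>
      (\<forall>p\<in>{(U, V). clopenin X U \<and> clopenin X V \<and> U \<inter> V = {}}.
         \<mu> (fst p \<union> snd p) n = (\<mu> (fst p) n + \<mu> (snd p) n) mod int n)}"
    unfolding zmeasures_def by (simp add: split_paired_all Ball_def PiE_UNIV_domain Pi_iff)
  ultimately show "closedin ?P (zmeasures \<C> X)" by simp
qed

lemma measure_a_inv:
  assumes x: "x \<in> zmeasures \<C> X" and n: "n \<in> class_moduli \<C>"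
  shows "(\<ominus>\<^bsub>measure_module \<C> X\<^esub> x) U n = (- x U n) mod int n"
proof -
  let ?M = "measure_module \<C> X"
  interpret Module.module "zhat \<C>" ?M by (rule measure_module_module)
  let ?y = "\<lambda>U. \<lambda>n\<in>class_moduli \<C>. (- x U n) mod int n"
  have "?y \<oplus>\<^bsub>?M\<^esub> x = \<zero>\<^bsub>?M\<^esub>" by (auto simp: mod_simps fun_eq_iff)
  then have "\<ominus>\<^bsub>?M\<^esub> x = ?y"
    using M.minus_equality[of ?y x] measure_uminus[OF x] x by simp
  then show ?thesis using n by simp
qed

lemma profinite_measure_module: "profinite_module (zhat \<C>) (measure_module \<C> X)"
proof -
  let ?M = "measure_module \<C> X"
  interpret Module.module "zhat \<C>" ?M by (rule measure_module_module)
  note lc = locally_constant_compose[OF locally_constant_measure]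
  have "continuous_map (prod_topology (mtop ?M) (mtop ?M)) (mtop ?M) (\<lambda>z. fst z \<oplus>\<^bsub>?M\<^esub> snd z)"
    unfolding continuous_into_measures
  proof (intro conjI ballI allI)
    show "locally_constant (prod_topology (mtop ?M) (mtop ?M)) (\<lambda>z. (fst z \<oplus>\<^bsub>?M\<^esub> snd z) U n)"
      if "n \<in> class_moduli \<C>" for U n
      using that locally_constant_comp2[OF lc[OF that continuous_map_fst] lc[OF that continuous_map_snd], where h = "\<lambda>a b. (a + b) mod int n"]
      by simp
  qed (use M.a_closed in auto)
  moreover have "continuous_map (mtop ?M) (mtop ?M) (\<lambda>x. \<ominus>\<^bsub>?M\<^esub> x)"
    unfolding continuous_into_measures
  proof (intro conjI ballI allI)
    fix U n assume n: "n \<in> class_moduli \<C>"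
    show "locally_constant (mtop ?M) (\<lambda>x. (\<ominus>\<^bsub>?M\<^esub> x) U n)"
      by (intro locally_constant_cong[OF locally_constant_comp[OF locally_constant_measure[OF n, of X U], where g = "\<lambda>a. (- a) mod int n"]])
        (simp add: measure_a_inv[OF _ n])
  qed (use M.a_inv_closed in auto)
  moreover have "continuous_map (prod_topology (rtop (zhat \<C>)) (mtop ?M)) (mtop ?M) (\<lambda>z. fst z \<odot>\<^bsub>?M\<^esub> snd z)"
    unfolding continuous_into_measures
  proof (intro conjI ballI allI)
    show "locally_constant (prod_topology (rtop (zhat \<C>)) (mtop ?M)) (\<lambda>z. (fst z \<odot>\<^bsub>?M\<^esub> snd z) U n)"
      if "n \<in> class_moduli \<C>" for U n
      using that locally_constant_comp2[OF locally_constant_compose[OF locally_constant_zhat[OF that] continuous_map_fst]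
        lc[OF that continuous_map_snd], where h = "\<lambda>a b. (a * b) mod int n"]
      by simp
  qed (use smult_closed in auto)
  ultimately show ?thesis
    unfolding profinite_module_def case_prod_unfold
    using module_axioms profinite_measures by auto
qed

lemma continuous_dirac: "continuous_map X (mtop (measure_module \<C> X)) (dirac \<C> X)"
  unfolding continuous_into_measures
proof (intro conjI ballI allI measures_closed(4))
  fix U n assume n: "n \<in> class_moduli \<C>"
  show "locally_constant X (\<lambda>x. dirac \<C> X x U n)"
  proof (cases "clopenin X U")
    case True
    then have "locally_constant X (\<lambda>x. if x \<in> U then 1 mod int n else 0)"
      using locally_constant_comp[OF locally_constant_mem] by fast
    then show ?thesis
      by (rule locally_constant_cong) (use True n in \<open>simp add: dirac_def\<close>)
  next
    case False
    then have "(\<lambda>x. dirac \<C> X x U n) = (\<lambda>_. 0)" using n by (auto simp: dirac_def)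
    then show ?thesis by simp
  qed
qed

section \<open>Freeness of the module of zmeasures\<close>

text \<open>This view of a module makes \<open>open_normal_basis\<close> available for its additive
  group.\<close>

definition additive_topgroup :: "('r, 'm) topmodule \<Rightarrow> 'm topgroup" where
  "additive_topgroup N = \<lparr>carrier = carrier N, monoid.mult = add N, one = zero N, gtop = mtop N\<rparr>"

locale profinite_test_module = Module.module "zhat \<C>" N
  for \<C> :: "nat monoid \<Rightarrow> bool" and N :: "(nat \<Rightarrow> int, 'm) topmodule" +
  assumes profinite_N: "profinite_module (zhat \<C>) N"
begin

lemma topspace_N [simp]: "topspace (mtop N) = carrier N"
  and profinite_mtop: "profinite_space (mtop N)"
  using profinite_N by (auto simp: profinite_module_def)

lemma continuous_map_add:
  assumes "continuous_map Y (mtop N) f" "continuous_map Y (mtop N) g"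
  shows "continuous_map Y (mtop N) (\<lambda>y. f y \<oplus>\<^bsub>N\<^esub> g y)"
  using continuous_map_compose'[of Y "prod_topology (mtop N) (mtop N)" "\<lambda>y. (f y, g y)" "mtop N" "\<lambda>(x, y). x \<oplus>\<^bsub>N\<^esub> y"]
    assms profinite_N by (simp add: profinite_module_def continuous_map_pairedI)

lemma continuous_map_uminus:
  assumes "continuous_map Y (mtop N) f"
  shows "continuous_map Y (mtop N) (\<lambda>y. \<ominus>\<^bsub>N\<^esub> f y)"
  using continuous_map_compose'[OF assms, of "mtop N" "\<lambda>x. \<ominus>\<^bsub>N\<^esub> x"] profinite_N
  by (simp add: profinite_module_def)

lemma continuous_map_smult:
  assumes "continuous_map Y (rtop (zhat \<C>)) f" "continuous_map Y (mtop N) g"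
  shows "continuous_map Y (mtop N) (\<lambda>y. f y \<odot>\<^bsub>N\<^esub> g y)"
  using continuous_map_compose'[of Y "prod_topology (rtop (zhat \<C>)) (mtop N)" "\<lambda>y. (f y, g y)" "mtop N" "\<lambda>(x, y). x \<odot>\<^bsub>N\<^esub> y"]
    assms profinite_N by (simp add: profinite_module_def continuous_map_pairedI)

lemma additive_profinite_topgroup: "profinite_topgroup (additive_topgroup N)"
proof -
  let ?A = "additive_topgroup N"
  have A: "group ?A"
    by (rule groupI) (auto simp: additive_topgroup_def M.a_assoc M.l_neg intro!: bexI[of _ "\<ominus>\<^bsub>N\<^esub> _"])
  have "inv\<^bsub>?A\<^esub> x = \<ominus>\<^bsub>N\<^esub> x" for x
    by (simp add: additive_topgroup_def a_inv_def m_inv_def)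
  then have "profinite_group ?A"
    using A profinite_N by (simp add: profinite_group_def profinite_module_def additive_topgroup_def)
  then show ?thesis using A by (simp add: profinite_topgroup_def profinite_topgroup_axioms_def)
qed

definition open_submodule :: "'m set \<Rightarrow> bool" where
  "open_submodule W \<longleftrightarrow> openin (mtop N) W \<and> \<zero>\<^bsub>N\<^esub> \<in> W \<and> (\<forall>x\<in>W. \<forall>y\<in>W. x \<oplus>\<^bsub>N\<^esub> y \<in> W) \<and>
     (\<forall>x\<in>W. \<ominus>\<^bsub>N\<^esub> x \<in> W) \<and> (\<forall>r\<in>carrier (zhat \<C>). \<forall>x\<in>W. r \<odot>\<^bsub>N\<^esub> x \<in> W)"

lemma open_submodule_subset: "open_submodule W \<Longrightarrow> W \<subseteq> carrier N"
  using openin_subset[of "mtop N" W] by (simp add: open_submodule_def)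

text \<open>Let \<open>L\<close> be an open subgroup of the additive group inside \<open>U\<close>.
  The elements all of whose scalar multiples lie in \<open>L\<close> form a submodule, and it is
  open because the ring is compact.\<close>

lemma open_submodule_basis:
  assumes "openin (mtop N) U" "\<zero>\<^bsub>N\<^esub> \<in> U"
  obtains W where "open_submodule W" "W \<subseteq> U"
proof -
  let ?A = "additive_topgroup N"
  interpret A: profinite_topgroup ?A by (rule additive_profinite_topgroup)
  have A_simps: "gtop ?A = mtop N" "carrier ?A = carrier N" "\<one>\<^bsub>?A\<^esub> = \<zero>\<^bsub>N\<^esub>" "x \<otimes>\<^bsub>?A\<^esub> y = x \<oplus>\<^bsub>N\<^esub> y"
    "inv\<^bsub>?A\<^esub> x = \<ominus>\<^bsub>N\<^esub> x" for x y
    by (simp_all add: additive_topgroup_def a_inv_def m_inv_def)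
  obtain L where L: "L \<lhd> ?A" "openin (gtop ?A) L" "L \<subseteq> U"
    using A.open_normal_basis[of U] assms unfolding A_simps by metis
  have sL: "subgroup L ?A" using L(1) by (rule normal_imp_subgroup)
  have LN: "L \<subseteq> carrier N" using subgroup.subset[OF sL] by (simp add: A_simps)
  have Ladd: "x \<oplus>\<^bsub>N\<^esub> y \<in> L" if "x \<in> L" "y \<in> L" for x y
    using subgroup.m_closed[OF sL that] by (simp add: A_simps)
  have Luminus: "\<ominus>\<^bsub>N\<^esub> x \<in> L" if "x \<in> L" for x
    using subgroup.m_inv_closed[OF sL that] by (simp add: A_simps)
  have L0: "\<zero>\<^bsub>N\<^esub> \<in> L" using subgroup.one_closed[OF sL] by (simp add: A_simps)
  define W where "W = {x \<in> carrier N. \<forall>r\<in>zhat_carrier \<C>. r \<odot>\<^bsub>N\<^esub> x \<in> L}"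
  have "openin (mtop N) {x \<in> topspace (mtop N). \<forall>r\<in>topspace (rtop (zhat \<C>)). (\<lambda>z. fst z \<odot>\<^bsub>N\<^esub> snd z) (r, x) \<in> L}"
    by (rule openin_tube[OF profinite_space_compact[OF profinite_zhat]])
      (use L(2) A_simps in \<open>auto intro: continuous_map_smult continuous_map_fst continuous_map_snd\<close>)
  then have "openin (mtop N) W" by (simp add: W_def)
  moreover have "W \<subseteq> L"
  proof
    fix x assume x: "x \<in> W"
    have "\<one>\<^bsub>zhat \<C>\<^esub> \<in> zhat_carrier \<C>" using R.one_closed by (simp only: zhat_simps(1))
    then have "\<one>\<^bsub>zhat \<C>\<^esub> \<odot>\<^bsub>N\<^esub> x \<in> L" using x unfolding W_def by blast
    then show "x \<in> L" using x smult_one[of x] by (simp add: W_def del: zhat_simps(3))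
  qed
  moreover have "open_submodule W"
    unfolding open_submodule_def
  proof (intro conjI ballI)
    show "openin (mtop N) W" by fact
    show "\<zero>\<^bsub>N\<^esub> \<in> W" using L0 smult_r_null by (simp add: W_def)
    fix x assume x: "x \<in> W"
    show "\<ominus>\<^bsub>N\<^esub> x \<in> W" using x Luminus smult_r_minus by (simp add: W_def)
    show "x \<oplus>\<^bsub>N\<^esub> y \<in> W" if "y \<in> W" for y
      using x that Ladd smult_r_distr by (simp add: W_def)
    show "r \<odot>\<^bsub>N\<^esub> x \<in> W" if r: "r \<in> carrier (zhat \<C>)" for r
    proof -
      have xN: "x \<in> carrier N" using x by (simp add: W_def)
      have "s \<odot>\<^bsub>N\<^esub> (r \<odot>\<^bsub>N\<^esub> x) \<in> L" if s: "s \<in> carrier (zhat \<C>)" for s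
      proof -
        have "s \<otimes>\<^bsub>zhat \<C>\<^esub> r \<in> zhat_carrier \<C>" using R.m_closed[OF s r] by (simp del: zhat_simps(5))
        then have "(s \<otimes>\<^bsub>zhat \<C>\<^esub> r) \<odot>\<^bsub>N\<^esub> x \<in> L" using x unfolding W_def by blast
        then show ?thesis using smult_assoc1[OF s r xN] by simp
      qed
      then show ?thesis using smult_closed[OF r xN] by (simp add: W_def)
    qed
  qed
  ultimately show ?thesis using that L(3) by blast
qed

lemma open_submodule_Int: "open_submodule W \<Longrightarrow> open_submodule W' \<Longrightarrow> open_submodule (W \<inter> W')"
  unfolding open_submodule_def by (simp add: openin_Int)

lemma open_submodule_carrier: "open_submodule (carrier N)"
  unfolding open_submodule_def using openin_topspace[of "mtop N"] by (simp add: smult_closed[simplified])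

lemma open_submodule_Inter:
  assumes "finite \<W>" "\<And>W. W \<in> \<W> \<Longrightarrow> open_submodule W"
  shows "\<exists>W. open_submodule W \<and> (\<forall>W'\<in>\<W>. W \<subseteq> W')"
  using assms
proof (induction rule: finite_induct)
  case empty
  then show ?case using open_submodule_carrier by blast
next
  case (insert V \<W>)
  then obtain W where "open_submodule W" "\<forall>W'\<in>\<W>. W \<subseteq> W'" by auto
  then show ?case using open_submodule_Int[of V W] insert.prems by (intro exI[of _ "V \<inter> W"]) auto
qed

text \<open>Membership in \<open>W\<close> is invariant under translation by the open subgroup
  \<open>W\<close>.\<close>

lemma locally_constant_mem_submodule:
  assumes W: "open_submodule W" and h: "continuous_map Y (mtop N) h"
  shows "locally_constant Y (\<lambda>y. h y \<in> W)"
proof -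
  let ?A = "additive_topgroup N"
  interpret A: profinite_topgroup ?A by (rule additive_profinite_topgroup)
  have A_simps: "gtop ?A = mtop N" "carrier ?A = carrier N" "\<one>\<^bsub>?A\<^esub> = \<zero>\<^bsub>N\<^esub>" "x \<otimes>\<^bsub>?A\<^esub> y = x \<oplus>\<^bsub>N\<^esub> y"
    "inv\<^bsub>?A\<^esub> x = \<ominus>\<^bsub>N\<^esub> x" for x y
    by (simp_all add: additive_topgroup_def a_inv_def m_inv_def)
  note WN = open_submodule_subset[OF W]
  have "subgroup W ?A"
    by (rule A.subgroupI) (use W WN in \<open>auto simp: A_simps open_submodule_def\<close>)
  moreover have "g \<oplus>\<^bsub>N\<^esub> u \<in> W \<longleftrightarrow> g \<in> W" if "g \<in> carrier N" "u \<in> W" for g u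
  proof
    assume "g \<oplus>\<^bsub>N\<^esub> u \<in> W"
    then have "g \<oplus>\<^bsub>N\<^esub> u \<oplus>\<^bsub>N\<^esub> \<ominus>\<^bsub>N\<^esub> u \<in> W" using W that by (simp add: open_submodule_def)
    moreover have "u \<in> carrier N" using that WN by blast
    ultimately show "g \<in> W" using that by (simp add: M.a_assoc M.r_neg)
  qed (use W that in \<open>simp add: open_submodule_def\<close>)
  ultimately have "locally_constant (gtop ?A) (\<lambda>x. x \<in> W)"
    using W by (intro A.locally_constant_right_invariant[of W]) (auto simp: A_simps open_submodule_def)
  then show ?thesis using locally_constant_compose[OF _ h] by (simp add: A_simps)
qed

text \<open>Congruence modulo \<open>W\<close>. It stands in for the quotient module, whose elements
  would be sets and live in another type.\<close>

definition near :: "'m set \<Rightarrow> 'm \<Rightarrow> 'm \<Rightarrow> bool" where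
  "near W x y \<longleftrightarrow> x \<in> carrier N \<and> y \<in> carrier N \<and> x \<ominus>\<^bsub>N\<^esub> y \<in> W"

context
  fixes W assumes W: "open_submodule W"
begin

lemma W_props: "\<zero>\<^bsub>N\<^esub> \<in> W" "x \<in> W \<Longrightarrow> y \<in> W \<Longrightarrow> x \<oplus>\<^bsub>N\<^esub> y \<in> W" "x \<in> W \<Longrightarrow> \<ominus>\<^bsub>N\<^esub> x \<in> W"
  "r \<in> zhat_carrier \<C> \<Longrightarrow> x \<in> W \<Longrightarrow> r \<odot>\<^bsub>N\<^esub> x \<in> W"
  using W by (auto simp: open_submodule_def)

lemma near_refl: "x \<in> carrier N \<Longrightarrow> near W x x"
  using W_props by (simp add: near_def M.minus_eq M.r_neg)

lemma near_sym: "near W x y \<Longrightarrow> near W y x"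
  using W_props(3)[of "x \<ominus>\<^bsub>N\<^esub> y"]
  by (auto simp: near_def M.minus_eq M.minus_add M.a_comm)

lemma near_trans: "near W x y \<Longrightarrow> near W y z \<Longrightarrow> near W x z"
  using W_props(2)[of "x \<ominus>\<^bsub>N\<^esub> y" "y \<ominus>\<^bsub>N\<^esub> z"]
  by (auto simp: near_def M.minus_eq M.a_assoc M.r_neg1)

lemma near_add:
  assumes "near W x x'" "near W y y'"
  shows "near W (x \<oplus>\<^bsub>N\<^esub> y) (x' \<oplus>\<^bsub>N\<^esub> y')"
proof -
  have c: "x \<in> carrier N" "x' \<in> carrier N" "y \<in> carrier N" "y' \<in> carrier N"
    using assms by (auto simp: near_def)
  have "(x \<ominus>\<^bsub>N\<^esub> x') \<oplus>\<^bsub>N\<^esub> (y \<ominus>\<^bsub>N\<^esub> y') = (x \<oplus>\<^bsub>N\<^esub> y) \<ominus>\<^bsub>N\<^esub> (x' \<oplus>\<^bsub>N\<^esub> y')"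
    using c by (simp add: M.minus_eq M.minus_add M.a_ac)
  then show ?thesis using assms c W_props(2) by (metis M.a_closed near_def)
qed

lemma near_smult: "r \<in> zhat_carrier \<C> \<Longrightarrow> near W x y \<Longrightarrow> near W (r \<odot>\<^bsub>N\<^esub> x) (r \<odot>\<^bsub>N\<^esub> y)"
  using W_props(4)[of r "x \<ominus>\<^bsub>N\<^esub> y"] smult_r_minus[of r y] smult_r_distr[of r x "\<ominus>\<^bsub>N\<^esub> y"] smult_closed
  by (auto simp: near_def M.minus_eq)

end

lemma near_mono: "near W x y \<Longrightarrow> W \<subseteq> W' \<Longrightarrow> near W' x y"
  by (auto simp: near_def)

text \<open>The open submodules form a neighbourhood basis at zero in a Hausdorff space, so their
  intersection is zero.\<close>

lemma near_eqI:
  assumes "\<And>W. open_submodule W \<Longrightarrow> near W x y"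
  shows "x = y"
proof (rule ccontr)
  assume "x \<noteq> y"
  have c: "x \<in> carrier N" "y \<in> carrier N" using assms[OF open_submodule_carrier] by (auto simp: near_def)
  have "x \<ominus>\<^bsub>N\<^esub> y \<noteq> \<zero>\<^bsub>N\<^esub>"
  proof
    assume "x \<ominus>\<^bsub>N\<^esub> y = \<zero>\<^bsub>N\<^esub>"
    moreover have "x = (x \<ominus>\<^bsub>N\<^esub> y) \<oplus>\<^bsub>N\<^esub> y" using c by (simp add: M.minus_eq M.a_assoc M.l_neg)
    ultimately show False using c \<open>x \<noteq> y\<close> by simp
  qed
  then obtain f :: "'m \<Rightarrow> bool" where f: "locally_constant (mtop N) f" "f \<zero>\<^bsub>N\<^esub>" "\<not> f (x \<ominus>\<^bsub>N\<^esub> y)"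
    using profinite_space_separation[OF profinite_mtop, of "\<zero>\<^bsub>N\<^esub>" "x \<ominus>\<^bsub>N\<^esub> y"] c by auto
  obtain W where "open_submodule W" "W \<subseteq> {z \<in> topspace (mtop N). f z}"
    using open_submodule_basis[OF locally_constant_openin[OF f(1), where P = "\<lambda>b. b"]] f(2) by auto
  then show False using assms f(3) by (auto simp: near_def)
qed

lemma locally_constant_near:
  assumes "open_submodule W" "continuous_map Y (mtop N) h" "continuous_map Y (mtop N) k"
  shows "locally_constant Y (\<lambda>y. near W (h y) (k y))"
proof -
  have "continuous_map Y (mtop N) (\<lambda>y. h y \<oplus>\<^bsub>N\<^esub> (\<ominus>\<^bsub>N\<^esub> k y))"
    by (intro continuous_map_add continuous_map_uminus assms)
  then have "locally_constant Y (\<lambda>y. h y \<oplus>\<^bsub>N\<^esub> (\<ominus>\<^bsub>N\<^esub> k y) \<in> W)"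
    by (rule locally_constant_mem_submodule[OF assms(1)])
  moreover have "h y \<in> carrier N" "k y \<in> carrier N" if "y \<in> topspace Y" for y
    using that continuous_map_image_subset_topspace[OF assms(2)] continuous_map_image_subset_topspace[OF assms(3)] by auto
  ultimately show ?thesis
    by (rule_tac locally_constant_cong) (auto simp: near_def M.minus_eq)
qed

text \<open>Translates of open submodules form a basis, so it is enough that the map is locally
  constant modulo each of them.\<close>

lemma continuous_mapI_near:
  assumes "\<And>y. y \<in> topspace Y \<Longrightarrow> h y \<in> carrier N"
    and "\<And>W y. open_submodule W \<Longrightarrow> y \<in> topspace Y \<Longrightarrow>
      \<exists>T. openin Y T \<and> y \<in> T \<and> (\<forall>z\<in>T. near W (h z) (h y))"
  shows "continuous_map Y (mtop N) h"
  unfolding continuous_map_def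
proof (intro conjI allI impI)
  show "h \<in> topspace Y \<rightarrow> topspace (mtop N)" using assms(1) by simp
  fix U assume U: "openin (mtop N) U"
  show "openin Y {y \<in> topspace Y. h y \<in> U}"
  proof (subst openin_subopen, intro ballI)
    fix y assume y: "y \<in> {y \<in> topspace Y. h y \<in> U}"
    then have hy: "h y \<in> carrier N" using assms(1) by simp
    have "continuous_map (mtop N) (mtop N) (\<lambda>x. x \<oplus>\<^bsub>N\<^esub> h y)"
      using hy by (intro continuous_map_add) (simp_all add: continuous_map_id[unfolded id_def])
    then have "openin (mtop N) {x \<in> topspace (mtop N). x \<oplus>\<^bsub>N\<^esub> h y \<in> U}"
      using U by (rule openin_continuous_map_preimage)
    then obtain W where W: "open_submodule W" "W \<subseteq> {x \<in> topspace (mtop N). x \<oplus>\<^bsub>N\<^esub> h y \<in> U}"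
      using open_submodule_basis[of "{x \<in> topspace (mtop N). x \<oplus>\<^bsub>N\<^esub> h y \<in> U}"] y hy by auto
    obtain T where T: "openin Y T" "y \<in> T" "\<forall>z\<in>T. near W (h z) (h y)"
      using assms(2)[OF W(1), of y] y by auto
    have "h z \<in> U" if "z \<in> T" for z
    proof -
      have n: "near W (h z) (h y)" using T(3) that by blast
      then have "h z \<ominus>\<^bsub>N\<^esub> h y \<oplus>\<^bsub>N\<^esub> h y \<in> U" using W(2) by (auto simp: near_def)
      then show ?thesis using n by (simp add: near_def M.minus_eq M.a_assoc M.l_neg)
    qed
    then show "\<exists>T. openin Y T \<and> y \<in> T \<and> T \<subseteq> {y \<in> topspace Y. h y \<in> U}"
      using T openin_subset by blast
  qed
qed

end

section \<open>Density of the point masses\<close>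

lemma measure_add:
  assumes "\<mu> \<in> zmeasures \<C> X" "clopenin X U" "clopenin X V" "U \<inter> V = {}"
  shows "\<mu> (U \<union> V) = \<mu> U \<oplus>\<^bsub>zhat \<C>\<^esub> \<mu> V"
  by (rule zhat_eqI[of _ \<C>])
    (use measuresD(1)[OF assms(1)] measuresD(3)[OF assms(1) _ assms(2-4)] zhat_closed(3) in auto)

text \<open>On a finite family of clopen sets, a measure \<mu> agrees with a combination of point
  masses, one in each nonempty atom of the family, weighted by the \<mu>-measure of the atom. A
  basic open set of the product topology restricts finitely many values, so these combinations are
  dense.\<close>

lemma dirac_dense:
  assumes X: "profinite_space X" and L: "closedin (mtop (measure_module \<C> X)) L"
    and zero: "\<zero>\<^bsub>measure_module \<C> X\<^esub> \<in> L"
    and add: "\<And>\<mu> \<nu>. \<mu> \<in> L \<Longrightarrow> \<nu> \<in> L \<Longrightarrow> \<mu> \<oplus>\<^bsub>measure_module \<C> X\<^esub> \<nu> \<in> L"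
    and smult: "\<And>r \<mu>. r \<in> zhat_carrier \<C> \<Longrightarrow> \<mu> \<in> L \<Longrightarrow> r \<odot>\<^bsub>measure_module \<C> X\<^esub> \<mu> \<in> L"
    and dirac: "\<And>x. x \<in> topspace X \<Longrightarrow> dirac \<C> X x \<in> L"
  shows "zmeasures \<C> X \<subseteq> L"
proof
  fix \<mu> assume \<mu>: "\<mu> \<in> zmeasures \<C> X"
  let ?M = "measure_module \<C> X"
  interpret R: cring "zhat \<C>" by (rule zhat_cring)
  have LM: "L \<subseteq> zmeasures \<C> X" using closedin_subset[OF L] by simp
  have approx: "\<exists>\<rho>\<in>L. \<forall>U\<in>F. \<rho> U = \<mu> U" if F: "finite F" for F
  proof -
    \<comment> \<open>\<open>p x\<close> names the atom of \<open>x\<close>: it collects the clopen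
      members of \<open>F\<close> that contain \<open>x\<close>.\<close>
    define p where "p = (\<lambda>x. {U \<in> F. clopenin X U \<and> x \<in> U})"
    have lcp: "locally_constant X p"
    proof -
      have "locally_constant X (\<lambda>x. {U \<in> F'. clopenin X U \<and> x \<in> U})" if "finite F'" for F'
        using that
      proof (induction F' rule: finite_induct)
        case (insert V F')
        have "locally_constant X (\<lambda>x. clopenin X V \<and> x \<in> V)"
        proof (cases "clopenin X V")
          case False
          then have "(\<lambda>x. clopenin X V \<and> x \<in> V) = (\<lambda>_. False)" by auto
          then show ?thesis by (simp only: locally_constant_const)
        qed (use locally_constant_mem[of X V] in simp)
        from locally_constant_comp2[OF this insert.IH, where h = "\<lambda>b S. if b then insert V S else S"]
        show ?case by (rule locally_constant_cong) auto
      qed simp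
      then show ?thesis using F by (simp add: p_def)
    qed
    define E where "E = (\<lambda>B. {x \<in> topspace X. p x \<in> B})"
    have clE: "clopenin X (E B)" for B
      unfolding E_def using locally_constant_openin[OF lcp, where P = "\<lambda>b. b \<in> B"] locally_constant_closedin[OF lcp, where P = "\<lambda>b. b \<in> B"] by simp
    \<comment> \<open>These are the clopen unions of atoms. The induction that follows treats one
      atom at a time; on these sets the approximation equals \<open>\<mu>\<close> restricted to the
      atoms treated so far.\<close>
    define sat where "sat = (\<lambda>U. clopenin X U \<and>
      (\<forall>x\<in>topspace X. \<forall>y\<in>topspace X. p x = p y \<longrightarrow> x \<in> U \<longrightarrow> y \<in> U))"
    have "\<exists>\<rho>\<in>L. \<forall>U. sat U \<longrightarrow> \<rho> U = \<mu> (U \<inter> E B)" if "finite B" for B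
      using that
    proof (induction B rule: finite_induct)
      case empty
      have "\<mu> {} = \<zero>\<^bsub>zhat \<C>\<^esub>"
        by (rule zhat_eqI[of _ \<C>]) (use measuresD(1)[OF \<mu>] measure_empty[OF \<mu>] zhat_closed(1) in auto)
      then show ?case using zero by (intro bexI[of _ "\<zero>\<^bsub>?M\<^esub>"]) (auto simp: E_def)
    next
      case (insert b B)
      then obtain \<nu> where \<nu>: "\<nu> \<in> L" "\<And>U. sat U \<Longrightarrow> \<nu> U = \<mu> (U \<inter> E B)"
        by blast
      have Eb: "E (insert b B) = E B \<union> E {b}" "E B \<inter> E {b} = {}"
        using insert.hyps by (auto simp: E_def)
      show ?case
      proof (cases "E {b} = {}")
        case True
        then show ?thesis using \<nu> Eb by (intro bexI[of _ \<nu>]) auto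
      next
        case False
        then obtain x where x: "x \<in> topspace X" "p x = b" by (auto simp: E_def)
        define \<rho> where "\<rho> = \<nu> \<oplus>\<^bsub>?M\<^esub> (\<mu> (E {b}) \<odot>\<^bsub>?M\<^esub> dirac \<C> X x)"
        have "\<rho> \<in> L" unfolding \<rho>_def
          by (intro add smult dirac \<nu> x measuresD(1)[OF \<mu>])
        moreover have "\<rho> U = \<mu> (U \<inter> E (insert b B))"
          if sU: "sat U" for U
        proof -
          have U: "clopenin X U" "\<And>x y. x \<in> topspace X \<Longrightarrow> y \<in> topspace X \<Longrightarrow> p x = p y \<Longrightarrow> x \<in> U \<Longrightarrow> y \<in> U"
            using sU unfolding sat_def by blast+
          have \<rho>U: "\<rho> U = \<mu> (U \<inter> E B) \<oplus>\<^bsub>zhat \<C>\<^esub> (\<mu> (E {b}) \<otimes>\<^bsub>zhat \<C>\<^esub> dirac \<C> X x U)"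
            using \<nu>(2)[OF sU] by (simp add: \<rho>_def del: zhat_simps)
          have c: "\<mu> V \<in> carrier (zhat \<C>)" for V using measuresD(1)[OF \<mu>] by simp
          show ?thesis
          proof (cases "x \<in> U")
            case True
            have "E {b} \<subseteq> U" using U(2)[OF x(1)] True x by (auto simp: E_def)
            then have "U \<inter> E (insert b B) = (U \<inter> E B) \<union> E {b}" using Eb by blast
            moreover have "\<mu> ((U \<inter> E B) \<union> E {b}) = \<mu> (U \<inter> E B) \<oplus>\<^bsub>zhat \<C>\<^esub> \<mu> (E {b})"
              by (rule measure_add[OF \<mu>]) (use U(1) clE Eb in auto)
            moreover have "dirac \<C> X x U = \<one>\<^bsub>zhat \<C>\<^esub>" using True U(1) by (simp add: dirac_def)
            ultimately show ?thesis unfolding \<rho>U using c R.r_one by metis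
          next
            case False
            have "E {b} \<inter> U = {}" using U(2)[of _ x] False x by (auto simp: E_def)
            then have "U \<inter> E (insert b B) = U \<inter> E B" using Eb by blast
            moreover have "dirac \<C> X x U = \<zero>\<^bsub>zhat \<C>\<^esub>" using False by (simp add: dirac_def)
            ultimately show ?thesis unfolding \<rho>U using c R.r_null R.r_zero by metis
          qed
        qed
        ultimately show ?thesis by blast
      qed
    qed
    moreover have "finite (p ` topspace X)"
      using locally_constant_finite_image[OF profinite_space_compact[OF X] lcp] .
    ultimately obtain \<rho> where \<rho>: "\<rho> \<in> L" "\<And>U. sat U \<Longrightarrow> \<rho> U = \<mu> (U \<inter> E (p ` topspace X))"
      by blast
    have "\<rho> U = \<mu> U" if U: "U \<in> F" for U
    proof (cases "clopenin X U")
      case True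
      have "U \<inter> E (p ` topspace X) = U" using openin_subset[of X U] True by (auto simp: E_def)
      moreover have "\<rho> U = \<mu> (U \<inter> E (p ` topspace X))"
        by (rule \<rho>(2)) (use U True in \<open>auto simp: p_def sat_def\<close>)
      ultimately show ?thesis by simp
    next
      case False
      have \<rho>M: "\<rho> \<in> zmeasures \<C> X" using \<rho>(1) LM by blast
      show ?thesis
        by (rule zhat_eqI[of _ \<C>]) (use measuresD(1,2)[OF \<mu>] measuresD(1,2)[OF \<rho>M] False in auto)
    qed
    then show ?thesis using \<rho>(1) by blast
  qed
  show "\<mu> \<in> L"
  proof (rule ccontr)
    assume "\<mu> \<notin> L"
    have "openin (mtop ?M) (zmeasures \<C> X - L)" using L by (metis closedin_def topspace_measure_module)
    then obtain S where S: "openin (product_topology (\<lambda>_. rtop (zhat \<C>)) UNIV) S" "zmeasures \<C> X - L = S \<inter> zmeasures \<C> X"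
      unfolding mtop_measure_module openin_subtopology by blast
    then have "\<mu> \<in> S" using \<open>\<mu> \<notin> L\<close> \<mu> by blast
    then obtain V where V: "finite {U. V U \<noteq> zhat_carrier \<C>}" "\<mu> \<in> Pi\<^sub>E UNIV V" "Pi\<^sub>E UNIV V \<subseteq> S"
      using S(1) unfolding openin_product_topology_alt by fastforce
    obtain \<rho> where \<rho>: "\<rho> \<in> L" "\<And>U. V U \<noteq> zhat_carrier \<C> \<Longrightarrow> \<rho> U = \<mu> U"
      using approx[OF V(1)] by auto
    have "\<rho> U \<in> V U" for U
    proof (cases "V U = zhat_carrier \<C>")
      case True
      then show ?thesis using measuresD(1) \<rho>(1) LM by blast
    next
      case False
      then show ?thesis using V(2) \<rho>(2) by (auto simp: PiE_iff)
    qed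
    then have "\<rho> \<in> S" using V(3) by (auto simp: PiE_UNIV_domain)
    then show False using \<rho>(1) LM S(2) by blast
  qed
qed

section \<open>Homomorphisms out of the module of measures\<close>

context profinite_test_module
begin

abbreviation hom_measures :: "'a topology \<Rightarrow> ('a free_elem \<Rightarrow> 'm) set" where
  "hom_measures X \<equiv> cont_module_hom (zhat \<C>) (measure_module \<C> X) N"

lemma hom_measures_iff:
  "h \<in> hom_measures X \<longleftrightarrow> continuous_map (mtop (measure_module \<C> X)) (mtop N) h \<and>
     (\<forall>\<mu>\<in>zmeasures \<C> X. \<forall>\<nu>\<in>zmeasures \<C> X. h (\<mu> \<oplus>\<^bsub>measure_module \<C> X\<^esub> \<nu>) = h \<mu> \<oplus>\<^bsub>N\<^esub> h \<nu>) \<and>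
     (\<forall>r\<in>zhat_carrier \<C>. \<forall>\<mu>\<in>zmeasures \<C> X. h (r \<odot>\<^bsub>measure_module \<C> X\<^esub> \<mu>) = r \<odot>\<^bsub>N\<^esub> h \<mu>)"
proof -
  have "h \<in> zmeasures \<C> X \<rightarrow> carrier N" if "continuous_map (mtop (measure_module \<C> X)) (mtop N) h"
    using that continuous_map_image_subset_topspace[OF that] by auto
  then show ?thesis
    unfolding cont_module_hom_def hom_def by (auto simp del: measure_module_simps(3,4) zhat_simps(4,5))
qed

lemma hom_measures_zero:
  assumes "h \<in> hom_measures X"
  shows "h \<zero>\<^bsub>measure_module \<C> X\<^esub> = \<zero>\<^bsub>N\<^esub>"
proof -
  interpret MM: Module.module "zhat \<C>" "measure_module \<C> X" by (rule measure_module_module)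
  have "h (\<zero>\<^bsub>zhat \<C>\<^esub> \<odot>\<^bsub>measure_module \<C> X\<^esub> \<zero>\<^bsub>measure_module \<C> X\<^esub>) =
      \<zero>\<^bsub>zhat \<C>\<^esub> \<odot>\<^bsub>N\<^esub> h \<zero>\<^bsub>measure_module \<C> X\<^esub>"
    using assms R.zero_closed MM.M.zero_closed unfolding hom_measures_iff
    by (metis measure_module_simps(1) zhat_simps(1))
  moreover have "h \<zero>\<^bsub>measure_module \<C> X\<^esub> \<in> carrier N"
    using assms MM.M.zero_closed continuous_map_image_subset_topspace
    unfolding hom_measures_iff by (metis image_subset_iff measure_module_simps(1) topspace_N topspace_measure_module)
  ultimately show ?thesis
    using MM.smult_l_null[OF MM.M.zero_closed] smult_l_null by metis
qed

text \<open>The measures at which two homomorphisms are congruent modulo \<open>W\<close> form a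
  closed submodule. It contains the point masses, so \<open>dirac_dense\<close> applies.\<close>

lemma hom_measures_near:
  assumes X: "profinite_space X" and W: "open_submodule W"
    and h: "h \<in> hom_measures X" and k: "k \<in> hom_measures X"
    and eq: "\<And>x. x \<in> topspace X \<Longrightarrow> near W (h (dirac \<C> X x)) (k (dirac \<C> X x))"
    and \<mu>: "\<mu> \<in> zmeasures \<C> X"
  shows "near W (h \<mu>) (k \<mu>)"
proof -
  let ?M = "measure_module \<C> X"
  interpret MM: Module.module "zhat \<C>" ?M by (rule measure_module_module)
  let ?L = "{\<mu> \<in> topspace (mtop ?M). near W (h \<mu>) (k \<mu>)}"
  have hc: "continuous_map (mtop ?M) (mtop N) h" and kc: "continuous_map (mtop ?M) (mtop N) k"
    using h k by (auto simp: hom_measures_iff)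
  have hadd: "h (\<mu> \<oplus>\<^bsub>?M\<^esub> \<nu>) = h \<mu> \<oplus>\<^bsub>N\<^esub> h \<nu>" "k (\<mu> \<oplus>\<^bsub>?M\<^esub> \<nu>) = k \<mu> \<oplus>\<^bsub>N\<^esub> k \<nu>"
    if "\<mu> \<in> zmeasures \<C> X" "\<nu> \<in> zmeasures \<C> X" for \<mu> \<nu>
    using h k that unfolding hom_measures_iff by blast+
  have hsm: "h (r \<odot>\<^bsub>?M\<^esub> \<mu>) = r \<odot>\<^bsub>N\<^esub> h \<mu>" "k (r \<odot>\<^bsub>?M\<^esub> \<mu>) = r \<odot>\<^bsub>N\<^esub> k \<mu>"
    if "r \<in> zhat_carrier \<C>" "\<mu> \<in> zmeasures \<C> X" for r \<mu>
    using h k that unfolding hom_measures_iff by blast+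
  have "zmeasures \<C> X \<subseteq> ?L"
  proof (rule dirac_dense[OF X])
    show "closedin (mtop ?M) ?L"
      using locally_constant_closedin[OF locally_constant_near[OF W hc kc], where P = "\<lambda>b. b"] by simp
    show "\<zero>\<^bsub>?M\<^esub> \<in> ?L"
      using hom_measures_zero[OF h] hom_measures_zero[OF k] near_refl[OF W] MM.M.zero_closed by simp
    show "\<mu> \<oplus>\<^bsub>?M\<^esub> \<nu> \<in> ?L" if "\<mu> \<in> ?L" "\<nu> \<in> ?L" for \<mu> \<nu>
      using that hadd near_add[OF W] MM.M.a_closed[of \<mu> \<nu>] by (simp del: measure_module_simps(3))
    show "r \<odot>\<^bsub>?M\<^esub> \<mu> \<in> ?L" if "r \<in> zhat_carrier \<C>" "\<mu> \<in> ?L" for r \<mu>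
      using that hsm near_smult[OF W] MM.smult_closed[of r \<mu>] by (simp del: measure_module_simps(4))
    show "dirac \<C> X x \<in> ?L" if "x \<in> topspace X" for x
      using eq[OF that] measures_closed(4) by simp
  qed
  then show ?thesis using \<mu> by blast
qed

lemma hom_measures_unique:
  assumes X: "profinite_space X" and h: "h \<in> hom_measures X" and k: "k \<in> hom_measures X"
    and eq: "\<And>x. x \<in> topspace X \<Longrightarrow> h (dirac \<C> X x) = k (dirac \<C> X x)"
    and \<mu>: "\<mu> \<in> zmeasures \<C> X"
  shows "h \<mu> = k \<mu>"
proof (rule near_eqI)
  fix W assume W: "open_submodule W"
  have "h \<nu> \<in> carrier N" if "\<nu> \<in> zmeasures \<C> X" for \<nu>
    using h that continuous_map_image_subset_topspace unfolding hom_measures_iff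
    by (metis image_subset_iff topspace_N topspace_measure_module)
  then show "near W (h \<mu>) (k \<mu>)"
    using hom_measures_near[OF X W h k _ \<mu>] near_refl[OF W] eq measures_closed(4) by metis
qed

text \<open>Modulo \<open>W\<close> the map \<open>f\<close> takes finitely many values. Each value
  contributes a term \<open>\<mu> E \<odot> f y\<close>, where \<open>E\<close> is the clopen set on
  which it is taken and \<open>y\<close> a sample point of \<open>E\<close>; the sum is linear,
  continuous, and correct modulo \<open>W\<close> at point masses.\<close>

lemma hom_measures_approx:
  assumes X: "profinite_space X" and f: "continuous_map X (mtop N) f" and W: "open_submodule W"
  obtains \<Phi> where "\<Phi> \<in> hom_measures X" "\<And>x. x \<in> topspace X \<Longrightarrow> near W (\<Phi> (dirac \<C> X x)) (f x)"
proof -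
  let ?M = "measure_module \<C> X"
  interpret MM: Module.module "zhat \<C>" ?M by (rule measure_module_module)
  have fN: "f x \<in> carrier N" if "x \<in> topspace X" for x
    using continuous_map_image_subset_topspace[OF f] that by auto
  define p where "p = (\<lambda>x. {y \<in> carrier N. near W (f x) y})"
  have p_eq: "p x = p x' \<longleftrightarrow> near W (f x) (f x')" if "x \<in> topspace X" "x' \<in> topspace X" for x x'
  proof
    assume "p x = p x'"
    then have "f x' \<in> p x" using fN that near_refl[OF W] by (simp add: p_def)
    then show "near W (f x) (f x')" by (simp add: p_def)
  next
    assume "near W (f x) (f x')"
    then show "p x = p x'" unfolding p_def using near_trans[OF W] near_sym[OF W] by blast
  qed
  have lcp: "locally_constant X p"
  proof (rule locally_constantI)
    fix z
    show "openin X {x \<in> topspace X. p x = z}"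
    proof (cases "\<exists>x\<in>topspace X. p x = z")
      case True
      then obtain x where x: "x \<in> topspace X" "p x = z" by blast
      have "continuous_map X (mtop N) (\<lambda>_. f x)" using fN[OF x(1)] by simp
      from locally_constant_openin[OF locally_constant_near[OF W f this], where P = "\<lambda>b. b"]
      have "openin X {y \<in> topspace X. near W (f y) (f x)}" .
      moreover have "{y \<in> topspace X. p y = z} = {y \<in> topspace X. near W (f y) (f x)}"
        using p_eq[OF _ x(1)] x(2) by auto
      ultimately show ?thesis by simp
    next
      case False
      then have "{x \<in> topspace X. p x = z} = {}" by blast
      then show ?thesis by (metis openin_empty)
    qed
  qed
  \<comment> \<open>The second clause serves the induction: at points of the next class, the sum
    formed so far contributes zero.\<close>
  have ex: "\<exists>\<Phi>\<in>hom_measures X. \<forall>x\<in>topspace X.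
      (p x \<in> B \<longrightarrow> near W (\<Phi> (dirac \<C> X x)) (f x)) \<and> (p x \<notin> B \<longrightarrow> \<Phi> (dirac \<C> X x) = \<zero>\<^bsub>N\<^esub>)"
    if "finite B" for B
    using that
  proof (induction B rule: finite_induct)
    case empty
    have "(\<lambda>_. \<zero>\<^bsub>N\<^esub>) \<in> hom_measures X"
      unfolding hom_measures_iff using smult_r_null by simp
    then show ?case by (intro bexI[of _ "\<lambda>_. \<zero>\<^bsub>N\<^esub>"]) simp
  next
    case (insert b B)
    then obtain \<Phi> where \<Phi>: "\<Phi> \<in> hom_measures X"
      "\<And>x. x \<in> topspace X \<Longrightarrow> p x \<in> B \<Longrightarrow> near W (\<Phi> (dirac \<C> X x)) (f x)"
      "\<And>x. x \<in> topspace X \<Longrightarrow> p x \<notin> B \<Longrightarrow> \<Phi> (dirac \<C> X x) = \<zero>\<^bsub>N\<^esub>"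
      by blast
    show ?case
    proof (cases "\<exists>x\<in>topspace X. p x = b")
      case False
      then show ?thesis using \<Phi> by (intro bexI[of _ \<Phi>]) auto
    next
      case True
      then obtain y where y: "y \<in> topspace X" "p y = b" by blast
      define E where "E = {x \<in> topspace X. p x = b}"
      have clE: "clopenin X E"
        unfolding E_def using locally_constant_openin[OF lcp, where P = "\<lambda>z. z = b"] locally_constant_closedin[OF lcp, where P = "\<lambda>z. z = b"] by simp
      define \<Psi> where "\<Psi> = (\<lambda>\<mu>. \<Phi> \<mu> \<oplus>\<^bsub>N\<^esub> (\<mu> E \<odot>\<^bsub>N\<^esub> f y))"
      have \<Phi>c: "continuous_map (mtop ?M) (mtop N) \<Phi>" using \<Phi>(1) by (simp add: hom_measures_iff)
      have \<Phi>N: "\<Phi> \<mu> \<in> carrier N" if "\<mu> \<in> zmeasures \<C> X" for \<mu>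
        using continuous_map_image_subset_topspace[OF \<Phi>c] that by auto
      note fy = fN[OF y(1)]
      have sm: "\<mu> E \<odot>\<^bsub>N\<^esub> f y \<in> carrier N" if "\<mu> \<in> zmeasures \<C> X" for \<mu>
        using smult_closed[of "\<mu> E"] measuresD(1)[OF that] fy by simp
      have "\<Psi> \<in> hom_measures X"
        unfolding hom_measures_iff
      proof (intro conjI ballI)
        have "continuous_map (mtop ?M) (rtop (zhat \<C>)) (\<lambda>\<mu>. \<mu> E)"
          unfolding continuous_into_zhat using measuresD(1) locally_constant_measure by auto
        then show "continuous_map (mtop ?M) (mtop N) \<Psi>"
          unfolding \<Psi>_def using \<Phi>c fy by (intro continuous_map_add continuous_map_smult) auto
        fix \<mu> assume \<mu>: "\<mu> \<in> zmeasures \<C> X"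
        have \<mu>E: "\<mu> E \<in> carrier (zhat \<C>)" using measuresD(1)[OF \<mu>] by simp
        show "\<Psi> (\<mu> \<oplus>\<^bsub>?M\<^esub> \<nu>) = \<Psi> \<mu> \<oplus>\<^bsub>N\<^esub> \<Psi> \<nu>" if \<nu>: "\<nu> \<in> zmeasures \<C> X" for \<nu>
        proof -
          have \<nu>E: "\<nu> E \<in> carrier (zhat \<C>)" using measuresD(1)[OF \<nu>] by simp
          have "\<Phi> (\<mu> \<oplus>\<^bsub>?M\<^esub> \<nu>) = \<Phi> \<mu> \<oplus>\<^bsub>N\<^esub> \<Phi> \<nu>" using \<Phi>(1) \<mu> \<nu> unfolding hom_measures_iff by blast
          moreover have "(\<mu> \<oplus>\<^bsub>?M\<^esub> \<nu>) E \<odot>\<^bsub>N\<^esub> f y = \<mu> E \<odot>\<^bsub>N\<^esub> f y \<oplus>\<^bsub>N\<^esub> \<nu> E \<odot>\<^bsub>N\<^esub> f y"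
            using smult_l_distr[OF \<mu>E \<nu>E fy] by simp
          ultimately show ?thesis
            unfolding \<Psi>_def using \<Phi>N[OF \<mu>] \<Phi>N[OF \<nu>] sm[OF \<mu>] sm[OF \<nu>]
            by (simp add: M.a_ac del: measure_module_simps)
        qed
        show "\<Psi> (r \<odot>\<^bsub>?M\<^esub> \<mu>) = r \<odot>\<^bsub>N\<^esub> \<Psi> \<mu>" if r: "r \<in> zhat_carrier \<C>" for r
        proof -
          have rc: "r \<in> carrier (zhat \<C>)" using r by simp
          have "\<Phi> (r \<odot>\<^bsub>?M\<^esub> \<mu>) = r \<odot>\<^bsub>N\<^esub> \<Phi> \<mu>" using \<Phi>(1) \<mu> r unfolding hom_measures_iff by blast
          moreover have "(r \<odot>\<^bsub>?M\<^esub> \<mu>) E \<odot>\<^bsub>N\<^esub> f y = r \<odot>\<^bsub>N\<^esub> (\<mu> E \<odot>\<^bsub>N\<^esub> f y)"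
            using smult_assoc1[OF rc \<mu>E fy] by simp
          ultimately show ?thesis
            unfolding \<Psi>_def using smult_r_distr[OF rc \<Phi>N[OF \<mu>] sm[OF \<mu>]] by simp
        qed
      qed
      moreover have "near W (\<Psi> (dirac \<C> X x)) (f x)" if x: "x \<in> topspace X" "p x \<in> insert b B" for x
      proof (cases "p x = b")
        case True
        have "dirac \<C> X x E = \<one>\<^bsub>zhat \<C>\<^esub>" using clE x True by (simp add: dirac_def E_def)
        then have "\<Psi> (dirac \<C> X x) = \<zero>\<^bsub>N\<^esub> \<oplus>\<^bsub>N\<^esub> \<one>\<^bsub>zhat \<C>\<^esub> \<odot>\<^bsub>N\<^esub> f y"
          unfolding \<Psi>_def using \<Phi>(3)[OF x(1)] True insert.hyps by simp
        also have "\<dots> = f y" using smult_one[OF fy] fy by (simp del: zhat_simps)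
        finally show ?thesis using p_eq[OF y(1) x(1)] True y(2) by simp
      next
        case False
        have "dirac \<C> X x E = \<zero>\<^bsub>zhat \<C>\<^esub>" using False by (simp add: dirac_def E_def)
        then have "\<Psi> (dirac \<C> X x) = \<Phi> (dirac \<C> X x) \<oplus>\<^bsub>N\<^esub> \<zero>\<^bsub>zhat \<C>\<^esub> \<odot>\<^bsub>N\<^esub> f y"
          unfolding \<Psi>_def by simp
        also have "\<dots> = \<Phi> (dirac \<C> X x)"
          using smult_l_null[OF fy] \<Phi>N[OF measures_closed(4)] by (simp del: zhat_simps)
        finally show ?thesis using \<Phi>(2)[OF x(1)] x(2) False by simp
      qed
      moreover have "\<Psi> (dirac \<C> X x) = \<zero>\<^bsub>N\<^esub>" if x: "x \<in> topspace X" "p x \<notin> insert b B" for x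
      proof -
        have "dirac \<C> X x E = \<zero>\<^bsub>zhat \<C>\<^esub>" using x by (simp add: dirac_def E_def)
        then have "\<Psi> (dirac \<C> X x) = \<zero>\<^bsub>N\<^esub> \<oplus>\<^bsub>N\<^esub> \<zero>\<^bsub>zhat \<C>\<^esub> \<odot>\<^bsub>N\<^esub> f y"
          unfolding \<Psi>_def using \<Phi>(3)[OF x(1)] x(2) by simp
        then show ?thesis using smult_l_null[OF fy] by (simp del: zhat_simps)
      qed
      ultimately show ?thesis by blast
    qed
  qed
  have "finite (p ` topspace X)"
    using locally_constant_finite_image[OF profinite_space_compact[OF X] lcp] .
  from ex[OF this] obtain \<Phi> where "\<Phi> \<in> hom_measures X"
    "\<forall>x\<in>topspace X. p x \<in> p ` topspace X \<longrightarrow> near W (\<Phi> (dirac \<C> X x)) (f x)"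
    by blast
  then show ?thesis using that[of \<Phi>] by simp
qed

text \<open>The approximations \<open>\<Phi> W\<close> are compatible because point masses are
  dense. So for every measure the cosets of \<open>\<Phi> W \<mu>\<close> modulo \<open>W\<close>
  have the finite intersection property, and compactness provides a common element. It is unique
  because open submodules separate points, and uniqueness makes the limit linear.\<close>

lemma hom_measures_exists:
  assumes X: "profinite_space X" and f: "continuous_map X (mtop N) f"
  obtains h where "h \<in> hom_measures X" "h \<in> extensional (zmeasures \<C> X)"
    "\<And>x. x \<in> topspace X \<Longrightarrow> h (dirac \<C> X x) = f x"
proof -
  let ?M = "measure_module \<C> X"
  interpret MM: Module.module "zhat \<C>" ?M by (rule measure_module_module)
  have "\<exists>\<Phi>. open_submodule W \<longrightarrow> \<Phi> \<in> hom_measures X \<and> (\<forall>x\<in>topspace X. near W (\<Phi> (dirac \<C> X x)) (f x))" for W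
    using hom_measures_approx[OF X f] by metis
  then obtain \<Phi> where \<Phi>: "\<And>W. open_submodule W \<Longrightarrow> \<Phi> W \<in> hom_measures X"
    "\<And>W x. open_submodule W \<Longrightarrow> x \<in> topspace X \<Longrightarrow> near W (\<Phi> W (dirac \<C> X x)) (f x)"
    by metis
  have \<Phi>c: "continuous_map (mtop ?M) (mtop N) (\<Phi> W)" if "open_submodule W" for W
    using \<Phi>(1)[OF that] by (simp add: hom_measures_iff)
  have \<Phi>N: "\<Phi> W \<mu> \<in> carrier N" if "open_submodule W" "\<mu> \<in> zmeasures \<C> X" for W \<mu>
    using continuous_map_image_subset_topspace[OF \<Phi>c[OF that(1)]] that(2) by auto
  have compat: "near W' (\<Phi> W \<mu>) (\<Phi> W' \<mu>)"
    if "open_submodule W" "open_submodule W'" "W \<subseteq> W'" "\<mu> \<in> zmeasures \<C> X" for W W' \<mu>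
  proof (rule hom_measures_near[OF X that(2) \<Phi>(1)[OF that(1)] \<Phi>(1)[OF that(2)] _ that(4)])
    fix x assume x: "x \<in> topspace X"
    show "near W' (\<Phi> W (dirac \<C> X x)) (\<Phi> W' (dirac \<C> X x))"
      using near_mono[OF \<Phi>(2)[OF that(1) x] that(3)] \<Phi>(2)[OF that(2) x] near_sym[OF that(2)] near_trans[OF that(2)]
      by blast
  qed
  have ex: "\<exists>y\<in>carrier N. \<forall>W. open_submodule W \<longrightarrow> near W y (\<Phi> W \<mu>)" if \<mu>: "\<mu> \<in> zmeasures \<C> X" for \<mu>
  proof -
    define S where "S = (\<lambda>W. {y \<in> topspace (mtop N). near W y (\<Phi> W \<mu>)})"
    let ?\<U> = "S ` {W. open_submodule W}"
    have "closedin (mtop N) (S W)" if W: "open_submodule W" for W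
    proof -
      have "continuous_map (mtop N) (mtop N) (\<lambda>_. \<Phi> W \<mu>)" using \<Phi>N[OF W \<mu>] by simp
      from locally_constant_closedin[OF locally_constant_near[OF W continuous_map_id this], where P = "\<lambda>b. b"]
      show ?thesis by (simp add: S_def)
    qed
    then have cl: "\<forall>C\<in>?\<U>. closedin (mtop N) C" by blast
    \<comment> \<open>For an open submodule \<open>W\<close> inside all the given ones,
      \<open>\<Phi> W \<mu>\<close> lies in each of the chosen cosets, by compatibility.\<close>
    have fip: "\<Inter>\<F> \<noteq> {}" if \<F>: "finite \<F>" "\<F> \<subseteq> ?\<U>" for \<F>
    proof -
      obtain \<W> where \<W>: "finite \<W>" "\<W> \<subseteq> {W. open_submodule W}" "\<F> = S ` \<W>"
        using finite_subset_image[OF \<F>] by metis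
      then obtain W where W: "open_submodule W" "\<forall>W'\<in>\<W>. W \<subseteq> W'"
        using open_submodule_Inter[of \<W>] by blast
      have "\<Phi> W \<mu> \<in> S W'" if "W' \<in> \<W>" for W'
        using compat[OF W(1) _ _ \<mu>, of W'] that W(2) \<W>(2) \<Phi>N[OF W(1) \<mu>] unfolding S_def by auto
      then show ?thesis unfolding \<W>(3) by blast
    qed
    have "\<Inter>?\<U> \<noteq> {}"
      using profinite_space_compact[OF profinite_mtop] cl fip unfolding compact_space_fip by metis
    then obtain y where "\<And>W. open_submodule W \<Longrightarrow> y \<in> S W" by blast
    then show ?thesis using open_submodule_carrier unfolding S_def by auto
  qed
  define h where "h = (\<lambda>\<mu>\<in>zmeasures \<C> X. SOME y. y \<in> carrier N \<and> (\<forall>W. open_submodule W \<longrightarrow> near W y (\<Phi> W \<mu>)))"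
  have h: "h \<mu> \<in> carrier N" "\<And>W. open_submodule W \<Longrightarrow> near W (h \<mu>) (\<Phi> W \<mu>)" if \<mu>: "\<mu> \<in> zmeasures \<C> X" for \<mu>
  proof -
    have "\<exists>y. y \<in> carrier N \<and> (\<forall>W. open_submodule W \<longrightarrow> near W y (\<Phi> W \<mu>))" using ex[OF \<mu>] by blast
    from someI_ex[OF this] show "h \<mu> \<in> carrier N" "\<And>W. open_submodule W \<Longrightarrow> near W (h \<mu>) (\<Phi> W \<mu>)"
      using \<mu> by (auto simp: h_def)
  qed
  have h_eqI: "h \<mu> = y" if \<mu>: "\<mu> \<in> zmeasures \<C> X" and y: "\<And>W. open_submodule W \<Longrightarrow> near W y (\<Phi> W \<mu>)" for \<mu> y
  proof (rule near_eqI)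
    fix W assume W: "open_submodule W"
    show "near W (h \<mu>) y" by (rule near_trans[OF W h(2)[OF \<mu> W] near_sym[OF W y[OF W]]])
  qed
  have "h \<in> hom_measures X"
    unfolding hom_measures_iff
  proof (intro conjI ballI)
    show "continuous_map (mtop ?M) (mtop N) h"
    proof (rule continuous_mapI_near)
      show "h \<mu> \<in> carrier N" if "\<mu> \<in> topspace (mtop ?M)" for \<mu> using h(1) that by simp
      fix W \<mu> assume W: "open_submodule W" and "\<mu> \<in> topspace (mtop ?M)"
      then have \<mu>: "\<mu> \<in> zmeasures \<C> X" by simp
      let ?T = "{\<nu> \<in> topspace (mtop ?M). near W (\<Phi> W \<nu>) (\<Phi> W \<mu>)}"
      have "continuous_map (mtop ?M) (mtop N) (\<lambda>_. \<Phi> W \<mu>)" using \<Phi>N[OF W \<mu>] by simp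
      from locally_constant_openin[OF locally_constant_near[OF W \<Phi>c[OF W] this], where P = "\<lambda>b. b"]
      have "openin (mtop ?M) ?T" by simp
      moreover have "\<mu> \<in> ?T" using \<mu> near_refl[OF W \<Phi>N[OF W \<mu>]] by simp
      moreover have "near W (h \<nu>) (h \<mu>)" if "\<nu> \<in> ?T" for \<nu>
      proof -
        have \<nu>: "\<nu> \<in> zmeasures \<C> X" "near W (\<Phi> W \<nu>) (\<Phi> W \<mu>)" using that by auto
        show ?thesis
          by (rule near_trans[OF W near_trans[OF W h(2)[OF \<nu>(1) W] \<nu>(2)] near_sym[OF W h(2)[OF \<mu> W]]])
      qed
      ultimately show "\<exists>T. openin (mtop ?M) T \<and> \<mu> \<in> T \<and> (\<forall>z\<in>T. near W (h z) (h \<mu>))" by blast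
    qed
    fix \<mu> assume \<mu>: "\<mu> \<in> zmeasures \<C> X"
    show "h (\<mu> \<oplus>\<^bsub>?M\<^esub> \<nu>) = h \<mu> \<oplus>\<^bsub>N\<^esub> h \<nu>" if \<nu>: "\<nu> \<in> zmeasures \<C> X" for \<nu>
    proof (rule h_eqI)
      show "\<mu> \<oplus>\<^bsub>?M\<^esub> \<nu> \<in> zmeasures \<C> X" using MM.M.a_closed[of \<mu> \<nu>] \<mu> \<nu> by simp
      fix W assume W: "open_submodule W"
      have "\<Phi> W (\<mu> \<oplus>\<^bsub>?M\<^esub> \<nu>) = \<Phi> W \<mu> \<oplus>\<^bsub>N\<^esub> \<Phi> W \<nu>"
        using \<Phi>(1)[OF W] \<mu> \<nu> unfolding hom_measures_iff by blast
      then show "near W (h \<mu> \<oplus>\<^bsub>N\<^esub> h \<nu>) (\<Phi> W (\<mu> \<oplus>\<^bsub>?M\<^esub> \<nu>))"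
        using near_add[OF W h(2)[OF \<mu> W] h(2)[OF \<nu> W]] by simp
    qed
    show "h (r \<odot>\<^bsub>?M\<^esub> \<mu>) = r \<odot>\<^bsub>N\<^esub> h \<mu>" if r: "r \<in> zhat_carrier \<C>" for r
    proof (rule h_eqI)
      show "r \<odot>\<^bsub>?M\<^esub> \<mu> \<in> zmeasures \<C> X" using MM.smult_closed[of r \<mu>] \<mu> r by simp
      fix W assume W: "open_submodule W"
      have "\<Phi> W (r \<odot>\<^bsub>?M\<^esub> \<mu>) = r \<odot>\<^bsub>N\<^esub> \<Phi> W \<mu>"
        using \<Phi>(1)[OF W] \<mu> r unfolding hom_measures_iff by blast
      then show "near W (r \<odot>\<^bsub>N\<^esub> h \<mu>) (\<Phi> W (r \<odot>\<^bsub>?M\<^esub> \<mu>))"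
        using near_smult[OF W r h(2)[OF \<mu> W]] by simp
    qed
  qed
  moreover have "h (dirac \<C> X x) = f x" if x: "x \<in> topspace X" for x
    by (rule h_eqI[OF measures_closed(4)]) (rule near_sym[OF _ \<Phi>(2)[OF _ x]])
  moreover have "h \<in> extensional (zmeasures \<C> X)" by (simp add: h_def)
  ultimately show ?thesis using that by blast
qed

end

text \<open>The definition tests modules over the type of the measures; existence and uniqueness of
  the homomorphism hold for profinite modules over any type.\<close>

lemma free_measure_module:
  fixes X :: "'a topology"
  assumes X: "profinite_space X"
  shows "free_profinite_module (zhat \<C>) X {} (measure_module \<C> X) (dirac \<C> X)"
  unfolding free_profinite_module_def
proof (intro conjI allI impI profinite_measure_module continuous_dirac; (elim conjE)?)
  fix N :: "(nat \<Rightarrow> int, 'a free_elem) topmodule" and f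
  assume N: "profinite_module (zhat \<C>) N" and f: "continuous_map X (mtop N) f"
  interpret profinite_test_module \<C> N
    using N by (simp add: profinite_test_module_def profinite_test_module_axioms_def profinite_module_def)
  obtain h where h: "h \<in> hom_measures X" "h \<in> extensional (zmeasures \<C> X)"
    "\<And>x. x \<in> topspace X \<Longrightarrow> h (dirac \<C> X x) = f x"
    using hom_measures_exists[OF X f] by metis
  show "\<exists>!h. h \<in> extensional (carrier (measure_module \<C> X)) \<and> h \<in> hom_measures X \<and>
      (\<forall>x\<in>topspace X. h (dirac \<C> X x) = f x)"
  proof (rule ex1I[of _ h])
    fix k assume k: "k \<in> extensional (carrier (measure_module \<C> X)) \<and> k \<in> hom_measures X \<and>
      (\<forall>x\<in>topspace X. k (dirac \<C> X x) = f x)"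
    then have "k \<mu> = h \<mu>" if "\<mu> \<in> zmeasures \<C> X" for \<mu>
      using hom_measures_unique[OF X _ h(1) _ that, of k] h(3) by simp
    then show "k = h" using k h(2) by (intro extensionalityI[of k "zmeasures \<C> X"]) auto
  qed (use h in auto)
qed simp

section \<open>Acyclic graphs are pro-\<open>\<C>\<close> trees\<close>

text \<open>Continuous linear maps from the measures to the integers modulo \<open>n\<close>, given
  by integer representatives; the ring acts through its residue at \<open>n\<close>. Two of them
  that agree on point masses agree everywhere, which reduces identities between integrals to
  identities between functions.\<close>

definition functional :: "(nat monoid \<Rightarrow> bool) \<Rightarrow> nat \<Rightarrow> 'a topology \<Rightarrow> ('a free_elem \<Rightarrow> int) \<Rightarrow> bool" where
  "functional \<C> n X \<phi> \<longleftrightarrow> locally_constant (mtop (measure_module \<C> X)) \<phi> \<and>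
     (\<forall>\<mu>\<in>zmeasures \<C> X. \<forall>\<nu>\<in>zmeasures \<C> X.
        \<phi> (\<mu> \<oplus>\<^bsub>measure_module \<C> X\<^esub> \<nu>) mod int n = (\<phi> \<mu> + \<phi> \<nu>) mod int n) \<and>
     (\<forall>r\<in>zhat_carrier \<C>. \<forall>\<mu>\<in>zmeasures \<C> X.
        \<phi> (r \<odot>\<^bsub>measure_module \<C> X\<^esub> \<mu>) mod int n = (r n * \<phi> \<mu>) mod int n)"

lemma functionalD:
  assumes "functional \<C> n X \<phi>"
  shows "locally_constant (mtop (measure_module \<C> X)) \<phi>"
    and "\<mu> \<in> zmeasures \<C> X \<Longrightarrow> \<nu> \<in> zmeasures \<C> X \<Longrightarrow>
      \<phi> (\<mu> \<oplus>\<^bsub>measure_module \<C> X\<^esub> \<nu>) mod int n = (\<phi> \<mu> + \<phi> \<nu>) mod int n"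
    and "r \<in> zhat_carrier \<C> \<Longrightarrow> \<mu> \<in> zmeasures \<C> X \<Longrightarrow>
      \<phi> (r \<odot>\<^bsub>measure_module \<C> X\<^esub> \<mu>) mod int n = (r n * \<phi> \<mu>) mod int n"
  using assms unfolding functional_def by blast+

lemma functional_zero:
  assumes "functional \<C> n X \<phi>" "n \<in> class_moduli \<C>"
  shows "\<phi> \<zero>\<^bsub>measure_module \<C> X\<^esub> mod int n = 0"
proof -
  have "\<phi> (\<zero>\<^bsub>zhat \<C>\<^esub> \<odot>\<^bsub>measure_module \<C> X\<^esub> \<zero>\<^bsub>measure_module \<C> X\<^esub>) mod int n = 0"
    using functionalD(3)[OF assms(1), of "\<zero>\<^bsub>zhat \<C>\<^esub>" "\<zero>\<^bsub>measure_module \<C> X\<^esub>"]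
      zhat_closed(1)[of \<C>] measures_closed(1)[of \<C> X] assms(2) by simp
  moreover have "\<zero>\<^bsub>zhat \<C>\<^esub> \<odot>\<^bsub>measure_module \<C> X\<^esub> \<zero>\<^bsub>measure_module \<C> X\<^esub> = \<zero>\<^bsub>measure_module \<C> X\<^esub>"
    by (auto simp: fun_eq_iff)
  ultimately show ?thesis by (simp only:)
qed

lemma functional_eqI:
  assumes X: "profinite_space X" and n: "n \<in> class_moduli \<C>"
    and \<phi>: "functional \<C> n X \<phi>" and \<psi>: "functional \<C> n X \<psi>"
    and eq: "\<And>x. x \<in> topspace X \<Longrightarrow> \<phi> (dirac \<C> X x) mod int n = \<psi> (dirac \<C> X x) mod int n"
    and \<mu>: "\<mu> \<in> zmeasures \<C> X"
  shows "\<phi> \<mu> mod int n = \<psi> \<mu> mod int n"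
proof -
  let ?M = "measure_module \<C> X"
  let ?L = "{\<mu> \<in> topspace (mtop ?M). \<phi> \<mu> mod int n = \<psi> \<mu> mod int n}"
  interpret MM: Module.module "zhat \<C>" ?M by (rule measure_module_module)
  have "zmeasures \<C> X \<subseteq> ?L"
  proof (rule dirac_dense[OF X])
    show "closedin (mtop ?M) ?L"
      using locally_constant_closedin[OF locally_constant_comp2[OF functionalD(1)[OF \<phi>] functionalD(1)[OF \<psi>],
        where h = "\<lambda>a b. a mod int n = b mod int n"], where P = "\<lambda>b. b"] by simp
    show "\<zero>\<^bsub>?M\<^esub> \<in> ?L"
      using functional_zero[OF \<phi> n] functional_zero[OF \<psi> n] MM.M.zero_closed by simp
    show "\<mu> \<oplus>\<^bsub>?M\<^esub> \<nu> \<in> ?L" if "\<mu> \<in> ?L" "\<nu> \<in> ?L" for \<mu> \<nu>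
    proof -
      have c: "\<mu> \<in> zmeasures \<C> X" "\<nu> \<in> zmeasures \<C> X" "\<mu> \<oplus>\<^bsub>?M\<^esub> \<nu> \<in> zmeasures \<C> X"
        using that MM.M.a_closed[of \<mu> \<nu>] by (simp_all del: measure_module_simps(3))
      have "(\<phi> \<mu> + \<phi> \<nu>) mod int n = (\<psi> \<mu> + \<psi> \<nu>) mod int n"
        using that by (intro mod_add_cong) auto
      then show ?thesis
        using functionalD(2)[OF \<phi> c(1,2)] functionalD(2)[OF \<psi> c(1,2)] c(3)
        by (simp del: measure_module_simps(3))
    qed
    show "r \<odot>\<^bsub>?M\<^esub> \<mu> \<in> ?L" if r: "r \<in> zhat_carrier \<C>" and "\<mu> \<in> ?L" for r \<mu>
    proof -
      have c: "\<mu> \<in> zmeasures \<C> X" "r \<odot>\<^bsub>?M\<^esub> \<mu> \<in> zmeasures \<C> X"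
        using that MM.smult_closed[of r \<mu>] by (simp_all del: measure_module_simps(4))
      have "(r n * \<phi> \<mu>) mod int n = (r n * \<psi> \<mu>) mod int n"
        using that by (intro mod_mult_cong) auto
      then show ?thesis
        using functionalD(3)[OF \<phi> r c(1)] functionalD(3)[OF \<psi> r c(1)] c(2)
        by (simp del: measure_module_simps(4))
    qed
    show "dirac \<C> X x \<in> ?L" if "x \<in> topspace X" for x
      using eq[OF that] measures_closed(4) by simp
  qed
  then show ?thesis using \<mu> by blast
qed

lemma functional_combination:
  assumes \<phi>: "functional \<C> n X \<phi>" and \<psi>: "functional \<C> n X \<psi>"
  shows "functional \<C> n X (\<lambda>\<mu>. a * \<phi> \<mu> + b * \<psi> \<mu>)"
  unfolding functional_def
proof (intro conjI ballI)
  show "locally_constant (mtop (measure_module \<C> X)) (\<lambda>\<mu>. a * \<phi> \<mu> + b * \<psi> \<mu>)"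
    using locally_constant_comp2[OF functionalD(1)[OF \<phi>] functionalD(1)[OF \<psi>], where h = "\<lambda>x y. a * x + b * y"] .
  fix \<mu> assume \<mu>: "\<mu> \<in> zmeasures \<C> X"
  show "(a * \<phi> (\<mu> \<oplus>\<^bsub>measure_module \<C> X\<^esub> \<nu>) + b * \<psi> (\<mu> \<oplus>\<^bsub>measure_module \<C> X\<^esub> \<nu>)) mod int n =
      (a * \<phi> \<mu> + b * \<psi> \<mu> + (a * \<phi> \<nu> + b * \<psi> \<nu>)) mod int n" if \<nu>: "\<nu> \<in> zmeasures \<C> X" for \<nu>
  proof -
    have "(a * \<phi> (\<mu> \<oplus>\<^bsub>measure_module \<C> X\<^esub> \<nu>) + b * \<psi> (\<mu> \<oplus>\<^bsub>measure_module \<C> X\<^esub> \<nu>)) mod int n =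
        (a * (\<phi> \<mu> + \<phi> \<nu>) + b * (\<psi> \<mu> + \<psi> \<nu>)) mod int n"
      by (intro mod_add_cong mod_mult_cong functionalD(2)[OF \<phi> \<mu> \<nu>] functionalD(2)[OF \<psi> \<mu> \<nu>]) simp_all
    then show ?thesis by (simp add: algebra_simps)
  qed
  show "(a * \<phi> (r \<odot>\<^bsub>measure_module \<C> X\<^esub> \<mu>) + b * \<psi> (r \<odot>\<^bsub>measure_module \<C> X\<^esub> \<mu>)) mod int n =
      (r n * (a * \<phi> \<mu> + b * \<psi> \<mu>)) mod int n" if r: "r \<in> zhat_carrier \<C>" for r
  proof -
    have "(a * \<phi> (r \<odot>\<^bsub>measure_module \<C> X\<^esub> \<mu>) + b * \<psi> (r \<odot>\<^bsub>measure_module \<C> X\<^esub> \<mu>)) mod int n =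
        (a * (r n * \<phi> \<mu>) + b * (r n * \<psi> \<mu>)) mod int n"
      by (intro mod_add_cong mod_mult_cong functionalD(3)[OF \<phi> r \<mu>] functionalD(3)[OF \<psi> r \<mu>]) simp_all
    then show ?thesis by (simp add: algebra_simps)
  qed
qed

lemma functional_eval: "n \<in> class_moduli \<C> \<Longrightarrow> functional \<C> n X (\<lambda>\<mu>. \<mu> U n)"
  unfolding functional_def using locally_constant_measure by auto

lemma functional_const0: "functional \<C> n X (\<lambda>\<mu>. 0)"
  by (simp add: functional_def)

lemma functional_sum:
  assumes "finite J" "\<And>j. j \<in> J \<Longrightarrow> functional \<C> n X (\<phi> j)"
  shows "functional \<C> n X (\<lambda>\<mu>. \<Sum>j\<in>J. \<phi> j \<mu> * c j)"
  using assms
proof (induction J rule: finite_induct)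
  case empty
  then show ?case by (simp add: functional_const0)
next
  case (insert j J)
  then show ?case
    using functional_combination[of \<C> n X "\<phi> j" "\<lambda>\<mu>. \<Sum>j\<in>J. \<phi> j \<mu> * c j" "c j" 1]
    by (simp add: mult.commute)
qed

text \<open>Summing over the values of \<open>F\<close> keeps the sum finite when \<open>F\<close>
  is locally constant on a compact space.\<close>

definition integral_mod :: "'a topology \<Rightarrow> nat \<Rightarrow> ('a \<Rightarrow> int) \<Rightarrow> 'a free_elem \<Rightarrow> int" where
  "integral_mod X n F \<mu> = (\<Sum>j\<in>F ` topspace X. \<mu> {x \<in> topspace X. F x = j} n * j)"

lemma functional_integral:
  assumes "profinite_space X" "locally_constant X F" "n \<in> class_moduli \<C>"
  shows "functional \<C> n X (integral_mod X n F)"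
  unfolding integral_mod_def[abs_def]
  by (rule functional_sum) (use assms locally_constant_finite_image profinite_space_compact functional_eval in blast)+

text \<open>Only the level set through \<open>x\<close> has mass; the factor \<open>1 mod n\<close>
  accounts for \<open>n = 1\<close>.\<close>

lemma integral_dirac:
  assumes X: "profinite_space X" and F: "locally_constant X F" and n: "n \<in> class_moduli \<C>" and x: "x \<in> topspace X"
  shows "integral_mod X n F (dirac \<C> X x) mod int n = F x mod int n"
proof -
  have fin: "finite (F ` topspace X)" using locally_constant_finite_image[OF profinite_space_compact[OF X] F] .
  have cl: "clopenin X {y \<in> topspace X. F y = j}" for j
    using locally_constant_openin[OF F, where P = "\<lambda>z. z = j"] locally_constant_closedin[OF F, where P = "\<lambda>z. z = j"] by simp
  have "dirac \<C> X x {y \<in> topspace X. F y = j} n * j = (if j = F x then (1 mod int n) * F x else 0)" for j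
    using cl[of j] x n by (auto simp: dirac_def)
  then have "integral_mod X n F (dirac \<C> X x) = (1 mod int n) * F x"
    using fin x by (simp add: integral_mod_def sum.delta')
  then show ?thesis by (simp add: mod_simps)
qed

lemma integral_mod_dvd:
  assumes "\<mu> \<in> zmeasures \<C> X" "m \<in> class_moduli \<C>" "n \<in> class_moduli \<C>" "m dvd n"
  shows "integral_mod X n F \<mu> mod int m = integral_mod X m F \<mu> mod int m"
  unfolding integral_mod_def
proof (subst (1 2) mod_sum_eq[symmetric], rule arg_cong[where f = "\<lambda>x. x mod int m"], rule sum.cong[OF refl])
  fix j
  have "\<mu> U n mod int m = \<mu> U m" for U
    using measuresD(1)[OF assms(1), of U] assms(2-4) by (simp add: zhat_carrier_iff)
  then show "\<mu> {x \<in> topspace X. F x = j} n * j mod int m = \<mu> {x \<in> topspace X. F x = j} m * j mod int m"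
    by (metis mod_mult_left_eq)
qed

text \<open>With the vertex set open as well as closed, the edges form a profinite space, and
  collapsing the vertices adds an isolated base point to it. Hence measures on the edges form the
  free module on the pointed edge space.\<close>

locale clopen_graph =
  fixes \<C> :: "nat monoid \<Rightarrow> bool" and \<Gamma> :: "'a pgraph"
  assumes graph: "profinite_graph \<Gamma>" and open_verts: "openin (ptop \<Gamma>) (verts \<Gamma>)"
    and nonempty: "verts \<Gamma> \<noteq> {}"
    and acyclic: "\<And>n. n \<in> class_moduli \<C> \<Longrightarrow> acyclic_mod n \<Gamma>"
begin

definition etop :: "'a topology" where
  "etop = subtopology (ptop \<Gamma>) (edges \<Gamma>)"

lemma closed_verts: "closedin (ptop \<Gamma>) (verts \<Gamma>)"
  and profinite_ptop: "profinite_space (ptop \<Gamma>)"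
  using graph by (auto simp: profinite_graph_def)

lemma verts_points: "verts \<Gamma> \<subseteq> points \<Gamma>"
  using closedin_subset[OF closed_verts] .

lemma topspace_vtop [simp]: "topspace (vtop \<Gamma>) = verts \<Gamma>"
  using verts_points by auto

lemma topspace_etop [simp]: "topspace etop = edges \<Gamma>"
  by (auto simp: etop_def)

lemma clopen_edges: "clopenin (ptop \<Gamma>) (edges \<Gamma>)"
  using open_verts closed_verts by auto

lemma profinite_vtop: "profinite_space (vtop \<Gamma>)"
  using profinite_space_closed_subspace[OF profinite_ptop closed_verts] .

lemma profinite_etop: "profinite_space etop"
  unfolding etop_def using profinite_space_closed_subspace[OF profinite_ptop] clopen_edges by blast

lemma continuous_d:
  "continuous_map etop (vtop \<Gamma>) (d0 \<Gamma>)" "continuous_map etop (vtop \<Gamma>) (d1 \<Gamma>)"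
  using graph unfolding profinite_graph_def etop_def by (auto intro: continuous_map_from_subtopology)

lemma d_verts: "e \<in> edges \<Gamma> \<Longrightarrow> d0 \<Gamma> e \<in> verts \<Gamma>" "e \<in> edges \<Gamma> \<Longrightarrow> d1 \<Gamma> e \<in> verts \<Gamma>"
  using continuous_map_image_subset_topspace[OF continuous_d(1)]
    continuous_map_image_subset_topspace[OF continuous_d(2)] by auto

lemma clopen_preimage:
  assumes "clopenin (vtop \<Gamma>) U"
  shows "clopenin etop {e \<in> edges \<Gamma>. d0 \<Gamma> e \<in> U}" "clopenin etop {e \<in> edges \<Gamma>. d1 \<Gamma> e \<in> U}"
  using assms openin_continuous_map_preimage[OF continuous_d(1), of U] closedin_continuous_map_preimage[OF continuous_d(1), of U]
    openin_continuous_map_preimage[OF continuous_d(2), of U] closedin_continuous_map_preimage[OF continuous_d(2), of U]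
  by simp_all

lemma constant_mod:
  fixes F :: "'a \<Rightarrow> int"
  assumes n: "n \<in> class_moduli \<C>" and F: "locally_constant (vtop \<Gamma>) F"
    and eq: "\<And>e. e \<in> edges \<Gamma> \<Longrightarrow> F (d1 \<Gamma> e) mod int n = F (d0 \<Gamma> e) mod int n"
  obtains c where "\<And>v. v \<in> verts \<Gamma> \<Longrightarrow> F v mod int n = c mod int n"
proof -
  have "locally_constant (ptop \<Gamma>) (\<lambda>x. if x \<in> verts \<Gamma> then F x else 0)"
    by (rule locally_constant_extend[OF open_verts closed_verts F]) simp
  moreover have "\<forall>e\<in>edges \<Gamma>. (if d1 \<Gamma> e \<in> verts \<Gamma> then F (d1 \<Gamma> e) else 0) mod int n =
      (if d0 \<Gamma> e \<in> verts \<Gamma> then F (d0 \<Gamma> e) else 0) mod int n"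
    using eq d_verts by auto
  ultimately have "\<forall>v\<in>verts \<Gamma>. \<forall>w\<in>verts \<Gamma>.
      (if v \<in> verts \<Gamma> then F v else 0) mod int n = (if w \<in> verts \<Gamma> then F w else 0) mod int n"
    using conjunct1[OF acyclic[OF n, unfolded acyclic_mod_def], rule_format, OF conjI] by blast
  then show ?thesis using that nonempty by (metis equals0I)
qed

lemma potential:
  assumes n: "n \<in> class_moduli \<C>" and U: "clopenin etop U"
  shows "\<exists>F :: 'a \<Rightarrow> int. locally_constant (vtop \<Gamma>) F \<and>
    (\<forall>e\<in>edges \<Gamma>. (F (d1 \<Gamma> e) - F (d0 \<Gamma> e)) mod int n = of_bool (e \<in> U) mod int n)"
proof -
  have "locally_constant etop (\<lambda>e. of_bool (e \<in> U) :: int)"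
    using locally_constant_comp[OF locally_constant_mem] U by blast
  then have "locally_constant (ptop \<Gamma>) (\<lambda>x. if x \<in> edges \<Gamma> then of_bool (x \<in> U) else 0 :: int)"
    unfolding etop_def using clopen_edges by (intro locally_constant_extend) auto
  then obtain F :: "'a \<Rightarrow> int" where F: "locally_constant (ptop \<Gamma>) F"
    "\<forall>e\<in>edges \<Gamma>. (F (d1 \<Gamma> e) - F (d0 \<Gamma> e)) mod int n = (if e \<in> edges \<Gamma> then of_bool (e \<in> U) else 0) mod int n"
    using conjunct2[OF acyclic[OF n, unfolded acyclic_mod_def], rule_format] by blast
  then show ?thesis using locally_constant_subtopology by (intro exI[of _ F]) auto
qed

text \<open>The push-forward along \<open>d1\<close> minus the push-forward along \<open>d0\<close>;
  it is the transpose of the coboundary of functions.\<close>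

definition boundary :: "'a free_elem \<Rightarrow> 'a free_elem" where
  "boundary \<mu> = (\<lambda>U. \<lambda>n\<in>class_moduli \<C>. if clopenin (vtop \<Gamma>) U
     then (\<mu> {e \<in> edges \<Gamma>. d1 \<Gamma> e \<in> U} n - \<mu> {e \<in> edges \<Gamma>. d0 \<Gamma> e \<in> U} n) mod int n else 0)"

lemma boundary_measure:
  assumes \<mu>: "\<mu> \<in> zmeasures \<C> etop"
  shows "boundary \<mu> \<in> zmeasures \<C> (vtop \<Gamma>)"
proof (rule measuresI)
  fix U
  show "boundary \<mu> U \<in> zhat_carrier \<C>"
  proof (cases "clopenin (vtop \<Gamma>) U")
    case True
    have "(\<lambda>n\<in>class_moduli \<C>. (\<mu> {e \<in> edges \<Gamma>. d1 \<Gamma> e \<in> U} n - \<mu> {e \<in> edges \<Gamma>. d0 \<Gamma> e \<in> U} n) mod int n) \<in> zhat_carrier \<C>"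
    proof (rule zhat_residuesI)
      fix m n assume mn: "m \<in> class_moduli \<C>" "n \<in> class_moduli \<C>" "m dvd n"
      have "\<mu> W n mod int m = \<mu> W m mod int m" for W
        using measuresD(1)[OF \<mu>, of W] mn by (simp add: zhat_carrier_iff)
      then show "(\<mu> {e \<in> edges \<Gamma>. d1 \<Gamma> e \<in> U} n - \<mu> {e \<in> edges \<Gamma>. d0 \<Gamma> e \<in> U} n) mod int m =
          (\<mu> {e \<in> edges \<Gamma>. d1 \<Gamma> e \<in> U} m - \<mu> {e \<in> edges \<Gamma>. d0 \<Gamma> e \<in> U} m) mod int m"
        by (intro mod_diff_cong)
    qed
    then show ?thesis using True by (simp add: boundary_def)
  next
    case False
    then have "boundary \<mu> U = \<zero>\<^bsub>zhat \<C>\<^esub>" by (auto simp: boundary_def)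
    then show ?thesis using zhat_closed(1) by simp
  qed
  fix n assume n: "n \<in> class_moduli \<C>"
  show "boundary \<mu> U n = 0" if "\<not> clopenin (vtop \<Gamma>) U" using that n by (auto simp: boundary_def)
  fix V assume UV: "clopenin (vtop \<Gamma>) U" "clopenin (vtop \<Gamma>) V" "U \<inter> V = {}"
  have "\<mu> {e \<in> edges \<Gamma>. d \<Gamma> e \<in> U \<union> V} n = (\<mu> {e \<in> edges \<Gamma>. d \<Gamma> e \<in> U} n + \<mu> {e \<in> edges \<Gamma>. d \<Gamma> e \<in> V} n) mod int n"
    if "d = d0 \<or> d = d1" for d
  proof -
    have e: "{e \<in> edges \<Gamma>. d \<Gamma> e \<in> U \<union> V} = {e \<in> edges \<Gamma>. d \<Gamma> e \<in> U} \<union> {e \<in> edges \<Gamma>. d \<Gamma> e \<in> V}" by blast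
    have "clopenin etop {e \<in> edges \<Gamma>. d \<Gamma> e \<in> U}" "clopenin etop {e \<in> edges \<Gamma>. d \<Gamma> e \<in> V}"
      using that clopen_preimage UV(1,2) by blast+
    then show ?thesis
      unfolding e by (rule measuresD(3)[OF \<mu> n]) (use UV(3) in blast)
  qed
  from this[of d0] this[of d1]
  show "boundary \<mu> (U \<union> V) n = (boundary \<mu> U n + boundary \<mu> V n) mod int n"
    using UV n by (simp add: boundary_def openin_Un closedin_Un mod_simps del: Un_iff; simp add: algebra_simps)
qed

lemma boundary_add:
  "boundary (\<mu> \<oplus>\<^bsub>measure_module \<C> etop\<^esub> \<nu>) = boundary \<mu> \<oplus>\<^bsub>measure_module \<C> (vtop \<Gamma>)\<^esub> boundary \<nu>"
  by (auto simp: boundary_def fun_eq_iff mod_simps; simp add: algebra_simps)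

lemma boundary_smult:
  "boundary (r \<odot>\<^bsub>measure_module \<C> etop\<^esub> \<mu>) = r \<odot>\<^bsub>measure_module \<C> (vtop \<Gamma>)\<^esub> boundary \<mu>"
  by (auto simp: boundary_def fun_eq_iff mod_simps; simp add: algebra_simps)

lemma continuous_boundary:
  "continuous_map (mtop (measure_module \<C> etop)) (mtop (measure_module \<C> (vtop \<Gamma>))) boundary"
  unfolding continuous_into_measures
proof (intro conjI ballI allI)
  show "boundary \<mu> \<in> zmeasures \<C> (vtop \<Gamma>)" if "\<mu> \<in> topspace (mtop (measure_module \<C> etop))" for \<mu>
    using boundary_measure that by simp
  fix U n assume n: "n \<in> class_moduli \<C>"
  show "locally_constant (mtop (measure_module \<C> etop)) (\<lambda>\<mu>. boundary \<mu> U n)"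
    using locally_constant_comp2[OF locally_constant_measure[OF n, of etop "{e \<in> edges \<Gamma>. d1 \<Gamma> e \<in> U}"]
      locally_constant_measure[OF n, of etop "{e \<in> edges \<Gamma>. d0 \<Gamma> e \<in> U}"],
      where h = "\<lambda>a b. if clopenin (vtop \<Gamma>) U then (a - b) mod int n else 0"] n
    by (simp add: boundary_def del: Diff_iff)
qed

lemma boundary_hom: "boundary \<in> cont_module_hom (zhat \<C>) (measure_module \<C> etop) (measure_module \<C> (vtop \<Gamma>))"
proof -
  have "boundary \<in> hom (add_monoid (measure_module \<C> etop)) (add_monoid (measure_module \<C> (vtop \<Gamma>)))"
    by (rule homI) (use boundary_measure boundary_add in simp_all)
  then show ?thesis
    using boundary_smult continuous_boundary by (simp add: cont_module_hom_def)
qed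

lemma boundary_dirac:
  assumes e: "e \<in> edges \<Gamma>"
  shows "boundary (dirac \<C> etop e) = dirac \<C> (vtop \<Gamma>) (d1 \<Gamma> e) \<ominus>\<^bsub>measure_module \<C> (vtop \<Gamma>)\<^esub> dirac \<C> (vtop \<Gamma>) (d0 \<Gamma> e)"
proof (rule measure_eqI)
  let ?M = "measure_module \<C> (vtop \<Gamma>)"
  interpret MM: Module.module "zhat \<C>" ?M by (rule measure_module_module)
  have c: "dirac \<C> (vtop \<Gamma>) x \<in> carrier ?M" for x using measures_closed(4) by simp
  show "boundary (dirac \<C> etop e) \<in> zmeasures \<C> (vtop \<Gamma>)" by (rule boundary_measure[OF measures_closed(4)])
  show "dirac \<C> (vtop \<Gamma>) (d1 \<Gamma> e) \<ominus>\<^bsub>?M\<^esub> dirac \<C> (vtop \<Gamma>) (d0 \<Gamma> e) \<in> zmeasures \<C> (vtop \<Gamma>)"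
    using MM.M.minus_closed[OF c c] by simp
  fix U n assume U: "clopenin (vtop \<Gamma>) U" and n: "n \<in> class_moduli \<C>"
  have "dirac \<C> etop e {e \<in> edges \<Gamma>. d \<Gamma> e \<in> U} = dirac \<C> (vtop \<Gamma>) (d \<Gamma> e) U" if "d = d0 \<or> d = d1" for d
    using that clopen_preimage[OF U] U e by (auto simp: dirac_def)
  moreover have "(dirac \<C> (vtop \<Gamma>) (d1 \<Gamma> e) \<ominus>\<^bsub>?M\<^esub> dirac \<C> (vtop \<Gamma>) (d0 \<Gamma> e)) U n =
      (dirac \<C> (vtop \<Gamma>) (d1 \<Gamma> e) U n + (- dirac \<C> (vtop \<Gamma>) (d0 \<Gamma> e) U n) mod int n) mod int n"
    using n measure_a_inv[OF measures_closed(4)[of \<C> "vtop \<Gamma>"] n, of "d0 \<Gamma> e" U] by (simp add: a_minus_def)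
  ultimately show "boundary (dirac \<C> etop e) U n mod int n =
      (dirac \<C> (vtop \<Gamma>) (d1 \<Gamma> e) \<ominus>\<^bsub>?M\<^esub> dirac \<C> (vtop \<Gamma>) (d0 \<Gamma> e)) U n mod int n"
    using U n by (simp add: boundary_def mod_simps)
qed

lemma functional_boundary:
  assumes "functional \<C> n (vtop \<Gamma>) \<phi>"
  shows "functional \<C> n etop (\<lambda>\<mu>. \<phi> (boundary \<mu>))"
  unfolding functional_def
proof (intro conjI ballI)
  show "locally_constant (mtop (measure_module \<C> etop)) (\<lambda>\<mu>. \<phi> (boundary \<mu>))"
    by (rule locally_constant_compose[OF functionalD(1)[OF assms] continuous_boundary])
qed (simp_all only: boundary_add boundary_smult functionalD[OF assms] boundary_measure)

lemma functional_boundary_dirac: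
  assumes \<phi>: "functional \<C> n (vtop \<Gamma>) \<phi>" and e: "e \<in> edges \<Gamma>"
  shows "\<phi> (boundary (dirac \<C> etop e)) mod int n =
    (\<phi> (dirac \<C> (vtop \<Gamma>) (d1 \<Gamma> e)) - \<phi> (dirac \<C> (vtop \<Gamma>) (d0 \<Gamma> e))) mod int n"
proof -
  let ?M = "measure_module \<C> (vtop \<Gamma>)"
  interpret MM: Module.module "zhat \<C>" ?M by (rule measure_module_module)
  define x y where "x = dirac \<C> (vtop \<Gamma>) (d1 \<Gamma> e)" and "y = dirac \<C> (vtop \<Gamma>) (d0 \<Gamma> e)"
  have c: "x \<in> carrier ?M" "y \<in> carrier ?M" unfolding x_def y_def using measures_closed(4) by simp_all
  have "x = (x \<ominus>\<^bsub>?M\<^esub> y) \<oplus>\<^bsub>?M\<^esub> y"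
    using c by (simp add: MM.M.minus_eq MM.M.a_assoc MM.M.l_neg del: measure_module_simps)
  then have "\<phi> x mod int n = (\<phi> (x \<ominus>\<^bsub>?M\<^esub> y) + \<phi> y) mod int n"
    using functionalD(2)[OF \<phi>, of "x \<ominus>\<^bsub>?M\<^esub> y" y] c MM.M.minus_closed[OF c]
    by (metis measure_module_simps(1))
  then have "\<phi> (x \<ominus>\<^bsub>?M\<^esub> y) mod int n = (\<phi> x - \<phi> y) mod int n"
    by (metis add_diff_cancel_right' mod_diff_left_eq)
  then show ?thesis unfolding boundary_dirac[OF e] x_def y_def .
qed

text \<open>If \<open>F\<close> is a potential modulo \<open>n\<close> of the indicator function of
  \<open>U\<close>, the residue of \<mu>(U) at \<open>n\<close> is the integral of \<open>F\<close>
  against the boundary of \<mu>. So the boundary determines \<mu>.\<close>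

lemma boundary_inj: "inj_on boundary (zmeasures \<C> etop)"
proof (rule inj_onI)
  fix \<mu> \<nu> assume \<mu>: "\<mu> \<in> zmeasures \<C> etop" and \<nu>: "\<nu> \<in> zmeasures \<C> etop" and eq: "boundary \<mu> = boundary \<nu>"
  show "\<mu> = \<nu>"
  proof (rule measure_eqI[OF \<mu> \<nu>])
    fix U n assume U: "clopenin etop U" and n: "n \<in> class_moduli \<C>"
    obtain F :: "'a \<Rightarrow> int" where F: "locally_constant (vtop \<Gamma>) F"
      "\<And>e. e \<in> edges \<Gamma> \<Longrightarrow> (F (d1 \<Gamma> e) - F (d0 \<Gamma> e)) mod int n = of_bool (e \<in> U) mod int n"
      using potential[OF n U] by blast
    note I = functional_integral[OF profinite_vtop F(1) n]
    \<comment> \<open>Both sides are functionals of \<open>\<rho>\<close>, so they are compared on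
      point masses, where the identity is the defining property of \<open>F\<close>.\<close>
    have *: "\<rho> U n mod int n = integral_mod (vtop \<Gamma>) n F (boundary \<rho>) mod int n" if \<rho>: "\<rho> \<in> zmeasures \<C> etop" for \<rho>
    proof (rule functional_eqI[OF profinite_etop n functional_eval[OF n] functional_boundary[OF I] _ \<rho>])
      fix e assume "e \<in> topspace etop"
      then have e: "e \<in> edges \<Gamma>" by simp
      have "integral_mod (vtop \<Gamma>) n F (boundary (dirac \<C> etop e)) mod int n =
          (integral_mod (vtop \<Gamma>) n F (dirac \<C> (vtop \<Gamma>) (d1 \<Gamma> e)) - integral_mod (vtop \<Gamma>) n F (dirac \<C> (vtop \<Gamma>) (d0 \<Gamma> e))) mod int n"
        by (rule functional_boundary_dirac[OF I e])
      also have "\<dots> = (F (d1 \<Gamma> e) - F (d0 \<Gamma> e)) mod int n"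
        by (intro mod_diff_cong integral_dirac[OF profinite_vtop F(1) n])
          (simp_all only: topspace_vtop d_verts[OF e])
      finally show "dirac \<C> etop e U n mod int n = integral_mod (vtop \<Gamma>) n F (boundary (dirac \<C> etop e)) mod int n"
        using F(2)[OF e] U n by (simp add: dirac_def)
    qed
    show "\<mu> U n mod int n = \<nu> U n mod int n" using *[OF \<mu>] *[OF \<nu>] eq by simp
  qed
qed

text \<open>The difference between \<open>F\<close> and the combination of \<open>F1\<close> and
  \<open>F2\<close> has zero coboundary modulo \<open>n\<close>. So it is congruent to a constant,
  which integrates to zero against a measure of total mass zero. Thus the integral of a potential
  depends only on its coboundary.\<close>

lemma integral_potential:
  fixes F F1 F2 :: "'a \<Rightarrow> int"
  assumes n: "n \<in> class_moduli \<C>" and \<mu>: "\<mu> \<in> zmeasures \<C> (vtop \<Gamma>)" and zero: "\<mu> (verts \<Gamma>) n = 0"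
    and F: "locally_constant (vtop \<Gamma>) F" "locally_constant (vtop \<Gamma>) F1" "locally_constant (vtop \<Gamma>) F2"
    and eq: "\<And>e. e \<in> edges \<Gamma> \<Longrightarrow> (F (d1 \<Gamma> e) - F (d0 \<Gamma> e)) mod int n =
      (a * (F1 (d1 \<Gamma> e) - F1 (d0 \<Gamma> e)) + b * (F2 (d1 \<Gamma> e) - F2 (d0 \<Gamma> e))) mod int n"
  shows "integral_mod (vtop \<Gamma>) n F \<mu> mod int n =
    (a * integral_mod (vtop \<Gamma>) n F1 \<mu> + b * integral_mod (vtop \<Gamma>) n F2 \<mu>) mod int n"
proof -
  let ?I = "integral_mod (vtop \<Gamma>) n"
  have lcD: "locally_constant (vtop \<Gamma>) (\<lambda>v. F v - (a * F1 v + b * F2 v))"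
    using locally_constant_comp2[OF F(1) locally_constant_comp2[OF F(2,3), where h = "\<lambda>x y. a * x + b * y"], where h = "(-)"] .
  have eqD: "(F (d1 \<Gamma> e) - (a * F1 (d1 \<Gamma> e) + b * F2 (d1 \<Gamma> e))) mod int n =
      (F (d0 \<Gamma> e) - (a * F1 (d0 \<Gamma> e) + b * F2 (d0 \<Gamma> e))) mod int n" if "e \<in> edges \<Gamma>" for e
    using eq[OF that] by (simp add: mod_eq_dvd_iff algebra_simps)
  obtain c where c: "\<And>v. v \<in> verts \<Gamma> \<Longrightarrow> (F v - (a * F1 v + b * F2 v)) mod int n = c mod int n"
    using constant_mod[OF n lcD eqD] by blast
  have "?I F \<mu> mod int n = (1 * (a * ?I F1 \<mu> + b * ?I F2 \<mu>) + c * \<mu> (verts \<Gamma>) n) mod int n"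
  proof (rule functional_eqI[OF profinite_vtop n functional_integral[OF profinite_vtop F(1) n] _ _ \<mu>])
    show "functional \<C> n (vtop \<Gamma>) (\<lambda>\<mu>. 1 * (a * ?I F1 \<mu> + b * ?I F2 \<mu>) + c * \<mu> (verts \<Gamma>) n)"
      by (intro functional_combination functional_integral profinite_vtop F n functional_eval)
    fix v assume "v \<in> topspace (vtop \<Gamma>)"
    then have v: "v \<in> verts \<Gamma>" "v \<in> topspace (vtop \<Gamma>)" by simp_all
    have "clopenin (vtop \<Gamma>) (verts \<Gamma>)" by (metis closedin_topspace openin_topspace topspace_vtop)
    then have "dirac \<C> (vtop \<Gamma>) v (verts \<Gamma>) n = 1 mod int n" using v n by (simp add: dirac_def)
    moreover have "(1 * (a * ?I F1 (dirac \<C> (vtop \<Gamma>) v) + b * ?I F2 (dirac \<C> (vtop \<Gamma>) v)) + c * (1 mod int n)) mod int n =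
        (1 * (a * F1 v + b * F2 v) + c * 1) mod int n"
      by (intro mod_add_cong mod_mult_cong integral_dirac[OF profinite_vtop _ n v(2)] F) simp_all
    moreover have "(a * F1 v + b * F2 v + c) mod int n = F v mod int n"
      using c[OF v(1)] by (simp add: mod_eq_dvd_iff algebra_simps) (metis dvd_minus_iff minus_diff_eq diff_diff_eq2 diff_diff_add add.commute)
    ultimately show "?I F (dirac \<C> (vtop \<Gamma>) v) mod int n =
        (1 * (a * ?I F1 (dirac \<C> (vtop \<Gamma>) v) + b * ?I F2 (dirac \<C> (vtop \<Gamma>) v)) + c * dirac \<C> (vtop \<Gamma>) v (verts \<Gamma>) n) mod int n"
      using integral_dirac[OF profinite_vtop F(1) n v(2)] by simp
  qed
  then show ?thesis using zero by simp
qed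

text \<open>A preimage is forced by the argument for injectivity: its value on \<open>U\<close> must
  be the integral, against \<nu>, of a potential of the indicator function of \<open>U\<close>. By
  \<open>integral_potential\<close> every choice of the potential gives the same residue; this
  yields compatibility between moduli and additivity in \<open>U\<close>.\<close>

lemma boundary_surj:
  assumes \<nu>: "\<nu> \<in> zmeasures \<C> (vtop \<Gamma>)" and zero: "\<nu> (verts \<Gamma>) = \<zero>\<^bsub>zhat \<C>\<^esub>"
  shows "\<nu> \<in> boundary ` zmeasures \<C> etop"
proof -
  let ?I = "\<lambda>n F. integral_mod (vtop \<Gamma>) n F \<nu>"
  have z: "\<nu> (verts \<Gamma>) n = 0" if "n \<in> class_moduli \<C>" for n using zero that by simp
  \<comment> \<open>The conditions on \<open>U\<close> and \<open>n\<close> stand inside the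
    existential statement, so that the potentials can be chosen as a function of both.\<close>
  have "\<exists>F. clopenin etop U \<and> n \<in> class_moduli \<C> \<longrightarrow> locally_constant (vtop \<Gamma>) (F :: 'a \<Rightarrow> int) \<and>
    (\<forall>e\<in>edges \<Gamma>. (F (d1 \<Gamma> e) - F (d0 \<Gamma> e)) mod int n = of_bool (e \<in> U) mod int n)" for U n
    using potential by blast
  then obtain F :: "'a set \<Rightarrow> nat \<Rightarrow> 'a \<Rightarrow> int" where
    F: "\<And>U n. clopenin etop U \<Longrightarrow> n \<in> class_moduli \<C> \<Longrightarrow> locally_constant (vtop \<Gamma>) (F U n)"
    and pot: "\<And>U n e. clopenin etop U \<Longrightarrow> n \<in> class_moduli \<C> \<Longrightarrow> e \<in> edges \<Gamma> \<Longrightarrow>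
      (F U n (d1 \<Gamma> e) - F U n (d0 \<Gamma> e)) mod int n = of_bool (e \<in> U) mod int n"
    by metis
  define \<mu> where "\<mu> = (\<lambda>U. if clopenin etop U then \<lambda>n\<in>class_moduli \<C>. ?I n (F U n) mod int n else \<zero>\<^bsub>zhat \<C>\<^esub>)"
  have \<mu>: "\<mu> \<in> zmeasures \<C> etop"
  proof (rule measuresI)
    fix U
    show "\<mu> U \<in> zhat_carrier \<C>"
    proof (cases "clopenin etop U")
      case True
      have "(\<lambda>n\<in>class_moduli \<C>. ?I n (F U n) mod int n) \<in> zhat_carrier \<C>"
      proof (rule zhat_residuesI)
        fix m n assume mn: "m \<in> class_moduli \<C>" "n \<in> class_moduli \<C>" "m dvd n"
        have "?I m (F U n) mod int m = (1 * ?I m (F U m) + 0 * ?I m (F U m)) mod int m"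
        proof (rule integral_potential[OF mn(1) \<nu> z[OF mn(1)] F[OF True mn(2)] F[OF True mn(1)] F[OF True mn(1)]])
          fix e assume e: "e \<in> edges \<Gamma>"
          have "(F U n (d1 \<Gamma> e) - F U n (d0 \<Gamma> e)) mod int m = of_bool (e \<in> U) mod int m"
            using pot[OF True mn(2) e] mn(3) by (metis int_dvd_int_iff mod_mod_cancel)
          then show "(F U n (d1 \<Gamma> e) - F U n (d0 \<Gamma> e)) mod int m =
              (1 * (F U m (d1 \<Gamma> e) - F U m (d0 \<Gamma> e)) + 0 * (F U m (d1 \<Gamma> e) - F U m (d0 \<Gamma> e))) mod int m"
            using pot[OF True mn(1) e] by simp
        qed
        then show "?I n (F U n) mod int m = ?I m (F U m) mod int m"
          using integral_mod_dvd[OF \<nu> mn] by simp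
      qed
      then show ?thesis using True by (simp add: \<mu>_def)
    next
      case False
      then have "\<mu> U = \<zero>\<^bsub>zhat \<C>\<^esub>" unfolding \<mu>_def by (rule if_not_P)
      then show ?thesis using zhat_closed(1)[of \<C>] by simp
    qed
    fix n assume n: "n \<in> class_moduli \<C>"
    show "\<mu> U n = 0" if nU: "\<not> clopenin etop U"
    proof -
      have "\<mu> U = \<zero>\<^bsub>zhat \<C>\<^esub>" unfolding \<mu>_def using nU by (rule if_not_P)
      then show ?thesis using n by simp
    qed
    fix V assume UV: "clopenin etop U" "clopenin etop V" "U \<inter> V = {}"
    have UuV: "clopenin etop (U \<union> V)" using UV by auto
    have "?I n (F (U \<union> V) n) mod int n = (1 * ?I n (F U n) + 1 * ?I n (F V n)) mod int n"
    proof (rule integral_potential[OF n \<nu> z[OF n] F[OF UuV n] F[OF UV(1) n] F[OF UV(2) n]])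
      fix e assume e: "e \<in> edges \<Gamma>"
      have "(of_bool (e \<in> U \<union> V) :: int) = 1 * of_bool (e \<in> U) + 1 * of_bool (e \<in> V)" using UV(3) by auto
      moreover have "(1 * (F U n (d1 \<Gamma> e) - F U n (d0 \<Gamma> e)) + 1 * (F V n (d1 \<Gamma> e) - F V n (d0 \<Gamma> e))) mod int n =
          (1 * of_bool (e \<in> U) + 1 * of_bool (e \<in> V)) mod int n"
        by (intro mod_add_cong mod_mult_cong pot e n UV) simp_all
      ultimately show "(F (U \<union> V) n (d1 \<Gamma> e) - F (U \<union> V) n (d0 \<Gamma> e)) mod int n =
          (1 * (F U n (d1 \<Gamma> e) - F U n (d0 \<Gamma> e)) + 1 * (F V n (d1 \<Gamma> e) - F V n (d0 \<Gamma> e))) mod int n"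
        using pot[OF UuV n e] by simp
    qed
    then show "\<mu> (U \<union> V) n = (\<mu> U n + \<mu> V n) mod int n"
      using UV UuV n by (simp add: \<mu>_def mod_simps)
  qed
  have "boundary \<mu> = \<nu>"
  proof (rule measure_eqI[OF boundary_measure[OF \<mu>] \<nu>])
    fix W n assume W: "clopenin (vtop \<Gamma>) W" and n: "n \<in> class_moduli \<C>"
    define D0 D1 where "D0 = {e \<in> edges \<Gamma>. d0 \<Gamma> e \<in> W}" and "D1 = {e \<in> edges \<Gamma>. d1 \<Gamma> e \<in> W}"
    have cl: "clopenin etop D0" "clopenin etop D1"
      unfolding D0_def D1_def using clopen_preimage[OF W] by blast+
    \<comment> \<open>The indicator function of \<open>W\<close> is itself a potential of the
      indicator function of \<open>D1\<close> minus that of \<open>D0\<close>.\<close>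
    define ind where "ind = (\<lambda>v. of_bool (v \<in> W) :: int)"
    have lci: "locally_constant (vtop \<Gamma>) ind"
      unfolding ind_def using W by (intro locally_constant_comp[OF locally_constant_mem]) auto
    have "boundary \<mu> W n mod int n = (1 * ?I n (F D1 n) + (-1) * ?I n (F D0 n)) mod int n"
    proof -
      have "boundary \<mu> W n = (\<mu> D1 n - \<mu> D0 n) mod int n"
        using W n by (simp add: boundary_def D0_def D1_def)
      then show ?thesis using cl n by (simp add: \<mu>_def mod_simps)
    qed
    also have "\<dots> = ?I n ind mod int n"
    proof (rule integral_potential[OF n \<nu> z[OF n] lci F[OF cl(2) n] F[OF cl(1) n], symmetric])
      fix e assume e: "e \<in> edges \<Gamma>"
      have "(1 * (F D1 n (d1 \<Gamma> e) - F D1 n (d0 \<Gamma> e)) + (-1) * (F D0 n (d1 \<Gamma> e) - F D0 n (d0 \<Gamma> e))) mod int n =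
          (1 * of_bool (e \<in> D1) + (-1) * of_bool (e \<in> D0)) mod int n"
        by (intro mod_add_cong mod_mult_cong pot cl n e) simp_all
      moreover have "1 * of_bool (e \<in> D1) + (-1) * of_bool (e \<in> D0) = ind (d1 \<Gamma> e) - ind (d0 \<Gamma> e)"
        using e by (simp add: ind_def D0_def D1_def)
      ultimately show "(ind (d1 \<Gamma> e) - ind (d0 \<Gamma> e)) mod int n =
          (1 * (F D1 n (d1 \<Gamma> e) - F D1 n (d0 \<Gamma> e)) + (-1) * (F D0 n (d1 \<Gamma> e) - F D0 n (d0 \<Gamma> e))) mod int n"
        by simp
    qed
    also have "\<dots> = \<nu> W n mod int n"
    proof (rule functional_eqI[OF profinite_vtop n functional_integral[OF profinite_vtop lci n] functional_eval[OF n] _ \<nu>])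
      fix v assume v: "v \<in> topspace (vtop \<Gamma>)"
      show "integral_mod (vtop \<Gamma>) n ind (dirac \<C> (vtop \<Gamma>) v) mod int n = dirac \<C> (vtop \<Gamma>) v W n mod int n"
        using integral_dirac[OF profinite_vtop lci n v] W n by (simp add: dirac_def ind_def)
    qed
    finally show "boundary \<mu> W n mod int n = \<nu> W n mod int n" .
  qed
  then show ?thesis using \<mu> by blast
qed

definition edge_generator :: "'a option \<Rightarrow> 'a free_elem" where
  "edge_generator x = (case x of None \<Rightarrow> \<zero>\<^bsub>measure_module \<C> etop\<^esub> | Some e \<Rightarrow> dirac \<C> etop e)"

text \<open>The base point occurs because there is a vertex to be collapsed.\<close>

lemma topspace_edge_space: "topspace (edge_space \<Gamma>) = insert None (Some ` edges \<Gamma>)"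
  using nonempty verts_points by (auto simp: edge_space_def image_iff)

lemma continuous_from_edge_space:
  "continuous_map (edge_space \<Gamma>) Z h \<longleftrightarrow>
     continuous_map (ptop \<Gamma>) Z (\<lambda>x. h (if x \<in> verts \<Gamma> then None else Some x))"
  using continuous_compose_quotient_map_eq[OF quotient_map_quotient_topology[of "ptop \<Gamma>" "\<lambda>x. if x \<in> verts \<Gamma> then None else Some x"], of Z h]
  unfolding edge_space_def by (simp add: o_def)

lemma continuous_edge_generator: "continuous_map (edge_space \<Gamma>) (mtop (measure_module \<C> etop)) edge_generator"
  unfolding continuous_from_edge_space
  unfolding continuous_into_measures
proof (intro conjI ballI allI)
  show "edge_generator (if x \<in> verts \<Gamma> then None else Some x) \<in> zmeasures \<C> etop" for x
    using measures_closed(1,4)[of \<C> etop] by (simp add: edge_generator_def)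
  fix U n assume n: "n \<in> class_moduli \<C>"
  have "locally_constant etop (\<lambda>x. dirac \<C> etop x U n)"
    using continuous_dirac[of etop \<C>] n unfolding continuous_into_measures by blast
  then have "locally_constant (ptop \<Gamma>) (\<lambda>x. if x \<in> verts \<Gamma> then 0 else dirac \<C> etop x U n)"
    unfolding etop_def by (intro locally_constant_extend open_verts closed_verts) simp_all
  then show "locally_constant (ptop \<Gamma>) (\<lambda>x. edge_generator (if x \<in> verts \<Gamma> then None else Some x) U n)"
    by (rule locally_constant_cong) (use n in \<open>simp add: edge_generator_def\<close>)
qed

text \<open>A continuous map on the collapsed space that kills the base point restricts to a
  continuous map on the edges. Freeness thus reduces to the extension property of measures on
  \<open>etop\<close>.\<close>

lemma free_edge_module:
  "free_profinite_module (zhat \<C>) (edge_space \<Gamma>) {None} (measure_module \<C> etop) edge_generator"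
  unfolding free_profinite_module_def
proof (intro conjI allI impI profinite_measure_module continuous_edge_generator; (elim conjE)?)
  show "\<forall>b\<in>{None}. edge_generator b = \<zero>\<^bsub>measure_module \<C> etop\<^esub>" by (simp add: edge_generator_def)
  fix N :: "(nat \<Rightarrow> int, 'a free_elem) topmodule" and f
  assume N: "profinite_module (zhat \<C>) N" and f: "continuous_map (edge_space \<Gamma>) (mtop N) f"
    and f0: "\<forall>b\<in>{None}. f b = \<zero>\<^bsub>N\<^esub>"
  interpret profinite_test_module \<C> N
    using N by (simp add: profinite_test_module_def profinite_test_module_axioms_def profinite_module_def)
  have "continuous_map etop (mtop N) (\<lambda>x. f (if x \<in> verts \<Gamma> then None else Some x))"
    unfolding etop_def using f by (simp only: continuous_from_edge_space continuous_map_from_subtopology)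
  then have "continuous_map etop (mtop N) (\<lambda>x. f (Some x))"
    by (rule continuous_map_eq) simp
  then obtain h where h: "h \<in> hom_measures etop" "h \<in> extensional (zmeasures \<C> etop)"
    "\<And>x. x \<in> topspace etop \<Longrightarrow> h (dirac \<C> etop x) = f (Some x)"
    using hom_measures_exists[OF profinite_etop] by metis
  show "\<exists>!h. h \<in> extensional (carrier (measure_module \<C> etop)) \<and> h \<in> hom_measures etop \<and>
      (\<forall>x\<in>topspace (edge_space \<Gamma>). h (edge_generator x) = f x)"
  proof (rule ex1I[of _ h])
    show "h \<in> extensional (carrier (measure_module \<C> etop)) \<and> h \<in> hom_measures etop \<and>
        (\<forall>x\<in>topspace (edge_space \<Gamma>). h (edge_generator x) = f x)"
      using h hom_measures_zero[OF h(1)] f0 by (auto simp: topspace_edge_space edge_generator_def)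
    fix k assume k: "k \<in> extensional (carrier (measure_module \<C> etop)) \<and> k \<in> hom_measures etop \<and>
        (\<forall>x\<in>topspace (edge_space \<Gamma>). k (edge_generator x) = f x)"
    have "k (dirac \<C> etop x) = h (dirac \<C> etop x)" if "x \<in> topspace etop" for x
    proof -
      have "Some x \<in> topspace (edge_space \<Gamma>)" using that by (simp add: topspace_edge_space)
      then have "k (edge_generator (Some x)) = f (Some x)" using k by blast
      then show ?thesis using h(3)[OF that] by (simp add: edge_generator_def)
    qed
    then have "k \<mu> = h \<mu>" if "\<mu> \<in> zmeasures \<C> etop" for \<mu>
      using hom_measures_unique[OF profinite_etop _ h(1) _ that, of k] k by blast
    then show "k = h" using k h(2) by (intro extensionalityI[of k "zmeasures \<C> etop"]) auto
  qed
qed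

lemma pro_class_tree: "pro_class_tree \<C> \<Gamma>"
proof -
  let ?ME = "measure_module \<C> etop" and ?MV = "measure_module \<C> (vtop \<Gamma>)"
  \<comment> \<open>The augmentation is the total mass.\<close>
  let ?\<epsilon> = "\<lambda>\<mu> :: 'a free_elem. \<mu> (verts \<Gamma>)"
  have clV: "clopenin (vtop \<Gamma>) (verts \<Gamma>)" by (metis closedin_topspace openin_topspace topspace_vtop)
  have \<epsilon>dirac: "?\<epsilon> (dirac \<C> (vtop \<Gamma>) v) = \<one>\<^bsub>zhat \<C>\<^esub>" if "v \<in> verts \<Gamma>" for v
    using that clV by (simp add: dirac_def)
  have \<epsilon>hom: "?\<epsilon> \<in> cont_module_hom (zhat \<C>) ?MV (regular_module (zhat \<C>))"
  proof -
    have "continuous_map (mtop ?MV) (rtop (zhat \<C>)) ?\<epsilon>"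
      unfolding continuous_into_zhat using measuresD(1) locally_constant_measure by auto
    moreover have "?\<epsilon> \<in> hom (add_monoid ?MV) (add_monoid (regular_module (zhat \<C>)))"
      by (rule homI) (use measuresD(1) in \<open>auto simp: regular_module_def\<close>)
    ultimately show ?thesis by (simp add: cont_module_hom_def regular_module_def)
  qed
  have im: "boundary ` carrier ?ME = {m \<in> carrier ?MV. ?\<epsilon> m = \<zero>\<^bsub>zhat \<C>\<^esub>}"
  proof
    show "boundary ` carrier ?ME \<subseteq> {m \<in> carrier ?MV. ?\<epsilon> m = \<zero>\<^bsub>zhat \<C>\<^esub>}"
    proof
      fix m assume "m \<in> boundary ` carrier ?ME"
      then obtain \<mu> where \<mu>: "\<mu> \<in> zmeasures \<C> etop" "m = boundary \<mu>" by auto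
      have "{e \<in> edges \<Gamma>. d0 \<Gamma> e \<in> verts \<Gamma>} = edges \<Gamma>" "{e \<in> edges \<Gamma>. d1 \<Gamma> e \<in> verts \<Gamma>} = edges \<Gamma>"
        using d_verts by blast+
      then have "?\<epsilon> m = \<zero>\<^bsub>zhat \<C>\<^esub>" using \<mu> by (simp add: boundary_def fun_eq_iff del: Diff_iff)
      then show "m \<in> {m \<in> carrier ?MV. ?\<epsilon> m = \<zero>\<^bsub>zhat \<C>\<^esub>}" using \<mu> boundary_measure by simp
    qed
    show "{m \<in> carrier ?MV. ?\<epsilon> m = \<zero>\<^bsub>zhat \<C>\<^esub>} \<subseteq> boundary ` carrier ?ME"
      using boundary_surj by auto
  qed
  \<comment> \<open>The multiples of one point mass realise every total mass.\<close>
  have surj: "?\<epsilon> ` carrier ?MV = carrier (zhat \<C>)"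
  proof
    show "?\<epsilon> ` carrier ?MV \<subseteq> carrier (zhat \<C>)" using measuresD(1) by auto
    show "carrier (zhat \<C>) \<subseteq> ?\<epsilon> ` carrier ?MV"
    proof
      fix r assume r: "r \<in> carrier (zhat \<C>)"
      interpret R: cring "zhat \<C>" by (rule zhat_cring)
      obtain v where v: "v \<in> verts \<Gamma>" using nonempty by blast
      let ?\<mu> = "r \<odot>\<^bsub>?MV\<^esub> dirac \<C> (vtop \<Gamma>) v"
      have "?\<mu> \<in> carrier ?MV" using measures_closed(3)[OF _ measures_closed(4)] r by simp
      moreover have "?\<epsilon> ?\<mu> = r \<otimes>\<^bsub>zhat \<C>\<^esub> \<one>\<^bsub>zhat \<C>\<^esub>"
        using \<epsilon>dirac[OF v] by (simp only: measure_module_simps)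
      ultimately show "r \<in> ?\<epsilon> ` carrier ?MV" using R.r_one[OF r] by (metis imageI)
    qed
  qed
  have \<delta>dirac: "\<forall>e\<in>edges \<Gamma>. boundary (edge_generator (Some e)) =
      dirac \<C> (vtop \<Gamma>) (d1 \<Gamma> e) \<ominus>\<^bsub>?MV\<^esub> dirac \<C> (vtop \<Gamma>) (d0 \<Gamma> e)"
    using boundary_dirac by (simp add: edge_generator_def)
  have inj: "inj_on boundary (carrier ?ME)" using boundary_inj by simp
  show ?thesis
    unfolding pro_class_tree_def
    using graph free_edge_module free_measure_module[OF profinite_vtop] boundary_hom \<delta>dirac \<epsilon>hom \<epsilon>dirac inj im surj
    by blast
qed

end

section \<open>The blow-up of one tree along another\<close>

text \<open>By compactness of \<open>P\<close>, all parameters near \<open>p\<close> give the same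
  function on \<open>P\<close>. A choice made for each function on \<open>P\<close> then yields a
  family that is locally constant in the parameter.\<close>

lemma locally_constant_curry:
  assumes P: "compact_space P" and f: "locally_constant (prod_topology V P) f"
  shows "locally_constant V (\<lambda>p. \<lambda>x\<in>topspace P. f (p, x))"
proof (rule locally_constantI, subst openin_subopen, intro ballI)
  fix y p assume p: "p \<in> {p \<in> topspace V. (\<lambda>x\<in>topspace P. f (p, x)) = y}"
  have "locally_constant (prod_topology P V) (\<lambda>z. f (snd z, fst z) = f (p, fst z))"
  proof (rule locally_constant_comp2[where h = "(=)"])
    show "locally_constant (prod_topology P V) (\<lambda>z. f (snd z, fst z))"
      by (rule locally_constant_compose[OF f, of "prod_topology P V" "\<lambda>z. (snd z, fst z)"])
        (intro continuous_map_pairedI continuous_map_fst continuous_map_snd)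
    show "locally_constant (prod_topology P V) (\<lambda>z. f (p, fst z))"
      by (rule locally_constant_compose[OF f, of "prod_topology P V" "\<lambda>z. (p, fst z)"])
        (use p in \<open>intro continuous_map_pairedI continuous_map_fst; simp\<close>)
  qed
  then have "openin V {p' \<in> topspace V. \<forall>x\<in>topspace P. (\<lambda>z. f (snd z, fst z) = f (p, fst z)) (x, p') \<in> {True}}"
    unfolding locally_constant_def by (rule openin_tube[OF P]) simp
  moreover have "\<dots> \<subseteq> {p \<in> topspace V. (\<lambda>x\<in>topspace P. f (p, x)) = y}"
  proof -
    have y: "y = (\<lambda>x\<in>topspace P. f (p, x))" using p by simp
    show ?thesis unfolding y by (auto intro!: restrict_ext)
  qed
  ultimately show "\<exists>T. openin V T \<and> p \<in> T \<and> T \<subseteq> {p \<in> topspace V. (\<lambda>x\<in>topspace P. f (p, x)) = y}"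
    using p by (intro exI[of _ "{p' \<in> topspace V. \<forall>x\<in>topspace P. (\<lambda>z. f (snd z, fst z) = f (p, fst z)) (x, p') \<in> {True}}"])
      auto
qed

lemma locally_constant_uncurry:
  assumes \<kappa>: "locally_constant V \<kappa>" and H: "\<And>p. p \<in> topspace V \<Longrightarrow> locally_constant P (H (\<kappa> p))"
  shows "locally_constant (prod_topology V P) (\<lambda>z. H (\<kappa> (fst z)) (snd z))"
proof (rule locally_constantI, subst openin_subopen, intro ballI)
  fix y z assume z: "z \<in> {z \<in> topspace (prod_topology V P). H (\<kappa> (fst z)) (snd z) = y}"
  let ?T = "{p \<in> topspace V. \<kappa> p = \<kappa> (fst z)} \<times> {x \<in> topspace P. H (\<kappa> (fst z)) x = y}"
  have "openin (prod_topology V P) ?T"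
  proof -
    have "fst z \<in> topspace V" using z by (simp add: mem_Times_iff)
    from locally_constant_openin[OF \<kappa>, where P = "\<lambda>k. k = \<kappa> (fst z)"]
      locally_constant_openin[OF H[OF this], where P = "\<lambda>k. k = y"]
    show ?thesis by (simp add: openin_prod_Times_iff)
  qed
  then show "\<exists>T. openin (prod_topology V P) T \<and> z \<in> T \<and>
      T \<subseteq> {z \<in> topspace (prod_topology V P). H (\<kappa> (fst z)) (snd z) = y}"
    using z by (intro exI[of _ ?T]) (auto simp: mem_Times_iff)
qed

text \<open>
  Replace every vertex of \<open>T2\<close> by a copy of \<open>T1\<close>, and contract every edge \<open>e\<close> of \<open>T2\<close>, after
  attaching it to the copies of the vertex \<open>s e\<close>. Contraction means passing to the largest profinite
  quotient in which the end points are identified.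
\<close>

locale blow_up = profinite_topgroup G for G :: "'g topgroup" (structure) +
  fixes T1 :: "'a pgraph" and T2 :: "'b pgraph" and \<phi>1 :: "'g \<Rightarrow> 'a \<Rightarrow> 'a" and \<phi>2 :: "'g \<Rightarrow> 'b \<Rightarrow> 'b"
    and s :: "'b \<Rightarrow> 'a" and j :: "'b \<times> 'a \<Rightarrow> 'c"
  assumes graph1: "profinite_graph T1" and graph2: "profinite_graph T2"
    and open1: "openin (ptop T1) (verts T1)" and open2: "openin (ptop T2) (verts T2)"
    and nonempty1: "verts T1 \<noteq> {}" and nonempty2: "verts T2 \<noteq> {}"
    and action1: "graph_action G T1 \<phi>1" and action2: "graph_action G T2 \<phi>2"
    and s: "continuous_map (ptop T2) (vtop T1) s"
    and s_equivariant: "\<And>g e. g \<in> carrier G \<Longrightarrow> e \<in> edges T2 \<Longrightarrow> s (\<phi>2 g e) = \<phi>1 g (s e)"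
    and j: "inj j"
begin

definition X :: "('b \<times> 'a) topology" where
  "X = prod_topology (vtop T2) (ptop T1)"

lemma graph_facts:
  "closedin (ptop T1) (verts T1)" "closedin (ptop T2) (verts T2)"
  "verts T1 \<subseteq> points T1" "verts T2 \<subseteq> points T2"
  "profinite_space (ptop T1)" "profinite_space (ptop T2)"
  using graph1 graph2 closedin_subset[of "ptop T1" "verts T1"] closedin_subset[of "ptop T2" "verts T2"]
  by (auto simp: profinite_graph_def)

lemma vtop2: "profinite_space (vtop T2)" "topspace (vtop T2) = verts T2"
  using profinite_space_closed_subspace graph_facts by auto

lemma topspace_X: "topspace X = verts T2 \<times> points T1"
  using graph_facts by (auto simp: X_def)

lemma profinite_X: "profinite_space X"
  unfolding X_def using vtop2(1) graph_facts(5) by (rule profinite_space_prod)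

lemma d1_facts: "continuous_map (ptop T1) (ptop T1) (d0 T1)" "continuous_map (ptop T1) (ptop T1) (d1 T1)"
  "x \<in> points T1 \<Longrightarrow> d0 T1 x \<in> verts T1" "x \<in> points T1 \<Longrightarrow> d1 T1 x \<in> verts T1"
  "x \<in> verts T1 \<Longrightarrow> d0 T1 x = x" "x \<in> verts T1 \<Longrightarrow> d1 T1 x = x"
  using graph1 by (auto simp: profinite_graph_def continuous_map_in_subtopology)

lemma d2_facts: "continuous_map (ptop T2) (vtop T2) (d0 T2)" "continuous_map (ptop T2) (vtop T2) (d1 T2)"
  "x \<in> points T2 \<Longrightarrow> d0 T2 x \<in> verts T2" "x \<in> points T2 \<Longrightarrow> d1 T2 x \<in> verts T2"
  using graph2 by (auto simp: profinite_graph_def continuous_map_in_subtopology)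

lemma s_facts: "continuous_map (ptop T2) (ptop T1) s" "e \<in> points T2 \<Longrightarrow> s e \<in> verts T1"
  using s by (auto simp: continuous_map_in_subtopology)

lemma action_facts:
  "g \<in> carrier G \<Longrightarrow> x \<in> points T1 \<Longrightarrow> \<phi>1 g x \<in> points T1"
  "g \<in> carrier G \<Longrightarrow> y \<in> points T2 \<Longrightarrow> \<phi>2 g y \<in> points T2"
  "g \<in> carrier G \<Longrightarrow> h \<in> carrier G \<Longrightarrow> x \<in> points T1 \<Longrightarrow> \<phi>1 (g \<otimes> h) x = \<phi>1 g (\<phi>1 h x)"
  "g \<in> carrier G \<Longrightarrow> h \<in> carrier G \<Longrightarrow> y \<in> points T2 \<Longrightarrow> \<phi>2 (g \<otimes> h) y = \<phi>2 g (\<phi>2 h y)"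
  "x \<in> points T1 \<Longrightarrow> \<phi>1 \<one> x = x" "y \<in> points T2 \<Longrightarrow> \<phi>2 \<one> y = y"
proof -
  interpret A1: group_action G "points T1" \<phi>1 using action1 by (simp add: graph_action_def)
  interpret A2: group_action G "points T2" \<phi>2 using action2 by (simp add: graph_action_def)
  show "g \<in> carrier G \<Longrightarrow> x \<in> points T1 \<Longrightarrow> \<phi>1 g x \<in> points T1"
    using A1.element_image by blast
  show "g \<in> carrier G \<Longrightarrow> y \<in> points T2 \<Longrightarrow> \<phi>2 g y \<in> points T2"
    using A2.element_image by blast
  show "g \<in> carrier G \<Longrightarrow> h \<in> carrier G \<Longrightarrow> x \<in> points T1 \<Longrightarrow> \<phi>1 (g \<otimes> h) x = \<phi>1 g (\<phi>1 h x)"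
    using A1.composition_rule by blast
  show "g \<in> carrier G \<Longrightarrow> h \<in> carrier G \<Longrightarrow> y \<in> points T2 \<Longrightarrow> \<phi>2 (g \<otimes> h) y = \<phi>2 g (\<phi>2 h y)"
    using A2.composition_rule by blast
  show "x \<in> points T1 \<Longrightarrow> \<phi>1 \<one> x = x" using A1.id_eq_one by (metis restrict_apply')
  show "y \<in> points T2 \<Longrightarrow> \<phi>2 \<one> y = y" using A2.id_eq_one by (metis restrict_apply')
qed

lemma action_d:
  "g \<in> carrier G \<Longrightarrow> x \<in> points T1 \<Longrightarrow> d0 T1 (\<phi>1 g x) = \<phi>1 g (d0 T1 x)"
  "g \<in> carrier G \<Longrightarrow> x \<in> points T1 \<Longrightarrow> d1 T1 (\<phi>1 g x) = \<phi>1 g (d1 T1 x)"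
  "g \<in> carrier G \<Longrightarrow> y \<in> points T2 \<Longrightarrow> d0 T2 (\<phi>2 g y) = \<phi>2 g (d0 T2 y)"
  "g \<in> carrier G \<Longrightarrow> y \<in> points T2 \<Longrightarrow> d1 T2 (\<phi>2 g y) = \<phi>2 g (d1 T2 y)"
  using action1 action2 by (auto simp: graph_action_def)

lemma action_verts2: "g \<in> carrier G \<Longrightarrow> p \<in> verts T2 \<Longrightarrow> \<phi>2 g p \<in> verts T2"
  using action_d(3)[of g p] d2_facts(3)[of "\<phi>2 g p"] action_facts(2)[of g p] graph_facts(4) graph2
  by (auto simp: profinite_graph_def subset_iff)

lemma action_edges2: 
  assumes g: "g \<in> carrier G" and e: "e \<in> edges T2"
  shows "\<phi>2 g e \<in> edges T2"
proof -
  have "\<phi>2 (inv g) (\<phi>2 g e) = e"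
    using action_facts(4)[of "inv g" g e] action_facts(6)[of e] g e by simp
  then show ?thesis using action_verts2[of "inv g" "\<phi>2 g e"] action_facts(2)[of g e] g e by auto
qed

definition act :: "'g \<Rightarrow> 'b \<times> 'a \<Rightarrow> 'b \<times> 'a" where
  "act g x = (\<phi>2 g (fst x), \<phi>1 g (snd x))"

lemma act_X: "g \<in> carrier G \<Longrightarrow> x \<in> topspace X \<Longrightarrow> act g x \<in> topspace X"
  using action_verts2 action_facts(1) by (auto simp: act_def topspace_X)

lemma act_mult: "g \<in> carrier G \<Longrightarrow> h \<in> carrier G \<Longrightarrow> x \<in> topspace X \<Longrightarrow> act (g \<otimes> h) x = act g (act h x)"
  using action_facts(3,4) graph_facts(4) by (auto simp: act_def topspace_X subset_iff)

lemma act_one: "x \<in> topspace X \<Longrightarrow> act \<one> x = x"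
  using action_facts(5,6) graph_facts(4) by (auto simp: act_def topspace_X subset_iff)

lemma continuous_act: "continuous_map (prod_topology (gtop G) X) X (\<lambda>z. act (fst z) (snd z))"
proof -
  let ?Y = "prod_topology (gtop G) X"
  have f: "continuous_map ?Y (vtop T2) (\<lambda>z. fst (snd z))" "continuous_map ?Y (ptop T1) (\<lambda>z. snd (snd z))"
    unfolding X_def
    using continuous_map_compose'[OF continuous_map_snd continuous_map_fst]
      continuous_map_compose'[OF continuous_map_snd continuous_map_snd] by blast+
  have f': "continuous_map ?Y (ptop T2) (\<lambda>z. fst (snd z))"
    using f(1) by (simp add: continuous_map_in_subtopology)
  have "continuous_map ?Y (prod_topology (gtop G) (ptop T2)) (\<lambda>z. (fst z, fst (snd z)))"
    by (intro continuous_map_pairedI continuous_map_fst f')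
  then have "continuous_map ?Y (ptop T2) (\<lambda>z. (\<lambda>(g, x). \<phi>2 g x) (fst z, fst (snd z)))"
    by (rule continuous_map_compose'[where g = "\<lambda>(g, x). \<phi>2 g x"]) (use action2 in \<open>simp add: graph_action_def\<close>)
  then have "continuous_map ?Y (vtop T2) (\<lambda>z. \<phi>2 (fst z) (fst (snd z)))"
    using action_verts2 by (auto simp: continuous_map_in_subtopology topspace_X)
  moreover have "continuous_map ?Y (prod_topology (gtop G) (ptop T1)) (\<lambda>z. (fst z, snd (snd z)))"
    by (intro continuous_map_pairedI continuous_map_fst f(2))
  then have "continuous_map ?Y (ptop T1) (\<lambda>z. (\<lambda>(g, x). \<phi>1 g x) (fst z, snd (snd z)))"
    by (rule continuous_map_compose'[where g = "\<lambda>(g, x). \<phi>1 g x"]) (use action1 in \<open>simp add: graph_action_def\<close>)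
  ultimately show ?thesis
    unfolding act_def X_def by (intro continuous_map_pairedI) (simp_all add: X_def)
qed

lemma continuous_act_g:
  assumes "g \<in> carrier G"
  shows "continuous_map X X (act g)"
proof -
  have "continuous_map X (prod_topology (gtop G) X) (\<lambda>x. (g, x))"
    using assms by (intro continuous_map_pairedI continuous_map_id[unfolded id_def]) simp
  from continuous_map_compose'[OF this continuous_act] show ?thesis by simp
qed

text \<open>These are to become the locally constant functions on the quotient: the copies at the
  two ends of \<open>e\<close> are glued at the vertex \<open>s e\<close>.\<close>

definition compatible :: "('b \<times> 'a \<Rightarrow> 'd) \<Rightarrow> bool" where
  "compatible F \<longleftrightarrow> locally_constant X F \<and> (\<forall>e\<in>edges T2. F (d0 T2 e, s e) = F (d1 T2 e, s e))"

text \<open>The relation generated by the gluing need not have a profinite quotient, so points are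
  identified as soon as no compatible function separates them. Truth values are enough as a target,
  since a level set of a compatible function has a compatible indicator function.\<close>

definition rel :: "'b \<times> 'a \<Rightarrow> 'b \<times> 'a \<Rightarrow> bool" where
  "rel x y \<longleftrightarrow> (\<forall>F :: 'b \<times> 'a \<Rightarrow> bool. compatible F \<longrightarrow> F x = F y)"

text \<open>A class is represented by one chosen member, and \<open>j\<close> carries it into the
  type over which the trees are tested. The choice depends only on the class, since it is made from
  the predicate \<open>rel x\<close>.\<close>

definition q :: "'b \<times> 'a \<Rightarrow> 'c" where
  "q x = j (SOME y. y \<in> topspace X \<and> rel x y)"

definition r :: "'c \<Rightarrow> 'b \<times> 'a" where
  "r z = (SOME x. x \<in> topspace X \<and> q x = z)"

lemma rel_compatible: "rel x y \<Longrightarrow> compatible F \<Longrightarrow> F x = F y"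
proof -
  assume "rel x y" "compatible F"
  then have "compatible (\<lambda>z. F z = F x)"
    using locally_constant_comp[of X F "\<lambda>a. a = F x"] by (simp add: compatible_def)
  then show ?thesis using \<open>rel x y\<close>[unfolded rel_def, rule_format, of "\<lambda>z. F z = F x"] by simp
qed

lemma rel_refl: "rel x x" and rel_sym: "rel x y \<Longrightarrow> rel y x" and rel_trans: "rel x y \<Longrightarrow> rel y z \<Longrightarrow> rel x z"
  unfolding rel_def by blast+

lemma q_eq_iff:
  assumes "x \<in> topspace X" "y \<in> topspace X"
  shows "q x = q y \<longleftrightarrow> rel x y"
proof
  assume "rel x y"
  then have "rel x = rel y" using rel_sym rel_trans by blast
  then show "q x = q y" by (simp add: q_def)
next
  assume "q x = q y"
  then have e: "(SOME z. z \<in> topspace X \<and> rel x z) = (SOME z. z \<in> topspace X \<and> rel y z)"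
    using j by (simp add: q_def inj_eq)
  have "rel x (SOME z. z \<in> topspace X \<and> rel x z)"
    by (rule someI2[of _ x]) (use assms rel_refl in auto)
  moreover have "rel y (SOME z. z \<in> topspace X \<and> rel y z)"
    by (rule someI2[of _ y]) (use assms rel_refl in auto)
  ultimately show "rel x y" unfolding e using rel_sym rel_trans by blast
qed

lemma q_compatible: "q x = q y \<Longrightarrow> x \<in> topspace X \<Longrightarrow> y \<in> topspace X \<Longrightarrow> compatible F \<Longrightarrow> F x = F y"
  using q_eq_iff rel_compatible by blast

lemma q_glue:
  assumes "e \<in> edges T2"
  shows "q (d0 T2 e, s e) = q (d1 T2 e, s e)"
proof -
  have "(d0 T2 e, s e) \<in> topspace X" "(d1 T2 e, s e) \<in> topspace X"
    using assms d2_facts s_facts graph_facts by (auto simp: topspace_X subset_iff)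
  then show ?thesis using assms by (simp add: q_eq_iff rel_def compatible_def)
qed

lemma r_q: "x \<in> topspace X \<Longrightarrow> r (q x) \<in> topspace X \<and> q (r (q x)) = q x"
  unfolding r_def by (rule someI[of _ x]) simp

text \<open>The incidence maps are those of \<open>T1\<close> in the second coordinate. They are
  read off from the representative \<open>r z\<close>; \<open>d_q\<close> shows that the result is
  independent of it.\<close>

definition \<Gamma> :: "'c pgraph" where
  "\<Gamma> = \<lparr>ptop = quotient_topology X q, verts = q ` (verts T2 \<times> verts T1),
    d0 = (\<lambda>z. q (fst (r z), d0 T1 (snd (r z)))), d1 = (\<lambda>z. q (fst (r z), d1 T1 (snd (r z))))\<rparr>"

lemma points_\<Gamma>: "points \<Gamma> = q ` topspace X"
  by (simp add: \<Gamma>_def)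

lemma continuous_map_\<Gamma>: "continuous_map (ptop \<Gamma>) Z h \<longleftrightarrow> continuous_map X Z (\<lambda>x. h (q x))"
  using continuous_compose_quotient_map_eq[OF quotient_map_quotient_topology[of X q], of Z h]
  by (simp add: \<Gamma>_def o_def)

lemma continuous_q: "continuous_map X (ptop \<Gamma>) q"
  using continuous_map_\<Gamma>[of "ptop \<Gamma>" "\<lambda>z. z"] continuous_map_id[of "ptop \<Gamma>"] by (simp add: id_def)

lemma locally_constant_\<Gamma>: "locally_constant (ptop \<Gamma>) F \<longleftrightarrow> locally_constant X (\<lambda>x. F (q x))"
  unfolding locally_constant_def by (rule continuous_map_\<Gamma>)

lemma descend:
  assumes "compatible F"
  shows "locally_constant (ptop \<Gamma>) (\<lambda>z. F (r z))" "x \<in> topspace X \<Longrightarrow> F (r (q x)) = F x"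
proof -
  show e: "F (r (q x)) = F x" if "x \<in> topspace X" for x
    using q_compatible[OF _ _ that assms, of "r (q x)"] r_q[OF that] by blast
  then show "locally_constant (ptop \<Gamma>) (\<lambda>z. F (r z))"
    unfolding locally_constant_\<Gamma>
  proof -
    assume e: "\<And>x. x \<in> topspace X \<Longrightarrow> F (r (q x)) = F x"
    have "locally_constant X F" using assms by (simp add: compatible_def)
    then show "locally_constant X (\<lambda>x. F (r (q x)))"
      by (rule locally_constant_cong) (simp add: e)
  qed
qed

text \<open>Glued points share the second coordinate \<open>s e\<close>, so a locally constant
  function of the second coordinate is compatible. Hence the blow-up projects to
  \<open>T1\<close>.\<close>

lemma q_snd:
  assumes "q x = q y" "x \<in> topspace X" "y \<in> topspace X"
  shows "snd x = snd y"
proof (rule ccontr)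
  assume "snd x \<noteq> snd y"
  then obtain f :: "'a \<Rightarrow> bool" where f: "locally_constant (ptop T1) f" "f (snd x)" "\<not> f (snd y)"
    using profinite_space_separation[OF graph_facts(5), of "snd x" "snd y"] assms(2,3)
    unfolding topspace_X mem_Times_iff by metis
  have "locally_constant X (\<lambda>z. f (snd z))"
    unfolding X_def by (rule locally_constant_compose[OF f(1) continuous_map_snd])
  then have "compatible (\<lambda>z. f (snd z))" by (simp add: compatible_def)
  then show False using q_compatible[OF assms] f by blast
qed

lemma locally_constant_verts1: "locally_constant X (\<lambda>z. snd z \<in> verts T1)"
  unfolding X_def
  using locally_constant_compose[OF locally_constant_mem[OF open1 graph_facts(1)] continuous_map_snd] by blast

text \<open>The gluing takes place at vertices of \<open>T1\<close>, so a locally constant predicate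
  becomes compatible when it is made false there. Hence edges are not identified, and a group
  element that fixes an edge fixes both of its coordinates.\<close>

lemma q_edge_inj:
  assumes "q x = q y" "x \<in> topspace X" "y \<in> topspace X" "snd x \<in> edges T1"
  shows "x = y"
proof (rule ccontr)
  assume "x \<noteq> y"
  then obtain f :: "'b \<times> 'a \<Rightarrow> bool" where f: "locally_constant X f" "f x" "\<not> f y"
    using profinite_space_separation[OF profinite_X assms(2,3)] by metis
  have "locally_constant X (\<lambda>z. snd z \<notin> verts T1 \<and> f z)"
    using locally_constant_comp2[OF locally_constant_verts1 f(1), where h = "\<lambda>a b. \<not> a \<and> b"] .
  then have "compatible (\<lambda>z. snd z \<notin> verts T1 \<and> f z)" using s_facts(2) by (simp add: compatible_def)
  then have "(snd x \<notin> verts T1 \<and> f x) = (snd y \<notin> verts T1 \<and> f y)" by (rule q_compatible[OF assms(1-3)])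
  then show False using f assms(4) by simp
qed

text \<open>At an edge the representative is unique, and at a vertex the incidence maps are the
  identity.\<close>

lemma d_q:
  assumes "(p, x) \<in> topspace X"
  shows "d0 \<Gamma> (q (p, x)) = q (p, d0 T1 x)" "d1 \<Gamma> (q (p, x)) = q (p, d1 T1 x)"
proof -
  obtain p' x' where r: "r (q (p, x)) = (p', x')" by (cases "r (q (p, x))")
  have rX: "(p', x') \<in> topspace X" "q (p', x') = q (p, x)" using r_q[OF assms] by (simp_all add: r)
  have "x' = x" using q_snd[OF rX(2,1) assms] by simp
  have "q (p', d0 T1 x) = q (p, d0 T1 x) \<and> q (p', d1 T1 x) = q (p, d1 T1 x)"
  proof (cases "x \<in> verts T1")
    case True
    then show ?thesis using rX(2) d1_facts \<open>x' = x\<close> by simp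
  next
    case False
    then have "(p', x') = (p, x)" using q_edge_inj[OF rX(2,1) assms] \<open>x' = x\<close> rX(1) by (simp add: topspace_X)
    then show ?thesis by simp
  qed
  then show "d0 \<Gamma> (q (p, x)) = q (p, d0 T1 x)" "d1 \<Gamma> (q (p, x)) = q (p, d1 T1 x)"
    by (simp_all add: \<Gamma>_def r \<open>x' = x\<close>)
qed

lemma q_verts_iff:
  assumes "x \<in> topspace X"
  shows "q x \<in> verts \<Gamma> \<longleftrightarrow> snd x \<in> verts T1"
proof
  assume "q x \<in> verts \<Gamma>"
  then obtain y where y: "y \<in> verts T2 \<times> verts T1" "q x = q y" by (auto simp: \<Gamma>_def)
  have "y \<in> topspace X" using y(1) graph_facts by (auto simp: topspace_X)
  then show "snd x \<in> verts T1" using q_snd[OF y(2) assms] y(1) by auto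
next
  assume "snd x \<in> verts T1"
  then have "x \<in> verts T2 \<times> verts T1" using assms by (auto simp: topspace_X)
  then show "q x \<in> verts \<Gamma>" by (simp add: \<Gamma>_def)
qed

lemma points_\<Gamma>E:
  assumes "z \<in> points \<Gamma>"
  obtains p x where "(p, x) \<in> topspace X" "z = q (p, x)"
  using assms by (auto simp: points_\<Gamma>)

lemma verts_\<Gamma>E:
  assumes "z \<in> verts \<Gamma>"
  obtains p x where "p \<in> verts T2" "x \<in> verts T1" "z = q (p, x)"
  using assms by (auto simp: \<Gamma>_def)

lemma edges_\<Gamma>E:
  assumes "z \<in> edges \<Gamma>"
  obtains p x where "p \<in> verts T2" "x \<in> edges T1" "(p, x) \<in> topspace X" "z = q (p, x)"
  using assms q_verts_iff by (auto simp: points_\<Gamma> topspace_X)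

lemma edges_\<Gamma>I: "p \<in> verts T2 \<Longrightarrow> x \<in> edges T1 \<Longrightarrow> q (p, x) \<in> edges \<Gamma>"
  using q_verts_iff[of "(p, x)"] by (auto simp: points_\<Gamma> topspace_X)

text \<open>Distinct points of the quotient are separated by a compatible function, by the
  definition of \<open>rel\<close>, and such a function descends.\<close>

lemma profinite_\<Gamma>: "profinite_space (ptop \<Gamma>)"
proof (rule profinite_spaceI)
  show "compact_space (ptop \<Gamma>)"
    using image_compactin[OF _ continuous_q, of "topspace X"] profinite_space_compact[OF profinite_X]
    by (simp add: compact_space_def points_\<Gamma>)
  fix z w assume "z \<in> points \<Gamma>" "w \<in> points \<Gamma>" "z \<noteq> w"
  then obtain x y where xy: "x \<in> topspace X" "z = q x" "y \<in> topspace X" "w = q y"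
    unfolding points_\<Gamma> by blast
  then have "\<not> rel x y" using q_eq_iff \<open>z \<noteq> w\<close> by blast
  then obtain F :: "'b \<times> 'a \<Rightarrow> bool" where F: "compatible F" "F x \<noteq> F y" unfolding rel_def by blast
  then show "\<exists>F :: 'c \<Rightarrow> bool. locally_constant (ptop \<Gamma>) F \<and> F z \<noteq> F w"
    using descend[OF F(1)] xy by (intro exI[of _ "\<lambda>z. F (r z)"]) simp
qed

lemma clopen_verts_\<Gamma>: "openin (ptop \<Gamma>) (verts \<Gamma>)" "closedin (ptop \<Gamma>) (verts \<Gamma>)"
proof -
  have c: "compatible (\<lambda>z. snd z \<in> verts T1)"
    using locally_constant_verts1 by (simp add: compatible_def)
  have "z \<in> verts \<Gamma> \<longleftrightarrow> snd (r z) \<in> verts T1" if "z \<in> points \<Gamma>" for z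
  proof -
    obtain x where x: "x \<in> topspace X" "z = q x" using \<open>z \<in> points \<Gamma>\<close> by (auto simp: points_\<Gamma>)
    then show ?thesis using q_verts_iff[OF x(1)] descend(2)[OF c x(1)] by simp
  qed
  moreover have "verts \<Gamma> \<subseteq> points \<Gamma>" using graph_facts by (auto simp: \<Gamma>_def topspace_X)
  ultimately have "verts \<Gamma> = {z \<in> points \<Gamma>. snd (r z) \<in> verts T1}" by blast
  then show "openin (ptop \<Gamma>) (verts \<Gamma>)" "closedin (ptop \<Gamma>) (verts \<Gamma>)"
    using locally_constant_openin[OF descend(1)[OF c], where P = "\<lambda>b. b"]
      locally_constant_closedin[OF descend(1)[OF c], where P = "\<lambda>b. b"] by simp_all
qed

lemma profinite_graph_\<Gamma>: "profinite_graph \<Gamma>"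
proof -
  have cX: "continuous_map X X (\<lambda>z. (fst z, d (snd z)))"
    if "continuous_map (ptop T1) (ptop T1) d" for d
    unfolding X_def
    by (intro continuous_map_pairedI continuous_map_fst continuous_map_compose'[OF continuous_map_snd that])
  have "continuous_map X (ptop \<Gamma>) (\<lambda>z. d0 \<Gamma> (q z))"
    by (rule continuous_map_eq[OF continuous_map_compose'[OF cX[OF d1_facts(1)] continuous_q]])
      (simp add: d_q split_paired_all)
  moreover have "continuous_map X (ptop \<Gamma>) (\<lambda>z. d1 \<Gamma> (q z))"
    by (rule continuous_map_eq[OF continuous_map_compose'[OF cX[OF d1_facts(2)] continuous_q]])
      (simp add: d_q split_paired_all)
  moreover have "d0 \<Gamma> z \<in> verts \<Gamma>" "d1 \<Gamma> z \<in> verts \<Gamma>" if z: "z \<in> points \<Gamma>" for z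
  proof -
    obtain p x where x: "(p, x) \<in> topspace X" "z = q (p, x)" using z by (rule points_\<Gamma>E)
    then show "d0 \<Gamma> z \<in> verts \<Gamma>" "d1 \<Gamma> z \<in> verts \<Gamma>"
      using d1_facts(3,4) by (auto simp: d_q topspace_X) (auto simp: \<Gamma>_def)
  qed
  moreover have "d0 \<Gamma> v = v" "d1 \<Gamma> v = v" if v: "v \<in> verts \<Gamma>" for v
  proof -
    obtain p x where x: "p \<in> verts T2" "x \<in> verts T1" "v = q (p, x)" using v by (rule verts_\<Gamma>E)
    then have "(p, x) \<in> topspace X" using graph_facts by (auto simp: topspace_X)
    then show "d0 \<Gamma> v = v" "d1 \<Gamma> v = v" using x d1_facts(5,6) by (simp_all add: d_q)
  qed
  ultimately show ?thesis
    unfolding profinite_graph_def using profinite_\<Gamma> clopen_verts_\<Gamma>(2)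
    by (auto simp: continuous_map_in_subtopology continuous_map_\<Gamma>)
qed

section \<open>The action on the blow-up and its stabilizers\<close>

definition \<psi> :: "'g \<Rightarrow> 'c \<Rightarrow> 'c" where
  "\<psi> g = (\<lambda>z\<in>points \<Gamma>. q (act g (r z)))"

text \<open>Composition with \<open>act g\<close> preserves compatible functions, because the
  incidence maps of \<open>T2\<close> and the map \<open>s\<close> are equivariant. So the diagonal
  action respects \<open>rel\<close>.\<close>

lemma \<psi>_q:
  assumes g: "g \<in> carrier G" and x: "x \<in> topspace X"
  shows "\<psi> g (q x) = q (act g x)"
proof -
  have rx: "r (q x) \<in> topspace X" "q (r (q x)) = q x" using r_q[OF x] by auto
  have "rel (act g (r (q x))) (act g x)"
    unfolding rel_def
  proof (intro allI impI)
    fix F :: "'b \<times> 'a \<Rightarrow> bool" assume F: "compatible F"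
    have "compatible (\<lambda>z. F (act g z))"
      unfolding compatible_def
    proof (intro conjI ballI)
      show "locally_constant X (\<lambda>z. F (act g z))"
        using F locally_constant_compose[OF _ continuous_act_g[OF g]] unfolding compatible_def by blast
      fix e assume e: "e \<in> edges T2"
      have "F (d0 T2 (\<phi>2 g e), s (\<phi>2 g e)) = F (d1 T2 (\<phi>2 g e), s (\<phi>2 g e))"
        using F action_edges2[OF g e] unfolding compatible_def by blast
      then show "F (act g (d0 T2 e, s e)) = F (act g (d1 T2 e, s e))"
        using e g action_d(3,4) s_equivariant by (simp add: act_def)
    qed
    then show "F (act g (r (q x))) = F (act g x)" by (rule q_compatible[OF rx(2,1) x])
  qed
  then have "q (act g (r (q x))) = q (act g x)" using q_eq_iff act_X g rx x by blast
  then show ?thesis using x by (simp add: \<psi>_def points_\<Gamma>)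
qed

lemma graph_action_\<Gamma>: "graph_action G \<Gamma> \<psi>"
proof (rule graph_actionI)
  show "group G" by (rule is_group)
  show "\<psi> g \<in> extensional (points \<Gamma>)" for g by (simp add: \<psi>_def)
  show "\<psi> g z \<in> points \<Gamma>" if a: "g \<in> carrier G" "z \<in> points \<Gamma>" for g z
  proof -
    obtain x where x: "x \<in> topspace X" "z = q x" using a(2) unfolding points_\<Gamma> by blast
    show ?thesis
      unfolding x(2) \<psi>_q[OF a(1) x(1)] points_\<Gamma> using act_X[OF a(1) x(1)] by (rule imageI)
  qed
  show "\<psi> (g \<otimes> h) z = \<psi> g (\<psi> h z)" if a: "g \<in> carrier G" "h \<in> carrier G" "z \<in> points \<Gamma>" for g h z
  proof -
    obtain x where x: "x \<in> topspace X" "z = q x" using a(3) unfolding points_\<Gamma> by blast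
    show ?thesis
      using \<psi>_q[OF m_closed[OF a(1,2)] x(1)] \<psi>_q[OF a(2) x(1)] \<psi>_q[OF a(1) act_X[OF a(2) x(1)]]
        act_mult[OF a(1,2) x(1)]
      by (simp add: x(2))
  qed
  show "\<psi> \<one> z = z" if a: "z \<in> points \<Gamma>" for z
  proof -
    obtain x where x: "x \<in> topspace X" "z = q x" using a unfolding points_\<Gamma> by blast
    show ?thesis using \<psi>_q[OF one_closed x(1)] act_one[OF x(1)] by (simp add: x(2))
  qed
  show "d0 \<Gamma> (\<psi> g z) = \<psi> g (d0 \<Gamma> z)" "d1 \<Gamma> (\<psi> g z) = \<psi> g (d1 \<Gamma> z)" if g: "g \<in> carrier G" and z: "z \<in> points \<Gamma>" for g z
  proof -
    obtain p x where x: "(p, x) \<in> topspace X" "z = q (p, x)" using z by (rule points_\<Gamma>E)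
    have a: "(\<phi>2 g p, \<phi>1 g x) \<in> topspace X" using act_X[OF g x(1)] by (simp add: act_def)
    have b: "(p, d0 T1 x) \<in> topspace X" "(p, d1 T1 x) \<in> topspace X"
      using x(1) d1_facts(3,4) graph_facts by (auto simp: topspace_X)
    have xp: "x \<in> points T1" using x(1) by (simp add: topspace_X)
    show "d0 \<Gamma> (\<psi> g z) = \<psi> g (d0 \<Gamma> z)" "d1 \<Gamma> (\<psi> g z) = \<psi> g (d1 \<Gamma> z)"
      using \<psi>_q[OF g x(1)] \<psi>_q[OF g b(1)] \<psi>_q[OF g b(2)] d_q[OF a] d_q[OF x(1)] action_d(1,2)[OF g xp]
      by (simp_all add: x(2) act_def)
  qed
  show "continuous_map (prod_topology (gtop G) (ptop \<Gamma>)) (ptop \<Gamma>) (\<lambda>(g, z). \<psi> g z)"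
  proof (rule continuous_map_closed_compose)
    let ?q = "\<lambda>z. (fst z, q (snd z))"
    show "continuous_map (prod_topology (gtop G) X) (prod_topology (gtop G) (ptop \<Gamma>)) ?q"
      by (intro continuous_map_pairedI continuous_map_fst continuous_map_compose'[OF continuous_map_snd continuous_q])
    show "compact_space (prod_topology (gtop G) X)"
      using compact_gtop profinite_space_compact[OF profinite_X] by (simp add: compact_space_prod_topology)
    show "Hausdorff_space (prod_topology (gtop G) (ptop \<Gamma>))"
      using profinite_space_Hausdorff[OF profinite_space_prod[OF profinite_gtop profinite_\<Gamma>]] .
    show "?q ` topspace (prod_topology (gtop G) X) = topspace (prod_topology (gtop G) (ptop \<Gamma>))"
      by (force simp: points_\<Gamma>)
    show "continuous_map (prod_topology (gtop G) X) (ptop \<Gamma>) (\<lambda>z. (\<lambda>(g, z). \<psi> g z) (?q z))"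
      by (rule continuous_map_eq[OF continuous_map_compose'[OF continuous_act continuous_q]])
        (auto simp: \<psi>_q)
  qed
qed

lemma edge_stabilizer:
  assumes "g \<in> carrier G" "p \<in> verts T2" "x \<in> edges T1" "\<psi> g (q (p, x)) = q (p, x)"
  shows "\<phi>2 g p = p" "\<phi>1 g x = x"
proof -
  have X: "(p, x) \<in> topspace X" using assms by (simp add: topspace_X)
  have "(p, x) = act g (p, x)"
    by (rule q_edge_inj[OF _ X act_X[OF assms(1) X]]) (use assms \<psi>_q[OF assms(1) X] in simp_all)
  then show "\<phi>2 g p = p" "\<phi>1 g x = x" by (simp_all add: act_def)
qed

lemma vertex_stabilizer:
  assumes "g \<in> carrier G" "p \<in> verts T2" "x \<in> verts T1" "\<psi> g (q (p, x)) = q (p, x)"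
  shows "\<phi>1 g x = x"
proof -
  have X: "(p, x) \<in> topspace X" using assms graph_facts by (auto simp: topspace_X)
  have "snd (act g (p, x)) = snd (p, x)"
    by (rule q_snd[OF _ act_X[OF assms(1) X] X]) (use assms \<psi>_q[OF assms(1) X] in simp)
  then show ?thesis by (simp add: act_def)
qed

text \<open>A function with zero coboundary modulo \<open>n\<close> is constant on every copy of
  \<open>T1\<close>, and the glued vertices carry the constant from copy to copy along
  \<open>T2\<close>. For the existence of potentials, one is taken on every copy; their mismatch at
  the glued points is a function on the edges of \<open>T2\<close>, and a potential of it on
  \<open>T2\<close> corrects them.\<close>

lemma acyclic_\<Gamma>:
  assumes T1: "acyclic_mod n T1" and T2: "acyclic_mod n T2"
  shows "acyclic_mod n \<Gamma>"
  unfolding acyclic_mod_def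
proof (intro conjI allI impI ballI, elim conjE)
  fix F :: "'c \<Rightarrow> int" and v w
  assume F: "locally_constant (ptop \<Gamma>) F" "\<forall>e\<in>edges \<Gamma>. F (d1 \<Gamma> e) mod int n = F (d0 \<Gamma> e) mod int n"
    and vw: "v \<in> verts \<Gamma>" "w \<in> verts \<Gamma>"
  have FX: "locally_constant X (\<lambda>x. F (q x))" using F(1) by (simp add: locally_constant_\<Gamma>)
  have F1: "F (q (p, x)) mod int n = F (q (p, y)) mod int n"
    if p: "p \<in> verts T2" and x: "x \<in> verts T1" and y: "y \<in> verts T1" for p x y
  proof -
    have "continuous_map (ptop T1) X (\<lambda>x. (p, x))"
      unfolding X_def using p graph_facts(4)
      by (intro continuous_map_pairedI continuous_map_id[unfolded id_def]) auto
    then have "locally_constant (ptop T1) (\<lambda>x. F (q (p, x)))"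
      by (rule locally_constant_compose[OF FX])
    moreover have "\<forall>e\<in>edges T1. F (q (p, d1 T1 e)) mod int n = F (q (p, d0 T1 e)) mod int n"
    proof
      fix e assume e: "e \<in> edges T1"
      have "(p, e) \<in> topspace X" using e p by (simp add: topspace_X)
      then show "F (q (p, d1 T1 e)) mod int n = F (q (p, d0 T1 e)) mod int n"
        using F(2) edges_\<Gamma>I[OF p e] d_q[of p e] by metis
    qed
    ultimately show ?thesis
      using conjunct1[OF T1[unfolded acyclic_mod_def], rule_format, OF conjI, of "\<lambda>x. F (q (p, x))" x y] x y by blast
  qed
  obtain w0 where w0: "w0 \<in> verts T1" using nonempty1 by blast
  \<comment> \<open>By \<open>F1\<close> the residue on a copy can be read off at any vertex, here
    at \<open>w0\<close>.\<close>
  define P where "P = (\<lambda>p. if p \<in> verts T2 then F (q (p, w0)) else 0)"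
  have "continuous_map (vtop T2) X (\<lambda>p. (p, w0))"
    unfolding X_def using w0 graph_facts(3)
    by (intro continuous_map_pairedI continuous_map_id[unfolded id_def]) auto
  then have "locally_constant (vtop T2) (\<lambda>p. F (q (p, w0)))"
    by (rule locally_constant_compose[OF FX])
  then have "locally_constant (ptop T2) P"
    unfolding P_def by (intro locally_constant_extend open2 graph_facts(2)) simp_all
  moreover have "\<forall>e\<in>edges T2. P (d1 T2 e) mod int n = P (d0 T2 e) mod int n"
  proof
    fix e assume e: "e \<in> edges T2"
    have se: "s e \<in> verts T1" "d0 T2 e \<in> verts T2" "d1 T2 e \<in> verts T2" using e s_facts(2) d2_facts by auto
    have "F (q (d1 T2 e, w0)) mod int n = F (q (d1 T2 e, s e)) mod int n" by (rule F1[OF se(3) w0 se(1)])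
    also have "\<dots> = F (q (d0 T2 e, s e)) mod int n" by (simp only: q_glue[OF e])
    also have "\<dots> = F (q (d0 T2 e, w0)) mod int n" by (rule F1[OF se(2) se(1) w0])
    finally show "P (d1 T2 e) mod int n = P (d0 T2 e) mod int n" using se by (simp add: P_def)
  qed
  ultimately have P: "P p mod int n = P p' mod int n" if "p \<in> verts T2" "p' \<in> verts T2" for p p'
    using conjunct1[OF T2[unfolded acyclic_mod_def], rule_format, OF conjI, of P p p'] that by blast
  obtain p x where px: "p \<in> verts T2" "x \<in> verts T1" "v = q (p, x)" using vw(1) by (rule verts_\<Gamma>E)
  obtain p' x' where px': "p' \<in> verts T2" "x' \<in> verts T1" "w = q (p', x')" using vw(2) by (rule verts_\<Gamma>E)
  show "F v mod int n = F w mod int n"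
    using F1[OF px(1,2) w0] F1[OF px'(1,2) w0] P[OF px(1) px'(1)] px px' by (simp add: P_def)
next
  fix f :: "'c \<Rightarrow> int" assume f: "locally_constant (ptop \<Gamma>) f"
  have fX: "locally_constant X (\<lambda>x. f (q x))" using f by (simp add: locally_constant_\<Gamma>)
  define k where "k = (\<lambda>p. \<lambda>x\<in>points T1. f (q (p, x)))"
  have lck: "locally_constant (vtop T2) k"
    unfolding k_def using locally_constant_curry[OF profinite_space_compact[OF graph_facts(5)] fX[unfolded X_def]] .
  have "\<exists>F. locally_constant (ptop T1) h \<longrightarrow> locally_constant (ptop T1) (F :: 'a \<Rightarrow> int) \<and>
      (\<forall>e\<in>edges T1. (F (d1 T1 e) - F (d0 T1 e)) mod int n = h e mod int n)" for h :: "'a \<Rightarrow> int"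
    using conjunct2[OF T1[unfolded acyclic_mod_def], rule_format, of h] by blast
  \<comment> \<open>A potential is chosen for each function on \<open>T1\<close> and not for each
    copy. So it depends on \<open>p\<close> through \<open>k p\<close> alone, which is locally
    constant in \<open>p\<close>.\<close>
  then obtain Pot :: "('a \<Rightarrow> int) \<Rightarrow> 'a \<Rightarrow> int" where
    Pot: "\<And>h. locally_constant (ptop T1) h \<Longrightarrow> locally_constant (ptop T1) (Pot h)"
    "\<And>h e. locally_constant (ptop T1) h \<Longrightarrow> e \<in> edges T1 \<Longrightarrow> (Pot h (d1 T1 e) - Pot h (d0 T1 e)) mod int n = h e mod int n"
    by metis
  have kp: "locally_constant (ptop T1) (k p)" if p: "p \<in> verts T2" for p
  proof -
    have "continuous_map (ptop T1) X (\<lambda>x. (p, x))"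
      unfolding X_def using p graph_facts(4)
      by (intro continuous_map_pairedI continuous_map_id[unfolded id_def]) auto
    then have "locally_constant (ptop T1) (\<lambda>x. f (q (p, x)))" by (rule locally_constant_compose[OF fX])
    then show ?thesis by (rule locally_constant_cong) (simp add: k_def)
  qed
  define F0 where "F0 = (\<lambda>z. Pot (k (fst z)) (snd z))"
  have F0: "locally_constant X F0"
    unfolding F0_def X_def
    by (rule locally_constant_uncurry[OF lck]) (use Pot(1) kp vtop2(2) in simp)
  \<comment> \<open>The mismatch, at the vertex \<open>s e\<close>, between the potentials on the
    two copies that \<open>e\<close> glues.\<close>
  define h where "h = (\<lambda>e. F0 (d0 T2 e, s e) - F0 (d1 T2 e, s e))"
  have "locally_constant (ptop T2) (\<lambda>e. F0 (d0 T2 e, s e))"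
    by (rule locally_constant_compose[OF F0]) (unfold X_def, intro continuous_map_pairedI d2_facts s_facts)
  moreover have "locally_constant (ptop T2) (\<lambda>e. F0 (d1 T2 e, s e))"
    by (rule locally_constant_compose[OF F0]) (unfold X_def, intro continuous_map_pairedI d2_facts s_facts)
  ultimately have "locally_constant (ptop T2) h"
    unfolding h_def by (rule locally_constant_comp2)
  then obtain P :: "'b \<Rightarrow> int" where P: "locally_constant (ptop T2) P"
    "\<And>e. e \<in> edges T2 \<Longrightarrow> (P (d1 T2 e) - P (d0 T2 e)) mod int n = h e mod int n"
    using conjunct2[OF T2[unfolded acyclic_mod_def], rule_format, of h] by blast
  \<comment> \<open>Shifting the copy at \<open>p\<close> by \<open>P p\<close> removes the
    mismatch. Compatibility demands equality and not just congruence, hence the reduction modulo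
    \<open>n\<close>; edge points receive the value 0.\<close>
  define F where "F = (\<lambda>z. if snd z \<in> verts T1 then (F0 z + P (fst z)) mod int n else 0)"
  have "locally_constant X (\<lambda>z. P (fst z))"
    unfolding X_def by (rule locally_constant_compose[OF locally_constant_subtopology[OF P(1)] continuous_map_fst])
  then have "locally_constant X (\<lambda>z. (F0 z + P (fst z)) mod int n)"
    using locally_constant_comp2[OF F0, where h = "\<lambda>a b. (a + b) mod int n"] by blast
  then have lcF: "locally_constant X F"
    unfolding F_def using locally_constant_comp2[OF locally_constant_verts1, where h = "\<lambda>a b. if a then b else 0"] by blast
  have compat: "compatible F"
    unfolding compatible_def
  proof (intro conjI ballI lcF)
    fix e assume e: "e \<in> edges T2"
    have "(P (d1 T2 e) - P (d0 T2 e)) mod int n = (F0 (d0 T2 e, s e) - F0 (d1 T2 e, s e)) mod int n"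
      using P(2)[OF e] by (simp add: h_def)
    then have "(F0 (d0 T2 e, s e) + P (d0 T2 e)) mod int n = (F0 (d1 T2 e, s e) + P (d1 T2 e)) mod int n"
      by (simp add: mod_eq_dvd_iff) (metis add_diff_add diff_diff_eq2 diff_add_eq add.commute dvd_minus_iff minus_diff_eq)
    then show "F (d0 T2 e, s e) = F (d1 T2 e, s e)" using e s_facts(2) by (simp add: F_def)
  qed
  show "\<exists>F :: 'c \<Rightarrow> int. locally_constant (ptop \<Gamma>) F \<and>
      (\<forall>e\<in>edges \<Gamma>. (F (d1 \<Gamma> e) - F (d0 \<Gamma> e)) mod int n = f e mod int n)"
  proof (intro exI[of _ "\<lambda>z. F (r z)"] conjI ballI)
    show "locally_constant (ptop \<Gamma>) (\<lambda>z. F (r z))" by (rule descend(1)[OF compat])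
    fix z assume "z \<in> edges \<Gamma>"
    then obtain p x where px: "p \<in> verts T2" "x \<in> edges T1" "(p, x) \<in> topspace X" "z = q (p, x)" by (rule edges_\<Gamma>E)
    have dx: "d0 T1 x \<in> verts T1" "d1 T1 x \<in> verts T1" using px(2) d1_facts by auto
    then have dX: "(p, d0 T1 x) \<in> topspace X" "(p, d1 T1 x) \<in> topspace X"
      using px(1) graph_facts by (auto simp: topspace_X)
    have "(F (r (d1 \<Gamma> z)) - F (r (d0 \<Gamma> z))) mod int n = (F (p, d1 T1 x) - F (p, d0 T1 x)) mod int n"
      using d_q[OF px(3)] descend(2)[OF compat] dX by (simp add: px(4))
    also have "\<dots> = (F0 (p, d1 T1 x) - F0 (p, d0 T1 x)) mod int n"
      using dx by (simp add: F_def mod_simps)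
    also have "\<dots> = k p x mod int n" using Pot(2)[OF kp[OF px(1)] px(2)] by (simp add: F0_def)
    also have "\<dots> = f z mod int n" using px(2) by (simp add: k_def px(4))
    finally show "(F (r (d1 \<Gamma> z)) - F (r (d0 \<Gamma> z))) mod int n = f z mod int n" .
  qed
qed

lemma pro_class_tree_\<Gamma>:
  assumes "\<And>n. n \<in> class_moduli \<C> \<Longrightarrow> acyclic_mod n T1" "\<And>n. n \<in> class_moduli \<C> \<Longrightarrow> acyclic_mod n T2"
  shows "pro_class_tree \<C> \<Gamma>"
proof -
  have "verts \<Gamma> \<noteq> {}" using nonempty1 nonempty2 by (simp add: \<Gamma>_def)
  then interpret clopen_graph \<C> \<Gamma>
    using profinite_graph_\<Gamma> clopen_verts_\<Gamma>(1) acyclic_\<Gamma> assms by unfold_locales auto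
  show ?thesis by (rule pro_class_tree)
qed

end

text \<open>The hypothesis on \<open>G\<close> speaks of trees over \<open>'g set set\<close>. For
  infinite \<open>'g\<close> this type is infinite, so it absorbs the finite type of tags and the
  product of any two sets of at most its own size.\<close>

lemma inj_pairs_of_cosets:
  includes cardinal_syntax
  assumes "infinite (UNIV :: 'g set)"
  obtains j :: "(tag \<times> 'g set) \<times> (tag \<times> 'g set) \<Rightarrow> 'g set set" where "inj j"
proof -
  let ?B = "UNIV :: 'g set set set"
  have inf: "infinite (UNIV :: 'g set set)"
    using assms finite_imageD[of "\<lambda>x :: 'g. {x}" UNIV] by (metis finite_subset inj_singleton subset_UNIV)
  have infB: "infinite ?B"
    using inf finite_imageD[of "\<lambda>x :: 'g set. {x}" UNIV] by (metis finite_subset inj_singleton subset_UNIV)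
  have "UNIV = {LeftV, RightV, Edge}" using tag.exhaust by blast
  then have "finite (UNIV :: tag set)" by (metis finite.emptyI finite.insertI)
  then obtain k :: "tag \<Rightarrow> 'g set set" where "inj k"
    using finite_inj_into_infinite[OF _ infB] by metis
  then have tag: "|UNIV :: tag set| \<le>o |?B|" by (rule card_of_ordLeqI) simp
  have "inj (\<lambda>X :: 'g set. {X})" by (simp add: inj_on_def)
  then have set: "|UNIV :: 'g set set| \<le>o |?B|" by (rule card_of_ordLeqI) simp
  have infF: "infinite (Field |?B| )" using infB by (simp add: Field_card_of)
  have prod: "|(UNIV :: tag set) \<times> (UNIV :: 'g set set)| \<le>o |?B|"
    by (rule card_of_Times_ordLeq_infinite_Field[OF infF tag set card_of_Card_order])
  have "|((UNIV :: tag set) \<times> (UNIV :: 'g set set)) \<times> ((UNIV :: tag set) \<times> (UNIV :: 'g set set))| \<le>o |?B|"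
    by (rule card_of_Times_ordLeq_infinite_Field[OF infF prod prod card_of_Card_order])
  then obtain j :: "(tag \<times> 'g set) \<times> (tag \<times> 'g set) \<Rightarrow> 'g set set" where
    "inj_on j (((UNIV :: tag set) \<times> (UNIV :: 'g set set)) \<times> ((UNIV :: tag set) \<times> (UNIV :: 'g set set)))"
    unfolding card_of_ordLeq[symmetric] by blast
  then show ?thesis using that by simp
qed

theorem theorem1p1:
  fixes \<C> :: "nat monoid \<Rightarrow> bool"
    and G :: "'g topgroup"
  assumes "closed_class \<C>"
    and "pro_class_group \<C> G"
    and "\<And>(\<Gamma> :: 'g set set pgraph) \<phi>.
           pro_class_tree \<C> \<Gamma> \<Longrightarrow> graph_action G \<Gamma> \<phi> \<Longrightarrow> trivial_edge_stabilizers G \<Gamma> \<phi> \<Longrightarrow>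
           global_fixed_point G \<Gamma> \<phi>"
  shows "\<not> (\<exists>S\<^sub>1 S\<^sub>2. hyperbolic_elliptic_pair \<C> G S\<^sub>1 S\<^sub>2)"
proof
  note closed = assms(1) and pro_class = assms(2) and fixed_point = assms(3)
  assume "\<exists>S\<^sub>1 S\<^sub>2. hyperbolic_elliptic_pair \<C> G S\<^sub>1 S\<^sub>2"
  then obtain S1 S2 c1 c2 where S: "cyclic_splitting \<C> G S1" "cyclic_splitting \<C> G S2"
    and c: "c1 \<in> carrier G" "c2 \<in> carrier G"
    and C1: "edge_group S1 = top_generate G {c1}" and C2: "edge_group S2 = top_generate G {c2}"
    and hyp: "hyperbolic G (std_tree G S2) (std_action G S2) c1"
    and ell: "elliptic (std_tree G S1) (std_action G S1) c2"
    unfolding hyperbolic_elliptic_pair_def by blast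
  interpret G: profinite_topgroup G
    using pro_class by (simp add: profinite_topgroup_def profinite_topgroup_axioms_def pro_class_group_def profinite_group_def)
  define T1 T2 where "T1 = std_tree G S1" and "T2 = std_tree G S2"
  obtain I1 H1 i1 t1 where cg1: "coset_graph G T1 I1 H1 i1 t1" and H1: "H1 Edge = edge_group S1"
    unfolding T1_def by (rule G.cyclic_splitting_coset_graph[OF S(1)])
  obtain I2 H2 i2 t2 where cg2: "coset_graph G T2 I2 H2 i2 t2" and H2: "H2 Edge = edge_group S2"
    unfolding T2_def by (rule G.cyclic_splitting_coset_graph[OF S(2)])
  interpret T1: coset_graph G T1 I1 H1 i1 t1 by (rule cg1)
  interpret T2: coset_graph G T2 I2 H2 i2 t2 by (rule cg2)
  have act: "std_action G S1 = T1.vertex_action" "std_action G S2 = T2.vertex_action"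
  proof -
    show "std_action G S1 = T1.vertex_action"
      by (rule ext) (simp only: std_action_def T1.vertex_action_def, simp only: T1_def)
    show "std_action G S2 = T2.vertex_action"
      by (rule ext) (simp only: std_action_def T2.vertex_action_def, simp only: T2_def)
  qed

  \<comment> \<open>The infinite edge group makes \<open>G\<close> infinite; this leaves room for
    the finite test groups and gives a nontrivial element, hence a modulus at least 2.\<close>
  have "infinite_cyclic G (edge_group S1)" using S(1) by (cases S1) auto
  then have "infinite (edge_group S1)" by (simp add: infinite_cyclic_def)
  moreover have "edge_group S1 \<subseteq> carrier G"
    using subgroup.subset[OF T1.subgroup_H[OF T1.I(1)]] H1 by simp
  ultimately have infG: "infinite (carrier G)" using finite_subset by blast
  then obtain y where y: "y \<in> carrier G" "y \<noteq> \<one>\<^bsub>G\<^esub>"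
    by (metis G.one_closed finite.emptyI finite.insertI finite_subset insertI1 subsetI)
  obtain n where n: "n \<in> class_moduli \<C>" "n \<ge> 2"
    by (rule G.exists_modulus_infinite[OF pro_class closed y])
  have sg: "splitting_group G \<C> m" if "m \<in> class_moduli \<C>" for m
    using that closed pro_class infG G.profinite_topgroup_axioms
    by (simp add: splitting_group_def splitting_group_axioms_def)
  have acyclic: "acyclic_mod m T1" "acyclic_mod m T2" if "m \<in> class_moduli \<C>" for m
    using splitting_group.acyclic_mod_std_tree[OF sg[OF that]] S unfolding T1_def T2_def by blast+

  obtain v where v: "v \<in> verts T1" "T1.vertex_action c2 v = v"
    using ell unfolding elliptic_def act T1_def[symmetric] by blast
  have vp: "v \<in> points T1" using v(1) T1.verts_iff by blast
  have v_fixed: "T1.vertex_action h v = v" if "h \<in> H2 Edge" for h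
    using G.fixed_by_top_generate[OF T1.graph_action_T profinite_space_Hausdorff[OF T1.profinite_T] vp c(2) v(2)]
      that by (simp add: H2 C2)
  have H2_sub: "subgroup (H2 Edge) G" using T2.subgroup_H T2.I(1) by blast
  \<comment> \<open>The attaching map \<open>gC2 \<mapsto> gv\<close> is well defined because the
    closed subgroup generated by \<open>c2\<close> fixes \<open>v\<close>.\<close>
  obtain F where F: "\<And>g. g \<in> carrier G \<Longrightarrow> F (g <#\<^bsub>G\<^esub> H2 Edge) = T1.vertex_action g v"
  proof (rule G.l_coset_descend[OF H2_sub])
    fix g h assume gh: "g \<in> carrier G" "h \<in> H2 Edge"
    have "h \<in> carrier G" using gh(2) subgroup.subset[OF H2_sub] by blast
    then show "T1.vertex_action (g \<otimes>\<^bsub>G\<^esub> h) v = T1.vertex_action g v"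
      using T1.vertex_action_mult[OF gh(1) _ vp] v_fixed[OF gh(2)] by simp
  qed (rule that)
  \<comment> \<open>The attaching map is to be continuous on all of \<open>T2\<close>, so the
    vertices are given the constant value \<open>v\<close>.\<close>
  define s where "s = (\<lambda>(i, Y). if i = Edge then F Y else v)"
  have s_edge: "s (Edge, g <#\<^bsub>G\<^esub> H2 Edge) = T1.vertex_action g v" if "g \<in> carrier G" for g
    using F[OF that] by (simp add: s_def)
  have orbit: "continuous_map (gtop G) (vtop T1) (\<lambda>g. T1.vertex_action g v)"
  proof -
    have p: "continuous_map (gtop G) (prod_topology (gtop G) (ptop T1)) (\<lambda>g. (g, v))"
      using vp by (intro continuous_map_pairedI continuous_map_id[unfolded id_def]) simp
    have "continuous_map (gtop G) (ptop T1) (\<lambda>g. T1.vertex_action g v)"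
      using continuous_map_compose'[OF p T1.continuous_vertex_action] by simp
    then show ?thesis
      using T1.vertex_action_verts[OF _ v(1)] by (auto simp: continuous_map_in_subtopology)
  qed
  have s_cont: "continuous_map (ptop T2) (vtop T1) s"
    unfolding T2.continuous_map_T
  proof
    fix i assume "i \<in> I2"
    show "continuous_map (gtop G) (vtop T1) (\<lambda>g. s (i, g <#\<^bsub>G\<^esub> H2 i))"
    proof (cases "i = Edge")
      case True
      show ?thesis
        by (rule continuous_map_eq[OF orbit]) (simp add: True s_edge)
    next
      case False
      then show ?thesis using v(1) vp by (simp add: s_def)
    qed
  qed
  have s_equi: "s (T2.vertex_action g e) = T1.vertex_action g (s e)" if g: "g \<in> carrier G" and e: "e \<in> edges T2" for g e
  proof -
    obtain h where h: "h \<in> carrier G" "e = (Edge, h <#\<^bsub>G\<^esub> H2 Edge)" using e by (rule T2.edgesE)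
    then show ?thesis
      using g T2.vertex_action_point[OF T2.I(1) g h(1)] T1.vertex_action_mult[OF g h(1) vp] s_edge[OF h(1)] s_edge[of "g \<otimes>\<^bsub>G\<^esub> h"]
      by simp
  qed
  have "infinite (UNIV :: 'g set)" using infG rev_finite_subset by blast
  then obtain j :: "(tag \<times> 'g set) \<times> (tag \<times> 'g set) \<Rightarrow> 'g set set" where j: "inj j"
    by (rule inj_pairs_of_cosets)
  have ne: "verts T2 \<noteq> {}"
  proof -
    have "d0 T2 (Edge, \<one>\<^bsub>G\<^esub> <#\<^bsub>G\<^esub> H2 Edge) = (LeftV, \<one>\<^bsub>G\<^esub> <#\<^bsub>G\<^esub> H2 LeftV)"
      by (rule T2.d_edge(1)) simp
    have "(LeftV, \<one>\<^bsub>G\<^esub> <#\<^bsub>G\<^esub> H2 LeftV) \<in> verts T2"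
      unfolding T2.verts_iff using T2.pointsI[OF T2.I(2), of "\<one>\<^bsub>G\<^esub>"] by simp
    then show ?thesis by blast
  qed
  interpret B: blow_up G T1 T2 T1.vertex_action T2.vertex_action s j
    using T1.profinite_graph_T T2.profinite_graph_T T1.clopen_verts(1) T2.clopen_verts(1) v(1) ne
      T1.graph_action_T T2.graph_action_T s_cont s_equi j
    by unfold_locales blast+
  have "pro_class_tree \<C> B.\<Gamma>" by (rule B.pro_class_tree_\<Gamma>) (use acyclic in blast)+
  moreover have "trivial_edge_stabilizers G B.\<Gamma> B.\<psi>"
    unfolding trivial_edge_stabilizers_def
  proof
    fix z assume "z \<in> edges B.\<Gamma>"
    then obtain p e where pe: "p \<in> verts T2" "e \<in> edges T1" "z = B.q (p, e)" by (rule B.edges_\<Gamma>E)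
    obtain h where h: "h \<in> carrier G" "e = (Edge, h <#\<^bsub>G\<^esub> H1 Edge)" using pe(2) by (rule T1.edgesE)
    have H1_sub: "subgroup (H1 Edge) G" using T1.subgroup_H T1.I(1) by blast
    have pp: "p \<in> points T2" using pe(1) T2.verts_iff by blast
    \<comment> \<open>An element that fixes the edge \<open>hC1\<close> of \<open>T1\<close> has the
      form \<open>hkh\<inverse>\<close> with \<open>k\<close> in \<open>C1\<close>. If it also fixes
      \<open>p\<close>, then \<open>k\<close> fixes the translate \<open>h\<inverse>p\<close>, and
      hyperbolicity of \<open>c1\<close> forces \<open>k = \<one>\<close>.\<close>
    have "g = \<one>\<^bsub>G\<^esub>" if g: "g \<in> carrier G" "B.\<psi> g z = z" for g
    proof -
      have gp: "T2.vertex_action g p = p" and ge: "T1.vertex_action g e = e"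
        using B.edge_stabilizer[OF g(1) pe(1,2)] g(2) pe(3) by blast+
      have "h <#\<^bsub>G\<^esub> H1 Edge = (g \<otimes>\<^bsub>G\<^esub> h) <#\<^bsub>G\<^esub> H1 Edge"
        using ge T1.vertex_action_point[OF T1.I(1) g(1) h(1)] h(2) by simp
      then obtain k where k: "k \<in> H1 Edge" "g \<otimes>\<^bsub>G\<^esub> h = h \<otimes>\<^bsub>G\<^esub> k"
        using G.l_coset_eqD[OF H1_sub h(1)] g(1) h(1) by (metis G.m_closed)
      have kG: "k \<in> carrier G" using k(1) subgroup.subset[OF H1_sub] by blast
      let ?p = "T2.vertex_action (inv\<^bsub>G\<^esub> h) p"
      have "T2.vertex_action k ?p = ?p"
      proof -
        have "k \<otimes>\<^bsub>G\<^esub> inv\<^bsub>G\<^esub> h = inv\<^bsub>G\<^esub> h \<otimes>\<^bsub>G\<^esub> g"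
        proof -
          have "inv\<^bsub>G\<^esub> h \<otimes>\<^bsub>G\<^esub> (g \<otimes>\<^bsub>G\<^esub> h) \<otimes>\<^bsub>G\<^esub> inv\<^bsub>G\<^esub> h = inv\<^bsub>G\<^esub> h \<otimes>\<^bsub>G\<^esub> (h \<otimes>\<^bsub>G\<^esub> k) \<otimes>\<^bsub>G\<^esub> inv\<^bsub>G\<^esub> h"
            by (simp only: k(2))
          moreover have "inv\<^bsub>G\<^esub> h \<otimes>\<^bsub>G\<^esub> (g \<otimes>\<^bsub>G\<^esub> h) \<otimes>\<^bsub>G\<^esub> inv\<^bsub>G\<^esub> h = inv\<^bsub>G\<^esub> h \<otimes>\<^bsub>G\<^esub> g"
            using g(1) h(1) by (simp add: G.m_assoc)
          moreover have "inv\<^bsub>G\<^esub> h \<otimes>\<^bsub>G\<^esub> (h \<otimes>\<^bsub>G\<^esub> k) \<otimes>\<^bsub>G\<^esub> inv\<^bsub>G\<^esub> h = k \<otimes>\<^bsub>G\<^esub> inv\<^bsub>G\<^esub> h"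
            using kG h(1) by (simp add: G.m_assoc[symmetric])
          ultimately show ?thesis by simp
        qed
        then show ?thesis
          using T2.vertex_action_mult[OF kG _ pp, of "inv\<^bsub>G\<^esub> h"] T2.vertex_action_mult[OF _ g(1) pp, of "inv\<^bsub>G\<^esub> h"] gp h(1)
          by simp
      qed
      moreover have "?p \<in> points T2" using T2.vertex_action_points pp h(1) by simp
      moreover have "k \<in> top_generate G {c1}" using k(1) by (simp add: H1 C1)
      ultimately have "k = \<one>\<^bsub>G\<^esub>"
        using hyp unfolding hyperbolic_def act T2_def[symmetric] by blast
      then have "g \<otimes>\<^bsub>G\<^esub> h = h" using k(2) h(1) by simp
      then show "g = \<one>\<^bsub>G\<^esub>" using g(1) h(1) by simp
    qed
    moreover have "\<one>\<^bsub>G\<^esub> \<in> stabilizer G B.\<psi> z"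
    proof -
      have "(p, e) \<in> topspace B.X" using pe by (simp add: B.topspace_X)
      then have "B.\<psi> \<one>\<^bsub>G\<^esub> z = z" using B.\<psi>_q[OF G.one_closed] B.act_one pe(3) by simp
      then show ?thesis by (simp add: stabilizer_def)
    qed
    ultimately show "stabilizer G B.\<psi> z = {\<one>\<^bsub>G\<^esub>}" by (auto simp: stabilizer_def)
  qed
  ultimately have "global_fixed_point G B.\<Gamma> B.\<psi>"
    using fixed_point B.graph_action_\<Gamma> by blast
  then obtain z where z: "z \<in> verts B.\<Gamma>" "\<And>g. g \<in> carrier G \<Longrightarrow> B.\<psi> g z = z"
    unfolding global_fixed_point_def by blast
  obtain p x where px: "p \<in> verts T2" "x \<in> verts T1" "z = B.q (p, x)" using z(1) by (rule B.verts_\<Gamma>E)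
  show False
  proof (rule splitting_group.no_fixed_vertex[OF sg[OF n(1)] S(1) n(2)])
    show "x \<in> verts (std_tree G S1)" using px(2) by (simp only: T1_def)
    show "std_action G S1 g x = x" if "g \<in> carrier G" for g
      using B.vertex_stabilizer[OF that px(1,2)] z(2)[OF that] px(3) by (simp only: act)
  qed
qed

end
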